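(* Let $\lambda\in V_{\mathbb{C}}^*$. The space $\mathrm{BVP}_k(\lambda)^W$ of $W$-invariant solutions to the boundary value problem is one-dimensional or zero-dimensional. It is one-dimensional if and only if the spectral value $\lambda$ is a purely imaginary, regular solution of the Bethe ansatz equations $$e^{w\lambda(\varphi^\vee)}=\prod_{\alpha\in\Sigma_0^+}\left(\frac{w\lambda(\alpha^\vee)-k_\alpha}{w\lambda(\alpha^\vee)+k_\alpha}\right)^{\alpha(\varphi^\vee)}\qquad \forall\, w\in W_0.$$ If $\mathrm{BVP}_k(\lambda)^W$ is one-dimensional, then there exists a unique $\phi_\lambda^k\in \mathrm{BVP}_k(\lambda)^W$ normalized by $\phi_\lambda^k(0)=1$. The solution $\phi_\lambda^k$ is the unique $W$-invariant function on $V$ satisfying $$\phi_\lambda^k(v)=\frac{1}{\#W_0}\sum_{w\in W_0}\widetilde{c}_k(w\lambda)e^{w\lambda(v)},\qquad v\in \overline{C_+}.$$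
   Context: Root systems. Let $V$ be a Euclidean space of dimension $n$ and $V^*$ the dual Euclidean space, with norm $\|\cdot\|$ and inner product $\langle\cdot,\cdot\rangle$ on $V^*$. Let $\Sigma_0\subset V^*$ be a finite, irreducible, reduced crystallographic root system. The co-root $\alpha^\vee\in V$ of $\alpha\in\Sigma_0$ is determined by $\xi(\alpha^\vee)=2\langle\xi,\alpha\rangle/\|\alpha\|^2$ for all $\xi\in V^*$. Fix a basis $I_0=\{a_1,\ldots,a_n\}$ of $\Sigma_0$, with positive roots $\Sigma_0^+$ and highest root $\varphi$. The Weyl group $W_0$ is generated by the reflections $s_\alpha$ ($\alpha\in\Sigma_0$), acting on $V$ by $s_\alpha v=v-\alpha(v)\alpha^\vee$ and on $V^*$ by $s_\alpha\xi=\xi-\xi(\alpha^\vee)\alpha$. Let $V_{\mathbb{C}}^*=V^*\oplus iV^*$ be the complexification, with complex linear extension of the $W_0$-action and of evaluation. Affine root system. Affine linear functionals on $V$ are written as elements of $V^*\oplus\mathbb{R}$ (second summand: constants), and $D$ denotes the projection onto $V^*$ (the gradient). The affine root system is $\Sigma=\Sigma_0+\mathbb{Z}$, with basis $\{a_0=-\varphi+1,a_1,\ldots,a_n\}$ and corresponding positive roots $\Sigma^+$. For $a\in\Sigma$ write $Da^\vee=(Da)^\vee$, $V_a=a^{-1}(0)$, and $s_a(v)=v-a(v)Da^\vee$. The affine Weyl group $W$ is generated by all $s_a$ ($a\in\Sigma$); $W= W_0\ltimes Q^\vee$ with $Q^\vee$ the co-root lattice acting by translations. $W$ acts on functions on $V$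 (including affine functionals) by $(wf)(v)=f(w^{-1}v)$. Put $V_{reg}=V\setminus\bigcup_{a\in\Sigma^+}V_a$; its connected components are called alcoves, and $C_+=\{v\in V: a_j(v)>0,\ j=0,\ldots,n\}$ is the fundamental alcove. A vector $v\in V_a$ ($a\in\Sigma^+$) is sub-regular if it lies on no other $V_b$ ($b\in\Sigma^+$, $b\neq a$). Multiplicity function. $k:\Sigma\to\mathbb{R}_{>0}$ is a fixed $W$-invariant function with $k(a)=k(Da)$ for all $a\in\Sigma$; write $k_a=k(a)$. Boundary value problem. $CB^1(V)$ is the space of complex-valued continuous functions $f$ on $V$ such that for each alcove $C$ the restriction $f|_C$ has a continuously differentiable extension to some open neighborhood of $\overline{C}$. $C^{1,(k)}(V)$ is the space of $f\in CB^1(V)$ satisfying $$(\partial_{Da^\vee}f)(v+0Da^\vee)-(\partial_{Da^\vee}f)(v-0Da^\vee)=2k_af(v)$$ for all sub-regular $v\in V_a$, $a\in\Sigma^+$, where $\partial_u$ is the derivative in direction $u$ and $v\pm 0Da^\vee$ denotes the limit along $v\pm tDa^\vee$, $t\downarrow 0$. Identify the symmetric algebra $S(V)$ with the polynomial functions on $V^*$; $p(\partial)$ is the constant coefficient differential operator obtained from $v\mapsto\partial_v$, and $S(V)^{W_0}$ is the algebra of $W_0$-invariants. $\mathrm{BVP}_k(\lambda)$ is the space of $f\in C^{1,(k)}(V)$ with $p(\partial)f|_{V_{reg}}=p(\lambda)f|_{V_{reg}}$ in the distributional sense for all $p\in S(V)^{W_0}$. $\mathrm{BVP}_k(\lambda)^W$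 is the subspace of $W$-invariant functions. Spectral values. $\lambda\in V_{\mathbb{C}}^*$ is regular if $\lambda(\alpha^\vee)\neq0$ for all $\alpha\in\Sigma_0$, and purely imaginary if $\lambda\in iV^*$. The $c$-function is $\widetilde{c}_k(\lambda)=\prod_{\alpha\in\Sigma_0^+}\frac{\lambda(\alpha^\vee)+k_\alpha}{\lambda(\alpha^\vee)}$. *)

theory Defs
  imports "HOL-Analysis.Analysis" "HOL-Library.Function_Algebras"
begin

text \<open>
  Throughout, \<open>V\<close> is the Euclidean space \<open>'a\<close>, and its dual Euclidean space is identified with
  \<open>'a\<close> through the inner product: \<open>\<xi> :: 'a\<close> stands for the functional \<open>\<lambda>v. \<xi> \<bullet> v\<close>.  Under this
  identification the reflection \<open>s\<^sub>\<alpha> \<xi> = \<xi> - \<xi>(\<alpha>\<^sup>\<or>)\<alpha>\<close> of the dual is the same map as the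
  reflection \<open>s\<^sub>\<alpha> v = v - \<alpha>(v)\<alpha>\<^sup>\<or>\<close> of \<open>V\<close>, so that one copy of the finite Weyl group acts on both.
\<close>

definition coroot :: "'a::euclidean_space \<Rightarrow> 'a" where
  "coroot \<alpha> = (2 / (\<alpha> \<bullet> \<alpha>)) *\<^sub>R \<alpha>"

definition refl :: "'a::euclidean_space \<Rightarrow> 'a \<Rightarrow> 'a" where
  "refl \<alpha> v = v - (\<alpha> \<bullet> v) *\<^sub>R coroot \<alpha>"

definition irreducible_reduced_root_system :: "'a::euclidean_space set \<Rightarrow> bool" where
  "irreducible_reduced_root_system R \<longleftrightarrow>
     finite R \<and> 0 \<notin> R \<and> span R = UNIV \<and>
     (\<forall>\<alpha>\<in>R. \<forall>\<beta>\<in>R. refl \<alpha> \<beta> \<in> R) \<and>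
     (\<forall>\<alpha>\<in>R. \<forall>\<beta>\<in>R. \<beta> \<bullet> coroot \<alpha> \<in> \<int>) \<and>
     (\<forall>\<alpha>\<in>R. \<forall>c. c *\<^sub>R \<alpha> \<in> R \<longrightarrow> c = 1 \<or> c = -1) \<and>
     (\<forall>A B. A \<union> B = R \<and> A \<inter> B = {} \<and> (\<forall>\<alpha>\<in>A. \<forall>\<beta>\<in>B. \<alpha> \<bullet> \<beta> = 0) \<longrightarrow> A = {} \<or> B = {})"

definition nat_combinations :: "'b::real_vector set \<Rightarrow> 'b set" where
  "nat_combinations B = {(\<Sum>b\<in>B. real (c b) *\<^sub>R b) |c :: 'b \<Rightarrow> nat. True}"

definition root_basis :: "'a::euclidean_space set \<Rightarrow> 'a set \<Rightarrow> bool" where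
  "root_basis R I \<longleftrightarrow>
     I \<subseteq> R \<and> independent I \<and> span I = UNIV \<and>
     (\<forall>\<alpha>\<in>R. \<alpha> \<in> nat_combinations I \<or> - \<alpha> \<in> nat_combinations I)"

definition pos_roots :: "'a::euclidean_space set \<Rightarrow> 'a set \<Rightarrow> 'a set" where
  "pos_roots R I = R \<inter> nat_combinations I"

definition highest_root :: "'a::euclidean_space set \<Rightarrow> 'a set \<Rightarrow> 'a \<Rightarrow> bool" where
  "highest_root R I \<phi> \<longleftrightarrow> \<phi> \<in> R \<and> (\<forall>\<alpha>\<in>R. \<phi> - \<alpha> \<in> nat_combinations I)"

text \<open>Reflections are involutions, so closing under left multiplication gives the group
  generated by a set \<open>S\<close> of reflections.\<close>

inductive_set generated_by :: "('a \<Rightarrow> 'a) set \<Rightarrow> ('a \<Rightarrow> 'a) set" for S where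
  gen_id: "id \<in> generated_by S"
| gen_comp: "s \<in> S \<Longrightarrow> w \<in> generated_by S \<Longrightarrow> s \<circ> w \<in> generated_by S"

definition weyl_group :: "'a::euclidean_space set \<Rightarrow> ('a \<Rightarrow> 'a) set" where
  "weyl_group R = generated_by (refl ` R)"

text \<open>The pair \<open>(\<xi>, r)\<close> is the affine functional \<open>v \<mapsto> \<xi>(v) + r\<close>; its gradient is \<open>fst\<close>.\<close>

definition aff_eval :: "'a::euclidean_space \<times> real \<Rightarrow> 'a \<Rightarrow> real" where
  "aff_eval a v = fst a \<bullet> v + snd a"

definition aff_roots :: "'a::euclidean_space set \<Rightarrow> ('a \<times> real) set" where
  "aff_roots R = {(\<alpha>, of_int m) |\<alpha> m. \<alpha> \<in> R}"

definition aff_basis :: "'a::euclidean_space set \<Rightarrow> 'a \<Rightarrow> ('a \<times> real) set" where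
  "aff_basis I \<phi> = insert (- \<phi>, 1) ((\<lambda>\<alpha>. (\<alpha>, 0)) ` I)"

definition pos_aff_roots :: "'a::euclidean_space set \<Rightarrow> 'a set \<Rightarrow> 'a \<Rightarrow> ('a \<times> real) set" where
  "pos_aff_roots R I \<phi> = aff_roots R \<inter> nat_combinations (aff_basis I \<phi>)"

definition aff_refl :: "'a::euclidean_space \<times> real \<Rightarrow> 'a \<Rightarrow> 'a" where
  "aff_refl a v = v - aff_eval a v *\<^sub>R coroot (fst a)"

definition aff_weyl_group :: "'a::euclidean_space set \<Rightarrow> ('a \<Rightarrow> 'a) set" where
  "aff_weyl_group R = generated_by (aff_refl ` aff_roots R)"

definition act :: "('a \<Rightarrow> 'a) \<Rightarrow> ('a \<Rightarrow> 'b) \<Rightarrow> 'a \<Rightarrow> 'b" where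
  "act w f = (\<lambda>v. f (inv w v))"

definition invariant_under :: "('a \<Rightarrow> 'a) set \<Rightarrow> ('a \<Rightarrow> 'b) \<Rightarrow> bool" where
  "invariant_under G f \<longleftrightarrow> (\<forall>w\<in>G. act w f = f)"

definition aff_hyperplane :: "'a::euclidean_space \<times> real \<Rightarrow> 'a set" where
  "aff_hyperplane a = {v. aff_eval a v = 0}"

definition V_reg :: "'a::euclidean_space set \<Rightarrow> 'a set \<Rightarrow> 'a \<Rightarrow> 'a set" where
  "V_reg R I \<phi> = UNIV - (\<Union>a\<in>pos_aff_roots R I \<phi>. aff_hyperplane a)"

definition alcoves :: "'a::euclidean_space set \<Rightarrow> 'a set \<Rightarrow> 'a \<Rightarrow> 'a set set" where
  "alcoves R I \<phi> = components (V_reg R I \<phi>)"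

definition fundamental_alcove :: "'a::euclidean_space set \<Rightarrow> 'a \<Rightarrow> 'a set" where
  "fundamental_alcove I \<phi> = {v. \<forall>a\<in>aff_basis I \<phi>. aff_eval a v > 0}"

definition subregular ::
  "'a::euclidean_space set \<Rightarrow> 'a set \<Rightarrow> 'a \<Rightarrow> 'a \<times> real \<Rightarrow> 'a \<Rightarrow> bool" where
  "subregular R I \<phi> a v \<longleftrightarrow>
     v \<in> aff_hyperplane a \<and> (\<forall>b\<in>pos_aff_roots R I \<phi>. b \<noteq> a \<longrightarrow> v \<notin> aff_hyperplane b)"

definition multiplicity_function ::
  "'a::euclidean_space set \<Rightarrow> ('a \<times> real \<Rightarrow> real) \<Rightarrow> bool" where
  "multiplicity_function R k \<longleftrightarrow>
     (\<forall>a\<in>aff_roots R. k a > 0 \<and> k a = k (fst a, 0)) \<and>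
     (\<forall>w\<in>aff_weyl_group R. \<forall>a\<in>aff_roots R. \<forall>b\<in>aff_roots R.
        aff_eval b = act w (aff_eval a) \<longrightarrow> k b = k a)"

text \<open>The pair \<open>(\<xi>, \<eta>)\<close> stands for \<open>\<xi> + i\<eta>\<close>.  Spectral values are called \<open>\<mu>\<close>.\<close>

type_synonym 'a cdual = "'a \<times> 'a"

definition ceval :: "'a::euclidean_space cdual \<Rightarrow> 'a \<Rightarrow> complex" where
  "ceval \<mu> v = Complex (fst \<mu> \<bullet> v) (snd \<mu> \<bullet> v)"

definition cact :: "('a \<Rightarrow> 'a) \<Rightarrow> 'a cdual \<Rightarrow> 'a cdual" where
  "cact w \<mu> = (w (fst \<mu>), w (snd \<mu>))"

definition regular_spectral :: "'a::euclidean_space set \<Rightarrow> 'a cdual \<Rightarrow> bool" where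
  "regular_spectral R \<mu> \<longleftrightarrow> (\<forall>\<alpha>\<in>R. ceval \<mu> (coroot \<alpha>) \<noteq> 0)"

definition purely_imaginary :: "'a::euclidean_space cdual \<Rightarrow> bool" where
  "purely_imaginary \<mu> \<longleftrightarrow> fst \<mu> = 0"

definition c_function ::
  "'a::euclidean_space set \<Rightarrow> 'a set \<Rightarrow> ('a \<times> real \<Rightarrow> real) \<Rightarrow> 'a cdual \<Rightarrow> complex" where
  "c_function R I k \<mu> =
     (\<Prod>\<alpha>\<in>pos_roots R I.
        (ceval \<mu> (coroot \<alpha>) + of_real (k (\<alpha>, 0))) / ceval \<mu> (coroot \<alpha>))"

text \<open>The exponents \<open>\<alpha>(\<phi>\<^sup>\<or>)\<close> are integers, so taking the floor only changes their type.\<close>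

definition bethe_equations ::
  "'a::euclidean_space set \<Rightarrow> 'a set \<Rightarrow> 'a \<Rightarrow> ('a \<times> real \<Rightarrow> real) \<Rightarrow> 'a cdual \<Rightarrow> bool" where
  "bethe_equations R I \<phi> k \<mu> \<longleftrightarrow>
     (\<forall>w\<in>weyl_group R.
        exp (ceval (cact w \<mu>) (coroot \<phi>)) =
        (\<Prod>\<alpha>\<in>pos_roots R I.
           ((ceval (cact w \<mu>) (coroot \<alpha>) - of_real (k (\<alpha>, 0))) /
            (ceval (cact w \<mu>) (coroot \<alpha>) + of_real (k (\<alpha>, 0)))) powi \<lfloor>\<alpha> \<bullet> coroot \<phi>\<rfloor>))"

definition dir_deriv ::
  "'a::real_normed_vector \<Rightarrow> ('a \<Rightarrow> 'b::real_normed_vector) \<Rightarrow> 'a \<Rightarrow> 'b" where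
  "dir_deriv u f x = vector_derivative (\<lambda>t. f (x + t *\<^sub>R u)) (at 0)"

text \<open>
  An element of the symmetric algebra \<open>S(V)\<close> is represented by a finite list of terms \<open>(c, us)\<close>,
  standing for the sum of the products \<open>c \<cdot> u\<^sub>1 \<cdots> u\<^sub>m\<close> with \<open>us = [u\<^sub>1, \<dots>, u\<^sub>m]\<close> in \<open>V\<close>.
  Every element of \<open>S(V)\<close> has such representatives (many of them); both the polynomial function
  and the operator (on smooth functions) depend only on the element represented.
\<close>

type_synonym 'a sym = "(real \<times> 'a list) list"

text \<open>With \<open>\<xi>\<close> the evaluation map of an element of \<open>V\<^sup>*\<close> or of its complexification, this is the
  value of the polynomial function at that element.\<close>

definition sym_eval :: "'a sym \<Rightarrow> ('a \<Rightarrow> 'b::real_algebra_1) \<Rightarrow> 'b" where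
  "sym_eval p \<xi> = (\<Sum>(c, us)\<leftarrow>p. c *\<^sub>R prod_list (map \<xi> us))"

definition sym_invariant :: "'a::euclidean_space set \<Rightarrow> 'a sym \<Rightarrow> bool" where
  "sym_invariant R p \<longleftrightarrow>
     (\<forall>w\<in>weyl_group R. \<forall>\<xi>. sym_eval p (\<lambda>v. w \<xi> \<bullet> v) = sym_eval p (\<lambda>v. \<xi> \<bullet> v))"

text \<open>The formal transpose \<open>p(-\<partial>)\<close> of \<open>p(\<partial>)\<close>.\<close>

definition transpose_op ::
  "'a::euclidean_space sym \<Rightarrow> ('a \<Rightarrow> complex) \<Rightarrow> 'a \<Rightarrow> complex" where
  "transpose_op p \<psi> x = (\<Sum>(c, us)\<leftarrow>p. ((-1) ^ length us * c) *\<^sub>R foldr dir_deriv us \<psi> x)"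

text \<open>Differentiability of all iterated directional derivatives also makes each of them
  continuous, so this is being of class \<open>C\<^sup>\<infinity>\<close>.\<close>

definition smooth :: "('a::euclidean_space \<Rightarrow> complex) \<Rightarrow> bool" where
  "smooth \<psi> \<longleftrightarrow> (\<forall>us. foldr dir_deriv us \<psi> differentiable_on UNIV)"

definition test_function :: "'a::euclidean_space set \<Rightarrow> ('a \<Rightarrow> complex) \<Rightarrow> bool" where
  "test_function U \<psi> \<longleftrightarrow>
     smooth \<psi> \<and> compact (closure {x. \<psi> x \<noteq> 0}) \<and> closure {x. \<psi> x \<noteq> 0} \<subseteq> U"

text \<open>\<open>p(\<partial>)f = z f\<close> on the open set \<open>U\<close> in the sense of distributions.\<close>

definition weak_eigenfunction ::
  "'a::euclidean_space set \<Rightarrow> 'a sym \<Rightarrow> complex \<Rightarrow> ('a \<Rightarrow> complex) \<Rightarrow> bool" where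
  "weak_eigenfunction U p z f \<longleftrightarrow>
     (\<forall>\<psi>. test_function U \<psi> \<longrightarrow>
        (LINT x|lborel. f x * transpose_op p \<psi> x) = z * (LINT x|lborel. f x * \<psi> x))"

definition continuously_differentiable_on ::
  "('a::euclidean_space \<Rightarrow> complex) \<Rightarrow> 'a set \<Rightarrow> bool" where
  "continuously_differentiable_on g U \<longleftrightarrow>
     (\<exists>g' :: 'a \<Rightarrow> 'a \<Rightarrow>\<^sub>L complex.
        continuous_on U g' \<and> (\<forall>x\<in>U. (g has_derivative blinfun_apply (g' x)) (at x)))"

definition CB1 ::
  "'a::euclidean_space set \<Rightarrow> 'a set \<Rightarrow> 'a \<Rightarrow> ('a \<Rightarrow> complex) set" where
  "CB1 R I \<phi> =
     {f. continuous_on UNIV f \<and>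
         (\<forall>C\<in>alcoves R I \<phi>. \<exists>U g. open U \<and> closure C \<subseteq> U \<and>
            continuously_differentiable_on g U \<and> (\<forall>x\<in>C. g x = f x))}"

definition C1k ::
  "'a::euclidean_space set \<Rightarrow> 'a set \<Rightarrow> 'a \<Rightarrow> ('a \<times> real \<Rightarrow> real) \<Rightarrow> ('a \<Rightarrow> complex) set" where
  "C1k R I \<phi> k =
     {f \<in> CB1 R I \<phi>.
        \<forall>a\<in>pos_aff_roots R I \<phi>. \<forall>v. subregular R I \<phi> a v \<longrightarrow>
          (let u = coroot (fst a) in
           \<exists>dplus dminus.
             ((\<lambda>t. dir_deriv u f (v + t *\<^sub>R u)) \<longlongrightarrow> dplus) (at_right 0) \<and>
             ((\<lambda>t. dir_deriv u f (v - t *\<^sub>R u)) \<longlongrightarrow> dminus) (at_right 0) \<and>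
             dplus - dminus = 2 * of_real (k a) * f v)}"

definition BVP ::
  "'a::euclidean_space set \<Rightarrow> 'a set \<Rightarrow> 'a \<Rightarrow> ('a \<times> real \<Rightarrow> real) \<Rightarrow> 'a cdual \<Rightarrow>
   ('a \<Rightarrow> complex) set" where
  "BVP R I \<phi> k \<mu> =
     {f \<in> C1k R I \<phi> k.
        \<forall>p. sym_invariant R p \<longrightarrow>
          weak_eigenfunction (V_reg R I \<phi>) p (sym_eval p (ceval \<mu>)) f}"

definition BVP_W ::
  "'a::euclidean_space set \<Rightarrow> 'a set \<Rightarrow> 'a \<Rightarrow> ('a \<times> real \<Rightarrow> real) \<Rightarrow> 'a cdual \<Rightarrow>
   ('a \<Rightarrow> complex) set" where
  "BVP_W R I \<phi> k \<mu> = {f \<in> BVP R I \<phi> k \<mu>. invariant_under (aff_weyl_group R) f}"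

definition bethe_formula ::
  "'a::euclidean_space set \<Rightarrow> 'a set \<Rightarrow> 'a \<Rightarrow> ('a \<times> real \<Rightarrow> real) \<Rightarrow> 'a cdual \<Rightarrow>
   ('a \<Rightarrow> complex) \<Rightarrow> bool" where
  "bethe_formula R I \<phi> k \<mu> f \<longleftrightarrow>
     (\<forall>v\<in>closure (fundamental_alcove I \<phi>).
        f v = 1 / of_nat (card (weyl_group R)) *
          (\<Sum>w\<in>weyl_group R. c_function R I k (cact w \<mu>) * exp (ceval (cact w \<mu>) v)))"

global_interpretation cfun: vector_space "\<lambda>(c::complex) (f :: 'a \<Rightarrow> complex) x. c * f x"
  by unfold_locales (auto simp: fun_eq_iff algebra_simps)

text \<open>\<open>cfun.dim\<close> also takes the value 0 on infinite-dimensional spaces, hence the explicit basis.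
  In particular the predicate says that \<open>S\<close> is a linear subspace.\<close>

definition has_cdim :: "('a \<Rightarrow> complex) set \<Rightarrow> nat \<Rightarrow> bool" where
  "has_cdim S d \<longleftrightarrow> (\<exists>B. finite B \<and> card B = d \<and> cfun.independent B \<and> cfun.span B = S)"

end

theory Submission
  imports Defs "HOL-Complex_Analysis.Complex_Analysis"
begin

text \<open>
  On the fundamental alcove the invariant differential equations contain, for each direction, an
  ordinary differential equation with constant coefficients; hence a solution agrees there with an
  exponential polynomial \<open>F\<close>, and \<open>W\<close>-invariance turns the jump conditions into the boundary conditions
  \<open>\<partial>F = k\<^sub>a F\<close> (derivative along the co-root) on the walls.  By uniqueness for the Cauchy problem of
  the Laplacian, these say that the translates of \<open>F\<close> under \<open>W\<^sub>0\<close> satisfy linear relations, one for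
  each affine simple root, which are stable under constant coefficient operators.  If such a relation
  holds for a tuple of multiples of one exponential, then comparing the largest moduli of the
  coefficients shows that the exponent is purely imaginary, and the infinitesimal form of the same
  comparison excludes polynomial factors.  So \<open>F\<close> is a combination of the exponentials in the
  orbit of the spectral value.  The relations for the simple roots of \<open>\<Sigma>\<^sub>0\<close> force regularity and
  determine the coefficients up to a scalar as the values of the \<open>c\<close>-function; the relation for the
  affine simple root is then the Bethe ansatz equation.  Conversely the Bethe wave function on the
  closed alcove, folded to a \<open>W\<close>-invariant function, is a solution; its value at the origin is
  \<open>1\<close> by Macdonald's identity.
\<close>

section \<open>Affine Weyl group and fundamental alcove\<close>

text \<open>Since the spectral value is arbitrary, \<open>F\<close> may a priori carry polynomial
  factors and exponents off the imaginary axis, so coefficients cannot be compared at once. A wall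
  condition links \<open>F\<close> to a reflected copy, a relation not inherited by derivatives of
  \<open>F\<close> alone. Indexing the copies of \<open>F\<close> by \<open>W0\<close>, with the
  relation of index \<open>w\<close> written in the direction \<open>w (coroot (fst a))\<close>,
  gives relations with constant coefficients, preserved by every operator that acts on all
  components alike; this is why tuples are used. The comparison of moduli yields only inequalities,
  one for each affine simple root. They become equalities because the gradients of these roots,
  \<open>- \<phi>\<close> among them, satisfy a linear relation with positive coefficients;
  positivity of \<open>k\<close> makes each comparison strict. The ordinary differential equation in
  direction \<open>u\<close> stems from the product of \<open>u - v\<close> over the orbit of
  \<open>u\<close>: it vanishes, and its coefficients are invariants. As the equations hold only
  weakly, it is solved for mollified functions, and interpolation at finitely many points carries
  the result back to \<open>f\<close>.\<close>

lemma inner_coroot: "x \<bullet> coroot \<alpha> = 2 * (x \<bullet> \<alpha>) / (\<alpha> \<bullet> \<alpha>)"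
  by (simp add: coroot_def)

lemma refl_linear: "linear (refl \<alpha>)"
  unfolding refl_def by (intro linearI) (auto simp: algebra_simps inner_add_right)

lemma refl_minus_left [simp]: "refl (- \<alpha>) = refl \<alpha>"
  by (rule ext) (simp add: refl_def coroot_def)

lemma coroot_minus: "coroot (- \<alpha>) = - coroot \<alpha>"
  by (simp add: coroot_def)

lemma refl_self: "refl \<alpha> \<alpha> = - \<alpha>"
  by (cases "\<alpha> = 0") (auto simp: refl_def coroot_def algebra_simps simp flip: scaleR_2)

lemma refl_add: "refl \<alpha> (x + y) = refl \<alpha> x + refl \<alpha> y"
  by (rule linear_add[OF refl_linear])

lemma refl_diff: "refl \<alpha> (x - y) = refl \<alpha> x - refl \<alpha> y"
  by (rule linear_diff[OF refl_linear])

lemma refl_scale: "refl \<alpha> (c *\<^sub>R x) = c *\<^sub>R refl \<alpha> x"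
  by (rule linear_cmul[OF refl_linear])

lemma refl_adjoint: "refl \<alpha> x \<bullet> y = x \<bullet> refl \<alpha> y"
  by (simp add: refl_def coroot_def inner_diff_left inner_diff_right inner_commute)

lemma refl_refl [simp]: "refl \<alpha> (refl \<alpha> v) = v"
  by (cases "\<alpha> = 0") (auto simp: refl_def coroot_def inner_diff_right algebra_simps)

lemma refl_inner: "refl \<alpha> x \<bullet> refl \<alpha> y = x \<bullet> y"
  by (simp add: refl_adjoint)

lemma coroot_refl: "coroot (refl \<beta> \<alpha>) = refl \<beta> (coroot \<alpha>)"
  by (simp add: coroot_def refl_inner refl_scale)

lemma refl_conj: "refl (refl \<beta> \<alpha>) = refl \<beta> \<circ> refl \<alpha> \<circ> refl \<beta>"
proof
  fix v
  have "refl \<beta> (refl \<alpha> (refl \<beta> v)) = v - (\<alpha> \<bullet> refl \<beta> v) *\<^sub>R refl \<beta> (coroot \<alpha>)"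
    by (subst (2) refl_def) (simp add: refl_diff refl_scale)
  then show "refl (refl \<beta> \<alpha>) v = (refl \<beta> \<circ> refl \<alpha> \<circ> refl \<beta>) v"
    by (simp add: refl_def[of "refl \<beta> \<alpha>"] coroot_refl refl_adjoint)
qed

section \<open>Affine reflections on points and on affine roots\<close>

lemma aff_refl_eq: "aff_refl a v = refl (fst a) v - snd a *\<^sub>R coroot (fst a)"
  by (simp add: aff_refl_def refl_def aff_eval_def algebra_simps)

text \<open>Composition with \<open>aff_refl a\<close>, written as a linear map on pairs so that
  expansions in the affine basis transform coefficientwise; \<open>aff_eval_root_refl\<close>
  justifies the formula.\<close>

definition root_refl :: "'a::euclidean_space \<times> real \<Rightarrow> 'a \<times> real \<Rightarrow> 'a \<times> real" where
  "root_refl a b = b - (fst b \<bullet> coroot (fst a)) *\<^sub>R a"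

lemma aff_eval_add: "aff_eval (a + b) v = aff_eval a v + aff_eval b v"
  by (simp add: aff_eval_def inner_add_left)

lemma aff_eval_diff: "aff_eval (a - b) v = aff_eval a v - aff_eval b v"
  by (simp add: aff_eval_def inner_diff_left)

lemma aff_eval_scale: "aff_eval (c *\<^sub>R a) v = c * aff_eval a v"
  by (simp add: aff_eval_def algebra_simps)

lemma aff_eval_minus: "aff_eval (- a) v = - aff_eval a v"
  by (simp add: aff_eval_def)

lemma aff_eval_sum: "aff_eval (\<Sum>x\<in>S. f x) v = (\<Sum>x\<in>S. aff_eval (f x) v)"
  by (induction S rule: infinite_finite_induct) (auto simp: aff_eval_add, simp_all add: aff_eval_def)

lemma aff_eval_root_refl: "aff_eval (root_refl a b) v = aff_eval b (aff_refl a v)"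
  by (simp add: root_refl_def aff_eval_diff aff_eval_scale)
     (simp add: aff_refl_def aff_eval_def inner_diff_right)

lemma fst_root_refl: "fst (root_refl a b) = refl (fst a) (fst b)"
  by (simp add: root_refl_def refl_def coroot_def inner_commute)

lemma coroot_self: "\<alpha> \<noteq> 0 \<Longrightarrow> \<alpha> \<bullet> coroot \<alpha> = 2"
  by (simp add: coroot_def)

lemma aff_refl_aff_refl: "fst a \<noteq> 0 \<Longrightarrow> aff_refl a (aff_refl a v) = v"
  by (simp add: aff_refl_def aff_eval_def inner_diff_right coroot_self algebra_simps)

lemma root_refl_self: "fst a \<noteq> 0 \<Longrightarrow> root_refl a a = - a"
  by (simp add: root_refl_def coroot_self scaleR_2)

lemma root_refl_involution: "fst a \<noteq> 0 \<Longrightarrow> root_refl a (root_refl a b) = b"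
  by (simp add: root_refl_def coroot_self inner_diff_left algebra_simps)

lemma aff_refl_conj:
  "fst a \<noteq> 0 \<Longrightarrow> aff_refl (root_refl a b) = aff_refl a \<circ> aff_refl b \<circ> aff_refl a"
proof
  fix v assume a: "fst a \<noteq> 0"
  have lin: "aff_refl a (x - y) = aff_refl a x - refl (fst a) y" for x y
    by (simp add: aff_refl_eq refl_diff)
  have "aff_refl a (aff_refl b (aff_refl a v)) =
    aff_refl a (aff_refl a v - aff_eval b (aff_refl a v) *\<^sub>R coroot (fst b))"
    by (simp add: aff_refl_def[of b])
  also have "\<dots> = v - aff_eval (root_refl a b) v *\<^sub>R coroot (fst (root_refl a b))"
    by (simp add: lin aff_refl_aff_refl[OF a] refl_scale fst_root_refl coroot_refl aff_eval_root_refl)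
  finally show "aff_refl (root_refl a b) v = (aff_refl a \<circ> aff_refl b \<circ> aff_refl a) v"
    by (simp add: aff_refl_def[of "root_refl a b"])
qed

section \<open>Generated groups and non-negative integer combinations\<close>

lemma generated_by_comp:
  "w \<in> generated_by S \<Longrightarrow> w' \<in> generated_by S \<Longrightarrow> w \<circ> w' \<in> generated_by S"
  by (induction rule: generated_by.induct) (simp_all add: comp_assoc generated_by.gen_comp)

lemma generated_by_base: "s \<in> S \<Longrightarrow> s \<in> generated_by S"
  using generated_by.gen_comp[OF _ generated_by.gen_id] by fastforce

lemma generated_by_least: "S \<subseteq> generated_by T \<Longrightarrow> generated_by S \<subseteq> generated_by T"
proof
  fix w assume S: "S \<subseteq> generated_by T" and "w \<in> generated_by S"
  from this(2) show "w \<in> generated_by T"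
  proof (induction rule: generated_by.induct)
    case (gen_comp s w)
    then show ?case using S generated_by_comp by blast
  qed (rule generated_by.gen_id)
qed

lemma generated_by_inv:
  assumes S: "\<And>s v. s \<in> S \<Longrightarrow> s (s v) = v" and w: "w \<in> generated_by S"
  shows "bij w \<and> inv w \<in> generated_by S"
  using w
proof (induction rule: generated_by.induct)
  case gen_id show ?case by (metis generated_by.gen_id bij_id inv_id)
next
  case (gen_comp s w)
  have "s \<circ> s = id" using S gen_comp by auto
  then have s: "bij s" "inv s = s" using o_bij inv_unique_comp by blast+
  then have "inv (s \<circ> w) = inv w \<circ> s" using gen_comp by (simp add: o_inv_distrib)
  then show ?case using s gen_comp generated_by_comp generated_by_base by (metis bij_comp)
qed

lemma nat_combinations_add:
  assumes "x \<in> nat_combinations B" "y \<in> nat_combinations B"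
  shows "x + y \<in> nat_combinations B"
proof -
  obtain c d :: "'a \<Rightarrow> nat" where "x = (\<Sum>b\<in>B. real (c b) *\<^sub>R b)" "y = (\<Sum>b\<in>B. real (d b) *\<^sub>R b)"
    using assms unfolding nat_combinations_def by blast
  then have "x + y = (\<Sum>b\<in>B. real (c b + d b) *\<^sub>R b)"
    by (simp add: sum.distrib scaleR_add_left)
  then show ?thesis unfolding nat_combinations_def by (intro CollectI exI[of _ "\<lambda>b. c b + d b"]) auto
qed

lemma nat_combinations_0: "0 \<in> nat_combinations B"
  unfolding nat_combinations_def by (intro CollectI exI[of _ "\<lambda>b. 0"]) auto

lemma nat_combinations_base: "finite B \<Longrightarrow> x \<in> B \<Longrightarrow> x \<in> nat_combinations B"
proof -
  assume B: "finite B" "x \<in> B"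
  have "(\<Sum>b\<in>B. real (if b = x then 1 else 0) *\<^sub>R b) = (\<Sum>b\<in>B. if b = x then b else 0)"
    by (intro sum.cong) auto
  also have "\<dots> = x" using B by simp
  finally show ?thesis unfolding nat_combinations_def by (intro CollectI exI[of _ "\<lambda>b. if b = x then 1 else 0"]) auto
qed

lemma nat_combinations_times: "x \<in> nat_combinations B \<Longrightarrow> real n *\<^sub>R x \<in> nat_combinations B"
  by (induction n) (auto simp: scaleR_add_left nat_combinations_0 nat_combinations_add)

section \<open>Positive affine roots, heights and descent\<close>

locale affine_root_system =
  fixes R I :: "'a::euclidean_space set" and \<phi> :: 'a and k :: "'a \<times> real \<Rightarrow> real"
  assumes root_system: "irreducible_reduced_root_system R"
    and basis: "root_basis R I"
    and highest: "highest_root R I \<phi>"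
    and multiplicity: "multiplicity_function R k"
begin

abbreviation "A \<equiv> aff_basis I \<phi>"
abbreviation "pos \<equiv> pos_aff_roots R I \<phi>"
abbreviation "P \<equiv> pos_roots R I"
abbreviation "W0 \<equiv> weyl_group R"
abbreviation "W \<equiv> aff_weyl_group R"

lemma finite_R: "finite R" and R_nz: "0 \<notin> R" and span_R: "span R = UNIV"
  and refl_R: "\<alpha> \<in> R \<Longrightarrow> \<beta> \<in> R \<Longrightarrow> refl \<alpha> \<beta> \<in> R"
  and integral_R: "\<alpha> \<in> R \<Longrightarrow> \<beta> \<in> R \<Longrightarrow> \<beta> \<bullet> coroot \<alpha> \<in> \<int>"
  and reduced_R: "\<alpha> \<in> R \<Longrightarrow> c *\<^sub>R \<alpha> \<in> R \<Longrightarrow> c = 1 \<or> c = -1"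
  by (use root_system in \<open>simp_all add: irreducible_reduced_root_system_def\<close>)

lemma I_R: "I \<subseteq> R" and indep_I: "independent I" and span_I: "span I = UNIV"
  and R_cases: "\<alpha> \<in> R \<Longrightarrow> \<alpha> \<in> nat_combinations I \<or> - \<alpha> \<in> nat_combinations I"
  using basis unfolding root_basis_def by blast+

lemma phi_R: "\<phi> \<in> R" and phi_highest: "\<alpha> \<in> R \<Longrightarrow> \<phi> - \<alpha> \<in> nat_combinations I"
  using highest unfolding highest_root_def by blast+

lemma finite_I: "finite I" using I_R finite_R finite_subset by blast

lemma I_nonempty: "I \<noteq> {}"
proof
  assume "I = {}"
  then have "UNIV = {0::'a}" using span_I by simp
  then show False using nonempty_Basis nonzero_Basis by (metis UNIV_I all_not_in_conv singletonD)
qed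

lemma R_minus: "\<alpha> \<in> R \<Longrightarrow> - \<alpha> \<in> R"
  using refl_R[of \<alpha> \<alpha>] by (simp add: refl_self)

lemma R_ne0: "\<alpha> \<in> R \<Longrightarrow> \<alpha> \<noteq> 0" using R_nz by blast

lemma dual_basis: "i \<in> I \<Longrightarrow> \<exists>\<omega>. \<forall>j\<in>I. j \<bullet> \<omega> = (if j = i then 1 else 0)"
proof -
  assume "i \<in> I"
  obtain g :: "'a \<Rightarrow> real" where g: "linear g" "\<forall>j\<in>I. g j = (if j = i then 1 else 0)"
    using linear_independent_extend[OF indep_I, of "\<lambda>j. if j = i then 1 else 0::real"] by blast
  have "j \<bullet> adjoint g 1 = g j" for j using g(1) by (simp add: adjoint_clauses)
  then show ?thesis using g(2) by (intro exI[of _ "adjoint g 1"]) auto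
qed

text \<open>Dual to the simple roots under the inner product, hence the fundamental co-weights;
  pairing with them reads off coefficients along \<open>I\<close>.\<close>

definition fund_weight :: "'a \<Rightarrow> 'a" where
  "fund_weight i = (SOME \<omega>. \<forall>j\<in>I. j \<bullet> \<omega> = (if j = i then 1 else 0))"

lemma fund_weight: "i \<in> I \<Longrightarrow> j \<in> I \<Longrightarrow> j \<bullet> fund_weight i = (if j = i then 1 else 0)"
  using someI_ex[OF dual_basis] unfolding fund_weight_def by blast

lemma nat_comb_weight_ge0: "x \<in> nat_combinations I \<Longrightarrow> i \<in> I \<Longrightarrow> 0 \<le> x \<bullet> fund_weight i"
  unfolding nat_combinations_def by (auto simp: inner_sum_left fund_weight intro!: sum_nonneg)

text \<open>The coefficient of \<open>i\<close> in \<open>\<phi> - i\<close> is still non-negative.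
  That every simple root occurs in \<open>\<phi>\<close> is used twice: to place the vertices of the
  alcove, and to turn inequalities into equalities in \<open>chamber_linear_zero\<close>.\<close>

lemma phi_weight: "i \<in> I \<Longrightarrow> 1 \<le> \<phi> \<bullet> fund_weight i"
  using nat_comb_weight_ge0[OF phi_highest, of i i] I_R fund_weight[of i i]
  by (auto simp: inner_diff_left)

lemma phi_nat_comb: "\<phi> \<in> nat_combinations I"
proof -
  obtain i where i: "i \<in> I" using I_nonempty by blast
  then have "(\<phi> - i) + i \<in> nat_combinations I"
    using I_R by (intro nat_combinations_add phi_highest nat_combinations_base[OF finite_I]) auto
  then show ?thesis by simp
qed

lemma finite_A: "finite A" using finite_I by (simp add: aff_basis_def)

lemma A_roots: "a \<in> A \<Longrightarrow> a \<in> aff_roots R"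
proof -
  assume "a \<in> A"
  then consider "a = (- \<phi>, of_int 1)" | i where "i \<in> I" "a = (i, of_int 0)"
    unfolding aff_basis_def by auto
  then show ?thesis unfolding aff_roots_def using phi_R R_minus I_R by cases blast+
qed

lemma aff_root_fst: "a \<in> aff_roots R \<Longrightarrow> fst a \<in> R"
  unfolding aff_roots_def by auto

lemma aff_root_ne0: "a \<in> aff_roots R \<Longrightarrow> fst a \<noteq> 0"
  using aff_root_fst R_ne0 by blast

lemma A_ne0: "a \<in> A \<Longrightarrow> fst a \<noteq> 0" using A_roots aff_root_ne0 by blast

lemma A_pos: "a \<in> A \<Longrightarrow> a \<in> pos"
  unfolding pos_aff_roots_def using A_roots nat_combinations_base[OF finite_A] by blast

text \<open>These are the vertices of the alcove. The origin lies opposite the wall of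
  \<open>(- \<phi>, 1)\<close>; the vertex opposite the wall of a simple root \<open>i\<close> is
  its co-weight divided by the coefficient of \<open>i\<close> in \<open>\<phi>\<close>.\<close>

lemma vertex_exists:
  assumes "a \<in> A"
  shows "\<exists>p. aff_eval a p > 0 \<and> (\<forall>b\<in>A - {a}. aff_eval b p = 0)"
proof -
  consider "a = (- \<phi>, 1)" | i where "i \<in> I" "a = (i, 0)"
    using assms unfolding aff_basis_def by auto
  then show ?thesis
  proof cases
    case 1 then show ?thesis by (intro exI[of _ 0]) (auto simp: aff_eval_def aff_basis_def)
  next
    case 2
    define m where "m = \<phi> \<bullet> fund_weight i"
    have m: "m \<ge> 1" using phi_weight 2 m_def by simp
    show ?thesis
      by (rule exI[of _ "(1/m) *\<^sub>R fund_weight i"])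
         (use 2 m in \<open>auto simp: aff_eval_def aff_basis_def fund_weight m_def split: if_splits\<close>)
  qed
qed

definition vertex :: "'a \<times> real \<Rightarrow> 'a" where
  "vertex a = (SOME p. aff_eval a p > 0 \<and> (\<forall>b\<in>A - {a}. aff_eval b p = 0))"

lemma vertex_pos: "a \<in> A \<Longrightarrow> aff_eval a (vertex a) > 0"
  and vertex_zero: "a \<in> A \<Longrightarrow> b \<in> A \<Longrightarrow> b \<noteq> a \<Longrightarrow> aff_eval b (vertex a) = 0"
  using someI_ex[OF vertex_exists] unfolding vertex_def by blast+

lemma A_nonneg_vertex: "a \<in> A \<Longrightarrow> b \<in> A \<Longrightarrow> 0 \<le> aff_eval b (vertex a)"
  using vertex_pos vertex_zero by (cases "b = a") (auto simp: less_imp_le)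

text \<open>All basis functionals but one vanish at a vertex, so evaluation there isolates one
  coefficient. Signs at the vertices thereby replace any argument about uniqueness of expansions in
  the affine basis.\<close>

lemma pos_expand:
  assumes "b \<in> pos"
  obtains c :: "'a \<times> real \<Rightarrow> nat" where "b = (\<Sum>a\<in>A. real (c a) *\<^sub>R a)"
    "\<And>a. a \<in> A \<Longrightarrow> aff_eval b (vertex a) = real (c a) * aff_eval a (vertex a)"
proof -
  obtain c :: "'a \<times> real \<Rightarrow> nat" where c: "b = (\<Sum>a\<in>A. real (c a) *\<^sub>R a)"
    using assms unfolding nat_combinations_def pos_aff_roots_def by auto
  then have e: "aff_eval b v = (\<Sum>a\<in>A. real (c a) * aff_eval a v)" for v
    by (simp add: aff_eval_sum aff_eval_scale)
  have "aff_eval b (vertex a) = real (c a) * aff_eval a (vertex a)" if "a \<in> A" for a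
    unfolding e using that by (subst sum.remove[OF finite_A that]) (auto intro!: sum.neutral simp: vertex_zero)
  then show ?thesis using that c by blast
qed

lemma lift_nat_comb: "x \<in> nat_combinations I \<Longrightarrow> (x, 0) \<in> nat_combinations A"
proof -
  assume "x \<in> nat_combinations I"
  then obtain c :: "'a \<Rightarrow> nat" where c: "x = (\<Sum>i\<in>I. real (c i) *\<^sub>R i)"
    unfolding nat_combinations_def by auto
  have "(- \<phi>, 1::real) \<notin> (\<lambda>i. (i, 0)) ` I" by auto
  then have "(\<Sum>a\<in>A. real (if snd a = 0 then c (fst a) else 0) *\<^sub>R a) = (\<Sum>a\<in>(\<lambda>i. (i, 0)) ` I. real (c (fst a)) *\<^sub>R a)"
    unfolding aff_basis_def using finite_I by (subst sum.insert) (simp_all add: zero_prod_def[symmetric], rule sum.cong, auto)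
  also have "\<dots> = (\<Sum>i\<in>I. (real (c i) *\<^sub>R i, 0))"
    by (subst sum.reindex) (auto simp: inj_on_def)
  also have "\<dots> = (x, 0)" unfolding c by (induction I rule: infinite_finite_induct) (auto simp: zero_prod_def)
  finally show ?thesis unfolding nat_combinations_def
    by (intro CollectI exI[of _ "\<lambda>a. if snd a = 0 then c (fst a) else 0"]) simp
qed

lemma delta_nat_comb: "(0, 1) \<in> nat_combinations A"
proof -
  have "(- \<phi>, 1) + (\<phi>, 0) \<in> nat_combinations A"
    by (rule nat_combinations_add[OF nat_combinations_base[OF finite_A] lift_nat_comb[OF phi_nat_comb]])
       (simp add: aff_basis_def)
  then show ?thesis by simp
qed

text \<open>Add \<open>(- \<phi>, 1)\<close> to \<open>\<phi> - (- \<alpha>)\<close>, which is a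
  non-negative combination because \<open>\<phi>\<close> also dominates \<open>- \<alpha>\<close>.
  With \<open>delta_nat_comb\<close> this makes every root with constant part at least 1
  positive.\<close>

lemma neg_root_shift: "\<alpha> \<in> R \<Longrightarrow> (\<alpha>, 1) \<in> nat_combinations A"
proof -
  assume "\<alpha> \<in> R"
  then have "(- \<phi>, 1) + (\<phi> - (- \<alpha>), 0) \<in> nat_combinations A"
    by (intro nat_combinations_add[OF nat_combinations_base[OF finite_A] lift_nat_comb[OF phi_highest]] R_minus)
       (simp add: aff_basis_def)
  then show ?thesis by simp
qed

lemma root_ge1_nat_comb: "\<alpha> \<in> R \<Longrightarrow> (\<alpha>, real (Suc n)) \<in> nat_combinations A"
  using nat_combinations_add[OF neg_root_shift nat_combinations_times[OF delta_nat_comb, of n], of \<alpha>]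
  by (simp add: add.commute)

lemma pos_or_neg: "b \<in> aff_roots R \<Longrightarrow> b \<in> pos \<or> - b \<in> pos"
proof -
  assume "b \<in> aff_roots R"
  then obtain \<alpha> m where b: "b = (\<alpha>, of_int m)" "\<alpha> \<in> R" unfolding aff_roots_def by auto
  have r: "b \<in> aff_roots R" "- b \<in> aff_roots R"
    using b R_minus unfolding aff_roots_def by (auto intro!: exI[of _ "- m"])
  consider "m = 0" | n where "m = int (Suc n)" | n where "m = - int (Suc n)"
    by (metis int_cases of_nat_0 old.nat.exhaust)
  then have "b \<in> nat_combinations A \<or> - b \<in> nat_combinations A"
  proof cases
    case 1 then show ?thesis using R_cases[OF b(2)] lift_nat_comb b by auto
  next
    case 2 then show ?thesis using root_ge1_nat_comb[OF b(2)] b by (auto simp: add.commute)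
  next
    case 3 then show ?thesis using root_ge1_nat_comb[OF R_minus[OF b(2)]] b by (auto simp: add.commute)
  qed
  then show ?thesis using r unfolding pos_aff_roots_def by auto
qed

lemma pos_roots_aff: "b \<in> pos \<Longrightarrow> b \<in> aff_roots R" unfolding pos_aff_roots_def by auto

lemma pos_vertex: "b \<in> pos \<Longrightarrow> a \<in> A \<Longrightarrow> 0 \<le> aff_eval b (vertex a)"
proof -
  assume b: "b \<in> pos" and a: "a \<in> A"
  obtain c :: "'a \<times> real \<Rightarrow> nat" where c: "b = (\<Sum>a\<in>A. real (c a) *\<^sub>R a)"
    "\<And>a. a \<in> A \<Longrightarrow> aff_eval b (vertex a) = real (c a) * aff_eval a (vertex a)"
    using pos_expand[OF b] by blast
  show ?thesis using vertex_pos[OF a] c(2)[OF a] by simp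
qed

lemma posI: "b \<in> aff_roots R \<Longrightarrow> a \<in> A \<Longrightarrow> 0 < aff_eval b (vertex a) \<Longrightarrow> b \<in> pos"
  using pos_or_neg[of b] pos_vertex[of "- b" a] by (auto simp: aff_eval_minus)

lemma pos_not_neg: "b \<in> pos \<Longrightarrow> - b \<notin> pos"
proof
  assume b: "b \<in> pos" "- b \<in> pos"
  obtain c :: "'a \<times> real \<Rightarrow> nat" where c: "b = (\<Sum>a\<in>A. real (c a) *\<^sub>R a)"
    "\<And>a. a \<in> A \<Longrightarrow> aff_eval b (vertex a) = real (c a) * aff_eval a (vertex a)"
    using pos_expand[OF b(1)] by blast
  have "c a = 0" if "a \<in> A" for a
    using pos_vertex[OF b(1) that] pos_vertex[OF b(2) that] vertex_pos[OF that] c(2)[OF that]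
    by (auto simp: aff_eval_minus mult_le_0_iff)
  then have "b = 0" unfolding c(1) by simp
  then show False using aff_root_ne0[OF pos_roots_aff[OF b(1)]] by simp
qed

lemma root_refl_roots: "a \<in> aff_roots R \<Longrightarrow> b \<in> aff_roots R \<Longrightarrow> root_refl a b \<in> aff_roots R"
proof -
  assume "a \<in> aff_roots R" "b \<in> aff_roots R"
  then obtain \<alpha> m \<beta> n where ab: "a = (\<alpha>, of_int m)" "\<alpha> \<in> R" "b = (\<beta>, of_int n)" "\<beta> \<in> R"
    unfolding aff_roots_def by auto
  obtain l where l: "\<beta> \<bullet> coroot \<alpha> = of_int l" using integral_R[OF ab(2,4)] Ints_cases by blast
  have "root_refl a b = (refl \<alpha> \<beta>, of_int (n - l * m))"
    using fst_root_refl[of a b] ab l by (auto simp: root_refl_def prod_eq_iff)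
  then show ?thesis unfolding aff_roots_def using refl_R[OF ab(2,4)] by blast
qed

text \<open>The reflection changes only the coefficient of \<open>a\<close>. Since the root system
  is reduced, a positive \<open>b \<noteq> a\<close> has a non-zero coefficient elsewhere, and that
  one value at a vertex keeps the reflected root positive.\<close>

lemma simple_refl_pos:
  assumes a: "a \<in> A" and b: "b \<in> pos" "b \<noteq> a"
  shows "root_refl a b \<in> pos" "root_refl a b \<noteq> a"
proof -
  obtain c :: "'a \<times> real \<Rightarrow> nat" where c: "b = (\<Sum>a\<in>A. real (c a) *\<^sub>R a)"
    "\<And>a. a \<in> A \<Longrightarrow> aff_eval b (vertex a) = real (c a) * aff_eval a (vertex a)"
    using pos_expand[OF b(1)] by blast
  have "\<exists>j\<in>A - {a}. c j \<noteq> 0"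
  proof (rule ccontr)
    assume "\<not> ?thesis"
    then have eq: "b = real (c a) *\<^sub>R a"
      using a by (subst c(1), subst sum.remove[OF finite_A a]) (auto intro!: sum.neutral)
    then have "real (c a) *\<^sub>R fst a \<in> R" using aff_root_fst[OF pos_roots_aff[OF b(1)]] by simp
    then have "real (c a) = 1" using reduced_R[OF aff_root_fst[OF A_roots[OF a]], of "real (c a)"] by auto
    then show False using eq b(2) by simp
  qed
  then obtain j where j: "j \<in> A" "j \<noteq> a" "c j \<noteq> 0" by blast
  have "aff_eval (root_refl a b) (vertex j) = real (c j) * aff_eval j (vertex j)"
    using j a c(2)[OF j(1)] by (simp add: root_refl_def aff_eval_diff aff_eval_scale vertex_zero)
  also have "\<dots> > 0" using j vertex_pos by simp
  finally show "root_refl a b \<in> pos"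
    using root_refl_roots[OF A_roots[OF a] pos_roots_aff[OF b(1)]] j(1) by (rule posI[rotated 2])
  show "root_refl a b \<noteq> a"
  proof
    assume "root_refl a b = a"
    then have "b = - a" using root_refl_involution[OF A_ne0[OF a], of b] root_refl_self[OF A_ne0[OF a]] by simp
    then show False using pos_not_neg A_pos a b(1) by blast
  qed
qed

text \<open>The sum of the coefficients in the affine basis, expressed through the vertices so that
  it is linear in \<open>b\<close> without choosing an expansion.\<close>

definition height :: "'a \<times> real \<Rightarrow> real" where
  "height b = (\<Sum>a\<in>A. aff_eval b (vertex a) / aff_eval a (vertex a))"

lemma height_pos_nat: "b \<in> pos \<Longrightarrow> \<exists>n. height b = real n"
proof -
  assume b: "b \<in> pos"
  obtain c :: "'a \<times> real \<Rightarrow> nat" where c: "b = (\<Sum>a\<in>A. real (c a) *\<^sub>R a)"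
    "\<And>a. a \<in> A \<Longrightarrow> aff_eval b (vertex a) = real (c a) * aff_eval a (vertex a)"
    using pos_expand[OF b] by blast
  from c(2) have "height b = (\<Sum>a\<in>A. real (c a))"
    unfolding height_def using vertex_pos by (intro sum.cong) (auto simp: less_imp_neq[symmetric])
  then show ?thesis by (intro exI[of _ "\<Sum>a\<in>A. c a"]) simp
qed

lemma height_simple: "a \<in> A \<Longrightarrow> height a = 1"
proof -
  assume a: "a \<in> A"
  have "aff_eval a (vertex x) / aff_eval x (vertex x) = 0" if "x \<in> A - {a}" for x
    using vertex_zero[of x a] a that by auto
  then have "(\<Sum>x\<in>A - {a}. aff_eval a (vertex x) / aff_eval x (vertex x)) = 0"
    by (intro sum.neutral) blast
  then show ?thesis unfolding height_def sum.remove[OF finite_A a] using vertex_pos[OF a] by simp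
qed

lemma height_root_refl: "a \<in> A \<Longrightarrow> height (root_refl a b) = height b - fst b \<bullet> coroot (fst a)"
proof -
  assume a: "a \<in> A"
  have "height (root_refl a b) = height b - (fst b \<bullet> coroot (fst a)) * height a"
    unfolding height_def root_refl_def
    by (simp add: aff_eval_diff aff_eval_scale diff_divide_distrib sum_subtractf sum_distrib_left)
  then show ?thesis using height_simple[OF a] by simp
qed

text \<open>Expanding the positive number \<open>fst b \<bullet> fst b\<close> along the affine
  basis, some term must be positive. The clause on \<open>snd\<close> keeps the descent inside the
  finite root system: all constants in the basis are non-negative, so a root with constant part zero
  does not involve \<open>(- \<phi>, 1)\<close>.\<close>

lemma pos_descent:
  assumes b: "b \<in> pos"
  shows "\<exists>a\<in>A. 0 < fst b \<bullet> fst a \<and> (snd b = 0 \<longrightarrow> snd a = 0)"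
proof -
  obtain c :: "'a \<times> real \<Rightarrow> nat" where c: "b = (\<Sum>a\<in>A. real (c a) *\<^sub>R a)"
    "\<And>a. a \<in> A \<Longrightarrow> aff_eval b (vertex a) = real (c a) * aff_eval a (vertex a)"
    using pos_expand[OF b] by blast
  have "fst b = (\<Sum>a\<in>A. real (c a) *\<^sub>R fst a)" by (subst c(1)) (simp add: fst_sum)
  then have "fst b \<bullet> fst b = (\<Sum>a\<in>A. real (c a) * (fst b \<bullet> fst a))"
    by (metis (no_types, lifting) inner_scaleR_right inner_sum_right sum.cong)
  moreover have "0 < fst b \<bullet> fst b" using aff_root_ne0[OF pos_roots_aff[OF b]] by simp
  ultimately have s0: "0 < (\<Sum>a\<in>A. real (c a) * (fst b \<bullet> fst a))" by simp
  have "\<exists>a\<in>A. 0 < real (c a) * (fst b \<bullet> fst a)"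
  proof (rule ccontr)
    assume "\<not> ?thesis"
    then have "(\<Sum>a\<in>A. real (c a) * (fst b \<bullet> fst a)) \<le> 0" by (intro sum_nonpos) (meson not_less)
    then show False using s0 by linarith
  qed
  then obtain a where a: "a \<in> A" "0 < real (c a) * (fst b \<bullet> fst a)" by blast
  then have ca: "c a \<noteq> 0" "0 < fst b \<bullet> fst a" by (auto simp: zero_less_mult_iff)
  have sA: "0 \<le> snd a" if "a \<in> A" for a using that unfolding aff_basis_def by auto
  have "snd b = (\<Sum>a\<in>A. real (c a) * snd a)" by (subst c(1)) (simp add: snd_sum)
  then have "real (c a) * snd a \<le> snd b"
    using member_le_sum[of a A "\<lambda>a. real (c a) * snd a"] a finite_A sA by auto
  then have "snd b = 0 \<longrightarrow> snd a = 0" using ca sA[OF a(1)] by (auto simp: mult_le_0_iff)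
  then show ?thesis using a ca by blast
qed

lemma simple_zero_I: "a \<in> A \<Longrightarrow> snd a = 0 \<Longrightarrow> fst a \<in> I" unfolding aff_basis_def by auto

text \<open>Induction on the height, which a reflection with positive pairing lowers by a positive
  integer. The affine and the finite statement share the induction because the descent preserves
  constant part zero.\<close>

lemma root_reduction:
  assumes "b \<in> pos"
  shows "aff_refl b \<in> generated_by (aff_refl ` A) \<and>
    (snd b = 0 \<longrightarrow> refl (fst b) \<in> generated_by (refl ` I) \<and>
      (\<exists>w\<in>generated_by (refl ` I). w (fst b) \<in> I))"
  using assms
proof (induction "nat \<lfloor>height b\<rfloor>" arbitrary: b rule: less_induct)
  case less
  obtain a where a: "a \<in> A" "0 < fst b \<bullet> fst a" "snd b = 0 \<longrightarrow> snd a = 0"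
    using pos_descent[OF less.prems] by blast
  show ?case
  proof (cases "b = a")
    case True
    have "aff_refl b \<in> generated_by (aff_refl ` A)" using True a by (intro generated_by_base imageI) simp
    moreover have "refl (fst b) \<in> generated_by (refl ` I) \<and> id (fst b) \<in> I" if "snd b = 0"
      using True a simple_zero_I[OF a(1)] that by (auto intro: generated_by_base)
    ultimately show ?thesis using generated_by.gen_id by blast
  next
    case False
    note a' = A_ne0[OF a(1)]
    define b' where "b' = root_refl a b"
    have b': "b' \<in> pos" unfolding b'_def using simple_refl_pos a False less.prems by blast
    obtain l where l: "fst b \<bullet> coroot (fst a) = of_int l"
      using integral_R[OF aff_root_fst[OF A_roots[OF a(1)]] aff_root_fst[OF pos_roots_aff[OF less.prems]]]
        Ints_cases by blast
    have "0 < fst b \<bullet> coroot (fst a)" using a a' by (simp add: inner_coroot)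
    then have "height b' \<le> height b - 1"
      unfolding b'_def height_root_refl[OF a(1)] using l by simp
    then have "nat \<lfloor>height b'\<rfloor> < nat \<lfloor>height b\<rfloor>"
      using height_pos_nat[OF b'] height_pos_nat[OF less.prems] by auto
    note IH = less.hyps[OF this b']
    have bb: "b = root_refl a b'" unfolding b'_def by (simp add: root_refl_involution[OF a'])
    have "aff_refl b = aff_refl a \<circ> aff_refl b' \<circ> aff_refl a"
      by (subst bb) (rule aff_refl_conj[OF a'])
    then have 1: "aff_refl b \<in> generated_by (aff_refl ` A)"
      using IH a generated_by_comp generated_by_base by (metis imageI)
    have 2: "refl (fst b) \<in> generated_by (refl ` I) \<and> (\<exists>w\<in>generated_by (refl ` I). w (fst b) \<in> I)"
      if "snd b = 0"
    proof -
      have a0: "snd a = 0" "fst a \<in> I" using a that simple_zero_I by auto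
      have "snd b' = 0" unfolding b'_def root_refl_def using that a0 by simp
      then obtain w where w: "refl (fst b') \<in> generated_by (refl ` I)" "w \<in> generated_by (refl ` I)" "w (fst b') \<in> I"
        using IH by blast
      have f: "fst b = refl (fst a) (fst b')" by (subst bb) (rule fst_root_refl)
      have "refl (fst b) = refl (fst a) \<circ> refl (fst b') \<circ> refl (fst a)"
        unfolding f by (rule refl_conj)
      moreover have "(w \<circ> refl (fst a)) (fst b) \<in> I" using w unfolding f by simp
      moreover have ra: "refl (fst a) \<in> generated_by (refl ` I)" using a0 by (intro generated_by_base imageI)
      ultimately show ?thesis using w generated_by_comp by metis
    qed
    show ?thesis using 1 2 by blast
  qed
qed

end

lemma aff_eval_continuous [continuous_intros]:
  "continuous_on S f \<Longrightarrow> continuous_on S (\<lambda>x. aff_eval a (f x))"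
  unfolding aff_eval_def by (intro continuous_intros)

lemma aff_refl_continuous [continuous_intros]:
  "continuous_on S f \<Longrightarrow> continuous_on S (\<lambda>x. aff_refl a (f x))"
  unfolding aff_refl_def by (intro continuous_intros)

lemma aff_eval_shift: "aff_eval a (x + t *\<^sub>R u) = aff_eval a x + t * (fst a \<bullet> u)"
  by (simp add: aff_eval_def inner_add_right)

lemma aff_refl_minus: "aff_refl (- a) = aff_refl a"
  by (rule ext) (simp add: aff_refl_def aff_eval_def coroot_minus algebra_simps)

lemma dist_aff_refl: "dist (aff_refl a x) (aff_refl a y) = dist x y"
proof -
  have "aff_refl a x - aff_refl a y = refl (fst a) (x - y)" by (simp add: aff_refl_eq refl_diff)
  then show ?thesis by (simp add: dist_norm norm_eq_sqrt_inner refl_inner)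
qed

text \<open>Reflecting \<open>v\<close> to the side of \<open>x\<close> changes the squared distance
  by \<open>4 * aff_eval a v * aff_eval a x\<close> divided by the squared length of the gradient,
  which is not positive. This is the source of the continuity of folding.\<close>

lemma dist_reflect_le:
  assumes "fst a \<noteq> 0" "aff_eval a v \<le> 0" "0 \<le> aff_eval a x"
  shows "dist x (aff_refl a v) \<le> dist x v"
proof -
  let ?n = "fst a \<bullet> fst a"
  have n: "?n > 0" using assms by simp
  have e: "x - aff_refl a v = (x - v) + aff_eval a v *\<^sub>R coroot (fst a)" by (simp add: aff_refl_def)
  have i: "(x - v) \<bullet> coroot (fst a) = 2 * (aff_eval a x - aff_eval a v) / ?n"
    by (simp add: coroot_def aff_eval_def inner_diff_left inner_diff_right inner_commute)
  have c: "coroot (fst a) \<bullet> coroot (fst a) = 4 / ?n"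
    using n by (simp add: coroot_def)
  have "(x - aff_refl a v) \<bullet> (x - aff_refl a v) =
     (x - v) \<bullet> (x - v) + 2 * aff_eval a v * ((x - v) \<bullet> coroot (fst a)) +
     (aff_eval a v)\<^sup>2 * (coroot (fst a) \<bullet> coroot (fst a))"
    unfolding e by (simp add: inner_add_left inner_add_right inner_commute power2_eq_square)
  also have "\<dots> = (x - v) \<bullet> (x - v) + 4 * (aff_eval a v * aff_eval a x) / ?n"
    unfolding i c using n by (simp add: field_simps power2_eq_square)
  also have "\<dots> \<le> (x - v) \<bullet> (x - v)"
    using assms n by (simp add: divide_le_0_iff mult_nonpos_nonneg)
  finally show ?thesis by (simp add: dist_norm norm_eq_sqrt_inner)
qed

context affine_root_system
begin

lemma W_eq: "W = generated_by (aff_refl ` A)"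
proof
  show "W \<subseteq> generated_by (aff_refl ` A)" unfolding aff_weyl_group_def
  proof (rule generated_by_least, rule image_subsetI)
    fix b assume "b \<in> aff_roots R"
    then consider "b \<in> pos" | "- b \<in> pos" using pos_or_neg by blast
    then show "aff_refl b \<in> generated_by (aff_refl ` A)"
      using root_reduction[of b] root_reduction[of "- b"] by cases (auto simp: aff_refl_minus)
  qed
  show "generated_by (aff_refl ` A) \<subseteq> W" unfolding aff_weyl_group_def
    by (rule generated_by_least) (auto intro!: generated_by_base A_roots)
qed

lemma R_pos: "\<alpha> \<in> R \<Longrightarrow> (\<alpha>, 0) \<in> pos \<or> (- \<alpha>, 0) \<in> pos"
  using pos_or_neg[of "(\<alpha>, 0)"] unfolding aff_roots_def by (auto intro!: exI[of _ 0])

lemma W0_eq: "W0 = generated_by (refl ` I)"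
proof
  show "W0 \<subseteq> generated_by (refl ` I)" unfolding weyl_group_def
  proof (rule generated_by_least, rule image_subsetI)
    fix b assume "b \<in> R"
    then consider "(b, 0) \<in> pos" | "(- b, 0) \<in> pos" using R_pos by blast
    then show "refl b \<in> generated_by (refl ` I)"
      using root_reduction[of "(b, 0)"] root_reduction[of "(- b, 0)"] by cases auto
  qed
  show "generated_by (refl ` I) \<subseteq> W0" unfolding weyl_group_def
    by (rule generated_by_least) (use I_R in \<open>auto intro!: generated_by_base\<close>)
qed

lemma root_conj_simple: "\<alpha> \<in> R \<Longrightarrow> \<exists>w\<in>W0. w \<alpha> \<in> I"
proof -
  assume a: "\<alpha> \<in> R"
  have *: "\<exists>w\<in>W0. w \<beta> \<in> I" if "(\<beta>, 0) \<in> pos" for \<beta>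
    using root_reduction[OF that] unfolding W0_eq by simp
  show ?thesis
  proof (cases "(\<alpha>, 0) \<in> pos")
    case False
    then obtain w where w: "w \<in> W0" "w (- \<alpha>) \<in> I" using R_pos[OF a] * by blast
    have "refl \<alpha> \<in> W0" unfolding weyl_group_def using a by (intro generated_by_base imageI)
    then have "w \<circ> refl \<alpha> \<in> W0" using w(1) generated_by_comp unfolding weyl_group_def by blast
    moreover have "(w \<circ> refl \<alpha>) \<alpha> \<in> I" using w(2) by (simp add: refl_self)
    ultimately show ?thesis by blast
  qed (rule *)
qed

section \<open>Words, exchange, and the alcove as a fundamental domain\<close>

definition word :: "('a \<times> real) list \<Rightarrow> 'a \<Rightarrow> 'a" where
  "word l = foldr (\<lambda>a g. aff_refl a \<circ> g) l id"

lemma word_simps [simp]: "word [] = id" "word (a # l) = aff_refl a \<circ> word l"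
  by (simp_all add: word_def)

lemma W_word: "w \<in> W \<Longrightarrow> \<exists>l. set l \<subseteq> A \<and> w = word l"
  unfolding W_eq
proof (induction rule: generated_by.induct)
  case gen_id show ?case by (intro exI[of _ "[]"]) simp
next
  case (gen_comp s w)
  then obtain l a where "set l \<subseteq> A" "w = word l" "a \<in> A" "s = aff_refl a" by blast
  then show ?case by (intro exI[of _ "a # l"]) simp
qed

lemma word_W: "set l \<subseteq> A \<Longrightarrow> word l \<in> W"
  unfolding W_eq
proof (induction l)
  case Nil show ?case by (simp only: word_simps generated_by.gen_id)
next
  case (Cons a l)
  then have "aff_refl a \<in> aff_refl ` A" "word l \<in> generated_by (aff_refl ` A)" by auto
  then show ?case by (simp only: word_simps generated_by.gen_comp)
qed

text \<open>\<open>pull l b\<close> is the affine root \<open>b \<circ> word l\<close>.\<close>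

definition pull :: "('a \<times> real) list \<Rightarrow> 'a \<times> real \<Rightarrow> 'a \<times> real" where
  "pull l b = fold root_refl l b"

lemma aff_eval_pull: "aff_eval (pull l b) v = aff_eval b (word l v)"
  by (induction l arbitrary: b) (auto simp: pull_def aff_eval_root_refl)

text \<open>Follow \<open>b\<close> through the word. Simple reflections keep positive roots
  positive except their own root, so at the letter where \<open>b\<close> turns negative it equals
  the root of that letter, and this letter can be deleted.\<close>

lemma exchange:
  assumes "set l \<subseteq> A" "b \<in> pos" "pull l b \<notin> pos"
  shows "\<exists>l'. set l' \<subseteq> A \<and> length l' < length l \<and> word l' = aff_refl b \<circ> word l"
  using assms
proof (induction l arbitrary: b)
  case Nil then show ?case by (simp add: pull_def)
next
  case (Cons a l)
  have a: "a \<in> A" and l: "set l \<subseteq> A" and a0: "fst a \<noteq> 0" using Cons.prems A_ne0 by auto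
  show ?case
  proof (cases "b = a")
    case True
    have "word l = aff_refl b \<circ> word (a # l)"
      by (rule ext) (simp add: aff_refl_aff_refl[OF a0] True)
    moreover have "set l \<subseteq> A" "length l < length (a # l)" using Cons.prems by auto
    ultimately show ?thesis by blast
  next
    case False
    have "root_refl a b \<in> pos" using simple_refl_pos a Cons.prems False by blast
    moreover have "pull l (root_refl a b) \<notin> pos" using Cons.prems by (simp add: pull_def)
    ultimately obtain l' where l': "set l' \<subseteq> A" "length l' < length l"
      "word l' = aff_refl (root_refl a b) \<circ> word l"
      using Cons.IH[of "root_refl a b"] l by blast
    have "word (a # l') = aff_refl b \<circ> word (a # l)"
      by (rule ext) (simp add: l'(3) aff_refl_conj[OF a0, of b] aff_refl_aff_refl[OF a0])
    moreover have "set (a # l') \<subseteq> A" "length (a # l') < length (a # l)" using l' a by auto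
    ultimately show ?thesis by blast
  qed
qed

definition Cbar :: "'a set" where "Cbar = {v. \<forall>a\<in>A. 0 \<le> aff_eval a v}"

lemma CbarD: "v \<in> Cbar \<Longrightarrow> a \<in> A \<Longrightarrow> 0 \<le> aff_eval a v" by (simp add: Cbar_def)

lemma pos_eval_expand:
  assumes "b \<in> pos"
  obtains c :: "'a \<times> real \<Rightarrow> nat" where "\<And>v. aff_eval b v = (\<Sum>a\<in>A. real (c a) * aff_eval a v)"
    "\<exists>a\<in>A. c a \<noteq> 0"
proof -
  obtain c :: "'a \<times> real \<Rightarrow> nat" where c: "b = (\<Sum>a\<in>A. real (c a) *\<^sub>R a)"
    using pos_expand[OF assms] by blast
  have "b \<noteq> 0" using aff_root_ne0[OF pos_roots_aff[OF assms]] by auto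
  then have "\<exists>a\<in>A. c a \<noteq> 0" using c by (metis (no_types, lifting) of_nat_0 scale_zero_left sum.neutral)
  moreover have "aff_eval b v = (\<Sum>a\<in>A. real (c a) * aff_eval a v)" for v
    by (subst c) (simp add: aff_eval_sum aff_eval_scale)
  ultimately show ?thesis using that by blast
qed

lemma pos_Cbar: "b \<in> pos \<Longrightarrow> v \<in> Cbar \<Longrightarrow> 0 \<le> aff_eval b v"
  by (erule pos_eval_expand) (auto intro!: sum_nonneg mult_nonneg_nonneg simp: CbarD)

lemma pos_alcove: "b \<in> pos \<Longrightarrow> v \<in> fundamental_alcove I \<phi> \<Longrightarrow> 0 < aff_eval b v"
proof -
  assume b: "b \<in> pos" and v: "v \<in> fundamental_alcove I \<phi>"
  have v': "0 < aff_eval a v" if "a \<in> A" for a using v that by (simp add: fundamental_alcove_def)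
  obtain c :: "'a \<times> real \<Rightarrow> nat" where c: "\<And>v. aff_eval b v = (\<Sum>a\<in>A. real (c a) * aff_eval a v)"
    "\<exists>a\<in>A. c a \<noteq> 0" using pos_eval_expand[OF b] by blast
  then obtain a where a: "a \<in> A" "c a \<noteq> 0" by blast
  show ?thesis unfolding c(1)
    by (rule sum_pos2[OF finite_A a(1)]) (use a v' in \<open>auto simp: less_imp_le\<close>)
qed

lemma alcove_Cbar: "fundamental_alcove I \<phi> \<subseteq> Cbar"
  by (auto simp: fundamental_alcove_def Cbar_def less_imp_le)

lemma zero_Cbar: "0 \<in> Cbar"
  by (auto simp: Cbar_def aff_basis_def aff_eval_def)

text \<open>Let \<open>a\<close> be the outermost letter and \<open>m\<close> the rest. If
  \<open>pull m a\<close> is positive, then \<open>a\<close> is non-negative both at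
  \<open>word m x\<close> and, by assumption, at its mirror image, so the letter acts trivially
  there. Otherwise the exchange property shortens the word.\<close>

lemma word_fixes_Cbar:
  assumes "set l \<subseteq> A" "x \<in> Cbar" "word l x \<in> Cbar"
  shows "word l x = x"
  using assms
proof (induction "length l" arbitrary: l rule: less_induct)
  case less
  show ?case
  proof (cases l)
    case (Cons a m)
    have a: "a \<in> A" "set m \<subseteq> A" using less.prems Cons by auto
    have eq: "word l x = aff_refl a (word m x)" using Cons by simp
    show ?thesis
    proof (cases "pull m a \<in> pos")
      case True
      then have "0 \<le> aff_eval a (word m x)" using pos_Cbar less.prems by (metis aff_eval_pull)
      moreover have "0 \<le> aff_eval a (word l x)" using CbarD less.prems a by blast
      then have "aff_eval a (word m x) \<le> 0"
        unfolding eq by (simp flip: aff_eval_root_refl add: root_refl_self[OF A_ne0[OF a(1)]] aff_eval_minus)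
      ultimately have "aff_eval a (word m x) = 0" by simp
      then have "word l x = word m x" unfolding eq by (simp add: aff_refl_def)
      then show ?thesis using less.hyps[of m] less.prems a Cons by simp
    next
      case False
      then obtain m' where "set m' \<subseteq> A" "length m' < length m" "word m' = aff_refl a \<circ> word m"
        using exchange[OF a(2) A_pos[OF a(1)]] by blast
      then show ?thesis using less.hyps[of m'] less.prems eq Cons by simp
    qed
  qed simp
qed

lemma W_fixes_Cbar: "w \<in> W \<Longrightarrow> x \<in> Cbar \<Longrightarrow> w x \<in> Cbar \<Longrightarrow> w x = x"
  using W_word word_fixes_Cbar by metis

lemma W_refl: "b \<in> aff_roots R \<Longrightarrow> aff_refl b \<in> W"
  unfolding aff_weyl_group_def by (intro generated_by_base imageI)

lemma W_comp: "w \<in> W \<Longrightarrow> w' \<in> W \<Longrightarrow> w \<circ> w' \<in> W"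
  unfolding aff_weyl_group_def by (rule generated_by_comp)

lemma W_inv: "w \<in> W \<Longrightarrow> bij w" "w \<in> W \<Longrightarrow> inv w \<in> W"
  unfolding aff_weyl_group_def
  using generated_by_inv[of "aff_refl ` aff_roots R" w] aff_refl_aff_refl aff_root_ne0 by blast+

lemma W_inv_apply: "w \<in> W \<Longrightarrow> w (inv w x) = x" "w \<in> W \<Longrightarrow> inv w (w x) = x"
  using W_inv(1) by (auto simp: bij_is_surj surj_f_inv_f bij_is_inj inv_f_f)

lemma W_dist: "w \<in> W \<Longrightarrow> dist (w x) (w y) = dist x y"
  unfolding aff_weyl_group_def
  by (induction rule: generated_by.induct) (auto simp: dist_aff_refl)

section \<open>Folding the space onto the closed alcove\<close>

lemma finite_neg: "finite {b\<in>pos. aff_eval b v < 0}"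
proof -
  \<comment> \<open>Bounds the pairing of every root with \<open>v\<close>, and hence the constant
    part of a positive affine root that is negative at \<open>v\<close>.\<close>
  define M where "M = (\<Sum>\<alpha>\<in>R. \<bar>\<alpha> \<bullet> v\<bar>)"
  have "{b\<in>pos. aff_eval b v < 0} \<subseteq> (\<lambda>(\<alpha>, m). (\<alpha>, of_int m)) ` (R \<times> {0..\<lfloor>M\<rfloor>})"
  proof
    fix b assume b: "b \<in> {b\<in>pos. aff_eval b v < 0}"
    then have "b \<in> aff_roots R" using pos_roots_aff by blast
    then obtain \<alpha> m where m: "b = (\<alpha>, of_int m)" "\<alpha> \<in> R" unfolding aff_roots_def by blast
    have "0 \<le> aff_eval b 0" using pos_Cbar zero_Cbar b by blast
    then have "0 \<le> m" using m by (simp add: aff_eval_def)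
    moreover have "of_int m \<le> M"
    proof -
      have "\<bar>\<alpha> \<bullet> v\<bar> \<le> M" unfolding M_def using m(2) finite_R
        by (intro member_le_sum[where f = "\<lambda>\<alpha>. \<bar>\<alpha> \<bullet> v\<bar>"]) auto
      then show ?thesis using b m(1) by (auto simp: aff_eval_def)
    qed
    then have "m \<le> \<lfloor>M\<rfloor>" by (simp add: le_floor_iff)
    ultimately show "b \<in> (\<lambda>(\<alpha>, m). (\<alpha>, of_int m)) ` (R \<times> {0..\<lfloor>M\<rfloor>})" using m by auto
  qed
  then show ?thesis using finite_R finite_subset by blast
qed

text \<open>Induction on the number of positive roots negative at \<open>v\<close>: reflecting in a
  violated wall \<open>a\<close> permutes the positive roots other than \<open>a\<close> and makes
  \<open>a\<close> positive. The distance inequality is carried along so that folding turns out to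
  be a contraction.\<close>

lemma fold_exists: "\<exists>w\<in>W. w v \<in> Cbar \<and> (\<forall>x\<in>Cbar. dist x (w v) \<le> dist x v)"
proof (induction "card {b\<in>pos. aff_eval b v < 0}" arbitrary: v rule: less_induct)
  case less
  show ?case
  proof (cases "v \<in> Cbar")
    case True
    then show ?thesis using word_W[of "[]"] by (intro bexI[of _ id]) auto
  next
    case False
    then obtain a where a: "a \<in> A" "aff_eval a v < 0" unfolding Cbar_def by (auto simp: not_le)
    note a0 = A_ne0[OF a(1)]
    define v' where "v' = aff_refl a v"
    have av': "aff_eval a v' > 0"
      unfolding v'_def by (simp flip: aff_eval_root_refl add: root_refl_self[OF a0] aff_eval_minus a(2))
    have sub: "root_refl a ` {b\<in>pos. aff_eval b v' < 0} \<subseteq> {b\<in>pos. aff_eval b v < 0} - {a}"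
    proof (rule image_subsetI)
      fix b assume b: "b \<in> {b\<in>pos. aff_eval b v' < 0}"
      then have "b \<noteq> a" using av' by auto
      then show "root_refl a b \<in> {b\<in>pos. aff_eval b v < 0} - {a}"
        using simple_refl_pos[OF a(1), of b] b by (auto simp: aff_eval_root_refl v'_def)
    qed
    have "inj_on (root_refl a) {b\<in>pos. aff_eval b v' < 0}"
      by (rule inj_onI) (metis root_refl_involution[OF a0])
    then have "card {b\<in>pos. aff_eval b v' < 0} \<le> card ({b\<in>pos. aff_eval b v < 0} - {a})"
      using sub finite_neg by (intro card_inj_on_le) auto
    also have "\<dots> < card {b\<in>pos. aff_eval b v < 0}"
      using a A_pos finite_neg by (intro card_Diff1_less) auto
    finally obtain w where w: "w \<in> W" "w v' \<in> Cbar" "\<And>x. x \<in> Cbar \<Longrightarrow> dist x (w v') \<le> dist x v'"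
      using less by blast
    have "dist x (w v') \<le> dist x v" if "x \<in> Cbar" for x
      using w(3)[OF that] dist_reflect_le[OF a0, of v x] a CbarD[OF that a(1)] unfolding v'_def by simp
    then show ?thesis using w W_comp[OF w(1) W_refl[OF A_roots[OF a(1)]]] unfolding v'_def
      by (intro bexI[of _ "w \<circ> aff_refl a"]) auto
  qed
qed

definition fold_pt :: "'a \<Rightarrow> 'a" where
  "fold_pt v = (SOME y. y \<in> Cbar \<and> (\<exists>w\<in>W. y = w v))"

lemma fold_pt: "fold_pt v \<in> Cbar" "\<exists>w\<in>W. fold_pt v = w v"
proof -
  have "\<exists>y. y \<in> Cbar \<and> (\<exists>w\<in>W. y = w v)" using fold_exists[of v] by blast
  from someI_ex[OF this] show "fold_pt v \<in> Cbar" "\<exists>w\<in>W. fold_pt v = w v"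
    unfolding fold_pt_def by blast+
qed

lemma fold_pt_eq:
  assumes "w \<in> W" "w v \<in> Cbar"
  shows "fold_pt v = w v"
proof -
  obtain w' where w': "w' \<in> W" "fold_pt v = w' v" using fold_pt by blast
  have "(w' \<circ> inv w) (w v) = w v"
    by (rule W_fixes_Cbar[OF W_comp[OF w'(1) W_inv(2)[OF assms(1)]] assms(2)])
       (use fold_pt(1)[of v] w'(2) W_inv_apply[OF assms(1)] in simp)
  then show ?thesis using w' W_inv_apply[OF assms(1)] by simp
qed

lemma fold_pt_Cbar: "v \<in> Cbar \<Longrightarrow> fold_pt v = v"
  using fold_pt_eq[OF word_W[of "[]"], of v] by simp

lemma fold_pt_W: "w \<in> W \<Longrightarrow> fold_pt (w v) = fold_pt v"
proof -
  assume w: "w \<in> W"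
  obtain w' where w': "w' \<in> W" "fold_pt (w v) = w' (w v)" using fold_pt by blast
  then have "(w' \<circ> w) v \<in> Cbar" using fold_pt(1)[of "w v"] by simp
  then show ?thesis using fold_pt_eq[OF W_comp[OF w'(1) w]] w'(2) by simp
qed

text \<open>Move \<open>x\<close> into the closed alcove by an isometry \<open>w\<close>. Folding
  \<open>w y\<close> then does not increase its distance to points of the closed alcove, in
  particular to \<open>w x\<close>.\<close>

lemma fold_pt_dist: "dist (fold_pt x) (fold_pt y) \<le> dist x y"
proof -
  obtain w where w: "w \<in> W" "fold_pt x = w x" using fold_pt by blast
  obtain w' where w': "w' \<in> W" "w' (w y) \<in> Cbar" "\<forall>z\<in>Cbar. dist z (w' (w y)) \<le> dist z (w y)"
    using fold_exists[of "w y"] by blast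
  have "fold_pt y = w' (w y)" using fold_pt_eq[of w' "w y"] w' w fold_pt_W by simp
  then have "dist (fold_pt x) (fold_pt y) \<le> dist (w x) (w y)"
    using w' w fold_pt(1)[of x] by simp
  then show ?thesis using W_dist[OF w(1)] by simp
qed

lemma fold_pt_continuous: "continuous_on S fold_pt"
  by (rule continuous_onI) (meson fold_pt_dist order_trans less_imp_le)

section \<open>The finite Weyl group and linear parts\<close>

lemma W0_props:
  "w \<in> W0 \<Longrightarrow> linear w \<and> (\<forall>x y. w x \<bullet> w y = x \<bullet> y) \<and> (\<forall>\<alpha>\<in>R. w \<alpha> \<in> R)"
  unfolding weyl_group_def
proof (induction rule: generated_by.induct)
  case gen_id show ?case by (auto intro: linearI)
next
  case (gen_comp s w)
  then obtain \<alpha> where "\<alpha> \<in> R" "s = refl \<alpha>" by blast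
  note s = this
  have "linear (s \<circ> w)" using s gen_comp.IH linear_compose[of w s] refl_linear by blast
  moreover have "(s \<circ> w) x \<bullet> (s \<circ> w) y = x \<bullet> y" for x y using s gen_comp.IH by (simp add: refl_inner)
  moreover have "(s \<circ> w) \<alpha> \<in> R" if "\<alpha> \<in> R" for \<alpha> using s gen_comp.IH that refl_R by simp
  ultimately show ?case by blast
qed

lemma W0_linear: "w \<in> W0 \<Longrightarrow> linear w"
  and W0_inner: "w \<in> W0 \<Longrightarrow> w x \<bullet> w y = x \<bullet> y"
  and W0_R: "w \<in> W0 \<Longrightarrow> \<alpha> \<in> R \<Longrightarrow> w \<alpha> \<in> R"
  using W0_props by blast+

lemma W0_id: "id \<in> W0" unfolding weyl_group_def by (rule generated_by.gen_id)

lemma W0_refl: "\<alpha> \<in> R \<Longrightarrow> refl \<alpha> \<in> W0"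
  unfolding weyl_group_def by (intro generated_by_base imageI)

lemma W0_comp: "w \<in> W0 \<Longrightarrow> w' \<in> W0 \<Longrightarrow> w \<circ> w' \<in> W0"
  unfolding weyl_group_def by (rule generated_by_comp)

lemma W0_inv: "w \<in> W0 \<Longrightarrow> bij w" "w \<in> W0 \<Longrightarrow> inv w \<in> W0"
  unfolding weyl_group_def
  using generated_by_inv[of "refl ` R" w] refl_refl by blast+

lemma W0_inv_apply: "w \<in> W0 \<Longrightarrow> w (inv w x) = x" "w \<in> W0 \<Longrightarrow> inv w (w x) = x"
  using W0_inv(1) by (auto simp: bij_is_surj surj_f_inv_f bij_is_inj inv_f_f)

lemma W0_adjoint: "w \<in> W0 \<Longrightarrow> w x \<bullet> y = x \<bullet> inv w y"
  using W0_inner[of w x "inv w y"] W0_inv_apply(1)[of w y] by simp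

lemma W0_coroot: "w \<in> W0 \<Longrightarrow> w (coroot \<alpha>) = coroot (w \<alpha>)"
  by (simp add: coroot_def W0_inner linear_cmul[OF W0_linear])

lemma refl_W0_conj: "w \<in> W0 \<Longrightarrow> refl (w \<alpha>) = w \<circ> refl \<alpha> \<circ> inv w"
proof
  fix v assume w: "w \<in> W0"
  have "w (refl \<alpha> (inv w v)) = w (inv w v) - (\<alpha> \<bullet> inv w v) *\<^sub>R w (coroot \<alpha>)"
    unfolding refl_def by (simp add: linear_diff[OF W0_linear[OF w]] linear_cmul[OF W0_linear[OF w]])
  then show "refl (w \<alpha>) v = (w \<circ> refl \<alpha> \<circ> inv w) v"
    by (simp add: W0_inv_apply[OF w] refl_def[of "w \<alpha>"] W0_coroot[OF w] W0_adjoint[OF w])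
qed

text \<open>A linear map is determined by its restriction to the spanning set \<open>R\<close>, and
  only finitely many maps from \<open>R\<close> to \<open>R\<close> exist.\<close>

lemma finite_W0: "finite W0"
proof -
  have "inj_on (\<lambda>w. restrict w R) W0"
  proof (rule inj_onI)
    fix w w' assume w: "w \<in> W0" "w' \<in> W0" and eq: "restrict w R = restrict w' R"
    have "w x = w' x" for x
      by (rule linear_eq_on_span[of w w' R])
         (use w W0_linear eq span_R in \<open>auto simp: restrict_def fun_eq_iff, metis\<close>)
    then show "w = w'" by auto
  qed
  moreover have "(\<lambda>w. restrict w R) ` W0 \<subseteq> R \<rightarrow>\<^sub>E R" using W0_R by auto
  ultimately show ?thesis using finite_PiE[of R "\<lambda>_. R"] finite_R inj_on_finite by blast
qed

lemma card_W0: "card W0 > 0" using finite_W0 W0_id by (auto simp: card_gt_0_iff)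

lemma W_linear_part: "w \<in> W \<Longrightarrow> \<exists>g\<in>W0. \<exists>y. \<forall>v. w v = g v + y"
  unfolding aff_weyl_group_def
proof (induction rule: generated_by.induct)
  case gen_id show ?case using W0_id by (intro bexI[of _ id] exI[of _ 0]) auto
next
  case (gen_comp s w)
  then obtain a g y where a: "a \<in> aff_roots R" "s = aff_refl a" and g: "g \<in> W0" "\<And>v. w v = g v + y" by blast
  have "\<forall>v. (s \<circ> w) v = (refl (fst a) \<circ> g) v + (refl (fst a) y - snd a *\<^sub>R coroot (fst a))"
    using a g by (simp add: aff_refl_eq refl_add)
  then show ?case using W0_comp[OF W0_refl[OF aff_root_fst[OF a(1)]] g(1)] by blast
qed

lemma W_roots: "w \<in> W \<Longrightarrow> b \<in> aff_roots R \<Longrightarrow> \<exists>c\<in>aff_roots R. \<forall>x. aff_eval c (w x) = aff_eval b x"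
  unfolding aff_weyl_group_def
proof (induction rule: generated_by.induct)
  case gen_id then show ?case by auto
next
  case (gen_comp s w)
  then obtain a c where a: "a \<in> aff_roots R" "s = aff_refl a" and
    c: "c \<in> aff_roots R" "\<forall>x. aff_eval c (w x) = aff_eval b x" by blast
  then show ?case using root_refl_roots[OF a(1) c(1)]
    by (intro bexI[of _ "root_refl a c"]) (auto simp: aff_eval_root_refl aff_refl_aff_refl[OF aff_root_ne0[OF a(1)]])
qed

section \<open>Walls, alcoves and sub-regular points\<close>

lemma aff_eval_vertex_mean:
  assumes "finite B" "B \<noteq> {}"
  shows "aff_eval a ((1 / real (card B)) *\<^sub>R (\<Sum>b\<in>B. vertex b)) = (\<Sum>b\<in>B. aff_eval a (vertex b)) / real (card B)"
  using assms by (simp add: aff_eval_def sum.distrib inner_sum_right add_divide_distrib)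

lemma A_two: "a \<in> A \<Longrightarrow> A - {a} \<noteq> {}"
proof
  assume "a \<in> A" "A - {a} = {}"
  then have A: "A = {a}" by blast
  obtain i where "i \<in> I" using I_nonempty by blast
  then have "(- \<phi>, 1) \<in> A" "(i, 0) \<in> A" unfolding aff_basis_def by auto
  then show False unfolding A by auto
qed

text \<open>The barycentre of the vertices, an explicit base point for arguments along segments;
  \<open>wall_center\<close> does the same for each wall.\<close>

definition center :: "'a" where "center = (1 / real (card A)) *\<^sub>R (\<Sum>b\<in>A. vertex b)"

definition wall_center :: "'a \<times> real \<Rightarrow> 'a" where
  "wall_center a = (1 / real (card (A - {a}))) *\<^sub>R (\<Sum>b\<in>A - {a}. vertex b)"

lemma vertex_sum_pos: "B \<subseteq> A \<Longrightarrow> a \<in> B \<Longrightarrow> 0 < (\<Sum>b\<in>B. aff_eval a (vertex b))"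
proof (intro sum_pos2[of B a])
  assume B: "B \<subseteq> A" "a \<in> B"
  show "finite B" using B finite_A finite_subset by blast
  show "a \<in> B" "0 < aff_eval a (vertex a)" using B vertex_pos by blast+
  fix b assume "b \<in> B"
  then show "0 \<le> aff_eval a (vertex b)" using B by (intro A_nonneg_vertex) blast+
qed

lemma center: "a \<in> A \<Longrightarrow> 0 < aff_eval a center"
proof -
  assume a: "a \<in> A"
  then have "card A > 0" "A \<noteq> {}" using finite_A by (auto simp: card_gt_0_iff)
  then show ?thesis unfolding center_def
    using aff_eval_vertex_mean[of A a] vertex_sum_pos[OF order_refl a] finite_A by simp
qed

lemma wall_center:
  assumes a: "a \<in> A"
  shows "aff_eval a (wall_center a) = 0" "b \<in> A - {a} \<Longrightarrow> 0 < aff_eval b (wall_center a)"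
proof -
  have f: "finite (A - {a})" "card (A - {a}) > 0" using finite_A A_two[OF a] by (auto simp: card_gt_0_iff)
  have "(\<Sum>b\<in>A - {a}. aff_eval a (vertex b)) = 0" by (intro sum.neutral ballI) (metis vertex_zero a Diff_iff singletonI)
  then show "aff_eval a (wall_center a) = 0"
    unfolding wall_center_def using aff_eval_vertex_mean[OF f(1) A_two[OF a], of a] by simp
  assume b: "b \<in> A - {a}"
  then show "0 < aff_eval b (wall_center a)"
    unfolding wall_center_def
    using aff_eval_vertex_mean[OF f(1) A_two[OF a], of b] vertex_sum_pos[OF Diff_subset b] f by simp
qed

lemma aff_eval_segment: "aff_eval a (x + t *\<^sub>R (y - x)) = (1 - t) * aff_eval a x + t * aff_eval a y"
  by (simp add: aff_eval_def inner_add_right inner_diff_right algebra_simps)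

abbreviation "C0 \<equiv> fundamental_alcove I \<phi>"

lemma center_C0: "center \<in> C0" using center by (simp add: fundamental_alcove_def)

lemma open_C0: "open C0"
proof -
  have "C0 = (\<Inter>a\<in>A. {v. 0 < aff_eval a v})" by (auto simp: fundamental_alcove_def)
  moreover have "open {v. 0 < aff_eval a v}" for a :: "'a \<times> real" by (intro open_Collect_less continuous_intros)
  ultimately show ?thesis by (simp only:) (intro open_INT finite_A ballI, simp)
qed

lemma segment_C0:
  assumes "x \<in> C0" "y \<in> Cbar" "0 \<le> t" "t < 1"
  shows "x + t *\<^sub>R (y - x) \<in> C0"
  using assms unfolding fundamental_alcove_def Cbar_def
  by (auto simp: aff_eval_segment intro!: add_pos_nonneg)

lemma segment_C0': "x \<in> C0 \<Longrightarrow> y \<in> C0 \<Longrightarrow> 0 \<le> t \<Longrightarrow> t \<le> 1 \<Longrightarrow> x + t *\<^sub>R (y - x) \<in> C0"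
  using segment_C0[of x y t] alcove_Cbar by (cases "t = 1") auto

lemma convex_C0: "convex C0"
  unfolding convex_alt using segment_C0' by (auto simp: algebra_simps)

lemma closed_Cbar: "closed Cbar"
proof -
  have "Cbar = (\<Inter>a\<in>A. {v. 0 \<le> aff_eval a v})" by (auto simp: Cbar_def)
  moreover have "closed {v. 0 \<le> aff_eval a v}" for a :: "'a \<times> real" by (intro closed_Collect_le continuous_intros)
  ultimately show ?thesis by auto
qed

text \<open>The segment from the centre to a point satisfying the weak inequalities runs inside the
  open alcove until its endpoint.\<close>

lemma closure_C0: "closure C0 = Cbar"
proof
  show "closure C0 \<subseteq> Cbar" using alcove_Cbar closed_Cbar by (rule closure_minimal)
  show "Cbar \<subseteq> closure C0"
  proof
    fix y assume y: "y \<in> Cbar"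
    have "((\<lambda>t::real. center + t *\<^sub>R (y - center)) \<longlongrightarrow> center + 1 *\<^sub>R (y - center)) (at_left 1)"
      by (intro tendsto_intros)
    then have l: "((\<lambda>t::real. center + t *\<^sub>R (y - center)) \<longlongrightarrow> y) (at_left 1)" by simp
    have "eventually (\<lambda>t::real. center + t *\<^sub>R (y - center) \<in> closure C0) (at_left 1)"
      unfolding eventually_at_left_field
      using segment_C0[OF center_C0 y] closure_subset[of C0] by (intro exI[of _ 0]) auto
    then show "y \<in> closure C0"
      by (rule Lim_in_closed_set[OF closed_closure _ trivial_limit_at_left_real l])
  qed
qed

lemma V_reg_eq: "V_reg R I \<phi> = {v. \<forall>b\<in>aff_roots R. aff_eval b v \<noteq> 0}"
proof -
  have "(\<forall>b\<in>pos. aff_eval b v \<noteq> 0) \<longleftrightarrow> (\<forall>b\<in>aff_roots R. aff_eval b v \<noteq> 0)" for v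
    using pos_or_neg pos_roots_aff by (metis aff_eval_minus neg_equal_0_iff_equal)
  then show ?thesis by (auto simp: V_reg_def aff_hyperplane_def)
qed

lemma C0_V_reg: "C0 \<subseteq> V_reg R I \<phi>"
proof -
  have "aff_eval b v \<noteq> 0" if "v \<in> C0" "b \<in> aff_roots R" for b v
    using pos_or_neg[OF that(2)] pos_alcove[OF _ that(1), of b] pos_alcove[OF _ that(1), of "- b"]
    by (auto simp: aff_eval_minus)
  then show ?thesis unfolding V_reg_eq by blast
qed

lemma V_reg_W: "w \<in> W \<Longrightarrow> v \<in> V_reg R I \<phi> \<Longrightarrow> w v \<in> V_reg R I \<phi>"
proof -
  assume w: "w \<in> W" and v: "v \<in> V_reg R I \<phi>"
  have "aff_eval b (w v) \<noteq> 0" if b: "b \<in> aff_roots R" for b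
  proof -
    obtain c where c: "c \<in> aff_roots R" "\<forall>x. aff_eval c (inv w x) = aff_eval b x"
      using W_roots[OF W_inv(2)[OF w] b] by blast
    then have "aff_eval b (w v) = aff_eval c v" using W_inv_apply[OF w] by metis
    then show ?thesis using v c unfolding V_reg_eq by simp
  qed
  then show ?thesis unfolding V_reg_eq by blast
qed

lemma V_reg_Cbar: "v \<in> V_reg R I \<phi> \<Longrightarrow> v \<in> Cbar \<Longrightarrow> v \<in> C0"
  unfolding V_reg_eq Cbar_def fundamental_alcove_def using A_roots by (force simp: less_le)

lemma V_reg_alcove: "v \<in> V_reg R I \<phi> \<Longrightarrow> \<exists>w\<in>W. w v \<in> C0"
  using fold_pt V_reg_W V_reg_Cbar by metis

lemma connected_sign:
  assumes "connected S" "S \<subseteq> V_reg R I \<phi>" "b \<in> aff_roots R" "x \<in> S" "0 < aff_eval b x" "y \<in> S"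
  shows "0 < aff_eval b y"
proof (rule ccontr)
  assume "\<not> ?thesis"
  then have y: "aff_eval b y \<le> 0" by simp
  have "connected (aff_eval b ` S)"
    by (intro connected_continuous_image aff_eval_continuous continuous_on_id assms)
  then have "{aff_eval b y..aff_eval b x} \<subseteq> aff_eval b ` S"
    using assms by (intro connected_contains_Icc) blast+
  moreover have "0 \<in> {aff_eval b y..aff_eval b x}" using y assms by simp
  ultimately have "0 \<in> aff_eval b ` S" by blast
  then show False using assms unfolding V_reg_eq by auto
qed

text \<open>One point of the component can be moved into the fundamental alcove. The signs of affine
  roots are constant on connected subsets of the regular set, so the same element moves the whole
  component.\<close>

lemma alcove_W:
  assumes "C \<in> alcoves R I \<phi>"
  shows "\<exists>w\<in>W. \<forall>x\<in>C. w x \<in> C0"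
proof -
  have C: "connected C" "C \<subseteq> V_reg R I \<phi>" "C \<noteq> {}"
    using assms unfolding alcoves_def
    by (auto simp: in_components_connected in_components_subset in_components_nonempty)
  then obtain x where x: "x \<in> C" by blast
  then obtain w where w: "w \<in> W" "w x \<in> C0" using V_reg_alcove C by blast
  have "w y \<in> C0" if y: "y \<in> C" for y
  proof -
    have "0 < aff_eval a (w y)" if a: "a \<in> A" for a
    proof -
      obtain c where c: "c \<in> aff_roots R" "\<forall>x. aff_eval c (inv w x) = aff_eval a x"
        using W_roots[OF W_inv(2)[OF w(1)] A_roots[OF a]] by blast
      then have e: "aff_eval a (w y) = aff_eval c y" for y using W_inv_apply[OF w(1)] by metis
      have "0 < aff_eval a (w x)" using w(2) a unfolding fundamental_alcove_def by blast
      then show ?thesis unfolding e using connected_sign[OF C(1,2) c(1) x _ y] by blast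
    qed
    then show ?thesis by (simp add: fundamental_alcove_def)
  qed
  then show ?thesis using w by blast
qed

text \<open>Near a relatively interior point of the wall no other basis functional changes sign,
  neither at \<open>z\<close> nor at its mirror image; these finitely many strict inequalities cut
  out the neighbourhood.\<close>

lemma wall_nbhd:
  assumes a: "a \<in> A" and y: "aff_eval a y = 0" "\<And>b. b \<in> A - {a} \<Longrightarrow> 0 < aff_eval b y"
  shows "\<exists>U. open U \<and> y \<in> U \<and> (\<forall>z\<in>U. (0 < aff_eval a z \<longrightarrow> z \<in> C0) \<and>
    (aff_eval a z < 0 \<longrightarrow> aff_refl a z \<in> C0))"
proof -
  define U where "U = (\<Inter>b\<in>A - {a}. {z. 0 < aff_eval b z} \<inter> {z. 0 < aff_eval b (aff_refl a z)})"
  have "open ({z. 0 < aff_eval b z} \<inter> {z. 0 < aff_eval b (aff_refl a z)})" for b :: "'a \<times> real"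
    by (intro open_Int open_Collect_less continuous_intros)
  then have 1: "open U" unfolding U_def using finite_A by (intro open_INT) auto
  have "aff_refl a y = y" using y by (simp add: aff_refl_def)
  then have 2: "y \<in> U" unfolding U_def using y by auto
  have ar: "aff_eval a (aff_refl a z) = - aff_eval a z" for z
    by (simp flip: aff_eval_root_refl add: root_refl_self[OF A_ne0[OF a]] aff_eval_minus)
  have 3: "z \<in> C0" if "z \<in> U" "0 < aff_eval a z" for z
    using that unfolding U_def fundamental_alcove_def by auto
  have 4: "aff_refl a z \<in> C0" if "z \<in> U" "aff_eval a z < 0" for z
    using that ar[of z] unfolding U_def fundamental_alcove_def by auto
  show ?thesis using 1 2 3 4 by blast
qed

text \<open>A positive root vanishing at \<open>y\<close> has no component along basis elements that
  are positive there. It is thus a multiple of \<open>a\<close>, and equal to \<open>a\<close>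
  because the root system is reduced.\<close>

lemma wall_subregular:
  assumes a: "a \<in> A" and y: "aff_eval a y = 0" "\<And>b. b \<in> A - {a} \<Longrightarrow> 0 < aff_eval b y"
  shows "subregular R I \<phi> a y"
  unfolding subregular_def aff_hyperplane_def
proof (intro conjI ballI impI)
  fix b assume b: "b \<in> pos" "b \<noteq> a"
  show "y \<notin> {v. aff_eval b v = 0}"
  proof
    assume "y \<in> {v. aff_eval b v = 0}"
    moreover have "aff_eval (root_refl a b) y = aff_eval b y"
      using y by (simp add: aff_eval_root_refl aff_refl_def)
    ultimately have z: "aff_eval b y = 0" by simp
    obtain c :: "'a \<times> real \<Rightarrow> nat" where c: "b = (\<Sum>a\<in>A. real (c a) *\<^sub>R a)"
      using pos_expand[OF b(1)] by blast
    have "aff_eval b y = (\<Sum>x\<in>A. real (c x) * aff_eval x y)"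
      by (subst c) (simp add: aff_eval_sum aff_eval_scale)
    then have s: "(\<Sum>x\<in>A - {a}. real (c x) * aff_eval x y) = 0"
      using z y(1) by (simp add: sum.remove[OF finite_A a])
    have "real (c x) * aff_eval x y = 0" if "x \<in> A - {a}" for x
      using sum_nonneg_0[of "A - {a}" "\<lambda>x. real (c x) * aff_eval x y"] s that y(2) finite_A
      by (auto simp: less_imp_le)
    then have c0: "c x = 0" if "x \<in> A - {a}" for x using y(2)[OF that] that by fastforce
    then have eq: "b = real (c a) *\<^sub>R a"
      by (subst c, subst sum.remove[OF finite_A a]) (auto intro!: sum.neutral)
    then have "real (c a) *\<^sub>R fst a \<in> R" using aff_root_fst[OF pos_roots_aff[OF b(1)]] by simp
    then have "real (c a) = 1" using reduced_R[OF aff_root_fst[OF A_roots[OF a]], of "real (c a)"] by auto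
    then show False using eq b(2) by simp
  qed
qed (use y in simp)

text \<open>Fold \<open>v\<close> into the closed alcove. A wall through the folded point pulls back
  to a root vanishing at \<open>v\<close>, which sub-regularity identifies with \<open>b\<close> up
  to sign. Two such walls would be proportional as functionals, contradicting their values at a
  vertex.\<close>

lemma subregular_wall:
  assumes b: "b \<in> pos" and v: "subregular R I \<phi> b v"
  shows "\<exists>w\<in>W. \<exists>a\<in>A. aff_eval a (w v) = 0 \<and> (\<forall>a'\<in>A - {a}. 0 < aff_eval a' (w v)) \<and>
    (\<exists>\<epsilon>\<in>{1,-1}. \<forall>x. aff_eval a (w x) = \<epsilon> * aff_eval b x)"
proof -
  obtain w where w: "w \<in> W" "w v \<in> Cbar" using fold_pt by metis
  obtain c where c: "c \<in> aff_roots R" "\<forall>x. aff_eval c (w x) = aff_eval b x"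
    using W_roots[OF w(1) pos_roots_aff[OF b]] by blast
  have bv: "aff_eval b v = 0" using v by (simp add: subregular_def aff_hyperplane_def)
  have key: "\<exists>\<epsilon>\<in>{1,-1}. \<forall>x. aff_eval a (w x) = \<epsilon> * aff_eval b x"
    if a: "a \<in> A" "aff_eval a (w v) = 0" for a
  proof -
    obtain d where d: "d \<in> aff_roots R" "\<forall>x. aff_eval d (inv w x) = aff_eval a x"
      using W_roots[OF W_inv(2)[OF w(1)] A_roots[OF a(1)]] by blast
    then have e: "aff_eval a (w y) = aff_eval d y" for y using W_inv_apply[OF w(1)] by metis
    have dv: "aff_eval d v = 0" using e a by simp
    have "d = b \<or> - d = b"
      using pos_or_neg[OF d(1)] v dv unfolding subregular_def aff_hyperplane_def
      by (auto simp: aff_eval_minus)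
    then show ?thesis
    proof
      assume "d = b" then show ?thesis using e by (intro bexI[of _ 1]) auto
    next
      assume "- d = b"
      then have "d = - b" by auto
      then show ?thesis using e by (intro bexI[of _ "-1"]) (auto simp: aff_eval_minus)
    qed
  qed
  have "\<exists>a\<in>A. aff_eval a (w v) = 0"
  proof (rule ccontr)
    assume "\<not> ?thesis"
    then have "w v \<in> C0" using w(2) unfolding Cbar_def fundamental_alcove_def by (auto simp: less_le)
    then have "w v \<in> V_reg R I \<phi>" using C0_V_reg by blast
    then show False using c bv unfolding V_reg_eq by auto
  qed
  then obtain a where a: "a \<in> A" "aff_eval a (w v) = 0" by blast
  have "0 < aff_eval a' (w v)" if a': "a' \<in> A - {a}" for a'
  proof (rule ccontr)
    assume "\<not> ?thesis"
    then have "aff_eval a' (w v) = 0" using CbarD[OF w(2)] a' by (simp add: order.antisym)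
    then obtain \<epsilon> \<epsilon>' where e: "\<epsilon> \<in> {1,-1}" "\<epsilon>' \<in> {1,-1::real}" "\<And>x. aff_eval a' (w x) = \<epsilon>' * aff_eval b x"
      "\<And>x. aff_eval a (w x) = \<epsilon> * aff_eval b x" using key a a' by (metis DiffD1)
    then have "aff_eval a' (w x) = (\<epsilon> * \<epsilon>') * aff_eval a (w x)" for x by auto
    then have "aff_eval a' x = (\<epsilon> * \<epsilon>') * aff_eval a x" for x using W_inv_apply[OF w(1)] by metis
    then have "aff_eval a' (vertex a) = (\<epsilon> * \<epsilon>') * aff_eval a (vertex a)" .
    then show False using vertex_zero[of a a'] vertex_pos[of a] a a' e by auto
  qed
  then show ?thesis using w a key[OF a] by blast
qed

end

section \<open>Calculus\<close>

lemma dir_deriv_eqI: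
  assumes "(f has_derivative f') (at x)"
  shows "dir_deriv u f x = f' u"
proof -
  have "((\<lambda>t. x + t *\<^sub>R u) has_derivative (\<lambda>t. t *\<^sub>R u)) (at 0)"
    by (auto intro!: derivative_eq_intros)
  moreover have "(f has_derivative f') (at (x + 0 *\<^sub>R u))" using assms by simp
  ultimately have "((\<lambda>t. f (x + t *\<^sub>R u)) has_derivative (\<lambda>t. f' (t *\<^sub>R u))) (at 0)"
    by (rule has_derivative_compose)
  moreover have "(\<lambda>t. f' (t *\<^sub>R u)) = (\<lambda>t. t *\<^sub>R f' u)"
    using has_derivative_linear[OF assms] by (simp add: linear_cmul)
  ultimately have "((\<lambda>t. f (x + t *\<^sub>R u)) has_vector_derivative f' u) (at 0)"
    by (simp add: has_vector_derivative_def)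
  then show ?thesis unfolding dir_deriv_def by (rule vector_derivative_at)
qed

lemma has_derivative_dir_deriv:
  assumes "f differentiable at x"
  shows "(f has_derivative (\<lambda>u. dir_deriv u f x)) (at x)"
proof -
  obtain f' where "(f has_derivative f') (at x)" using assms differentiable_def by blast
  moreover from this have "(\<lambda>u. dir_deriv u f x) = f'" by (auto simp: dir_deriv_eqI)
  ultimately show ?thesis by simp
qed

lemma dir_deriv_line:
  assumes "f differentiable at (x + t *\<^sub>R u)"
  shows "((\<lambda>t. f (x + t *\<^sub>R u)) has_vector_derivative dir_deriv u f (x + t *\<^sub>R u)) (at t)"
proof -
  have l: "((\<lambda>t. x + t *\<^sub>R u) has_derivative (\<lambda>t. t *\<^sub>R u)) (at t)"
    by (auto intro!: derivative_eq_intros)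
  have "((\<lambda>t. f (x + t *\<^sub>R u)) has_derivative (\<lambda>s. dir_deriv (s *\<^sub>R u) f (x + t *\<^sub>R u))) (at t)"
    by (rule has_derivative_compose[OF l has_derivative_dir_deriv[OF assms]])
  moreover have "(\<lambda>s. dir_deriv (s *\<^sub>R u) f (x + t *\<^sub>R u)) = (\<lambda>s. s *\<^sub>R dir_deriv u f (x + t *\<^sub>R u))"
    using linear_cmul[OF has_derivative_linear[OF has_derivative_dir_deriv[OF assms]]] by auto
  ultimately show ?thesis by (simp add: has_vector_derivative_def)
qed

lemma dir_deriv_linear:
  assumes "f differentiable at x"
  shows "linear (\<lambda>u. dir_deriv u f x)"
  using has_derivative_linear[OF has_derivative_dir_deriv[OF assms]] .

lemma dir_deriv_cong:
  assumes "open S" "x \<in> S" "\<And>y. y \<in> S \<Longrightarrow> f y = g y"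
  shows "dir_deriv u f x = dir_deriv u g x"
proof -
  have "((\<lambda>t::real. x + t *\<^sub>R u) \<longlongrightarrow> x + 0 *\<^sub>R u) (at 0)" by (intro tendsto_intros)
  then have "eventually (\<lambda>t. x + t *\<^sub>R u \<in> S) (at (0::real))"
    using assms by (intro topological_tendstoD) auto
  then have "eventually (\<lambda>t. x + t *\<^sub>R u \<in> S) (nhds (0::real))"
    using assms(2) by (auto simp: eventually_at_filter elim!: eventually_mono)
  then have "eventually (\<lambda>t. f (x + t *\<^sub>R u) = g (x + t *\<^sub>R u)) (nhds (0::real))"
    by eventually_elim (use assms in auto)
  moreover from eventually_nhds_x_imp_x[OF this] have "f (x + 0 *\<^sub>R u) = g (x + 0 *\<^sub>R u)" .
  ultimately show ?thesis unfolding dir_deriv_def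
    by (intro vector_derivative_cong_eq) auto
qed

lemma dir_deriv_add:
  assumes "f differentiable at x" "g differentiable at x"
  shows "dir_deriv u (\<lambda>x. f x + g x) x = dir_deriv u f x + dir_deriv u g x"
  by (rule dir_deriv_eqI) (auto intro!: derivative_eq_intros has_derivative_dir_deriv assms)

lemma dir_deriv_diff:
  assumes "f differentiable at x" "g differentiable at x"
  shows "dir_deriv u (\<lambda>x. f x - g x) x = dir_deriv u f x - dir_deriv u g x"
  by (rule dir_deriv_eqI) (auto intro!: derivative_eq_intros has_derivative_dir_deriv assms)

lemma dir_deriv_mult:
  fixes f g :: "'a::real_normed_vector \<Rightarrow> complex"
  assumes "f differentiable at x" "g differentiable at x"
  shows "dir_deriv u (\<lambda>x. f x * g x) x = f x * dir_deriv u g x + dir_deriv u f x * g x"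
  by (rule dir_deriv_eqI) (auto intro!: derivative_eq_intros has_derivative_dir_deriv assms)

lemma dir_deriv_const [simp]: "dir_deriv u (\<lambda>x. c) = (\<lambda>x. 0)"
  by (rule ext, rule dir_deriv_eqI) (auto intro!: derivative_eq_intros)

lemma dir_deriv_cmult:
  fixes f :: "'a::real_normed_vector \<Rightarrow> complex"
  assumes "f differentiable at x"
  shows "dir_deriv u (\<lambda>x. c * f x) x = c * dir_deriv u f x"
  using dir_deriv_mult[of "\<lambda>_. c" x f u] assms by simp

lemma dir_deriv_affine:
  assumes "f differentiable at (A x + y)" "bounded_linear A"
  shows "dir_deriv u (\<lambda>x. f (A x + y)) x = dir_deriv (A u) f (A x + y)"
proof -
  have "((\<lambda>x. A x + y) has_derivative A) (at x)"
    using assms(2) by (auto intro!: derivative_eq_intros bounded_linear_imp_has_derivative)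
  from has_derivative_compose[OF this has_derivative_dir_deriv[OF assms(1)]]
  show ?thesis by (rule dir_deriv_eqI)
qed

section \<open>Bump functions and exponential polynomials\<close>

definition flat :: "nat \<Rightarrow> real \<Rightarrow> real" where
  "flat m t = (if t \<le> 0 then 0 else exp (- (1/t)) / t ^ m)"

lemma flat_tendsto_0: "(flat m \<longlongrightarrow> 0) (at_right 0)"
proof -
  have "((\<lambda>x::real. x ^ m / exp x) \<longlongrightarrow> 0) at_top" by (rule tendsto_power_div_exp_0)
  then have "((\<lambda>t::real. inverse t ^ m / exp (inverse t)) \<longlongrightarrow> 0) (at_right 0)"
    using filterlim_compose filterlim_inverse_at_top_right by blast
  moreover have "eventually (\<lambda>t::real. inverse t ^ m / exp (inverse t) = flat m t) (at_right 0)"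
    by (auto simp: eventually_at_filter flat_def exp_minus field_simps)
  ultimately show ?thesis by (rule Lim_transform_eventually)
qed

text \<open>Differentiation only raises the power in the denominator, so the family is closed under
  it up to linear combinations. At the origin the exponential decay beats every power.\<close>

lemma flat_has_derivative:
  "(flat m has_real_derivative (flat (m + 2) t - real m * flat (m + 1) t)) (at t)"
proof (cases t "0::real" rule: linorder_cases)
  case less
  have "((\<lambda>_. 0::real) has_real_derivative 0) (at t)" by simp
  moreover have "eventually (\<lambda>s. s \<in> {..<0}) (nhds t)"
    using less by (intro eventually_nhds_in_open) auto
  then have "eventually (\<lambda>s. flat m s = 0) (nhds t)"
    by eventually_elim (auto simp: flat_def)
  ultimately have "(flat m has_real_derivative 0) (at t)"
    using DERIV_cong_ev[of t t "flat m" "\<lambda>_. 0" 0 0] by simp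
  then show ?thesis using less by (simp add: flat_def)
next
  case greater
  have "((\<lambda>t. exp (- (1/t)) / t ^ m) has_real_derivative (flat (m + 2) t - real m * flat (m + 1) t)) (at t)"
    using greater apply (auto intro!: derivative_eq_intros simp: flat_def)
    apply (cases m) apply (auto simp: field_simps power2_eq_square)
    done
  moreover have "eventually (\<lambda>s. s \<in> {0<..}) (nhds t)"
    using greater by (intro eventually_nhds_in_open) auto
  then have "eventually (\<lambda>s. flat m s = exp (- (1/s)) / s ^ m) (nhds t)"
    by eventually_elim (auto simp: flat_def)
  ultimately show ?thesis
    using DERIV_cong_ev[of t t "flat m" "\<lambda>s. exp (- (1/s)) / s ^ m"] by blast
next
  case equal
  have "((\<lambda>h. (flat m (0 + h) - flat m 0) / h) \<longlongrightarrow> 0) (at 0)"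
  proof (rule filterlim_split_at)
    have "eventually (\<lambda>h. flat (m + 1) h = (flat m (0 + h) - flat m 0) / h) (at_right 0)"
      by (auto simp: eventually_at_filter flat_def)
    from Lim_transform_eventually[OF flat_tendsto_0 this]
    show "((\<lambda>h. (flat m (0 + h) - flat m 0) / h) \<longlongrightarrow> 0) (at_right 0)" .
    have "eventually (\<lambda>h. 0 = (flat m (0 + h) - flat m 0) / h) (at_left 0)"
      by (auto simp: eventually_at_filter flat_def)
    from Lim_transform_eventually[OF tendsto_const this]
    show "((\<lambda>h. (flat m (0 + h) - flat m 0) / h) \<longlongrightarrow> 0) (at_left 0)" .
  qed
  then show ?thesis using equal by (simp add: DERIV_def flat_def)
qed

text \<open>Flag \<open>False\<close> gives the exponential polynomials, flag \<open>True\<close>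
  admits bump functions as well. Since the class is closed under directional derivatives, smoothness
  and the symmetry of second derivatives follow by induction on its generation.\<close>

inductive_set elementary :: "bool \<Rightarrow> ('a::euclidean_space \<Rightarrow> complex) set" for b where
  const: "(\<lambda>x. c) \<in> elementary b"
| lin: "(\<lambda>x. of_real (u \<bullet> x)) \<in> elementary b"
| expo: "(\<lambda>x. exp (ceval \<nu> x)) \<in> elementary b"
| bump: "b \<Longrightarrow> (\<lambda>x. of_real (flat m (r - (x - p) \<bullet> (x - p)))) \<in> elementary b"
| add: "f \<in> elementary b \<Longrightarrow> g \<in> elementary b \<Longrightarrow> (\<lambda>x. f x + g x) \<in> elementary b"
| mult: "f \<in> elementary b \<Longrightarrow> g \<in> elementary b \<Longrightarrow> (\<lambda>x. f x * g x) \<in> elementary b"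

abbreviation EP :: "('a::euclidean_space \<Rightarrow> complex) set" where "EP \<equiv> elementary False"

lemma ceval_alt: "ceval \<nu> x = of_real (fst \<nu> \<bullet> x) + \<i> * of_real (snd \<nu> \<bullet> x)"
  by (simp add: ceval_def complex_eq_iff)

lemma ceval_add: "ceval \<nu> (x + y) = ceval \<nu> x + ceval \<nu> y"
  by (simp add: ceval_alt inner_add_right algebra_simps)

lemma ceval_diff: "ceval \<nu> (x - y) = ceval \<nu> x - ceval \<nu> y"
  by (simp add: ceval_alt inner_diff_right algebra_simps)

lemma ceval_scale: "ceval \<nu> (c *\<^sub>R x) = of_real c * ceval \<nu> x"
  by (simp add: ceval_alt algebra_simps)

lemma ceval_minus: "ceval \<nu> (- x) = - ceval \<nu> x"
  by (simp add: ceval_alt)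

lemma ceval_zero [simp]: "ceval \<nu> 0 = 0"
  by (simp add: ceval_alt)

lemma ceval_sum: "ceval \<nu> (sum f S) = (\<Sum>x\<in>S. ceval \<nu> (f x))"
  by (induction S rule: infinite_finite_induct) (auto simp: ceval_add)

lemma ceval_has_derivative [derivative_intros]:
  "(g has_derivative g') (at x within S) \<Longrightarrow>
    ((\<lambda>x. ceval \<nu> (g x)) has_derivative (\<lambda>u. ceval \<nu> (g' u))) (at x within S)"
  unfolding ceval_alt by (auto intro!: derivative_eq_intros simp: inner_commute)

lemma dir_deriv_exp:
  "dir_deriv u (\<lambda>x. exp (ceval \<nu> x)) = (\<lambda>x. ceval \<nu> u * exp (ceval \<nu> x))"
proof (rule ext, rule dir_deriv_eqI)
  fix x
  have "((\<lambda>x. exp (ceval \<nu> x)) has_derivative (\<lambda>u. ceval \<nu> u * exp (ceval \<nu> x))) (at x)"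
    using has_derivative_compose[OF ceval_has_derivative[OF has_derivative_ident, where S=UNIV]
       DERIV_exp[THEN has_field_derivative_imp_has_derivative]]
    by (simp add: mult.commute)
  then show "((\<lambda>x. exp (ceval \<nu> x)) has_derivative (\<lambda>u. ceval \<nu> u * exp (ceval \<nu> x))) (at x)" .
qed

lemma exp_ceval_differentiable: "(\<lambda>x. exp (ceval \<nu> x)) differentiable at x"
  unfolding differentiable_def
  using has_derivative_compose[OF ceval_has_derivative[OF has_derivative_ident, where S=UNIV]
       DERIV_exp[THEN has_field_derivative_imp_has_derivative]] by blast

lemma dir_deriv_lin: "dir_deriv v (\<lambda>x. of_real (u \<bullet> x)) = (\<lambda>x. of_real (u \<bullet> v))"
  by (rule ext, rule dir_deriv_eqI) (auto intro!: derivative_eq_intros)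

lemma bump_has_derivative:
  "((\<lambda>x. complex_of_real (flat m (r - (x - p) \<bullet> (x - p)))) has_derivative
    (\<lambda>u. of_real ((- 2) * (u \<bullet> (x - p)) * (flat (m + 2) (r - (x - p) \<bullet> (x - p)) -
       real m * flat (m + 1) (r - (x - p) \<bullet> (x - p)))))) (at x)"
proof -
  have "((\<lambda>x. r - (x - p) \<bullet> (x - p)) has_derivative (\<lambda>u. (- 2) * (u \<bullet> (x - p)))) (at x)"
    by (auto intro!: derivative_eq_intros simp: inner_commute algebra_simps)
  from has_derivative_compose[OF this flat_has_derivative[THEN has_field_derivative_imp_has_derivative]]
  have "((\<lambda>x. flat m (r - (x - p) \<bullet> (x - p))) has_derivative
    (\<lambda>u. (- 2) * (u \<bullet> (x - p)) * (flat (m + 2) (r - (x - p) \<bullet> (x - p)) -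
       real m * flat (m + 1) (r - (x - p) \<bullet> (x - p))))) (at x)"
    by (simp add: mult_ac)
  from has_derivative_of_real[OF this] show ?thesis .
qed

lemma elementary_cmult: "f \<in> elementary b \<Longrightarrow> (\<lambda>x. c * f x) \<in> elementary b"
  by (rule elementary.mult[OF elementary.const])

lemma elementary_diff: "f \<in> elementary b \<Longrightarrow> g \<in> elementary b \<Longrightarrow> (\<lambda>x. f x - g x) \<in> elementary b"
  using elementary.add[of f b "\<lambda>x. (-1) * g x"] elementary_cmult[of g b "-1"] by simp

lemma elementary_sum: "(\<And>i. i \<in> S \<Longrightarrow> f i \<in> elementary b) \<Longrightarrow> (\<lambda>x. \<Sum>i\<in>S. f i x) \<in> elementary b"
  by (induction S rule: infinite_finite_induct) (auto intro: elementary.intros)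

lemma elementary_bump_deriv:
  assumes b: "b"
  shows "dir_deriv u (\<lambda>x. complex_of_real (flat m (r - (x - p) \<bullet> (x - p)))) \<in> elementary b"
proof -
  have "dir_deriv u (\<lambda>x. complex_of_real (flat m (r - (x - p) \<bullet> (x - p)))) =
     (\<lambda>x. (of_real (((-2) *\<^sub>R u) \<bullet> x) + of_real (2 * (u \<bullet> p))) *
       (of_real (flat (m + 2) (r - (x - p) \<bullet> (x - p))) -
        of_real (real m) * of_real (flat (m + 1) (r - (x - p) \<bullet> (x - p)))))"
    by (rule ext) (simp only: dir_deriv_eqI[OF bump_has_derivative], simp add: algebra_simps inner_diff_right)
  also have "\<dots> \<in> elementary b"
    using b by (intro elementary.mult elementary.add elementary_diff elementary.lin
        elementary.const elementary.bump)
  finally show ?thesis .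
qed

lemma elementary_differentiable: "f \<in> elementary b \<Longrightarrow> f differentiable at x"
proof (induction rule: elementary.induct)
  case (lin u)
  have "((\<lambda>x. complex_of_real (u \<bullet> x)) has_derivative (\<lambda>v. of_real (u \<bullet> v))) (at x)"
    by (auto intro!: derivative_eq_intros)
  then show ?case unfolding differentiable_def by blast
next
  case (expo \<nu>) then show ?case by (rule exp_ceval_differentiable)
next
  case (bump m r p)
  then show ?case unfolding differentiable_def using bump_has_derivative by blast
qed auto

lemma elementary_dir_deriv:
  "f \<in> elementary b \<Longrightarrow> dir_deriv u f \<in> elementary b"
proof (induction rule: elementary.induct)
  case (add f g)
  have "dir_deriv u (\<lambda>x. f x + g x) = (\<lambda>x. dir_deriv u f x + dir_deriv u g x)"
    using add by (intro ext dir_deriv_add elementary_differentiable)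
  then show ?case using add by (auto intro: elementary.intros)
next
  case (mult f g)
  have "dir_deriv u (\<lambda>x. f x * g x) = (\<lambda>x. f x * dir_deriv u g x + dir_deriv u f x * g x)"
    using mult by (intro ext dir_deriv_mult elementary_differentiable)
  then show ?case using mult by (auto intro: elementary.intros)
next
  case (bump m r p)
  then show ?case by (rule elementary_bump_deriv)
qed (auto simp: dir_deriv_exp dir_deriv_lin intro: elementary.intros)

text \<open>For each constructor the second derivative is computed explicitly, and the resulting
  expression is symmetric in \<open>u\<close> and \<open>v\<close>. For bumps this also uses that
  the gradient of the squared distance is linear.\<close>

lemma elementary_dir_deriv_commute:
  "f \<in> elementary b \<Longrightarrow> dir_deriv u (dir_deriv v f) = dir_deriv v (dir_deriv u f)"
proof (induction rule: elementary.induct)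
  case (expo \<nu>)
  then show ?case
    by (simp add: dir_deriv_exp fun_eq_iff dir_deriv_cmult exp_ceval_differentiable)
next
  case (add f g)
  have "dir_deriv u (dir_deriv v (\<lambda>x. f x + g x)) x =
     dir_deriv u (dir_deriv v f) x + dir_deriv u (dir_deriv v g) x" for u v x
  proof -
    have "dir_deriv v (\<lambda>x. f x + g x) = (\<lambda>x. dir_deriv v f x + dir_deriv v g x)"
      using add by (intro ext dir_deriv_add elementary_differentiable)
    moreover have "dir_deriv v f differentiable at x" "dir_deriv v g differentiable at x"
      using add by (auto intro: elementary_differentiable elementary_dir_deriv)
    ultimately show ?thesis by (simp add: dir_deriv_add)
  qed
  then show ?case using add by (auto simp: fun_eq_iff)
next
  case (mult f g)
  have d: "f differentiable at x" "g differentiable at x" "dir_deriv v f differentiable at x"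
     "dir_deriv v g differentiable at x" for x v
    using mult by (auto intro: elementary_differentiable elementary_dir_deriv)
  have "dir_deriv u (dir_deriv v (\<lambda>x. f x * g x)) x =
     f x * dir_deriv u (dir_deriv v g) x + dir_deriv u f x * dir_deriv v g x +
     (dir_deriv v f x * dir_deriv u g x + dir_deriv u (dir_deriv v f) x * g x)" for u v x
  proof -
    have "dir_deriv v (\<lambda>x. f x * g x) = (\<lambda>x. f x * dir_deriv v g x + dir_deriv v f x * g x)"
      using d by (intro ext dir_deriv_mult)
    then show ?thesis using d by (simp add: dir_deriv_add dir_deriv_mult)
  qed
  then show ?case using mult by (auto simp: fun_eq_iff)
next
  case (bump m r p)
  define w where "w \<equiv> \<lambda>m x. complex_of_real (flat m (r - (x - p) \<bullet> (x - p)))"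
  have wd: "w m differentiable at x" for m x
    unfolding w_def using bump by (intro elementary_differentiable[of _ b] elementary.bump)
  have dw: "dir_deriv v (w m) = (\<lambda>x. (of_real (((-2) *\<^sub>R v) \<bullet> x) + of_real (2 * (v \<bullet> p))) *
       (w (m + 2) x - of_real (real m) * w (m + 1) x))" for v m
    unfolding w_def
    by (rule ext) (simp only: dir_deriv_eqI[OF bump_has_derivative], simp add: algebra_simps inner_diff_right)
  have ld: "(\<lambda>x. complex_of_real (((-2) *\<^sub>R v) \<bullet> x) + of_real (2 * (v \<bullet> p))) differentiable at x" for v x
    by (rule elementary_differentiable[of _ False]) (intro elementary.intros)
  have ldd: "dir_deriv u (\<lambda>x. complex_of_real (((-2) *\<^sub>R v) \<bullet> x) + of_real (2 * (v \<bullet> p))) x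
     = of_real (((-2) *\<^sub>R v) \<bullet> u)" for u v x
    using elementary_differentiable[OF elementary.lin[of "(-2) *\<^sub>R v" False], of x]
    by (simp only: dir_deriv_add[of "\<lambda>x. complex_of_real (((-2) *\<^sub>R v) \<bullet> x)"]
          differentiable_const dir_deriv_const dir_deriv_lin) simp
  have qd: "dir_deriv u (\<lambda>x. w (m + 2) x - of_real (real m) * w (m + 1) x) x =
     dir_deriv u (w (m + 2)) x - of_real (real m) * dir_deriv u (w (m + 1)) x" for u x m
    using wd by (simp add: dir_deriv_diff dir_deriv_cmult)
  have q: "(\<lambda>x. w (m + 2) x - of_real (real m) * w (m + 1) x) differentiable at x" for x m
    using wd by auto
  have "dir_deriv u (dir_deriv v (w m)) = dir_deriv v (dir_deriv u (w m))" for m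
    unfolding dw[of _ m]
    by (rule ext) (simp only: dir_deriv_mult[OF ld q] ldd qd dw, simp add: algebra_simps inner_commute)
  then show ?case by (simp add: w_def)
qed (simp_all add: dir_deriv_lin)

lemma elementary_foldr_dir_deriv: "f \<in> elementary b \<Longrightarrow> foldr dir_deriv us f \<in> elementary b"
  by (induction us) (auto intro: elementary_dir_deriv)

lemma elementary_smooth: "f \<in> elementary b \<Longrightarrow> smooth f"
  unfolding smooth_def differentiable_on_def
  by (meson differentiable_at_withinI elementary_differentiable elementary_foldr_dir_deriv)

section \<open>Exponential polynomials on lines\<close>

lemma EP_affine:
  fixes A :: "'a::euclidean_space \<Rightarrow> 'b::euclidean_space"
  assumes "linear A"
  shows "f \<in> EP \<Longrightarrow> (\<lambda>x. f (A x + y)) \<in> EP"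
proof (induction rule: elementary.induct)
  case (lin u)
  have "(\<lambda>x. complex_of_real (u \<bullet> (A x + y))) =
     (\<lambda>x. of_real (adjoint A u \<bullet> x) + of_real (u \<bullet> y))"
    using assms by (auto simp: inner_add_right adjoint_clauses)
  also have "\<dots> \<in> EP" by (intro elementary.intros)
  finally show ?case .
next
  case (expo \<nu>)
  have "(\<lambda>x. exp (ceval \<nu> (A x + y))) =
     (\<lambda>x. exp (ceval (adjoint A (fst \<nu>), adjoint A (snd \<nu>)) x) * exp (ceval \<nu> y))"
  proof
    fix x
    have "ceval (adjoint A (fst \<nu>), adjoint A (snd \<nu>)) x = ceval \<nu> (A x)"
      using assms by (simp add: ceval_alt adjoint_clauses)
    then show "exp (ceval \<nu> (A x + y)) =
      exp (ceval (adjoint A (fst \<nu>), adjoint A (snd \<nu>)) x) * exp (ceval \<nu> y)"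
      by (simp add: ceval_add exp_add)
  qed
  also have "\<dots> \<in> EP" by (intro elementary.intros)
  finally show ?case .
qed (simp_all add: elementary.const elementary.add elementary.mult)

text \<open>Extension to an entire function of one complex variable makes the identity theorem
  available; it is the source of all unique continuation below.\<close>

lemma EP_entire_on_line:
  "f \<in> EP \<Longrightarrow> \<exists>h. h holomorphic_on UNIV \<and> (\<forall>t. f (x + t *\<^sub>R u) = h (of_real t))"
proof (induction rule: elementary.induct)
  case (const c) then show ?case by (intro exI[of _ "\<lambda>_. c"]) auto
next
  case (lin v)
  show ?case
    by (intro exI[of _ "\<lambda>z. of_real (v \<bullet> x) + z * of_real (v \<bullet> u)"])
       (auto intro!: holomorphic_intros simp: inner_add_right)
next
  case (expo \<nu>)
  show ?case
    by (intro exI[of _ "\<lambda>z. exp (ceval \<nu> x + z * ceval \<nu> u)"])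
       (auto intro!: holomorphic_intros simp: ceval_add ceval_scale)
next
  case (add f g)
  then obtain h k where "h holomorphic_on UNIV" "\<forall>t. f (x + t *\<^sub>R u) = h (of_real t)"
    "k holomorphic_on UNIV" "\<forall>t. g (x + t *\<^sub>R u) = k (of_real t)" by blast
  then show ?case by (intro exI[of _ "\<lambda>z. h z + k z"]) (auto intro!: holomorphic_intros)
next
  case (mult f g)
  then obtain h k where "h holomorphic_on UNIV" "\<forall>t. f (x + t *\<^sub>R u) = h (of_real t)"
    "k holomorphic_on UNIV" "\<forall>t. g (x + t *\<^sub>R u) = k (of_real t)" by blast
  then show ?case by (intro exI[of _ "\<lambda>z. h z * k z"]) (auto intro!: holomorphic_intros)
qed simp

lemma EP_line_eq_0:
  assumes f: "f \<in> EP" and ab: "a < b" and z: "\<And>t. a < t \<Longrightarrow> t < b \<Longrightarrow> f (x + t *\<^sub>R u) = 0"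
  shows "f (x + t *\<^sub>R u) = 0"
proof -
  obtain h where h: "h holomorphic_on UNIV" "\<And>t. f (x + t *\<^sub>R u) = h (of_real t)"
    using EP_entire_on_line[OF f] by blast
  let ?U = "of_real ` {a<..<b} :: complex set"
  define c where "c = (a + b) / 2"
  have c: "a < c" "c < b" using ab by (auto simp: c_def)
  have "of_real c islimpt ?U"
  proof (rule islimpt_approachable[THEN iffD2], intro allI impI)
    fix e :: real assume e: "e > 0"
    obtain d where d: "0 < d" "d < min e (b - c)" using dense[of 0 "min e (b - c)"] e c by auto
    then have "complex_of_real (c + d) \<in> ?U" using c by (intro imageI) auto
    moreover have "complex_of_real (c + d) \<noteq> of_real c \<and> dist (complex_of_real (c + d)) (of_real c) < e"
      using d by (auto simp: dist_norm)
    ultimately show "\<exists>x'\<in>?U. x' \<noteq> of_real c \<and> dist x' (of_real c) < e" by blast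
  qed
  moreover have "\<And>w. w \<in> ?U \<Longrightarrow> h w = 0" using z h(2) by (metis greaterThanLessThan_iff imageE)
  ultimately have "h (of_real t) = 0"
    by (rule analytic_continuation[OF h(1) open_UNIV connected_UNIV subset_UNIV UNIV_I _ _ UNIV_I])
  then show ?thesis using h by simp
qed

text \<open>The line from \<open>p\<close> to \<open>x\<close> stays in \<open>U\<close> on an
  initial interval, and on that line the function is the restriction of an entire one.\<close>

lemma EP_eq_0:
  assumes f: "f \<in> EP" and U: "open U" "p \<in> U" and z: "\<And>x. x \<in> U \<Longrightarrow> f x = 0"
  shows "f x = 0"
proof -
  have "((\<lambda>t::real. p + t *\<^sub>R (x - p)) \<longlongrightarrow> p + 0 *\<^sub>R (x - p)) (at_right 0)" by (intro tendsto_intros)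
  then have "eventually (\<lambda>t. p + t *\<^sub>R (x - p) \<in> U) (at_right (0::real))"
    using U by (intro topological_tendstoD) auto
  then obtain b where b: "b > 0" "\<forall>t>0. t < b \<longrightarrow> p + t *\<^sub>R (x - p) \<in> U"
    unfolding eventually_at_right_field by blast
  have "f (p + 1 *\<^sub>R (x - p)) = 0"
    by (rule EP_line_eq_0[OF f b(1)]) (use b(2) z in blast)
  then show ?thesis by simp
qed

text \<open>The iterated directional derivatives are the complex derivatives of the entire
  extension, so its Taylor series at the base point vanishes. This serves the Cauchy problem for the
  Laplacian.\<close>

lemma EP_line_derivs_eq_0:
  assumes f: "f \<in> EP" and z: "\<And>m. foldr dir_deriv (replicate m u) f x = 0"
  shows "f (x + t *\<^sub>R u) = 0"
proof -
  obtain h where h: "h holomorphic_on UNIV" "\<And>t. f (x + t *\<^sub>R u) = h (of_real t)"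
    using EP_entire_on_line[OF f] by blast
  have "(deriv ^^ m) h (of_real t) = foldr dir_deriv (replicate m u) f (x + t *\<^sub>R u)" for m t
  proof (induction m arbitrary: t)
    case (Suc m)
    have "((deriv ^^ m) h has_field_derivative deriv ((deriv ^^ m) h) (of_real t)) (at (of_real t))"
      using h(1) by (intro holomorphic_derivI[of _ UNIV] holomorphic_higher_deriv) auto
    from has_vector_derivative_real_field[OF this]
    have "((\<lambda>t. (deriv ^^ m) h (of_real t)) has_vector_derivative (deriv ^^ Suc m) h (of_real t)) (at t)"
      by simp
    moreover have "((\<lambda>t. foldr dir_deriv (replicate m u) f (x + t *\<^sub>R u)) has_vector_derivative
       dir_deriv u (foldr dir_deriv (replicate m u) f) (x + t *\<^sub>R u)) (at t)"
      by (intro dir_deriv_line elementary_differentiable[OF elementary_foldr_dir_deriv[OF f]])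
    ultimately show ?case using Suc.IH vector_derivative_unique_at by auto
  qed (simp add: h)
  from this[of _ 0] have "(deriv ^^ m) h 0 = 0" for m using z by simp
  then have "h w = 0" for w
    using h(1) by (intro holomorphic_fun_eq_0_on_connected[of h UNIV 0]) auto
  then show ?thesis using h(2) by simp
qed

section \<open>Test functions\<close>

lemma smooth_differentiable: "smooth f \<Longrightarrow> f differentiable at x"
  unfolding smooth_def using differentiable_on_eq_differentiable_at[of UNIV] 
  by (metis UNIV_I foldr_Nil id_apply open_UNIV)

lemma smooth_dir_deriv: "smooth f \<Longrightarrow> smooth (dir_deriv u f)"
  unfolding smooth_def
proof
  fix us assume "\<forall>us. foldr dir_deriv us f differentiable_on UNIV"
  then have "foldr dir_deriv (us @ [u]) f differentiable_on UNIV" by blast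
  then show "foldr dir_deriv us (dir_deriv u f) differentiable_on UNIV" by simp
qed

lemma smooth_continuous: "smooth f \<Longrightarrow> continuous_on S f"
  by (meson continuous_at_imp_continuous_on differentiable_imp_continuous_within smooth_differentiable)

lemma support_dir_deriv:
  fixes \<psi> :: "'a::real_normed_vector \<Rightarrow> complex"
  shows "closure {x. dir_deriv u \<psi> x \<noteq> 0} \<subseteq> closure {x. \<psi> x \<noteq> 0}"
proof (rule closure_minimal)
  show "{x. dir_deriv u \<psi> x \<noteq> 0} \<subseteq> closure {x. \<psi> x \<noteq> 0}"
  proof (rule ccontr)
    assume "\<not> ?thesis"
    then obtain x where x: "dir_deriv u \<psi> x \<noteq> 0" "x \<in> - closure {x. \<psi> x \<noteq> 0}" by blast
    have "dir_deriv u \<psi> x = dir_deriv u (\<lambda>_. 0) x"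
      by (rule dir_deriv_cong[of "- closure {x. \<psi> x \<noteq> 0}"]) (use x closure_subset[of "{x. \<psi> x \<noteq> 0}"] in auto)
    then show False using x by simp
  qed
qed simp

lemma test_function_dir_deriv: "test_function U \<psi> \<Longrightarrow> test_function U (dir_deriv u \<psi>)"
  unfolding test_function_def
  using smooth_dir_deriv support_dir_deriv[of u \<psi>] closed_closure compact_Int_closed
  by (metis (no_types, lifting) inf.absorb_iff2 inf_commute order_trans)

lemma test_function_zero: "test_function U \<psi> \<Longrightarrow> x \<notin> U \<Longrightarrow> \<psi> x = 0"
  unfolding test_function_def using closure_subset[of "{x. \<psi> x \<noteq> 0}"] by auto

lemma test_function_bounded: "test_function U \<psi> \<Longrightarrow> bounded {x. \<psi> x \<noteq> 0}"
  unfolding test_function_def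
  using bounded_subset[OF compact_imp_bounded closure_subset[of "{x. \<psi> x \<noteq> 0}"]] by blast

section \<open>Integrals against compactly supported functions\<close>

lemma compact_support_integral:
  fixes f :: "'a::euclidean_space \<Rightarrow> complex"
  assumes f: "continuous_on UNIV f" and z: "\<And>x. x \<notin> cbox a b \<Longrightarrow> f x = 0"
  shows "integrable lborel f" "(LINT x|lborel. f x) = integral (cbox a b) f"
proof -
  have "integrable lborel (\<lambda>x. indicator (cbox a b) x *\<^sub>R f x)"
    using continuous_on_subset[OF f subset_UNIV] by (intro borel_integrable_compact) auto
  moreover have "(\<lambda>x. indicator (cbox a b) x *\<^sub>R f x) = f" using z by (auto simp: indicator_def)
  ultimately show i: "integrable lborel f" by simp
  have "(LINT x|lborel. f x) = integral UNIV f" using integral_lborel[OF i] by simp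
  also have "\<dots> = integral (cbox a b) f"
    by (rule integral_spike_set[OF _ _]) (auto intro!: empty_imp_negligible simp: z)
  finally show "(LINT x|lborel. f x) = integral (cbox a b) f" .
qed

lemma bounded_support_integrable:
  fixes f :: "'a::euclidean_space \<Rightarrow> complex"
  assumes f: "continuous_on UNIV f" and b: "bounded {x. f x \<noteq> 0}"
  shows "integrable lborel f"
proof -
  obtain a where "{x. f x \<noteq> 0} \<subseteq> cbox (- a) a" using bounded_subset_cbox_symmetric[OF b] by blast
  then show ?thesis using compact_support_integral[OF f, of "- a" a] by blast
qed

text \<open>Integrability is not assumed: if it fails for \<open>f\<close> it fails for the
  translate, and both integrals then take the default value 0.\<close>

lemma lborel_integral_shift:
  fixes f :: "'a::euclidean_space \<Rightarrow> complex"
  shows "(LINT y|lborel. f (c + y)) = (LINT y|lborel. f y)"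
proof (cases "integrable lborel f")
  case True
  then have m: "f \<in> borel_measurable borel" by auto
  have "(LINT y|lborel. f y) = (LINT y|distr lborel borel ((+) c). f y)"
    by (simp add: lborel_distr_plus)
  also have "\<dots> = (LINT y|lborel. f (c + y))" using m by (intro integral_distr) auto
  finally show ?thesis by simp
next
  case False
  have "\<not> integrable lborel (\<lambda>y. f (c + y))"
  proof
    assume i: "integrable lborel (\<lambda>y. f (c + y))"
    then have m: "(\<lambda>y. f (c + y)) \<in> borel_measurable borel" by auto
    have "integrable (distr lborel borel ((+) (- c))) (\<lambda>y. f (c + y))"
      using i by (simp add: lborel_distr_plus)
    then have "integrable lborel (\<lambda>y. f (c + (- c + y)))"
      by (subst (asm) integrable_distr_eq) (use m in auto)
    then show False using False by simp
  qed
  then show ?thesis using False by (simp add: not_integrable_integral_eq)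
qed

lemma dir_deriv_shift: "dir_deriv u (\<lambda>y. f (y - c)) = (\<lambda>y. dir_deriv u f (y - c))"
  by (rule ext) (simp add: dir_deriv_def algebra_simps)

text \<open>Differentiation under the integral sign, with the derivative falling on
  \<open>\<eta>\<close>, so that continuity of \<open>f\<close> suffices. Restricting
  \<open>t\<close> to distance at most 1 from \<open>s\<close> puts all supports into one box, where
  the Leibniz rule for compact domains applies.\<close>

lemma convolution_line_deriv:
  fixes f \<eta> :: "'a::euclidean_space \<Rightarrow> complex"
  assumes f: "continuous_on UNIV f" and d: "\<And>x. \<eta> differentiable at x"
    and c: "continuous_on UNIV (dir_deriv u \<eta>)" and b: "bounded {x. \<eta> x \<noteq> 0}"
  shows "((\<lambda>t. LINT y|lborel. f y * \<eta> (y - (x + t *\<^sub>R u))) has_vector_derivative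
    (LINT y|lborel. f y * (- dir_deriv u \<eta> (y - (x + s *\<^sub>R u))))) (at s)"
proof -
  obtain B where B: "\<And>x. \<eta> x \<noteq> 0 \<Longrightarrow> norm x \<le> B" using b unfolding bounded_iff by blast
  define T where "T = {s - 1..s + 1}"
  \<comment> \<open>A bound on the norm of every \<open>y\<close> for which
    \<open>y - (x + t *\<^sub>R u)\<close> meets the support of \<open>\<eta>\<close> for some
    \<open>t\<close> in \<open>T\<close>.\<close>
  define M where "M = B + norm x + (\<bar>s\<bar> + 1) * norm u"
  obtain a where a: "cball (0::'a) M \<subseteq> cbox (- a) a"
    using bounded_subset_cbox_symmetric[OF bounded_cball] by blast
  have cchi: "continuous_on UNIV \<eta>"
    using d by (simp add: continuous_at_imp_continuous_on differentiable_imp_continuous_within)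
  have out: "\<eta> (y - (x + t *\<^sub>R u)) = 0" if "t \<in> T" "y \<notin> cbox (- a) a" for t y
  proof (rule ccontr)
    assume "\<eta> (y - (x + t *\<^sub>R u)) \<noteq> 0"
    then have "norm (y - (x + t *\<^sub>R u)) \<le> B" by (rule B)
    moreover have "norm (t *\<^sub>R u) \<le> (\<bar>s\<bar> + 1) * norm u"
      using that(1) by (auto simp: T_def intro!: mult_right_mono)
    moreover have "norm y \<le> norm (y - (x + t *\<^sub>R u)) + norm x + norm (t *\<^sub>R u)"
      using norm_triangle_ineq[of "y - (x + t *\<^sub>R u)" "x + t *\<^sub>R u"] norm_triangle_ineq[of x "t *\<^sub>R u"] by simp
    ultimately have "y \<in> cball 0 M" by (simp add: M_def)
    then show False using a that by blast
  qed
  have dout: "dir_deriv u \<eta> (y - (x + s *\<^sub>R u)) = 0" if "y \<notin> cbox (- a) a" for y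
  proof -
    have "dir_deriv u (\<lambda>y. \<eta> (y - (x + s *\<^sub>R u))) y = dir_deriv u (\<lambda>_. 0) y"
      by (rule dir_deriv_cong[of "- cbox (- a) a"]) (use that out[of s] in \<open>auto simp: T_def\<close>)
    then show ?thesis by (simp add: dir_deriv_shift)
  qed
  have cont: "continuous_on S (\<lambda>y. f y * \<eta> (y - (x + t *\<^sub>R u)))" for t S
    by (intro continuous_intros continuous_on_compose2[OF cchi] continuous_on_subset[OF f]) auto
  have "((\<lambda>t. integral (cbox (- a) a) (\<lambda>y. f y * \<eta> (y - (x + t *\<^sub>R u)))) has_vector_derivative
    integral (cbox (- a) a) (\<lambda>y. f y * (- dir_deriv u \<eta> (y - (x + s *\<^sub>R u))))) (at s within T)"
  proof (rule leibniz_rule_vector_derivative)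
    show "(\<lambda>y. f y * \<eta> (y - (x + t *\<^sub>R u))) integrable_on cbox (- a) a" for t
      by (intro integrable_continuous cont)
    show "s \<in> T" "convex T" by (auto simp: T_def)
    show "((\<lambda>t. f y * \<eta> (y - (x + t *\<^sub>R u))) has_vector_derivative f y * (- dir_deriv u \<eta> (y - (x + t *\<^sub>R u)))) (at t within T)"
      for t y
    proof -
      have "((\<lambda>t. \<eta> ((y - x) + t *\<^sub>R (- u))) has_vector_derivative dir_deriv (- u) \<eta> ((y - x) + t *\<^sub>R (- u))) (at t)"
        by (rule dir_deriv_line[OF d])
      moreover have "dir_deriv (- u) \<eta> z = - dir_deriv u \<eta> z" for z
        using linear_neg[OF dir_deriv_linear[OF d]] by auto
      ultimately have "((\<lambda>t. \<eta> (y - (x + t *\<^sub>R u))) has_vector_derivative - dir_deriv u \<eta> (y - (x + t *\<^sub>R u))) (at t within T)"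
        by (simp add: algebra_simps has_vector_derivative_at_within)
      then show ?thesis by (rule has_vector_derivative_mult_right)
    qed
    show "continuous_on (T \<times> cbox (- a) a) (\<lambda>(t, y). f y * (- dir_deriv u \<eta> (y - (x + t *\<^sub>R u))))"
      unfolding split_beta
      by (intro continuous_intros continuous_on_compose2[OF c] continuous_on_compose2[OF f]) auto
  qed
  moreover have "(LINT y|lborel. f y * \<eta> (y - (x + t *\<^sub>R u))) = integral (cbox (- a) a) (\<lambda>y. f y * \<eta> (y - (x + t *\<^sub>R u)))"
    if "t \<in> T" for t
    using out[OF that] by (intro compact_support_integral cont) auto
  moreover have "(LINT y|lborel. f y * (- dir_deriv u \<eta> (y - (x + s *\<^sub>R u)))) =
     integral (cbox (- a) a) (\<lambda>y. f y * (- dir_deriv u \<eta> (y - (x + s *\<^sub>R u))))"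
    using dout by (intro compact_support_integral continuous_intros continuous_on_compose2[OF c] f) auto
  ultimately have "((\<lambda>t. LINT y|lborel. f y * \<eta> (y - (x + t *\<^sub>R u))) has_vector_derivative
    (LINT y|lborel. f y * (- dir_deriv u \<eta> (y - (x + s *\<^sub>R u))))) (at s within T)"
    by (subst has_vector_derivative_cong_ev) (auto simp: T_def eventually_at_filter)
  moreover have "at s within T = at s" unfolding T_def by (rule at_within_interior) simp
  ultimately show ?thesis by simp
qed

text \<open>The case of the constant function 1 in \<open>convolution_line_deriv\<close>: the
  integral of a translate does not depend on the translation, so its derivative is zero.\<close>

lemma integral_dir_deriv_0:
  fixes \<eta> :: "'a::euclidean_space \<Rightarrow> complex"
  assumes d: "\<And>x. \<eta> differentiable at x"
    and c: "continuous_on UNIV (dir_deriv u \<eta>)" and b: "bounded {x. \<eta> x \<noteq> 0}"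
  shows "(LINT y|lborel. dir_deriv u \<eta> y) = 0"
proof -
  have "((\<lambda>t. LINT y|lborel. 1 * \<eta> (y - (0 + t *\<^sub>R u))) has_vector_derivative
    (LINT y|lborel. 1 * (- dir_deriv u \<eta> (y - (0 + 0 *\<^sub>R u))))) (at 0)"
    by (rule convolution_line_deriv[OF _ d c b]) auto
  moreover have "(LINT y|lborel. \<eta> (y - t *\<^sub>R u)) = (LINT y|lborel. \<eta> y)" for t
    using lborel_integral_shift[of \<eta> "- (t *\<^sub>R u)"] by (simp add: algebra_simps)
  ultimately have "((\<lambda>t::real. LINT y|lborel. \<eta> y) has_vector_derivative - (LINT y|lborel. dir_deriv u \<eta> y)) (at 0)"
    by simp
  then have "- (LINT y|lborel. dir_deriv u \<eta> y) = 0"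
    using vector_derivative_unique_at has_vector_derivative_const by blast
  then show ?thesis by simp
qed

text \<open>\<open>g\<close> may be arbitrary outside \<open>U\<close>. The product is continuous on
  \<open>U\<close> and zero on the complement of the support, and these two open sets cover the
  space.\<close>

lemma test_product_continuous:
  assumes U: "open U" and g: "continuous_on U g" and \<psi>: "test_function U \<psi>"
  shows "continuous_on UNIV (\<lambda>x. g x * \<psi> x)"
proof -
  let ?K = "closure {x. \<psi> x \<noteq> 0}"
  have "continuous_on U (\<lambda>x. g x * \<psi> x)"
    using \<psi> by (intro continuous_on_mult[OF g smooth_continuous]) (auto simp: test_function_def)
  moreover have "continuous_on (- ?K) (\<lambda>x. g x * \<psi> x)"
  proof -
    have "continuous_on (- ?K) (\<lambda>x. 0::complex)" by simp
    then show ?thesis by (rule continuous_on_eq) (use closure_subset[of "{x. \<psi> x \<noteq> 0}"] in auto)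
  qed
  ultimately have "continuous_on (U \<union> - ?K) (\<lambda>x. g x * \<psi> x)"
    using U by (intro continuous_on_open_Un) auto
  moreover have "U \<union> - ?K = UNIV" using \<psi> by (auto simp: test_function_def)
  ultimately show ?thesis by simp
qed

lemma test_product_integrable:
  assumes U: "open U" and g: "continuous_on U g" and \<psi>: "test_function U \<psi>"
  shows "integrable lborel (\<lambda>x. g x * \<psi> x)"
proof (rule bounded_support_integrable[OF test_product_continuous[OF assms]])
  show "bounded {x. g x * \<psi> x \<noteq> 0}"
    by (rule bounded_subset[OF test_function_bounded[OF \<psi>]]) auto
qed

text \<open>The derivative of the product \<open>h x * \<psi> x\<close>, extended by zero, has
  integral zero.\<close>

lemma integration_by_parts:
  assumes U: "open U" and h: "\<And>x. x \<in> U \<Longrightarrow> h differentiable at x"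
    and c: "continuous_on U (dir_deriv u h)" and \<psi>: "test_function U \<psi>"
  shows "(LINT x|lborel. h x * dir_deriv u \<psi> x) = - (LINT x|lborel. dir_deriv u h x * \<psi> x)"
proof -
  let ?K = "closure {x. \<psi> x \<noteq> 0}"
  have ch: "continuous_on U h"
    using h by (simp add: continuous_at_imp_continuous_on differentiable_imp_continuous_within)
  have sm: "smooth \<psi>" using \<psi> by (simp add: test_function_def)
  define \<eta> where "\<eta> = (\<lambda>x. h x * \<psi> x)"
  have "\<eta> differentiable at x \<and> dir_deriv u \<eta> x = h x * dir_deriv u \<psi> x + dir_deriv u h x * \<psi> x" for x
  proof (cases "x \<in> U")
    case True
    then show ?thesis unfolding \<eta>_def
      using h[OF True] smooth_differentiable[OF sm] by (auto simp: dir_deriv_mult)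
  next
    case False
    then have x: "x \<in> - ?K" using \<psi> by (auto simp: test_function_def)
    have z: "\<eta> y = 0" if "y \<in> - ?K" for y using that closure_subset[of "{x. \<psi> x \<noteq> 0}"] by (auto simp: \<eta>_def)
    have "((\<lambda>_. 0) has_derivative (\<lambda>_. 0::complex)) (at x)" by simp
    then have "(\<eta> has_derivative (\<lambda>_. 0)) (at x)"
      by (rule has_derivative_transform_within_open[of _ _ _ _ "- ?K"]) (use x z in auto)
    moreover have "dir_deriv u \<psi> x = 0"
      using False test_function_zero[OF test_function_dir_deriv[OF \<psi>]] by blast
    moreover have "\<psi> x = 0" using False test_function_zero[OF \<psi>] by blast
    ultimately show ?thesis by (auto simp: differentiable_def dir_deriv_eqI)
  qed
  then have d: "\<eta> differentiable at x"
    and D: "dir_deriv u \<eta> = (\<lambda>x. h x * dir_deriv u \<psi> x + dir_deriv u h x * \<psi> x)" for x by auto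
  note \<psi>' = test_function_dir_deriv[OF \<psi>]
  have "(LINT x|lborel. dir_deriv u \<eta> x) = 0"
  proof (rule integral_dir_deriv_0[OF d])
    show "continuous_on UNIV (dir_deriv u \<eta>)" unfolding D
      by (intro continuous_on_add test_product_continuous[OF U] ch c \<psi> \<psi>')
    show "bounded {x. \<eta> x \<noteq> 0}"
      by (rule bounded_subset[OF test_function_bounded[OF \<psi>]]) (auto simp: \<eta>_def)
  qed
  then show ?thesis unfolding D
    using test_product_integrable[OF U ch \<psi>'] test_product_integrable[OF U c \<psi>]
    by (simp add: eq_neg_iff_add_eq_0)
qed

lemma bump_test_function:
  fixes p :: "'a::euclidean_space"
  assumes U: "open U" "p \<in> U"
  shows "\<exists>r>0. cball p r \<subseteq> U \<and>
    test_function U (\<lambda>x. complex_of_real (flat 0 (r\<^sup>2 - (x - p) \<bullet> (x - p))))"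
proof -
  obtain r where r: "r > 0" "cball p r \<subseteq> U" using open_contains_cball U by metis
  let ?b = "\<lambda>x. complex_of_real (flat 0 (r\<^sup>2 - (x - p) \<bullet> (x - p)))"
  have "{x. ?b x \<noteq> 0} \<subseteq> cball p r"
  proof
    fix x assume "x \<in> {x. ?b x \<noteq> 0}"
    then have "(norm (x - p))\<^sup>2 \<le> r\<^sup>2" by (auto simp: flat_def power2_norm_eq_inner split: if_splits)
    then have "norm (x - p) \<le> r" by (rule power2_le_imp_le[OF _ less_imp_le[OF r(1)]])
    then show "x \<in> cball p r" by (simp add: dist_norm norm_minus_commute)
  qed
  then have s: "closure {x. ?b x \<noteq> 0} \<subseteq> cball p r" by (intro closure_minimal) auto
  have "compact (closure {x. ?b x \<noteq> 0})"
    unfolding compact_eq_bounded_closed using bounded_subset[OF bounded_cball s] closed_closure by blast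
  moreover have "smooth ?b" by (rule elementary_smooth[of _ True]) (intro elementary.bump, simp)
  ultimately show ?thesis using r s by (auto simp: test_function_def)
qed

text \<open>If \<open>h p \<noteq> 0\<close>, then \<open>Re (cnj (h p) * h x)\<close> is positive
  near \<open>p\<close>, yet integrates to zero against a non-negative bump supported there. Only
  elementary test functions are demanded, since the operator calculus below is developed for that
  class.\<close>

lemma vanishing_by_test_functions:
  fixes h :: "'a::euclidean_space \<Rightarrow> complex"
  assumes h: "continuous_on UNIV h" and U: "open U" "p \<in> U"
    and z: "\<And>\<psi>. \<psi> \<in> elementary True \<Longrightarrow> test_function U \<psi> \<Longrightarrow> (LINT x|lborel. h x * \<psi> x) = 0"
  shows "h p = 0"
proof (rule ccontr)
  assume np: "h p \<noteq> 0"
  define g where "g = (\<lambda>x. Re (cnj (h p) * h x))"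
  have cg: "continuous_on S g" for S
    unfolding g_def by (intro continuous_intros continuous_on_subset[OF h]) auto
  have gp: "g p > 0" using np unfolding g_def
    by (metis Re_complex_of_real complex_mult_cnj mult.commute of_real_power cmod_power2 zero_less_power zero_less_norm_iff complex_norm_square)
  have "open (U \<inter> {x. 0 < g x})" using U cg by (intro open_Int open_Collect_less) auto
  then obtain r where r: "r > 0" "cball p r \<subseteq> U \<inter> {x. 0 < g x}"
    and t: "test_function (U \<inter> {x. 0 < g x}) (\<lambda>x. complex_of_real (flat 0 (r\<^sup>2 - (x - p) \<bullet> (x - p))))"
    using bump_test_function[of "U \<inter> {x. 0 < g x}" p] U gp by blast
  define b where "b = (\<lambda>x. flat 0 (r\<^sup>2 - (x - p) \<bullet> (x - p)))"
  define \<psi> where "\<psi> = (\<lambda>x. complex_of_real (b x))"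
  have el: "\<psi> \<in> elementary True" unfolding \<psi>_def b_def by (intro elementary.bump) simp
  have t: "test_function (U \<inter> {x. 0 < g x}) \<psi>" using t by (simp add: \<psi>_def b_def)
  then have tU: "test_function U \<psi>" by (auto simp: test_function_def)
  have z0: "(LINT x|lborel. h x * \<psi> x) = 0" by (rule z[OF el tU])
  have i: "integrable lborel (\<lambda>x. h x * \<psi> x)"
    by (rule test_product_integrable[OF U(1) continuous_on_subset[OF h subset_UNIV] tU])
  have "(LINT x|lborel. Re (cnj (h p) * (h x * \<psi> x))) = 0"
    using i z0 by (subst integral_Re) auto
  then have gz: "(LINT x|lborel. g x * b x) = 0"
    by (simp add: g_def \<psi>_def algebra_simps)
  have cgb: "continuous_on S (\<lambda>x. g x * b x)" for S
  proof -
    have "continuous_on S (\<lambda>x. Re (\<psi> x))"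
      by (intro continuous_intros smooth_continuous elementary_smooth[OF el])
    then show ?thesis using cg by (auto simp: \<psi>_def intro!: continuous_intros)
  qed
  have nn: "0 \<le> g x * b x" for x
  proof (cases "\<psi> x = 0")
    case False
    then have "x \<in> U \<inter> {x. 0 < g x}" using test_function_zero[OF t] by blast
    then show ?thesis by (simp add: b_def flat_def)
  qed (simp add: \<psi>_def)
  obtain c where c: "{x. \<psi> x \<noteq> 0} \<subseteq> cbox (- c) c"
    using bounded_subset_cbox_symmetric[OF test_function_bounded[OF t]] by blast
  have "\<psi> p \<noteq> 0" using r(1) by (simp add: \<psi>_def b_def flat_def)
  have "(LINT x|lborel. of_real (g x * b x)) = integral (cbox (- c) c) (\<lambda>x. complex_of_real (g x * b x))"
    using c by (intro compact_support_integral continuous_intros cgb) (auto simp: \<psi>_def)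
  moreover have "(LINT x|lborel. complex_of_real (g x * b x)) = 0"
    using integral_complex_of_real[of lborel "\<lambda>x. g x * b x"] gz by (simp only: of_real_0)
  ultimately have "integral (cbox (- c) c) (\<lambda>x. complex_of_real (g x * b x)) = 0" by simp
  moreover have "((\<lambda>x. g x * b x) has_integral integral (cbox (- c) c) (\<lambda>x. g x * b x)) (cbox (- c) c)"
    by (intro integrable_integral integrable_continuous cgb)
  moreover from has_integral_of_real[OF this]
  have "integral (cbox (- c) c) (\<lambda>x. complex_of_real (g x * b x)) = of_real (integral (cbox (- c) c) (\<lambda>x. g x * b x))"
    by (rule integral_unique)
  ultimately have hi: "((\<lambda>x. g x * b x) has_integral 0) (cbox (- c) c)" by simp
  have ope: "open {x. \<psi> x \<noteq> 0}"
    by (intro open_Collect_neq continuous_intros smooth_continuous elementary_smooth[OF el])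
  have "p \<in> interior (cbox (- c) c)"
    using interior_maximal[OF c ope] \<open>\<psi> p \<noteq> 0\<close> by blast
  then have ne: "box (- c) c \<noteq> {}" "p \<in> cbox (- c) c" using interior_cbox interior_subset by blast+
  have "g p * b p = 0"
    by (rule has_integral_0_cbox_imp_0[OF cgb nn hi ne])
  then show False using gp \<open>\<psi> p \<noteq> 0\<close> by (simp add: \<psi>_def)
qed

section \<open>Ordinary differential equations with constant coefficients\<close>

definition expo_monomial :: "nat \<Rightarrow> complex \<Rightarrow> real \<Rightarrow> complex" where
  "expo_monomial n a t = of_real t ^ n * exp (a * of_real t)"

lemma cspan_EP:
  assumes B: "B \<subseteq> EP" and f: "f \<in> cfun.span B"
  shows "f \<in> EP"
  using f
proof (induction rule: cfun.span_induct_alt)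
  case base show ?case using elementary.const[of 0 False] by (simp add: zero_fun_def)
next
  case (step c x y)
  then show ?case using B elementary.add[OF elementary_cmult[of x False c], of y]
    by (auto simp: plus_fun_def)
qed

lemma expo_monomial_EP: "expo_monomial n a \<in> EP"
proof -
  have "(\<lambda>t::real. complex_of_real t) \<in> EP" using elementary.lin[of "1::real" False] by simp
  then have p: "(\<lambda>t::real. complex_of_real t ^ n) \<in> EP"
    by (induction n) (auto intro: elementary.const elementary.mult)
  have "(\<lambda>t::real. exp (ceval (Re a, Im a) t)) \<in> EP" by (rule elementary.expo)
  moreover have "ceval (Re a, Im a) t = a * of_real t" for t
    by (simp add: ceval_def complex_eq_iff)
  ultimately have "(\<lambda>t::real. exp (a * of_real t)) \<in> EP" by simp
  from elementary.mult[OF p this] show ?thesis by (simp add: expo_monomial_def[abs_def])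
qed

lemma expo_monomial_deriv:
  "(expo_monomial n a has_vector_derivative a * expo_monomial n a t + of_nat n * expo_monomial (n - 1) a t) (at t)"
proof -
  have "((\<lambda>z. z ^ n * exp (a * z)) has_field_derivative
     (a * (z ^ n * exp (a * z)) + of_nat n * (z ^ (n - 1) * exp (a * z)))) (at z)" for z :: complex
    by (auto intro!: derivative_eq_intros simp: algebra_simps)
  from has_vector_derivative_real_field[OF this[of "of_real t"]]
  show ?thesis by (simp add: expo_monomial_def[abs_def])
qed

definition solves :: "complex \<Rightarrow> (real \<Rightarrow> complex) \<Rightarrow> (real \<Rightarrow> complex) \<Rightarrow> bool" where
  "solves z y h \<longleftrightarrow> (\<forall>t. (y has_vector_derivative z * y t + h t) (at t))"

definition expo_family :: "nat \<Rightarrow> complex set \<Rightarrow> (real \<Rightarrow> complex) set" where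
  "expo_family N Z = (\<lambda>(n, a). expo_monomial n a) ` ({..N} \<times> Z)"

lemma expo_familyI: "n \<le> N \<Longrightarrow> a \<in> Z \<Longrightarrow> expo_monomial n a \<in> expo_family N Z"
  unfolding expo_family_def by force

lemma expo_family_mono: "N \<le> N' \<Longrightarrow> Z \<subseteq> Z' \<Longrightarrow> expo_family N Z \<subseteq> expo_family N' Z'"
  unfolding expo_family_def by (intro image_mono Sigma_mono) auto

text \<open>In the resonant case \<open>a = z\<close> integration raises the degree by one, which
  accounts for \<open>Suc n\<close>. Otherwise induction on the degree inverts
  \<open>d/dt - z\<close> with powers of \<open>a - z\<close> as denominators.\<close>

lemma solves_monomial:
  "\<exists>y\<in>cfun.span (expo_family (Suc n) {a, z}). solves z y (expo_monomial n a)"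
proof (cases "a = z")
  case True
  let ?y = "\<lambda>t. inverse (of_nat (Suc n)) * expo_monomial (Suc n) z t"
  have "?y \<in> cfun.span (expo_family (Suc n) {a, z})"
    by (intro cfun.span_scale cfun.span_base expo_familyI) auto
  moreover have "solves z ?y (expo_monomial n a)"
    unfolding solves_def
  proof
    fix t
    have "inverse k * (z * e + k * m) = z * (inverse k * e) + m" if "k \<noteq> 0" for k e m :: complex
      using that by (simp add: field_simps)
    from this[of "of_nat (Suc n)"]
    show "(?y has_vector_derivative z * ?y t + expo_monomial n a t) (at t)"
      using True has_vector_derivative_mult_right[OF expo_monomial_deriv[of "Suc n" z t], of "inverse (of_nat (Suc n))"]
      by (simp del: of_nat_Suc)
  qed
  ultimately show ?thesis by blast
next
  case False
  then show ?thesis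
  proof (induction n)
    case 0
    let ?y = "\<lambda>t. inverse (a - z) * expo_monomial 0 a t"
    have "?y \<in> cfun.span (expo_family (Suc 0) {a, z})"
      by (intro cfun.span_scale cfun.span_base expo_familyI) auto
    moreover have "solves z ?y (expo_monomial 0 a)"
      unfolding solves_def
    proof
      fix t
      have "(?y has_vector_derivative inverse (a - z) * (a * expo_monomial 0 a t)) (at t)"
        using has_vector_derivative_mult_right[OF expo_monomial_deriv[of 0 a t], of "inverse (a - z)"] by simp
      moreover have "inverse (a - z) * (a * e) = z * (inverse (a - z) * e) + e" for e
        using 0 by (simp add: field_simps)
      ultimately show "(?y has_vector_derivative z * ?y t + expo_monomial 0 a t) (at t)" by simp
    qed
    ultimately show ?case by blast
  next
    case (Suc n)
    then obtain y where y: "y \<in> cfun.span (expo_family (Suc n) {a, z})" "solves z y (expo_monomial n a)" by blast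
    let ?c = "inverse (a - z)"
    \<comment> \<open>The operator \<open>d/dt - z\<close> maps the monomial of degree
      \<open>Suc n\<close> to \<open>a - z\<close> times itself plus \<open>Suc n\<close> times the
      monomial of degree \<open>n\<close>; the solution \<open>y\<close> removes the second
      term.\<close>
    let ?w = "\<lambda>t. ?c * (expo_monomial (Suc n) a t + (- of_nat (Suc n)) * y t)"
    have "y \<in> cfun.span (expo_family (Suc (Suc n)) {a, z})"
      using y(1) cfun.span_mono[OF expo_family_mono[of "Suc n" "Suc (Suc n)" "{a, z}" "{a, z}"]] by auto
    then have "?w \<in> cfun.span (expo_family (Suc (Suc n)) {a, z})"
      using cfun.span_scale[OF cfun.span_add[OF cfun.span_base[OF expo_familyI[of "Suc n"]]
           cfun.span_scale[of y _ "- of_nat (Suc n)"]], of "Suc (Suc n)" a "{a, z}" ?c]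
      by (simp add: plus_fun_def)
    moreover have "solves z ?w (expo_monomial (Suc n) a)"
      unfolding solves_def
    proof
      fix t
      let ?d = "?c * ((a * expo_monomial (Suc n) a t + of_nat (Suc n) * expo_monomial n a t) +
          (- of_nat (Suc n)) * (z * y t + expo_monomial n a t))"
      have "(?w has_vector_derivative ?d) (at t)"
        using expo_monomial_deriv[of "Suc n" a t] y(2) unfolding solves_def
        by (intro has_vector_derivative_mult_right has_vector_derivative_add) auto
      moreover have "?c * ((a * e + k * m) + (- k) * (z * v + m)) = z * (?c * (e + (- k) * v)) + e" for e k m v
      proof -
        have one: "?c * a = ?c * z + 1" using Suc.prems left_inverse[of "a - z"] by (simp add: algebra_simps)
        have "?c * ((a * e + k * m) + (- k) * (z * v + m)) = (?c * a) * e - ?c * k * z * v"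
          by (simp only: ring_distribs mult_minus_left mult_minus_right mult.assoc mult.left_commute add.assoc) simp
        also have "\<dots> = z * (?c * (e + (- k) * v)) + e" unfolding one by (simp add: algebra_simps)
        finally show ?thesis .
      qed
      ultimately show "(?w has_vector_derivative z * ?w t + expo_monomial (Suc n) a t) (at t)" by (simp only:)
    qed
    ultimately show ?case by blast
  qed
qed

lemma solves_span:
  assumes "h \<in> cfun.span (expo_family N Z)"
  shows "\<exists>y\<in>cfun.span (expo_family (Suc N) (insert z Z)). solves z y h"
  using assms
proof (induction rule: cfun.span_induct_alt)
  case base
  show ?case by (intro bexI[of _ 0] cfun.span_zero) (auto simp: solves_def)
next
  case (step c x y)
  then obtain n a where x: "x = expo_monomial n a" "n \<le> N" "a \<in> Z" unfolding expo_family_def by auto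
  obtain u where u: "u \<in> cfun.span (expo_family (Suc n) {a, z})" "solves z u x"
    using solves_monomial x by blast
  obtain v where v: "v \<in> cfun.span (expo_family (Suc N) (insert z Z))" "solves z v y"
    using step by blast
  have "u \<in> cfun.span (expo_family (Suc N) (insert z Z))"
    using u(1) cfun.span_mono[OF expo_family_mono[of "Suc n" "Suc N" "{a, z}" "insert z Z"]] x by auto
  then have "(\<lambda>t. c * u t) + v \<in> cfun.span (expo_family (Suc N) (insert z Z))"
    using v by (intro cfun.span_add cfun.span_scale)
  moreover have "solves z ((\<lambda>t. c * u t) + v) ((\<lambda>t. c * x t) + y)"
    unfolding solves_def
  proof
    fix t
    have "((\<lambda>t. c * u t + v t) has_vector_derivative c * (z * u t + x t) + (z * v t + y t)) (at t)"
      using u(2) v(2) unfolding solves_def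
      by (intro has_vector_derivative_mult_right has_vector_derivative_add) auto
    then show "((\<lambda>t. c * u t) + v has_vector_derivative z * ((\<lambda>t. c * u t) + v) t + ((\<lambda>t. c * x t) + y) t) (at t)"
      by (simp add: plus_fun_def algebra_simps)
  qed
  ultimately show ?case by blast
qed

text \<open>The product of the operators \<open>d/dt - z\<close>, applied one at a time. The
  existential quantifier makes the differentiability needed at each stage part of the
  predicate.\<close>

fun ode :: "complex list \<Rightarrow> (real \<Rightarrow> complex) \<Rightarrow> real set \<Rightarrow> bool" where
  "ode [] g J \<longleftrightarrow> (\<forall>t\<in>J. g t = 0)"
| "ode (z # zs) g J \<longleftrightarrow> (\<exists>g'. (\<forall>t\<in>J. (g has_vector_derivative g' t) (at t)) \<and> ode zs (\<lambda>t. g' t - z * g t) J)"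

text \<open>After one factor is peeled off, a particular solution is available inside the span. The
  difference solves the homogeneous equation, so its product with the exponential of
  \<open>- z * t\<close> is constant.\<close>

lemma ode_span:
  assumes J: "open J" "convex J"
  shows "ode zs g J \<Longrightarrow> \<exists>e\<in>cfun.span (expo_family (length zs) (set zs)). \<forall>t\<in>J. g t = e t"
proof (induction zs arbitrary: g)
  case Nil
  then show ?case by (intro bexI[of _ 0] cfun.span_zero) auto
next
  case (Cons z zs)
  from Cons.prems obtain g' where g': "\<And>t. t \<in> J \<Longrightarrow> (g has_vector_derivative g' t) (at t)"
    and o: "ode zs (\<lambda>t. g' t - z * g t) J" by auto
  from Cons.IH[OF o] obtain h where
    h: "h \<in> cfun.span (expo_family (length zs) (set zs))" "\<And>t. t \<in> J \<Longrightarrow> g' t - z * g t = h t"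
    by blast
  obtain y where y: "y \<in> cfun.span (expo_family (length (z # zs)) (set (z # zs)))" "solves z y h"
    using solves_span[OF h(1), of z] by auto
  have "\<exists>c. \<forall>t\<in>J. (g t - y t) * exp (- z * of_real t) = c"
  proof (rule has_derivative_zero_constant[OF J(2)])
    fix t assume t: "t \<in> J"
    have e: "((\<lambda>t::real. exp (- z * of_real t)) has_vector_derivative (- z) * exp (- z * of_real t)) (at t)"
      using expo_monomial_deriv[of 0 "- z" t] by (simp add: expo_monomial_def[abs_def])
    have "((\<lambda>t. (g t - y t) * exp (- z * of_real t)) has_vector_derivative
      (g t - y t) * ((- z) * exp (- z * of_real t)) + (g' t - (z * y t + h t)) * exp (- z * of_real t)) (at t)"
      using g'[OF t] y(2) unfolding solves_def
      by (intro has_vector_derivative_mult has_vector_derivative_diff e) auto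
    moreover have "(g t - y t) * ((- z) * exp (- z * of_real t)) + (g' t - (z * y t + h t)) * exp (- z * of_real t) = 0"
      by (simp flip: h(2)[OF t] add: algebra_simps)
    ultimately have "((\<lambda>t. (g t - y t) * exp (- z * of_real t)) has_vector_derivative 0) (at t)" by simp
    then show "((\<lambda>t. (g t - y t) * exp (- z * of_real t)) has_derivative (\<lambda>h. 0)) (at t within J)"
      by (simp add: has_vector_derivative_def has_derivative_at_withinI)
  qed
  then obtain c where c: "\<And>t. t \<in> J \<Longrightarrow> (g t - y t) * exp (- z * of_real t) = c" by blast
  have "g t = ((\<lambda>t. c * expo_monomial 0 z t) + y) t" if "t \<in> J" for t
    using c[OF that] by (simp add: expo_monomial_def exp_minus field_simps)
  moreover have "(\<lambda>t. c * expo_monomial 0 z t) + y \<in> cfun.span (expo_family (length (z # zs)) (set (z # zs)))"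
    by (rule cfun.span_add[OF cfun.span_scale[OF cfun.span_base[OF expo_familyI]] y(1)]) auto
  ultimately show ?case by blast
qed

text \<open>A finite-dimensional space of functions has finitely many nodes with a Lagrange basis.
  The resulting formula relates point values only, and can therefore pass from mollifications of a
  function to the function itself.\<close>

lemma interpolation:
  assumes "finite B"
  shows "\<exists>T \<kappa>. finite T \<and> T \<subseteq> S \<and> (\<forall>s\<in>T. \<kappa> s \<in> cfun.span B \<and> (\<forall>s'\<in>T. \<kappa> s s' = (if s = s' then 1 else 0))) \<and>
    (\<forall>g\<in>cfun.span B. \<forall>x\<in>S. g x = (\<Sum>s\<in>T. g s * \<kappa> s x))"
  using assms
proof (induction B rule: finite_induct)
  case empty
  show ?case by (intro exI[of _ "{}"]) auto
next
  case (insert e B)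
  from insert.IH obtain T \<kappa> where TT: "finite T \<and> T \<subseteq> S \<and>
    (\<forall>s\<in>T. \<kappa> s \<in> cfun.span B \<and> (\<forall>s'\<in>T. \<kappa> s s' = (if s = s' then 1 else 0))) \<and>
    (\<forall>g\<in>cfun.span B. \<forall>x\<in>S. g x = (\<Sum>s\<in>T. g s * \<kappa> s x))" by (elim exE)
  then have T: "finite T" "T \<subseteq> S" "\<And>s. s \<in> T \<Longrightarrow> \<kappa> s \<in> cfun.span B"
    "\<And>s s'. s \<in> T \<Longrightarrow> s' \<in> T \<Longrightarrow> \<kappa> s s' = (if s = s' then 1 else 0)"
    "\<And>g x. g \<in> cfun.span B \<Longrightarrow> x \<in> S \<Longrightarrow> g x = (\<Sum>s\<in>T. g s * \<kappa> s x)" by simp_all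
  have sub: "cfun.span B \<subseteq> cfun.span (insert e B)" by (intro cfun.span_mono) auto
  \<comment> \<open>The interpolation error of the new generator at the old nodes. If it vanishes on
    all of \<open>S\<close> the old nodes suffice; otherwise a point where it does not vanish
    becomes a new node.\<close>
  define e' where "e' = (\<lambda>x. e x - (\<Sum>s\<in>T. e s * \<kappa> s x))"
  have gdec: "\<exists>c g0. g0 \<in> cfun.span B \<and> (\<forall>x. g x = g0 x + c * e x)" if g: "g \<in> cfun.span (insert e B)" for g
  proof -
    obtain c where c: "g - (\<lambda>x. c * e x) \<in> cfun.span B" using g cfun.span_breakdown_eq by blast
    have "\<forall>x. g x = (g - (\<lambda>x. c * e x)) x + c * e x" by simp
    then show ?thesis using c by blast
  qed
  have e'T: "e' s = 0" if "s \<in> T" for s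
  proof -
    have "(\<Sum>s'\<in>T. e s' * \<kappa> s' s) = (\<Sum>s'\<in>T. if s' = s then e s' else 0)"
      using that T(4) by (intro sum.cong) auto
    then show ?thesis using that T(1) by (simp add: e'_def)
  qed
  show ?case
  proof (cases "\<forall>x\<in>S. e' x = 0")
    case True
    have "g x = (\<Sum>s\<in>T. g s * \<kappa> s x)" if g: "g \<in> cfun.span (insert e B)" and x: "x \<in> S" for g x
    proof -
      obtain c g0 where g0: "g0 \<in> cfun.span B" "\<forall>x. g x = g0 x + c * e x" using gdec[OF g] by blast
      have "e x = (\<Sum>s\<in>T. e s * \<kappa> s x)" using True x by (simp add: e'_def)
      then have "g x = (\<Sum>s\<in>T. g0 s * \<kappa> s x) + c * (\<Sum>s\<in>T. e s * \<kappa> s x)"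
        using T(5)[OF g0(1) x] g0(2) by simp
      also have "\<dots> = (\<Sum>s\<in>T. g s * \<kappa> s x)"
        using g0(2) by (simp add: sum_distrib_left sum.distrib algebra_simps)
      finally show ?thesis .
    qed
    then show ?thesis using T sub by (intro exI[of _ T] exI[of _ \<kappa>]) auto
  next
    case False
    then obtain x1 where x1: "x1 \<in> S" "e' x1 \<noteq> 0" by blast
    have x1T: "x1 \<notin> T" using x1 e'T by blast
    define \<kappa>1 where "\<kappa>1 = (\<lambda>x. inverse (e' x1) * e' x)"
    \<comment> \<open>\<open>\<kappa>1\<close> is 1 at \<open>x1\<close> and 0 at the old nodes, so
      subtracting a multiple of it corrects each old basis function at \<open>x1\<close>
      alone.\<close>
    define \<kappa>' where "\<kappa>' = (\<lambda>s x. if s = x1 then \<kappa>1 x else \<kappa> s x - \<kappa> s x1 * \<kappa>1 x)"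
    have sumspan: "(\<lambda>x. \<Sum>s\<in>T'. c s * \<kappa> s x) \<in> cfun.span (insert e B)" if "T' \<subseteq> T" for T' c
    proof -
      have "finite T'" using that T(1) finite_subset by blast
      then show ?thesis using that
      proof (induction T' rule: finite_induct)
        case empty show ?case using cfun.span_zero[of "insert e B"] by (simp add: zero_fun_def)
      next
        case (insert t T')
        then show ?case using cfun.span_add[OF cfun.span_scale[of "\<kappa> t" "insert e B" "c t"], of "\<lambda>x. \<Sum>s\<in>T'. c s * \<kappa> s x"] T(3) sub
          by (auto simp: plus_fun_def)
      qed
    qed
    have "e' \<in> cfun.span (insert e B)"
      using cfun.span_diff[OF cfun.span_base[of e "insert e B"] sumspan[OF order_refl, of e]]
      by (simp add: e'_def fun_diff_def)
    then have k1: "\<kappa>1 \<in> cfun.span (insert e B)" unfolding \<kappa>1_def by (rule cfun.span_scale)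
    have ks: "\<kappa>' s \<in> cfun.span (insert e B)" if "s \<in> insert x1 T" for s
    proof (cases "s = x1")
      case True then show ?thesis using k1 by (simp add: \<kappa>'_def)
    next
      case False
      then have "\<kappa> s \<in> cfun.span (insert e B)" using that T(3) sub by auto
      from cfun.span_diff[OF this cfun.span_scale[OF k1, of "\<kappa> s x1"]] show ?thesis
        using False by (simp add: \<kappa>'_def fun_diff_def)
    qed
    have delta: "\<kappa>' s s' = (if s = s' then 1 else 0)" if "s \<in> insert x1 T" "s' \<in> insert x1 T" for s s'
      using that x1T x1(2) e'T T(4) by (auto simp: \<kappa>'_def \<kappa>1_def)
    have rep: "g x = (\<Sum>s\<in>insert x1 T. g s * \<kappa>' s x)" if g: "g \<in> cfun.span (insert e B)" and x: "x \<in> S" for g x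
    proof -
      obtain c g0 where g0: "g0 \<in> cfun.span B" "\<forall>x. g x = g0 x + c * e x" using gdec[OF g] by blast
      have d: "g y - (\<Sum>s\<in>T. g s * \<kappa> s y) = c * e' y" if "y \<in> S" for y
        using T(5)[OF g0(1) that] g0(2)
        by (simp add: e'_def sum_distrib_left sum.distrib algebra_simps)
      have "(\<Sum>s\<in>insert x1 T. g s * \<kappa>' s x) = g x1 * \<kappa>1 x + (\<Sum>s\<in>T. g s * (\<kappa> s x - \<kappa> s x1 * \<kappa>1 x))"
        using T(1) x1T by (auto simp: \<kappa>'_def intro!: sum.cong)
      also have "\<dots> = (\<Sum>s\<in>T. g s * \<kappa> s x) + (g x1 - (\<Sum>s\<in>T. g s * \<kappa> s x1)) * \<kappa>1 x"
        by (simp add: sum_subtractf algebra_simps sum_distrib_left)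
      also have "\<dots> = (\<Sum>s\<in>T. g s * \<kappa> s x) + c * e' x1 * \<kappa>1 x" by (simp only: d[OF x1(1)])
      also have "\<dots> = (\<Sum>s\<in>T. g s * \<kappa> s x) + c * e' x" using x1(2) by (simp add: \<kappa>1_def)
      also have "\<dots> = g x" using d[OF x] by (simp add: algebra_simps)
      finally show ?thesis by simp
    qed
    show ?thesis
      by (intro exI[of _ "insert x1 T"] exI[of _ \<kappa>'] conjI ballI) (use T x1 ks delta rep in auto)
  qed
qed

section \<open>Mollification along lines\<close>

definition weak_factor :: "'a::euclidean_space \<Rightarrow> complex \<Rightarrow> ('a \<Rightarrow> complex) \<Rightarrow> 'a \<Rightarrow> complex" where
  "weak_factor u z \<psi> = (\<lambda>x. - dir_deriv u \<psi> x - z * \<psi> x)"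

lemma elementary_weak_factor: "\<psi> \<in> elementary b \<Longrightarrow> weak_factor u z \<psi> \<in> elementary b"
  unfolding weak_factor_def
  using elementary_diff[OF elementary_cmult[OF elementary_dir_deriv[of \<psi> b u], of "-1"] elementary_cmult[of \<psi> b z]]
  by simp

lemma elementary_shift: "\<psi> \<in> elementary b \<Longrightarrow> (\<lambda>y. \<psi> (y - c)) \<in> elementary b"
proof (induction rule: elementary.induct)
  case (lin u)
  have "(\<lambda>y. complex_of_real (u \<bullet> (y - c))) = (\<lambda>y. of_real (u \<bullet> y) - of_real (u \<bullet> c))"
    by (simp add: inner_diff_right)
  then show ?case using elementary_diff[OF elementary.lin[of u b] elementary.const[of "of_real (u \<bullet> c)"]] by simp
next
  case (expo \<nu>)
  have "(\<lambda>y. exp (ceval \<nu> (y - c))) = (\<lambda>y. exp (- ceval \<nu> c) * exp (ceval \<nu> y))"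
    by (simp add: ceval_diff exp_diff exp_minus field_simps)
  then show ?case using elementary_cmult[OF elementary.expo] by simp
next
  case (bump m r p)
  then show ?case using elementary.bump[of b m r "p + c"] by (simp add: algebra_simps)
qed (simp_all add: elementary.const elementary.add elementary.mult)

lemma elementary_continuous: "\<psi> \<in> elementary b \<Longrightarrow> continuous_on S \<psi>"
  by (rule smooth_continuous[OF elementary_smooth])

lemma support_weak_factor:
  "closure {x. weak_factor u z \<psi> x \<noteq> 0} \<subseteq> closure {x. \<psi> x \<noteq> 0}"
proof -
  have "{x. weak_factor u z \<psi> x \<noteq> 0} \<subseteq> {x. dir_deriv u \<psi> x \<noteq> 0} \<union> {x. \<psi> x \<noteq> 0}"
    by (auto simp: weak_factor_def)
  then have "closure {x. weak_factor u z \<psi> x \<noteq> 0} \<subseteq> closure {x. dir_deriv u \<psi> x \<noteq> 0} \<union> closure {x. \<psi> x \<noteq> 0}"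
    using closure_mono closure_Un by metis
  then show ?thesis using support_dir_deriv[of u \<psi>] by blast
qed

lemma test_function_weak_factor:
  assumes "\<psi> \<in> elementary b" "test_function U \<psi>"
  shows "test_function U (weak_factor u z \<psi>)"
proof -
  have "compact (closure {x. weak_factor u z \<psi> x \<noteq> 0})"
    using assms(2) support_weak_factor[of u z \<psi>] unfolding test_function_def
    by (metis bounded_subset closed_closure compact_eq_bounded_closed)
  then show ?thesis
    using assms support_weak_factor[of u z \<psi>] elementary_smooth[OF elementary_weak_factor[OF assms(1)]]
    unfolding test_function_def by blast
qed

text \<open>Moving the mollifier along the line differentiates only \<open>\<psi>\<close>, so each
  factor \<open>d/dt - z\<close> becomes \<open>weak_factor\<close>, the formal transpose of
  \<open>\<partial>_u - z\<close>. Thus a weak equation for a merely continuous \<open>f\<close>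
  turns into a classical one.\<close>

lemma mollified_ode:
  fixes f :: "'a::euclidean_space \<Rightarrow> complex"
  assumes f: "continuous_on UNIV f"
  shows "\<psi> \<in> elementary b \<Longrightarrow> bounded {x. \<psi> x \<noteq> 0} \<Longrightarrow>
    (\<And>t. t \<in> J \<Longrightarrow> (LINT y|lborel. f y * fold (weak_factor u) zs \<psi> (y - (x + t *\<^sub>R u))) = 0) \<Longrightarrow>
    ode zs (\<lambda>t. LINT y|lborel. f y * \<psi> (y - (x + t *\<^sub>R u))) J"
proof (induction zs arbitrary: \<psi>)
  case (Cons z zs)
  note el = \<open>\<psi> \<in> elementary b\<close>
  let ?g = "\<lambda>t. LINT y|lborel. f y * \<psi> (y - (x + t *\<^sub>R u))"
  let ?g' = "\<lambda>t. LINT y|lborel. f y * (- dir_deriv u \<psi> (y - (x + t *\<^sub>R u)))"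
  have d: "(?g has_vector_derivative ?g' t) (at t)" for t
    by (rule convolution_line_deriv[OF f elementary_differentiable[OF el]
       elementary_continuous[OF elementary_dir_deriv[OF el]] Cons.prems(2)])
  have bd: "bounded {x. dir_deriv u \<psi> x \<noteq> 0}"
    using bounded_closure[OF Cons.prems(2)] support_dir_deriv[of u \<psi>] closure_subset
    by (metis (no_types, lifting) bounded_subset order_trans)
  have int: "integrable lborel (\<lambda>y. f y * \<eta> (y - c))"
    if "\<eta> \<in> elementary b" "bounded {x. \<eta> x \<noteq> 0}" for \<eta> c
  proof (rule bounded_support_integrable)
    show "continuous_on UNIV (\<lambda>y. f y * \<eta> (y - c))"
      by (intro continuous_on_mult f elementary_continuous[OF elementary_shift[OF that(1)]])
    have "{y. f y * \<eta> (y - c) \<noteq> 0} \<subseteq> (+) c ` {x. \<eta> x \<noteq> 0}"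
    proof
      fix y assume "y \<in> {y. f y * \<eta> (y - c) \<noteq> 0}"
      then show "y \<in> (+) c ` {x. \<eta> x \<noteq> 0}" by (intro image_eqI[of _ _ "y - c"]) auto
    qed
    then show "bounded {y. f y * \<eta> (y - c) \<noteq> 0}"
      using bounded_translation[OF that(2), of c] bounded_subset by blast
  qed
  have e: "?g' t - z * ?g t = (LINT y|lborel. f y * weak_factor u z \<psi> (y - (x + t *\<^sub>R u)))" for t
  proof -
    have "(LINT y|lborel. f y * weak_factor u z \<psi> (y - (x + t *\<^sub>R u))) =
      (LINT y|lborel. f y * (- dir_deriv u \<psi> (y - (x + t *\<^sub>R u))) - z * (f y * \<psi> (y - (x + t *\<^sub>R u))))"
      by (intro Bochner_Integration.integral_cong) (auto simp: weak_factor_def algebra_simps)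
    also have "\<dots> = ?g' t - (LINT y|lborel. z * (f y * \<psi> (y - (x + t *\<^sub>R u))))"
      using int[OF elementary_dir_deriv[OF el] bd] int[OF el Cons.prems(2)]
      by (intro Bochner_Integration.integral_diff) auto
    finally show ?thesis by simp
  qed
  have "ode zs (\<lambda>t. LINT y|lborel. f y * weak_factor u z \<psi> (y - (x + t *\<^sub>R u))) J"
  proof (rule Cons.IH[OF elementary_weak_factor[OF el]])
    show "bounded {x. weak_factor u z \<psi> x \<noteq> 0}"
      using bounded_closure[OF Cons.prems(2)] support_weak_factor[of u z \<psi>] closure_subset
      by (metis (no_types, lifting) bounded_subset order_trans)
  qed (use Cons.prems(3) in auto)
  then show ?case using d e by (auto intro!: exI[of _ ?g'])
qed auto

text \<open>The nodes and coefficient functions depend only on \<open>J\<close> and the eigenvalues,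
  not on \<open>f\<close>, the line or the mollifier. The interpolation formula thus holds for all
  mollifications of \<open>f\<close> with the same data, and hence for \<open>f\<close>.\<close>

lemma weak_ode_interpolation:
  fixes J :: "real set"
  assumes J: "open J" "convex J"
  shows "\<exists>T \<kappa>. finite T \<and> T \<subseteq> J \<and> (\<forall>s\<in>T. \<kappa> s \<in> EP) \<and>
    (\<forall>(f :: 'a::euclidean_space \<Rightarrow> complex) U u x \<epsilon>. continuous_on UNIV f \<longrightarrow>
      (\<forall>\<psi>\<in>elementary True. test_function U \<psi> \<longrightarrow> (LINT y|lborel. f y * fold (weak_factor u) zs \<psi> y) = 0) \<longrightarrow>
      \<epsilon> > 0 \<longrightarrow> (\<forall>t\<in>J. ball (x + t *\<^sub>R u) \<epsilon> \<subseteq> U) \<longrightarrow>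
      (\<forall>t\<in>J. f (x + t *\<^sub>R u) = (\<Sum>s\<in>T. f (x + s *\<^sub>R u) * \<kappa> s t)))"
proof -
  let ?B = "expo_family (length zs) (set zs)"
  have fB: "finite ?B" unfolding expo_family_def by auto
  have BEP: "?B \<subseteq> EP" unfolding expo_family_def using expo_monomial_EP by auto
  from interpolation[OF fB, of J] obtain T \<kappa> where TT: "finite T \<and> T \<subseteq> J \<and>
    (\<forall>s\<in>T. \<kappa> s \<in> cfun.span ?B \<and> (\<forall>s'\<in>T. \<kappa> s s' = (if s = s' then 1 else 0))) \<and>
    (\<forall>g\<in>cfun.span ?B. \<forall>x\<in>J. g x = (\<Sum>s\<in>T. g s * \<kappa> s x))" by (elim exE)
  then have T: "finite T" "T \<subseteq> J" "\<And>s. s \<in> T \<Longrightarrow> \<kappa> s \<in> cfun.span ?B"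
    "\<And>g x. g \<in> cfun.span ?B \<Longrightarrow> x \<in> J \<Longrightarrow> g x = (\<Sum>s\<in>T. g s * \<kappa> s x)" by simp_all
  have main: "f (x + t *\<^sub>R u) = (\<Sum>s\<in>T. f (x + s *\<^sub>R u) * \<kappa> s t)"
    if f: "continuous_on UNIV f"
      and w: "\<And>\<psi>. \<psi> \<in> elementary True \<Longrightarrow> test_function U \<psi> \<Longrightarrow> (LINT y|lborel. f y * fold (weak_factor u) zs \<psi> y) = 0"
      and e: "\<epsilon> > 0" and b: "\<And>t. t \<in> J \<Longrightarrow> ball (x + t *\<^sub>R u) \<epsilon> \<subseteq> U" and t: "t \<in> J"
    for f :: "'a \<Rightarrow> complex" and U u x \<epsilon> t
  proof -
    \<comment> \<open>The interpolation error along the line displaced by \<open>v\<close>. Its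
      integral against \<open>\<psi>\<close> is the error for the mollified function, which is zero;
      the claim is \<open>h 0 = 0\<close>.\<close>
    define h where "h = (\<lambda>v. f (x + t *\<^sub>R u + v) - (\<Sum>s\<in>T. f (x + s *\<^sub>R u + v) * \<kappa> s t))"
    have cf: "continuous_on S (\<lambda>v. f (c + v))" for c S
      by (intro continuous_on_compose2[OF f] continuous_intros) auto
    have ch: "continuous_on UNIV h" unfolding h_def by (intro continuous_intros cf)
    have "h 0 = 0"
    proof (rule vanishing_by_test_functions[OF ch, of "ball 0 \<epsilon>"])
      fix \<psi> :: "'a \<Rightarrow> complex" assume el: "\<psi> \<in> elementary True" and tf: "test_function (ball 0 \<epsilon>) \<psi>"
      let ?g = "\<lambda>t. LINT y|lborel. f y * \<psi> (y - (x + t *\<^sub>R u))"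
      have sh: "?g t = (LINT v|lborel. f (x + t *\<^sub>R u + v) * \<psi> v)" for t
        using lborel_integral_shift[of "\<lambda>y. f y * \<psi> (y - (x + t *\<^sub>R u))" "x + t *\<^sub>R u"] by simp
      have wfs: "fold (weak_factor u) zs (\<lambda>y. \<psi> (y - c)) = (\<lambda>y. fold (weak_factor u) zs \<psi> (y - c))" for \<psi> c
        by (induction zs arbitrary: \<psi>) (simp_all add: weak_factor_def dir_deriv_shift)
      have "ode zs ?g J"
      proof (rule mollified_ode[OF f el test_function_bounded[OF tf]])
        fix r assume r: "r \<in> J"
        let ?c = "x + r *\<^sub>R u"
        have cl: "closure {y. \<psi> (y - ?c) \<noteq> 0} = (+) ?c ` closure {y. \<psi> y \<noteq> 0}"
        proof -
          have "{y. \<psi> (y - ?c) \<noteq> 0} = (+) ?c ` {y. \<psi> y \<noteq> 0}"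
          proof (intro set_eqI iffI)
            fix y assume "y \<in> {y. \<psi> (y - ?c) \<noteq> 0}"
            then show "y \<in> (+) ?c ` {y. \<psi> y \<noteq> 0}" by (intro image_eqI[of _ _ "y - ?c"]) auto
          qed auto
          then show ?thesis by (simp only: closure_translation)
        qed
        have "test_function U (\<lambda>y. \<psi> (y - ?c))"
          unfolding test_function_def cl
        proof (intro conjI)
          show "smooth (\<lambda>y. \<psi> (y - ?c))" by (rule elementary_smooth[OF elementary_shift[OF el]])
          show "compact ((+) ?c ` closure {y. \<psi> y \<noteq> 0})"
            using tf by (intro compact_translation) (auto simp: test_function_def)
          have "(+) ?c ` closure {y. \<psi> y \<noteq> 0} \<subseteq> (+) ?c ` ball 0 \<epsilon>"
            using tf by (intro image_mono) (simp add: test_function_def)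
          also have "\<dots> \<subseteq> ball ?c \<epsilon>" by (auto simp: dist_norm)
          finally show "(+) ?c ` closure {y. \<psi> y \<noteq> 0} \<subseteq> U" using b[OF r] by blast
        qed
        from w[OF elementary_shift[OF el] this] show "(LINT y|lborel. f y * fold (weak_factor u) zs \<psi> (y - ?c)) = 0"
          by (simp only: wfs)
      qed
      then obtain g where g: "g \<in> cfun.span ?B" "\<And>t. t \<in> J \<Longrightarrow> ?g t = g t" using ode_span[OF J] by blast
      have gt: "?g t = (\<Sum>s\<in>T. ?g s * \<kappa> s t)"
        using T(4)[OF g(1) t] g(2) t T(2) by (simp add: subset_iff)
      have int: "integrable lborel (\<lambda>v. f (c + v) * \<psi> v)" for c
      proof (rule bounded_support_integrable)
        show "continuous_on UNIV (\<lambda>v. f (c + v) * \<psi> v)"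
          by (intro continuous_on_mult cf elementary_continuous[OF el])
        show "bounded {v. f (c + v) * \<psi> v \<noteq> 0}"
          by (rule bounded_subset[OF test_function_bounded[OF tf]]) auto
      qed
      have "(LINT v|lborel. h v * \<psi> v) = (LINT v|lborel. f (x + t *\<^sub>R u + v) * \<psi> v -
          (\<Sum>s\<in>T. \<kappa> s t * (f (x + s *\<^sub>R u + v) * \<psi> v)))"
        by (intro Bochner_Integration.integral_cong) (auto simp: h_def sum_distrib_left algebra_simps)
      also have "\<dots> = (LINT v|lborel. f (x + t *\<^sub>R u + v) * \<psi> v) - (\<Sum>s\<in>T. \<kappa> s t * (LINT v|lborel. f (x + s *\<^sub>R u + v) * \<psi> v))"
        using int by (subst Bochner_Integration.integral_diff) (auto simp: Bochner_Integration.integral_sum)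
      also have "\<dots> = 0" using gt by (simp add: sh mult.commute)
      finally show "(LINT v|lborel. h v * \<psi> v) = 0" .
    qed (use e in auto)
    then show ?thesis by (simp add: h_def)
  qed
  have "\<forall>s\<in>T. \<kappa> s \<in> EP" using T(3) cspan_EP[OF BEP] by blast
  then show ?thesis using T(1,2) main by (intro exI[of _ T] exI[of _ \<kappa>]) blast
qed

section \<open>Elementary symmetric invariants\<close>

definition esym :: "nat \<Rightarrow> 'b::comm_ring_1 list \<Rightarrow> 'b" where
  "esym i xs = sum_list (map prod_list (filter (\<lambda>S. length S = i) (subseqs xs)))"

lemma filter_length_Suc: "filter (\<lambda>S. length S = Suc i) (map ((#) x) Ss) = map ((#) x) (filter (\<lambda>S. length S = i) Ss)"
  by (induction Ss) auto

lemma filter_length_0: "filter (\<lambda>S. length S = 0) (map ((#) x) Ss) = []"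
  by (induction Ss) auto

lemma sum_list_prod_Cons: "sum_list (map (prod_list \<circ> (#) x) Ss) = (x::'b::comm_ring_1) * sum_list (map prod_list Ss)"
  by (induction Ss) (auto simp: algebra_simps)

text \<open>Vieta's formula. In the generating product the order of the list visibly does not
  matter, which is hard to see from the sum over subsequences.\<close>

lemma coeff_prod_esym: "coeff (prod_list (map (\<lambda>x. [:1, x:]) xs)) i = esym i xs"
proof (induction xs arbitrary: i)
  case Nil
  show ?case by (cases i) (auto simp: esym_def)
next
  case (Cons x xs)
  show ?case
  proof (cases i)
    case 0
    then show ?thesis using Cons[of 0] by (simp add: esym_def Let_def filter_length_0 del: length_0_conv)
  next
    case (Suc j)
    then show ?thesis using Cons[of i] Cons[of j]
      by (simp add: esym_def Let_def filter_length_Suc sum_list_prod_Cons)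
  qed
qed

lemma esym_permute: "mset xs = mset ys \<Longrightarrow> esym i xs = esym i ys"
  unfolding coeff_prod_esym[symmetric]
  by (metis mset_map prod_mset_prod_list)

lemma subseqs_map: "subseqs (map f xs) = map (map f) (subseqs xs)"
  by (induction xs) (auto simp: Let_def)

lemma subseqs_length_le: "S \<in> set (subseqs xs) \<Longrightarrow> length S \<le> length xs"
  by (induction xs arbitrary: S) (auto simp: Let_def le_SucI)

definition minus_deriv :: "'a::euclidean_space \<Rightarrow> ('a \<Rightarrow> complex) \<Rightarrow> 'a \<Rightarrow> complex" where
  "minus_deriv u \<psi> = (\<lambda>x. - dir_deriv u \<psi> x)"

lemma elementary_minus_deriv: "\<psi> \<in> elementary b \<Longrightarrow> minus_deriv u \<psi> \<in> elementary b"
  unfolding minus_deriv_def using elementary_cmult[OF elementary_dir_deriv, of \<psi> b "-1"] by simp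

lemma elementary_minus_deriv_pow: "\<psi> \<in> elementary b \<Longrightarrow> (minus_deriv u ^^ m) \<psi> \<in> elementary b"
  by (induction m) (auto intro: elementary_minus_deriv)

lemma dir_deriv_linear_comb:
  fixes f g :: "'a::euclidean_space \<Rightarrow> complex"
  assumes "f \<in> elementary b" "g \<in> elementary b"
  shows "dir_deriv u (\<lambda>x. c * f x + d * g x) = (\<lambda>x. c * dir_deriv u f x + d * dir_deriv u g x)"
  using assms[THEN elementary_differentiable] by (auto simp: dir_deriv_add dir_deriv_cmult)

lemma minus_deriv_pow_linear:
  assumes "f \<in> elementary b" "g \<in> elementary b"
  shows "(minus_deriv u ^^ m) (\<lambda>x. c * f x + d * g x) =
    (\<lambda>x. c * (minus_deriv u ^^ m) f x + d * (minus_deriv u ^^ m) g x)"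
proof (induction m)
  case (Suc m)
  show ?case
    by (simp add: Suc, simp add: minus_deriv_def[of u "\<lambda>x. c * _ x + d * _ x"]
        dir_deriv_linear_comb[OF elementary_minus_deriv_pow[OF assms(1)] elementary_minus_deriv_pow[OF assms(2)]])
       (simp add: minus_deriv_def algebra_simps)
qed simp

lemma foldr_dir_deriv_linear:
  assumes "f \<in> elementary b" "g \<in> elementary b"
  shows "foldr dir_deriv S (\<lambda>x. c * f x + d * g x) =
    (\<lambda>x. c * foldr dir_deriv S f x + d * foldr dir_deriv S g x)"
  by (induction S) (auto simp: dir_deriv_linear_comb[OF elementary_foldr_dir_deriv[OF assms(1)] elementary_foldr_dir_deriv[OF assms(2)]])

lemma minus_deriv_pow_dir_deriv:
  "f \<in> elementary b \<Longrightarrow> (minus_deriv u ^^ m) (dir_deriv v f) = dir_deriv v ((minus_deriv u ^^ m) f)"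
proof (induction m)
  case (Suc m)
  let ?g = "(minus_deriv u ^^ m) f"
  have g: "?g \<in> elementary b" using Suc.prems by (rule elementary_minus_deriv_pow)
  have "minus_deriv u (dir_deriv v ?g) = dir_deriv v (minus_deriv u ?g)"
  proof
    fix x
    have "dir_deriv v (\<lambda>x. - dir_deriv u ?g x) x = - dir_deriv v (dir_deriv u ?g) x"
      using dir_deriv_cmult[OF elementary_differentiable[OF elementary_dir_deriv[OF g, of u], of x], where c = "-1" and u = v]
      by simp
    then show "minus_deriv u (dir_deriv v ?g) x = dir_deriv v (minus_deriv u ?g) x"
      using elementary_dir_deriv_commute[OF g, of u v] by (simp add: minus_deriv_def)
  qed
  then show ?case using Suc by simp
qed simp

lemma foldr_dir_deriv_commute:
  "f \<in> elementary b \<Longrightarrow> foldr dir_deriv S (dir_deriv v f) = dir_deriv v (foldr dir_deriv S f)"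
proof (induction S)
  case (Cons u S)
  then show ?case using elementary_dir_deriv_commute[OF elementary_foldr_dir_deriv[OF Cons.prems], of u v] by simp
qed simp

lemma weak_factor_expand:
  "\<psi> \<in> elementary b \<Longrightarrow> fold (weak_factor u) zs \<psi> x =
    (\<Sum>S\<leftarrow>subseqs zs. (-1) ^ length S * prod_list S * (minus_deriv u ^^ (length zs - length S)) \<psi> x)"
proof (induction zs arbitrary: \<psi>)
  case (Cons z zs)
  let ?M = "\<lambda>m. (minus_deriv u ^^ m) \<psi> x"
  have eq: "(minus_deriv u ^^ m) (weak_factor u z \<psi>) x = ?M (Suc m) - z * ?M m" for m
  proof -
    have "weak_factor u z \<psi> = (\<lambda>x. 1 * minus_deriv u \<psi> x + (- z) * \<psi> x)"
      by (simp add: weak_factor_def minus_deriv_def)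
    then show ?thesis
      using minus_deriv_pow_linear[OF elementary_minus_deriv[OF Cons.prems] Cons.prems, where u = u and m = m and c = 1 and d = "- z"]
      by (simp add: funpow_swap1)
  qed
  have "fold (weak_factor u) (z # zs) \<psi> x =
    (\<Sum>S\<leftarrow>subseqs zs. (-1) ^ length S * prod_list S * (?M (Suc (length zs - length S)) - z * ?M (length zs - length S)))"
    using Cons.IH[OF elementary_weak_factor[OF Cons.prems, of u z]] by (simp add: eq)
  also have "\<dots> = (\<Sum>S\<leftarrow>subseqs zs. (-1) ^ length S * prod_list S * ?M (Suc (length zs) - length S)) +
     (\<Sum>S\<leftarrow>map ((#) z) (subseqs zs). (-1) ^ length S * prod_list S * ?M (Suc (length zs) - length S))"
    unfolding map_map sum_list_addf[symmetric]
    by (intro arg_cong[where f = sum_list] map_cong)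
       (auto simp: algebra_simps Suc_diff_le subseqs_length_le)
  finally show ?case by (simp add: Let_def add.commute)
qed simp

text \<open>The transpose of \<open>\<partial>_u - \<partial>_v\<close>. The coefficients 1 are
  written out to match the linearity lemmas for combinations
  \<open>c * f x + d * g x\<close>.\<close>

definition op_factor :: "'a::euclidean_space \<Rightarrow> 'a \<Rightarrow> ('a \<Rightarrow> complex) \<Rightarrow> 'a \<Rightarrow> complex" where
  "op_factor u v \<psi> = (\<lambda>x. 1 * minus_deriv u \<psi> x + 1 * dir_deriv v \<psi> x)"

lemma elementary_op_factor: "\<psi> \<in> elementary b \<Longrightarrow> op_factor u v \<psi> \<in> elementary b"
  unfolding op_factor_def
  by (intro elementary.add elementary_cmult elementary_minus_deriv elementary_dir_deriv)

lemma op_factor_expand: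
  "\<psi> \<in> elementary b \<Longrightarrow> fold (op_factor u) vs \<psi> x =
    (\<Sum>S\<leftarrow>subseqs vs. foldr dir_deriv S ((minus_deriv u ^^ (length vs - length S)) \<psi>) x)"
proof (induction vs arbitrary: \<psi>)
  case (Cons v vs)
  let ?M = "\<lambda>m. (minus_deriv u ^^ m) \<psi>"
  have eq: "foldr dir_deriv S ((minus_deriv u ^^ m) (op_factor u v \<psi>)) x =
     foldr dir_deriv S (?M (Suc m)) x + foldr dir_deriv (v # S) (?M m) x" for m S
  proof -
    have "(minus_deriv u ^^ m) (op_factor u v \<psi>) = (\<lambda>x. 1 * ?M (Suc m) x + 1 * dir_deriv v (?M m) x)"
      unfolding op_factor_def
      by (subst minus_deriv_pow_linear[OF elementary_minus_deriv[OF Cons.prems] elementary_dir_deriv[OF Cons.prems]])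
         (simp add: minus_deriv_pow_dir_deriv[OF Cons.prems] funpow_swap1)
    then show ?thesis
      using foldr_dir_deriv_linear[OF elementary_minus_deriv_pow[OF Cons.prems, of "Suc m" u]
            elementary_dir_deriv[OF elementary_minus_deriv_pow[OF Cons.prems, of m u], of v], where S = S and c = 1 and d = 1]
        foldr_dir_deriv_commute[OF elementary_minus_deriv_pow[OF Cons.prems, of m u], of S v]
      by simp
  qed
  have "fold (op_factor u) (v # vs) \<psi> x =
    (\<Sum>S\<leftarrow>subseqs vs. foldr dir_deriv S (?M (Suc (length vs - length S))) x + foldr dir_deriv (v # S) (?M (length vs - length S)) x)"
    using Cons.IH[OF elementary_op_factor[OF Cons.prems, of u v]] by (simp add: eq)
  also have "\<dots> = (\<Sum>S\<leftarrow>subseqs vs. foldr dir_deriv S (?M (Suc (length vs) - length S)) x) +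
     (\<Sum>S\<leftarrow>map ((#) v) (subseqs vs). foldr dir_deriv S (?M (Suc (length vs) - length S)) x)"
    unfolding map_map sum_list_addf[symmetric]
    by (intro arg_cong[where f = sum_list] map_cong) (auto simp: Suc_diff_le subseqs_length_le)
  finally show ?case by (simp add: Let_def add.commute)
qed simp

lemma op_factor_zero: "op_factor u v (\<lambda>x. 0) = (\<lambda>x. 0)"
  by (simp add: op_factor_def minus_deriv_def)

lemma op_factor_same: "op_factor u u \<psi> = (\<lambda>x. 0)"
  by (simp add: op_factor_def minus_deriv_def)

lemma op_factor_vanish: "u \<in> set vs \<Longrightarrow> fold (op_factor u) vs \<psi> = (\<lambda>x. 0)"
proof (induction vs arbitrary: \<psi>)
  case (Cons v vs)
  have z: "fold (op_factor u) vs (\<lambda>x. 0) = (\<lambda>x. 0)" by (induction vs) (auto simp: op_factor_zero)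
  show ?case
  proof (cases "v = u")
    case True then show ?thesis using z by (simp add: op_factor_same)
  next
    case False then show ?thesis using Cons by simp
  qed
qed simp

lemma sum_list_by_length:
  fixes g :: "'b list \<Rightarrow> 'c::comm_monoid_add"
  assumes "\<And>S. S \<in> set Ss \<Longrightarrow> length S \<le> N"
  shows "(\<Sum>S\<leftarrow>Ss. g S) = (\<Sum>i\<le>N. \<Sum>S\<leftarrow>filter (\<lambda>S. length S = i) Ss. g S)"
  using assms
proof (induction Ss)
  case (Cons S Ss)
  have "(\<Sum>i\<le>N. \<Sum>S\<leftarrow>filter (\<lambda>S. length S = i) (S # Ss). g S) =
    (\<Sum>i\<le>N. (if i = length S then g S else 0) + (\<Sum>S\<leftarrow>filter (\<lambda>S. length S = i) Ss. g S))"
    by (intro sum.cong) auto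
  also have "\<dots> = g S + (\<Sum>i\<le>N. \<Sum>S\<leftarrow>filter (\<lambda>S. length S = i) Ss. g S)"
    using Cons.prems by (simp add: sum.distrib)
  finally show ?case using Cons by simp
qed simp

definition sym_esym :: "nat \<Rightarrow> 'a list \<Rightarrow> 'a sym" where
  "sym_esym i vs = map (\<lambda>S. (1, S)) (filter (\<lambda>S. length S = i) (subseqs vs))"

lemma filter_length_map: "filter (\<lambda>S. length S = i) (map (map f) Ss) = map (map f) (filter (\<lambda>S. length S = i) Ss)"
  by (induction Ss) auto

lemma sym_eval_sym_esym: "sym_eval (sym_esym i vs) (\<xi> :: 'a \<Rightarrow> 'b::{comm_ring_1,real_algebra_1}) = esym i (map \<xi> vs)"
  by (simp add: sym_eval_def sym_esym_def esym_def subseqs_map filter_length_map o_def split_def)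

lemma weak_factor_expand_esym:
  assumes "\<psi> \<in> elementary b"
  shows "fold (weak_factor u) (map \<xi> vs) \<psi> x =
    (\<Sum>i\<le>length vs. (-1) ^ i * (sym_eval (sym_esym i vs) \<xi> * (minus_deriv u ^^ (length vs - i)) \<psi> x))"
proof -
  have "fold (weak_factor u) (map \<xi> vs) \<psi> x = (\<Sum>i\<le>length vs. \<Sum>S\<leftarrow>filter (\<lambda>S. length S = i) (subseqs (map \<xi> vs)).
     (-1) ^ length S * prod_list S * (minus_deriv u ^^ (length vs - length S)) \<psi> x)"
    unfolding weak_factor_expand[OF assms]
    by (subst sum_list_by_length[where N = "length vs"]) (auto dest: subseqs_length_le)
  also have "\<dots> = (\<Sum>i\<le>length vs. (-1) ^ i * (esym i (map \<xi> vs) * (minus_deriv u ^^ (length vs - i)) \<psi> x))"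
  proof (intro sum.cong refl)
    fix i
    have "(\<Sum>S\<leftarrow>filter (\<lambda>S. length S = i) Ss. (-1) ^ length S * prod_list S * (minus_deriv u ^^ (length vs - length S)) \<psi> x) =
      (-1) ^ i * (sum_list (map prod_list (filter (\<lambda>S. length S = i) Ss)) * (minus_deriv u ^^ (length vs - i)) \<psi> x)" for Ss
      by (induction Ss) (auto simp: algebra_simps)
    then show "(\<Sum>S\<leftarrow>filter (\<lambda>S. length S = i) (subseqs (map \<xi> vs)).
      (-1) ^ length S * prod_list S * (minus_deriv u ^^ (length vs - length S)) \<psi> x) =
      (-1) ^ i * (esym i (map \<xi> vs) * (minus_deriv u ^^ (length vs - i)) \<psi> x)" by (simp add: esym_def)
  qed
  finally show ?thesis by (simp add: sym_eval_sym_esym)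
qed

lemma op_factor_expand_esym:
  assumes "\<psi> \<in> elementary b"
  shows "fold (op_factor u) vs \<psi> x =
    (\<Sum>i\<le>length vs. (-1) ^ i * transpose_op (sym_esym i vs) ((minus_deriv u ^^ (length vs - i)) \<psi>) x)"
proof -
  have "fold (op_factor u) vs \<psi> x = (\<Sum>i\<le>length vs. \<Sum>S\<leftarrow>filter (\<lambda>S. length S = i) (subseqs vs).
     foldr dir_deriv S ((minus_deriv u ^^ (length vs - length S)) \<psi>) x)"
    unfolding op_factor_expand[OF assms]
    by (subst sum_list_by_length[where N = "length vs"]) (auto dest: subseqs_length_le)
  also have "\<dots> = (\<Sum>i\<le>length vs. (-1) ^ i * transpose_op (sym_esym i vs) ((minus_deriv u ^^ (length vs - i)) \<psi>) x)"
  proof (intro sum.cong refl)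
    fix i
    have "(\<Sum>S\<leftarrow>filter (\<lambda>S. length S = i) Ss. foldr dir_deriv S ((minus_deriv u ^^ (length vs - length S)) \<psi>) x) =
      (-1) ^ i * (\<Sum>(c, us)\<leftarrow>map (\<lambda>S. (1, S)) (filter (\<lambda>S. length S = i) Ss).
        ((-1) ^ length us * c) *\<^sub>R foldr dir_deriv us ((minus_deriv u ^^ (length vs - i)) \<psi>) x)" for Ss
    proof (induction Ss)
      case (Cons S Ss)
      have "(-1) ^ i * (((-1) ^ i) *\<^sub>R z) = (z::complex)" for z
        by (simp add: scaleR_conv_of_real flip: mult.assoc power_mult_distrib)
      then show ?case using Cons by (auto simp: distrib_left)
    qed simp
    then show "(\<Sum>S\<leftarrow>filter (\<lambda>S. length S = i) (subseqs vs). foldr dir_deriv S ((minus_deriv u ^^ (length vs - length S)) \<psi>) x) =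
      (-1) ^ i * transpose_op (sym_esym i vs) ((minus_deriv u ^^ (length vs - i)) \<psi>) x"
      by (simp add: transpose_op_def sym_esym_def)
  qed
  finally show ?thesis .
qed

lemma test_function_foldr_dir_deriv: "test_function U \<psi> \<Longrightarrow> test_function U (foldr dir_deriv us \<psi>)"
  by (induction us) (auto intro: test_function_dir_deriv)

lemma test_function_minus_deriv_pow: "test_function U \<psi> \<Longrightarrow> \<psi> \<in> elementary b \<Longrightarrow> test_function U ((minus_deriv u ^^ m) \<psi>)"
proof (induction m)
  case (Suc m)
  let ?g = "(minus_deriv u ^^ m) \<psi>"
  have "minus_deriv u ?g = weak_factor u 0 ?g" by (simp add: minus_deriv_def weak_factor_def)
  then show ?case
    using test_function_weak_factor[OF elementary_minus_deriv_pow[OF Suc.prems(2), of m u] Suc.IH[OF Suc.prems], of u 0]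
    by (simp only: funpow.simps comp_apply)
qed simp

lemma transpose_op_integrable:
  assumes U: "open U" and f: "continuous_on U f" and \<psi>: "test_function U \<psi>"
  shows "integrable lborel (\<lambda>x. f x * transpose_op p \<psi> x)"
proof (induction p)
  case Nil show ?case by (simp add: transpose_op_def)
next
  case (Cons t p)
  obtain c us where t: "t = (c, us)" by force
  have "(\<lambda>x. f x * transpose_op (t # p) \<psi> x) =
    (\<lambda>x. ((-1) ^ length us * c) *\<^sub>R (f x * foldr dir_deriv us \<psi> x) + f x * transpose_op p \<psi> x)"
    by (auto simp: t transpose_op_def algebra_simps)
  then show ?case
    using Cons test_product_integrable[OF U f test_function_foldr_dir_deriv[OF \<psi>]] by simp
qed

text \<open>An argument of Cayley-Hamilton type. The product of
  \<open>\<partial>_u - \<partial>_v\<close> over the list is zero because \<open>u\<close> occurs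
  in it. Its coefficients are the elementary symmetric functions of the list, which act on
  \<open>f\<close> as scalars, so the product also equals that of the factors
  \<open>\<partial>_u - \<xi>(v)\<close> on \<open>f\<close>.\<close>

lemma weak_ode_of_invariants:
  assumes U: "open U" and f: "continuous_on U f" and u: "u \<in> set vs"
    and w: "\<And>i. weak_eigenfunction U (sym_esym i vs) (sym_eval (sym_esym i vs) \<xi>) f"
    and el: "\<psi> \<in> elementary b" and \<psi>: "test_function U \<psi>"
  shows "(LINT x|lborel. f x * fold (weak_factor u) (map \<xi> vs) \<psi> x) = 0"
proof -
  let ?N = "length vs"
  let ?M = "\<lambda>i. (minus_deriv u ^^ (?N - i)) \<psi>"
  have t: "test_function U (?M i)" for i using test_function_minus_deriv_pow[OF \<psi> el] .
  have "(LINT x|lborel. f x * fold (weak_factor u) (map \<xi> vs) \<psi> x) =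
    (LINT x|lborel. (\<Sum>i\<le>?N. ((-1) ^ i * sym_eval (sym_esym i vs) \<xi>) * (f x * ?M i x)))"
    by (intro Bochner_Integration.integral_cong) (auto simp: weak_factor_expand_esym[OF el] sum_distrib_left algebra_simps)
  also have "\<dots> = (\<Sum>i\<le>?N. ((-1) ^ i * sym_eval (sym_esym i vs) \<xi>) * (LINT x|lborel. f x * ?M i x))"
    using test_product_integrable[OF U f t] by (subst Bochner_Integration.integral_sum) auto
  \<comment> \<open>The eigenvalue equations enter here: each scalar is traded for the operator it
    is the eigenvalue of.\<close>
  also have "\<dots> = (\<Sum>i\<le>?N. (-1) ^ i * (LINT x|lborel. f x * transpose_op (sym_esym i vs) (?M i) x))"
    using w t unfolding weak_eigenfunction_def by (intro sum.cong) auto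
  also have "\<dots> = (LINT x|lborel. (\<Sum>i\<le>?N. (-1) ^ i * (f x * transpose_op (sym_esym i vs) (?M i) x)))"
    using transpose_op_integrable[OF U f t] by (subst Bochner_Integration.integral_sum) auto
  also have "\<dots> = (LINT x|lborel. f x * fold (op_factor u) vs \<psi> x)"
    by (intro Bochner_Integration.integral_cong) (auto simp: op_factor_expand_esym[OF el] sum_distrib_left algebra_simps)
  also have "\<dots> = 0" by (simp add: op_factor_vanish[OF u])
  finally show ?thesis .
qed

context affine_root_system
begin

definition W0_list :: "('a \<Rightarrow> 'a) list" where "W0_list = (SOME L. set L = W0 \<and> distinct L)"

lemma W0_list: "set W0_list = W0" "distinct W0_list"
  using someI_ex[OF finite_distinct_list[OF finite_W0]] unfolding W0_list_def by auto

text \<open>Indexed by the group, hence with repetitions when \<open>u\<close> has a stabilizer.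
  What matters is that \<open>u\<close> occurs and that the group permutes the list.\<close>

definition orbit_list :: "'a \<Rightarrow> 'a list" where "orbit_list u = map (\<lambda>w. w u) W0_list"

lemma esym_invariant: "sym_invariant R (sym_esym i (orbit_list u))"
  unfolding sym_invariant_def sym_eval_sym_esym
proof (intro ballI allI)
  fix w \<xi> assume w: "w \<in> W0"
  let ?h = "\<lambda>\<sigma>. inv w \<circ> \<sigma>"
  have "bij_betw ?h W0 W0"
  proof (rule bij_betwI[where g = "\<lambda>\<sigma>. w \<circ> \<sigma>"])
    show "?h \<in> W0 \<rightarrow> W0" "(\<lambda>\<sigma>. w \<circ> \<sigma>) \<in> W0 \<rightarrow> W0" using W0_comp W0_inv(2) w by auto
  qed (use W0_inv_apply[OF w] in \<open>auto simp: fun_eq_iff\<close>)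
  then have "inj_on ?h W0" "?h ` W0 = W0" by (auto simp: bij_betw_def)
  then have "mset (map ?h W0_list) = mset W0_list"
    using W0_list by (subst set_eq_iff_mset_eq_distinct[symmetric]) (auto simp: distinct_map)
  then have "mset (map (\<lambda>\<sigma>. \<xi> \<bullet> \<sigma> u) (map ?h W0_list)) = mset (map (\<lambda>\<sigma>. \<xi> \<bullet> \<sigma> u) W0_list)"
    by (simp only: mset_map)
  then have "mset (map (\<lambda>v. w \<xi> \<bullet> v) (orbit_list u)) = mset (map (\<lambda>v. \<xi> \<bullet> v) (orbit_list u))"
    by (simp add: orbit_list_def o_def W0_adjoint[OF w])
  then show "esym i (map (\<lambda>v. w \<xi> \<bullet> v) (orbit_list u)) = esym i (map (\<lambda>v. \<xi> \<bullet> v) (orbit_list u))"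
    by (rule esym_permute)
qed

lemma orbit_list_self: "u \<in> set (orbit_list u)"
  unfolding orbit_list_def using W0_list W0_id by (auto intro!: image_eqI[of _ _ id])

definition laplace_sym :: "'a sym" where
  "laplace_sym = map (\<lambda>b. (1, [b, b])) (SOME L. set L = Basis \<and> distinct L)"

lemma sum_list_laplace:
  fixes g :: "real \<times> 'a list \<Rightarrow> 'b::comm_monoid_add"
  shows "(\<Sum>t\<leftarrow>laplace_sym. g t) = (\<Sum>b\<in>Basis. g (1, [b, b]))"
proof -
  have "set (SOME L. set L = (Basis :: 'a set) \<and> distinct L) = Basis \<and> distinct (SOME L. set L = (Basis :: 'a set) \<and> distinct L)"
    by (rule someI_ex[OF finite_distinct_list[OF finite_Basis]])
  then show ?thesis unfolding laplace_sym_def by (simp add: sum_list_distinct_conv_sum_set o_def)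
qed

lemma laplace_invariant: "sym_invariant R laplace_sym"
proof -
  have "sym_eval laplace_sym (\<lambda>v. \<xi> \<bullet> v) = \<xi> \<bullet> \<xi>" for \<xi>
    unfolding sym_eval_def sum_list_laplace by (subst euclidean_inner) simp
  then show ?thesis unfolding sym_invariant_def by (simp add: W0_inner)
qed

end

section \<open>Locally exponential-polynomial functions\<close>

text \<open>A folded solution is given by a different exponential polynomial on each alcove, so on
  the regular set only the local property is available.\<close>

definition locally_EP :: "'a::euclidean_space set \<Rightarrow> ('a \<Rightarrow> complex) \<Rightarrow> bool" where
  "locally_EP U f \<longleftrightarrow> (\<forall>x\<in>U. \<exists>N F. open N \<and> x \<in> N \<and> N \<subseteq> U \<and> F \<in> EP \<and> (\<forall>y\<in>N. f y = F y))"

lemma locally_EP_D: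
  assumes "locally_EP U f" "x \<in> U"
  obtains N F where "open N" "x \<in> N" "N \<subseteq> U" "F \<in> EP" "\<And>y. y \<in> N \<Longrightarrow> f y = F y"
proof -
  have "\<exists>N F. open N \<and> x \<in> N \<and> N \<subseteq> U \<and> F \<in> EP \<and> (\<forall>y\<in>N. f y = F y)"
    using assms unfolding locally_EP_def by (rule bspec)
  then show ?thesis
  proof (elim exE conjE)
    fix N F assume "open N" "x \<in> N" "N \<subseteq> U" "F \<in> EP" "\<forall>y\<in>N. f y = F y"
    then show ?thesis by (intro that[of N F]) auto
  qed
qed

lemma locally_EP_dir_deriv: "locally_EP U f \<Longrightarrow> locally_EP U (dir_deriv u f)"
  unfolding locally_EP_def
proof
  fix x assume l: "\<forall>x\<in>U. \<exists>N F. open N \<and> x \<in> N \<and> N \<subseteq> U \<and> F \<in> EP \<and> (\<forall>y\<in>N. f y = F y)" and x: "x \<in> U"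
  from bspec[OF l x] obtain N F where N: "open N" "x \<in> N" "N \<subseteq> U" "F \<in> EP" "\<forall>y\<in>N. f y = F y"
    by (elim exE conjE)
  have "\<forall>y\<in>N. dir_deriv u f y = dir_deriv u F y" using dir_deriv_cong[OF N(1)] N(5) by blast
  then show "\<exists>N F. open N \<and> x \<in> N \<and> N \<subseteq> U \<and> F \<in> EP \<and> (\<forall>y\<in>N. dir_deriv u f y = F y)"
    by (intro exI[of _ N] exI[of _ "dir_deriv u F"] conjI N elementary_dir_deriv[OF N(4)])
qed

lemma locally_EP_differentiable: "locally_EP U f \<Longrightarrow> x \<in> U \<Longrightarrow> f differentiable at x"
proof -
  assume a: "locally_EP U f" "x \<in> U"
  obtain N F where N: "open N" "x \<in> N" "F \<in> EP" "\<And>y. y \<in> N \<Longrightarrow> f y = F y"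
    by (rule locally_EP_D[OF a]) blast
  obtain F' where "(F has_derivative F') (at x)"
    using elementary_differentiable[OF N(3), of x] unfolding differentiable_def by blast
  then have "(f has_derivative F') (at x)"
    by (rule has_derivative_transform_within_open[OF _ N(1,2)]) (use N(4) in auto)
  then show ?thesis unfolding differentiable_def by blast
qed

lemma locally_EP_continuous: "locally_EP U f \<Longrightarrow> continuous_on U f"
  by (simp add: continuous_at_imp_continuous_on differentiable_imp_continuous_within locally_EP_differentiable)

lemma foldr_dir_deriv_cong:
  "open N \<Longrightarrow> (\<And>y. y \<in> N \<Longrightarrow> f y = F y) \<Longrightarrow> x \<in> N \<Longrightarrow> foldr dir_deriv us f x = foldr dir_deriv us F x"
proof (induction us arbitrary: x)
  case (Cons u us)
  then show ?case using dir_deriv_cong[of N x "foldr dir_deriv us f" "foldr dir_deriv us F" u] by auto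
qed simp

definition diff_op :: "'a::euclidean_space sym \<Rightarrow> ('a \<Rightarrow> complex) \<Rightarrow> 'a \<Rightarrow> complex" where
  "diff_op p f x = (\<Sum>(c, us)\<leftarrow>p. c *\<^sub>R foldr dir_deriv us f x)"

lemma diff_op_cong:
  assumes "open N" "\<And>y. y \<in> N \<Longrightarrow> f y = F y" "x \<in> N"
  shows "diff_op p f x = diff_op p F x"
  unfolding diff_op_def using foldr_dir_deriv_cong[OF assms]
  by (intro arg_cong[where f = sum_list] map_cong) auto

lemma diff_op_EP: "F \<in> EP \<Longrightarrow> diff_op p F \<in> EP"
proof (induction p)
  case Nil
  then show ?case using elementary.const[of 0 False] by (simp add: diff_op_def[abs_def])
next
  case (Cons t p)
  obtain c us where t: "t = (c, us)" by force
  have "diff_op (t # p) F = (\<lambda>x. of_real c * foldr dir_deriv us F x + diff_op p F x)"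
    by (auto simp: diff_op_def t scaleR_conv_of_real)
  then show ?case using Cons
    by (auto intro!: elementary.add elementary_cmult elementary_foldr_dir_deriv)
qed

lemma foldr_by_parts:
  assumes U: "open U" and \<psi>: "test_function U \<psi>"
  shows "locally_EP U f \<Longrightarrow> (LINT x|lborel. f x * foldr dir_deriv us \<psi> x) =
    (-1) ^ length us * (LINT x|lborel. foldr dir_deriv us f x * \<psi> x)"
proof (induction us arbitrary: f)
  case (Cons u us)
  have l: "locally_EP U (dir_deriv u f)" by (rule locally_EP_dir_deriv[OF Cons.prems])
  have "(LINT x|lborel. f x * dir_deriv u (foldr dir_deriv us \<psi>) x) =
    - (LINT x|lborel. dir_deriv u f x * foldr dir_deriv us \<psi> x)"
    by (rule integration_by_parts[OF U locally_EP_differentiable[OF Cons.prems] locally_EP_continuous[OF l]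
        test_function_foldr_dir_deriv[OF \<psi>]])
  also have "\<dots> = (-1) ^ length (u # us) * (LINT x|lborel. foldr dir_deriv us (dir_deriv u f) x * \<psi> x)"
    using Cons.IH[OF l] by simp
  also have "(LINT x|lborel. foldr dir_deriv us (dir_deriv u f) x * \<psi> x) =
     (LINT x|lborel. foldr dir_deriv (u # us) f x * \<psi> x)"
  proof (intro Bochner_Integration.integral_cong refl)
    fix x
    show "foldr dir_deriv us (dir_deriv u f) x * \<psi> x = foldr dir_deriv (u # us) f x * \<psi> x"
    proof (cases "x \<in> U")
      case True
      obtain N F where N: "open N" "x \<in> N" "F \<in> EP" "\<And>y. y \<in> N \<Longrightarrow> f y = F y"
        by (rule locally_EP_D[OF Cons.prems True]) blast
      have "foldr dir_deriv us (dir_deriv u f) x = foldr dir_deriv us (dir_deriv u F) x"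
        by (rule foldr_dir_deriv_cong[OF N(1) _ N(2)]) (rule dir_deriv_cong[OF N(1) _ N(4)])
      also have "\<dots> = foldr dir_deriv (u # us) F x" by (simp add: foldr_dir_deriv_commute[OF N(3)])
      also have "\<dots> = foldr dir_deriv (u # us) f x"
        by (rule foldr_dir_deriv_cong[OF N(1) _ N(2), symmetric]) (rule N(4))
      finally show ?thesis by simp
    next
      case False
      then show ?thesis using test_function_zero[OF \<psi>] by simp
    qed
  qed
  finally show ?case by simp
qed simp

lemma locally_EP_foldr: "locally_EP U f \<Longrightarrow> locally_EP U (foldr dir_deriv us f)"
  by (induction us) (auto intro: locally_EP_dir_deriv)

lemma transpose_op_by_parts:
  assumes U: "open U" and \<psi>: "test_function U \<psi>" and f: "locally_EP U f"
  shows "(LINT x|lborel. f x * transpose_op p \<psi> x) = (LINT x|lborel. diff_op p f x * \<psi> x) \<and>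
    integrable lborel (\<lambda>x. diff_op p f x * \<psi> x)"
proof (induction p)
  case Nil show ?case by (simp add: transpose_op_def diff_op_def)
next
  case (Cons t p)
  obtain c us where t: "t = (c, us)" by force
  note cf = locally_EP_continuous[OF f]
  have i1: "integrable lborel (\<lambda>x. f x * foldr dir_deriv us \<psi> x)"
    by (rule test_product_integrable[OF U cf test_function_foldr_dir_deriv[OF \<psi>]])
  have i2: "integrable lborel (\<lambda>x. foldr dir_deriv us f x * \<psi> x)"
    by (rule test_product_integrable[OF U locally_EP_continuous[OF locally_EP_foldr[OF f]] \<psi>])
  have "(LINT x|lborel. f x * transpose_op (t # p) \<psi> x) =
    (LINT x|lborel. ((-1) ^ length us * c) *\<^sub>R (f x * foldr dir_deriv us \<psi> x) + f x * transpose_op p \<psi> x)"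
    by (intro Bochner_Integration.integral_cong) (auto simp: t transpose_op_def algebra_simps)
  also have "\<dots> = ((-1) ^ length us * c) *\<^sub>R (LINT x|lborel. f x * foldr dir_deriv us \<psi> x) + (LINT x|lborel. diff_op p f x * \<psi> x)"
    using i1 transpose_op_integrable[OF U cf \<psi>] Cons by (subst Bochner_Integration.integral_add) auto
  also have "\<dots> = c *\<^sub>R (LINT x|lborel. foldr dir_deriv us f x * \<psi> x) + (LINT x|lborel. diff_op p f x * \<psi> x)"
    unfolding foldr_by_parts[OF U \<psi> f] by (simp add: scaleR_conv_of_real flip: mult.assoc power_mult_distrib)
  also have "\<dots> = (LINT x|lborel. c *\<^sub>R (foldr dir_deriv us f x * \<psi> x) + diff_op p f x * \<psi> x)"
    using i2 Cons by (subst Bochner_Integration.integral_add) auto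
  also have "\<dots> = (LINT x|lborel. diff_op (t # p) f x * \<psi> x)"
    by (intro Bochner_Integration.integral_cong) (auto simp: t diff_op_def algebra_simps)
  finally have 1: "(LINT x|lborel. f x * transpose_op (t # p) \<psi> x) = (LINT x|lborel. diff_op (t # p) f x * \<psi> x)" .
  have "(\<lambda>x. diff_op (t # p) f x * \<psi> x) = (\<lambda>x. c *\<^sub>R (foldr dir_deriv us f x * \<psi> x) + diff_op p f x * \<psi> x)"
    by (auto simp: t diff_op_def algebra_simps)
  then show ?case using 1 i2 Cons by simp
qed

lemma weak_eigenfunction_locally_EP:
  assumes U: "open U" and f: "locally_EP U f" and e: "\<And>x. x \<in> U \<Longrightarrow> diff_op p f x = z * f x"
  shows "weak_eigenfunction U p z f"
  unfolding weak_eigenfunction_def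
proof (intro allI impI)
  fix \<psi> assume \<psi>: "test_function U \<psi>"
  have "(LINT x|lborel. f x * transpose_op p \<psi> x) = (LINT x|lborel. z * (f x * \<psi> x))"
    unfolding transpose_op_by_parts[OF U \<psi> f, of p, THEN conjunct1]
  proof (intro Bochner_Integration.integral_cong refl)
    fix x
    show "diff_op p f x * \<psi> x = z * (f x * \<psi> x)"
      using e[of x] test_function_zero[OF \<psi>, of x] by (cases "x \<in> U") auto
  qed
  then show "(LINT x|lborel. f x * transpose_op p \<psi> x) = z * (LINT x|lborel. f x * \<psi> x)" by simp
qed

text \<open>Integration by parts moves the operator to \<open>F\<close>. The equation then holds
  pointwise on \<open>U\<close>, and everywhere by unique continuation.\<close>

lemma weak_eigenfunction_EP:
  assumes U: "open U" "p0 \<in> U" and F: "F \<in> EP" and eq: "\<And>x. x \<in> U \<Longrightarrow> f x = F x"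
    and w: "weak_eigenfunction U p z f"
  shows "diff_op p F x = z * F x"
proof -
  let ?h = "\<lambda>x. diff_op p F x - z * F x"
  have h: "?h \<in> EP" using F by (intro elementary_diff elementary_cmult diff_op_EP)
  have l: "locally_EP U F" unfolding locally_EP_def using U F by blast
  have "?h y = 0" if y: "y \<in> U" for y
  proof (rule vanishing_by_test_functions[OF elementary_continuous[OF h] U(1) y])
    fix \<psi> assume el: "\<psi> \<in> elementary True" and \<psi>: "test_function U \<psi>"
    have c: "(LINT x|lborel. f x * transpose_op q \<psi> x) = (LINT x|lborel. F x * transpose_op q \<psi> x)" for q
    proof (intro Bochner_Integration.integral_cong refl)
      fix x show "f x * transpose_op q \<psi> x = F x * transpose_op q \<psi> x"
      proof (cases "x \<in> U")
        case False
        then have "foldr dir_deriv us \<psi> x = 0" for us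
          using test_function_zero[OF test_function_foldr_dir_deriv[OF \<psi>]] by blast
        then have "transpose_op q \<psi> x = 0" unfolding transpose_op_def by (induction q) auto
        then show ?thesis by simp
      qed (simp add: eq)
    qed
    have c2: "(LINT x|lborel. f x * \<psi> x) = (LINT x|lborel. F x * \<psi> x)"
    proof (intro Bochner_Integration.integral_cong refl)
      fix x show "f x * \<psi> x = F x * \<psi> x"
        using eq[of x] test_function_zero[OF \<psi>, of x] by (cases "x \<in> U") auto
    qed
    have i: "integrable lborel (\<lambda>x. F x * \<psi> x)"
      by (rule test_product_integrable[OF U(1) elementary_continuous[OF F] \<psi>])
    have "(LINT x|lborel. diff_op p F x * \<psi> x) = z * (LINT x|lborel. F x * \<psi> x)"
    proof -
      have "(LINT x|lborel. f x * transpose_op p \<psi> x) = z * (LINT x|lborel. f x * \<psi> x)"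
        using w \<psi> unfolding weak_eigenfunction_def by blast
      then show ?thesis using transpose_op_by_parts[OF U(1) \<psi> l, of p] by (simp only: c c2)
    qed
    moreover have "(LINT x|lborel. ?h x * \<psi> x) = (LINT x|lborel. diff_op p F x * \<psi> x - z * (F x * \<psi> x))"
      by (intro Bochner_Integration.integral_cong) (auto simp: algebra_simps)
    ultimately show "(LINT x|lborel. ?h x * \<psi> x) = 0"
      using i transpose_op_by_parts[OF U(1) \<psi> l, of p] by simp
  qed
  from EP_eq_0[OF h U this, of x] show ?thesis by simp
qed

text \<open>On a cube the interpolation formula is applied in one coordinate direction after the
  other. This expresses \<open>f\<close> through finitely many of its values, with exponential
  polynomials as coefficients.\<close>

lemma EP_on_box:
  fixes f :: "'a::euclidean_space \<Rightarrow> complex"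
  assumes f: "continuous_on UNIV f" and U: "open U" "x0 \<in> U"
    and w: "\<And>u \<psi>. \<psi> \<in> elementary True \<Longrightarrow> test_function U \<psi> \<Longrightarrow>
      (LINT y|lborel. f y * fold (weak_factor u) (zs u) \<psi> y) = 0"
  shows "\<exists>F\<in>EP. \<exists>N. open N \<and> x0 \<in> N \<and> N \<subseteq> U \<and> (\<forall>x\<in>N. f x = F x)"
proof -
  obtain e where e: "e > 0" "ball x0 e \<subseteq> U" using U open_contains_ball by blast
  \<comment> \<open>By the bound of the norm by the sum of the coordinates, the cube lies within
    \<open>e / 2\<close> of \<open>x0\<close>, which leaves room for mollifiers of radius
    \<open>e / 2\<close>.\<close>
  define r where "r = e / (2 * real DIM('a))"
  have r: "r > 0" using e by (simp add: r_def)
  define Q where "Q = {x. \<forall>b\<in>Basis. \<bar>x \<bullet> b - x0 \<bullet> b\<bar> < r}"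
  have Qball: "ball x (e / 2) \<subseteq> U" if x: "x \<in> Q" for x
  proof -
    have "norm (x - x0) \<le> (\<Sum>b\<in>Basis. \<bar>(x - x0) \<bullet> b\<bar>)" by (rule norm_le_l1)
    also have "\<dots> \<le> (\<Sum>b\<in>(Basis::'a set). r)"
      using x by (intro sum_mono) (auto simp: Q_def inner_diff_left less_imp_le)
    also have "\<dots> = e / 2" by (simp add: r_def)
    finally have d: "dist x0 x \<le> e / 2" by (simp add: dist_norm norm_minus_commute)
    have "ball x (e / 2) \<subseteq> ball x0 e"
    proof
      fix y assume "y \<in> ball x (e / 2)"
      then show "y \<in> ball x0 e" using d dist_triangle[of x0 y x] by simp
    qed
    then show ?thesis using e by blast
  qed
  have "Q = (\<Inter>b\<in>Basis. {x. \<bar>x \<bullet> b - x0 \<bullet> b\<bar> < r})" by (auto simp: Q_def)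
  moreover have "open {x. \<bar>x \<bullet> b - x0 \<bullet> b\<bar> < r}" for b :: 'a by (intro open_Collect_less continuous_intros)
  ultimately have oQ: "open Q" by auto
  have x0Q: "x0 \<in> Q" using r by (simp add: Q_def)
  define J where "J b = {x0 \<bullet> b - r<..<x0 \<bullet> b + r}" for b :: 'a
  have mv: "x + (s - x \<bullet> b) *\<^sub>R b \<in> Q" if "x \<in> Q" "b \<in> Basis" "s \<in> J b" for x b s
    unfolding Q_def
  proof (intro CollectI ballI)
    fix c :: 'a assume c: "c \<in> Basis"
    have "(x + (s - x \<bullet> b) *\<^sub>R b) \<bullet> c = (if c = b then s else x \<bullet> c)"
      using that(2) c by (simp add: inner_add_left inner_Basis)
    then show "\<bar>(x + (s - x \<bullet> b) *\<^sub>R b) \<bullet> c - x0 \<bullet> c\<bar> < r"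
      using that c by (auto simp: Q_def J_def abs_less_iff)
  qed
  have rep: "\<exists>T \<kappa>. finite T \<and> T \<subseteq> J b \<and> (\<forall>s\<in>T. \<kappa> s \<in> EP) \<and>
     (\<forall>x\<in>Q. f x = (\<Sum>s\<in>T. f (x + (s - x \<bullet> b) *\<^sub>R b) * \<kappa> s (x \<bullet> b)))" if b: "b \<in> Basis" for b
  proof -
    have "open (J b)" "convex (J b)" by (auto simp: J_def)
    from weak_ode_interpolation[where 'a = 'a, OF this, of "zs b"] obtain T \<kappa> where TT: "finite T \<and> T \<subseteq> J b \<and> (\<forall>s\<in>T. \<kappa> s \<in> EP) \<and>
      (\<forall>(f :: 'a \<Rightarrow> complex) U u x \<epsilon>. continuous_on UNIV f \<longrightarrow>
      (\<forall>\<psi>\<in>elementary True. test_function U \<psi> \<longrightarrow> (LINT y|lborel. f y * fold (weak_factor u) (zs b) \<psi> y) = 0) \<longrightarrow>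
      \<epsilon> > 0 \<longrightarrow> (\<forall>t\<in>J b. ball (x + t *\<^sub>R u) \<epsilon> \<subseteq> U) \<longrightarrow>
      (\<forall>t\<in>J b. f (x + t *\<^sub>R u) = (\<Sum>s\<in>T. f (x + s *\<^sub>R u) * \<kappa> s t)))" by (elim exE)
    have "f x = (\<Sum>s\<in>T. f (x + (s - x \<bullet> b) *\<^sub>R b) * \<kappa> s (x \<bullet> b))" if x: "x \<in> Q" for x
    proof -
      let ?x = "x - (x \<bullet> b) *\<^sub>R b"
      have "?x + t *\<^sub>R b \<in> Q" if "t \<in> J b" for t using mv[OF x b that] by (simp add: algebra_simps)
      then have "\<forall>t\<in>J b. ball (?x + t *\<^sub>R b) (e / 2) \<subseteq> U" using Qball by blast
      moreover have "e / 2 > 0" using e by simp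
      moreover have "\<forall>\<psi>\<in>elementary True. test_function U \<psi> \<longrightarrow> (LINT y|lborel. f y * fold (weak_factor b) (zs b) \<psi> y) = 0"
        using w by blast
      ultimately have "\<forall>t\<in>J b. f (?x + t *\<^sub>R b) = (\<Sum>s\<in>T. f (?x + s *\<^sub>R b) * \<kappa> s t)"
        by (intro TT[THEN conjunct2, THEN conjunct2, THEN conjunct2, THEN spec[of _ f], THEN spec[of _ U],
          THEN spec[of _ b], THEN spec[of _ ?x], THEN spec[of _ "e / 2"], THEN mp, THEN mp, THEN mp, THEN mp, OF f])
      moreover have "x \<bullet> b \<in> J b" using x b by (auto simp: Q_def J_def abs_less_iff)
      ultimately have "f (?x + (x \<bullet> b) *\<^sub>R b) = (\<Sum>s\<in>T. f (?x + s *\<^sub>R b) * \<kappa> s (x \<bullet> b))" by blast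
      then show ?thesis by (simp add: algebra_simps)
    qed
    then show ?thesis
      using TT[THEN conjunct1] TT[THEN conjunct2, THEN conjunct1] TT[THEN conjunct2, THEN conjunct2, THEN conjunct1]
      by (intro exI[of _ T] exI[of _ \<kappa>] conjI ballI) simp_all
  qed
  \<comment> \<open>\<open>B\<close> is the set of coordinates already released: on each slice with
    the other coordinates fixed, \<open>f\<close> agrees with an exponential polynomial.\<close>
  have main: "\<forall>y\<in>Q. \<exists>F\<in>EP. \<forall>x\<in>Q. (\<forall>c\<in>Basis - B. x \<bullet> c = y \<bullet> c) \<longrightarrow> f x = F x"
    if "finite B" "B \<subseteq> Basis" for B
    using that
  proof (induction B rule: finite_induct)
    case empty
    show ?case
    proof
      fix y assume "y \<in> Q"
      have "\<forall>x\<in>Q. (\<forall>c\<in>Basis - {}. x \<bullet> c = y \<bullet> c) \<longrightarrow> f x = f y"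
        using euclidean_eq_iff by (metis Diff_empty)
      then show "\<exists>F\<in>EP. \<forall>x\<in>Q. (\<forall>c\<in>Basis - {}. x \<bullet> c = y \<bullet> c) \<longrightarrow> f x = F x"
        by (intro bexI[of _ "\<lambda>x. f y"] elementary.const)
    qed
  next
    case (insert b B)
    then have b: "b \<in> Basis" by simp
    from rep[OF b] obtain T \<kappa> where T: "finite T" "T \<subseteq> J b" "\<forall>s\<in>T. \<kappa> s \<in> EP"
      "\<forall>x\<in>Q. f x = (\<Sum>s\<in>T. f (x + (s - x \<bullet> b) *\<^sub>R b) * \<kappa> s (x \<bullet> b))" by (elim exE conjE)
    show ?case
    proof
      fix y assume y: "y \<in> Q"
      let ?y = "\<lambda>s. y + (s - y \<bullet> b) *\<^sub>R b"
      have "\<forall>s\<in>T. \<exists>F\<in>EP. \<forall>x\<in>Q. (\<forall>c\<in>Basis - B. x \<bullet> c = ?y s \<bullet> c) \<longrightarrow> f x = F x"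
      proof
        fix s assume "s \<in> T"
        then have "?y s \<in> Q" using mv[OF y b] T(2) by blast
        then show "\<exists>F\<in>EP. \<forall>x\<in>Q. (\<forall>c\<in>Basis - B. x \<bullet> c = ?y s \<bullet> c) \<longrightarrow> f x = F x"
          using insert by blast
      qed
      then obtain G where G: "\<forall>s\<in>T. G s \<in> EP \<and> (\<forall>x\<in>Q. (\<forall>c\<in>Basis - B. x \<bullet> c = ?y s \<bullet> c) \<longrightarrow> f x = G s x)"
        by metis
      define F where "F = (\<lambda>x. \<Sum>s\<in>T. G s (x + (s - x \<bullet> b) *\<^sub>R b) * \<kappa> s (x \<bullet> b))"
      have lin1: "linear (\<lambda>x. x - (x \<bullet> b) *\<^sub>R b)"
        by (intro linearI) (auto simp: inner_add_left algebra_simps)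
      have lin2: "linear (\<lambda>x. x \<bullet> b)" by (intro linearI) (auto simp: inner_add_left)
      have "F \<in> EP" unfolding F_def
      proof (intro elementary_sum elementary.mult)
        fix s assume s: "s \<in> T"
        have "(\<lambda>x. G s ((x - (x \<bullet> b) *\<^sub>R b) + s *\<^sub>R b)) \<in> EP" using EP_affine[OF lin1, of "G s"] G s by blast
        then show "(\<lambda>x. G s (x + (s - x \<bullet> b) *\<^sub>R b)) \<in> EP" by (simp add: algebra_simps)
        have "(\<lambda>x. \<kappa> s (x \<bullet> b + 0)) \<in> EP" using EP_affine[OF lin2, of "\<kappa> s"] T(3) s by blast
        then show "(\<lambda>x. \<kappa> s (x \<bullet> b)) \<in> EP" by simp
      qed
      moreover have "f x = F x" if x: "x \<in> Q" and c: "\<forall>c\<in>Basis - insert b B. x \<bullet> c = y \<bullet> c" for x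
      proof -
        have "f (x + (s - x \<bullet> b) *\<^sub>R b) = G s (x + (s - x \<bullet> b) *\<^sub>R b)" if s: "s \<in> T" for s
        proof -
          have "\<forall>c\<in>Basis - B. (x + (s - x \<bullet> b) *\<^sub>R b) \<bullet> c = ?y s \<bullet> c"
            using c b by (auto simp: inner_add_left inner_Basis)
          moreover have "x + (s - x \<bullet> b) *\<^sub>R b \<in> Q" using mv[OF x b] T(2) s by blast
          ultimately show ?thesis using G s by blast
        qed
        then show ?thesis using T(4) x by (simp add: F_def)
      qed
      ultimately show "\<exists>F\<in>EP. \<forall>x\<in>Q. (\<forall>c\<in>Basis - insert b B. x \<bullet> c = y \<bullet> c) \<longrightarrow> f x = F x"
        by blast
    qed
  qed
  from main[of Basis] obtain F where "F \<in> EP" "\<forall>x\<in>Q. f x = F x" using x0Q by auto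
  moreover have "Q \<subseteq> U" using Qball e by (meson centre_in_ball half_gt_zero subsetD subsetI)
  ultimately show ?thesis using oQ x0Q by blast
qed

text \<open>Along the segment from \<open>x0\<close> to another point the interpolation formula
  makes \<open>f\<close> an exponential polynomial of one variable. It agrees with \<open>F\<close>
  near \<open>x0\<close>, and therefore on the whole segment.\<close>

lemma EP_extension:
  fixes f :: "'a::euclidean_space \<Rightarrow> complex"
  assumes f: "continuous_on UNIV f" and U: "open U" "convex U" "x0 \<in> U"
    and w: "\<And>u \<psi>. \<psi> \<in> elementary True \<Longrightarrow> test_function U \<psi> \<Longrightarrow>
      (LINT y|lborel. f y * fold (weak_factor u) (zs u) \<psi> y) = 0"
  shows "\<exists>F\<in>EP. \<forall>x\<in>U. f x = F x"
proof -
  obtain F N where F: "F \<in> EP" and N: "open N" "x0 \<in> N" "\<forall>x\<in>N. f x = F x"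
    using EP_on_box[OF f U(1,3) w] by blast
  have "f x1 = F x1" if x1: "x1 \<in> U" for x1
  proof -
    define u where "u = x1 - x0"
    define K where "K = (\<lambda>t. x0 + t *\<^sub>R u) ` {0..1::real}"
    have "compact K" unfolding K_def by (intro compact_continuous_image continuous_intros) auto
    have "K \<subseteq> U"
    proof
      fix y assume "y \<in> K"
      then obtain t where t: "y = x0 + t *\<^sub>R u" "t \<in> {0..1}" unfolding K_def by (rule imageE)
      have "y = (1 - t) *\<^sub>R x0 + t *\<^sub>R x1" using t by (simp add: u_def algebra_simps)
      then show "y \<in> U" using convexD_alt[OF U(2,3) x1] t by simp
    qed
    then have disj: "K \<inter> - U = {}" by blast
    have "closed (- U)" by (rule closed_Compl[OF U(1)])
    from separate_compact_closed[OF \<open>compact K\<close> this disj] obtain e where e: "e > 0"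
      "\<forall>x\<in>K. \<forall>y\<in>- U. e \<le> dist x y" by blast
    \<comment> \<open>The parameter interval is enlarged by \<open>\<delta>\<close> beyond both
      endpoints, so that it is open and contains 1, while balls of radius \<open>e / 2\<close>
      around its points stay in \<open>U\<close>.\<close>
    define \<delta> where "\<delta> = e / (2 * (norm u + 1))"
    have n1: "norm u + 1 > 0" by (rule add_nonneg_pos) auto
    have \<delta>: "\<delta> > 0" using e n1 by (simp add: \<delta>_def)
    have "\<delta> * norm u \<le> \<delta> * (norm u + 1)" using \<delta> by (intro mult_left_mono) auto
    also have "\<dots> = e / 2" using n1 by (simp add: \<delta>_def field_simps)
    finally have \<delta>u: "\<delta> * norm u \<le> e / 2" .
    define J where "J = {- \<delta><..<1 + \<delta>}"
    have ballJ: "ball (x0 + t *\<^sub>R u) (e / 2) \<subseteq> U" if t: "t \<in> J" for t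
    proof
      fix y assume y: "y \<in> ball (x0 + t *\<^sub>R u) (e / 2)"
      define t' where "t' = max 0 (min 1 t)"
      have t': "x0 + t' *\<^sub>R u \<in> K" unfolding K_def by (intro image_eqI[of _ _ t']) (auto simp: t'_def)
      have tt: "\<bar>t' - t\<bar> \<le> \<delta>" using t \<delta> by (auto simp: t'_def J_def)
      have "dist (x0 + t' *\<^sub>R u) (x0 + t *\<^sub>R u) = \<bar>t' - t\<bar> * norm u"
        by (simp add: dist_norm flip: scaleR_diff_left)
      also have "\<dots> \<le> \<delta> * norm u" using tt by (intro mult_right_mono) auto
      finally have "dist (x0 + t' *\<^sub>R u) (x0 + t *\<^sub>R u) \<le> e / 2" using \<delta>u by simp
      then have "dist (x0 + t' *\<^sub>R u) y < e"
        using y dist_triangle[of "x0 + t' *\<^sub>R u" y "x0 + t *\<^sub>R u"] by simp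
      then show "y \<in> U" using e(2) t' by force
    qed
    have "open J" "convex J" by (auto simp: J_def)
    from weak_ode_interpolation[where 'a = 'a, OF this, of "zs u"] obtain T \<kappa> where TT: "finite T \<and> T \<subseteq> J \<and> (\<forall>s\<in>T. \<kappa> s \<in> EP) \<and>
      (\<forall>(f :: 'a \<Rightarrow> complex) U v x \<epsilon>. continuous_on UNIV f \<longrightarrow>
      (\<forall>\<psi>\<in>elementary True. test_function U \<psi> \<longrightarrow> (LINT y|lborel. f y * fold (weak_factor v) (zs u) \<psi> y) = 0) \<longrightarrow>
      \<epsilon> > 0 \<longrightarrow> (\<forall>t\<in>J. ball (x + t *\<^sub>R v) \<epsilon> \<subseteq> U) \<longrightarrow>
      (\<forall>t\<in>J. f (x + t *\<^sub>R v) = (\<Sum>s\<in>T. f (x + s *\<^sub>R v) * \<kappa> s t)))" by (elim exE)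
    have *: "e / 2 > 0" "\<forall>t\<in>J. ball (x0 + t *\<^sub>R u) (e / 2) \<subseteq> U"
      "\<forall>\<psi>\<in>elementary True. test_function U \<psi> \<longrightarrow> (LINT y|lborel. f y * fold (weak_factor u) (zs u) \<psi> y) = 0"
      using e ballJ w by auto
    have rep: "\<forall>t\<in>J. f (x0 + t *\<^sub>R u) = (\<Sum>s\<in>T. f (x0 + s *\<^sub>R u) * \<kappa> s t)"
      by (rule TT[THEN conjunct2, THEN conjunct2, THEN conjunct2, THEN spec[of _ f], THEN spec[of _ U],
          THEN spec[of _ u], THEN spec[of _ x0], THEN spec[of _ "e / 2"], THEN mp, THEN mp, THEN mp, THEN mp,
          OF f *(3) *(1) *(2)])
    define d where "d = (\<lambda>t::real. (\<Sum>s\<in>T. f (x0 + s *\<^sub>R u) * \<kappa> s t) - F (t *\<^sub>R u + x0))"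
    have lin: "linear (\<lambda>t::real. t *\<^sub>R u)" by (intro linearI) (auto simp: algebra_simps)
    have dEP: "d \<in> EP" unfolding d_def
      using TT[THEN conjunct2, THEN conjunct2, THEN conjunct1]
      by (intro elementary_diff elementary_sum elementary_cmult EP_affine[OF lin F]) simp
    have "((\<lambda>t::real. x0 + t *\<^sub>R u) \<longlongrightarrow> x0 + 0 *\<^sub>R u) (at_right 0)" by (intro tendsto_intros)
    then have "eventually (\<lambda>t. x0 + t *\<^sub>R u \<in> N) (at_right (0::real))"
      using N by (intro topological_tendstoD) auto
    then obtain b where b: "b > 0" "\<forall>t>0. t < b \<longrightarrow> x0 + t *\<^sub>R u \<in> N"
      unfolding eventually_at_right_field by blast
    have "d (0 + 1 *\<^sub>R 1) = 0"
    proof (rule EP_line_eq_0[OF dEP])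
      show "0 < min b 1" using b by simp
      fix t :: real assume t: "0 < t" "t < min b 1"
      then have "t \<in> J" using \<delta> by (auto simp: J_def)
      moreover have "f (x0 + t *\<^sub>R u) = F (x0 + t *\<^sub>R u)" using N b t by auto
      ultimately show "d (0 + t *\<^sub>R 1) = 0" using rep by (simp add: d_def add.commute)
    qed
    moreover have "1 \<in> J" using \<delta> by (auto simp: J_def)
    then have "f (x0 + 1 *\<^sub>R u) = (\<Sum>s\<in>T. f (x0 + s *\<^sub>R u) * \<kappa> s 1)" by (rule bspec[OF rep])
    ultimately have "f (x0 + 1 *\<^sub>R u) = F (x0 + 1 *\<^sub>R u)" by (simp add: d_def add.commute)
    then show ?thesis by (simp add: u_def)
  qed
  then show ?thesis using F by blast
qed

definition lin_factor :: "'a::euclidean_space \<Rightarrow> complex \<Rightarrow> ('a \<Rightarrow> complex) \<Rightarrow> 'a \<Rightarrow> complex" where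
  "lin_factor u z h = (\<lambda>x. dir_deriv u h x - z * h x)"

lemma lin_factor_EP: "h \<in> EP \<Longrightarrow> lin_factor u z h \<in> EP"
  unfolding lin_factor_def by (intro elementary_diff elementary_cmult elementary_dir_deriv)

lemma foldr_lin_factor_EP: "h \<in> EP \<Longrightarrow> foldr (lin_factor u) zs h \<in> EP"
  by (induction zs) (auto intro: lin_factor_EP)

lemma weak_factor_by_parts:
  assumes U: "open U" and h: "h \<in> EP" and \<psi>: "test_function U \<psi>"
  shows "(LINT x|lborel. h x * weak_factor u z \<psi> x) = (LINT x|lborel. lin_factor u z h x * \<psi> x)"
proof -
  note c = elementary_continuous[OF h] and c' = elementary_continuous[OF elementary_dir_deriv[OF h]]
  have i: "integrable lborel (\<lambda>x. h x * \<psi> x)" "integrable lborel (\<lambda>x. h x * dir_deriv u \<psi> x)"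
    "integrable lborel (\<lambda>x. dir_deriv u h x * \<psi> x)"
    using test_product_integrable[OF U c \<psi>] test_product_integrable[OF U c test_function_dir_deriv[OF \<psi>]]
      test_product_integrable[OF U c' \<psi>] by auto
  have "(LINT x|lborel. h x * weak_factor u z \<psi> x) = (LINT x|lborel. - (h x * dir_deriv u \<psi> x) - z * (h x * \<psi> x))"
    by (intro Bochner_Integration.integral_cong) (auto simp: weak_factor_def algebra_simps)
  also have "\<dots> = (LINT x|lborel. dir_deriv u h x * \<psi> x) - z * (LINT x|lborel. h x * \<psi> x)"
    using i integration_by_parts[OF U elementary_differentiable[OF h] c' \<psi>, of u] by simp
  also have "\<dots> = (LINT x|lborel. dir_deriv u h x * \<psi> x - z * (h x * \<psi> x))" using i by simp
  also have "\<dots> = (LINT x|lborel. lin_factor u z h x * \<psi> x)"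
    by (intro Bochner_Integration.integral_cong) (auto simp: lin_factor_def algebra_simps)
  finally show ?thesis .
qed

lemma weak_factors_by_parts:
  assumes U: "open U" and h: "h \<in> EP"
  shows "\<psi> \<in> elementary b \<Longrightarrow> test_function U \<psi> \<Longrightarrow>
    (LINT x|lborel. h x * fold (weak_factor u) zs \<psi> x) = (LINT x|lborel. foldr (lin_factor u) zs h x * \<psi> x)"
proof (induction zs arbitrary: \<psi>)
  case (Cons z zs)
  show ?case
    using Cons.IH[OF elementary_weak_factor[OF Cons.prems(1)] test_function_weak_factor[OF Cons.prems], of u z]
      weak_factor_by_parts[OF U foldr_lin_factor_EP[OF h] Cons.prems(2)] by simp
qed simp

lemma weak_ode_EP:
  assumes U: "open U" "p0 \<in> U" and F: "F \<in> EP" and eq: "\<And>x. x \<in> U \<Longrightarrow> f x = F x"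
    and w: "\<And>\<psi>. \<psi> \<in> elementary True \<Longrightarrow> test_function U \<psi> \<Longrightarrow> (LINT y|lborel. f y * fold (weak_factor u) zs \<psi> y) = 0"
  shows "foldr (lin_factor u) zs F = (\<lambda>x. 0)"
proof -
  let ?h = "foldr (lin_factor u) zs F"
  have h: "?h \<in> EP" by (rule foldr_lin_factor_EP[OF F])
  have "?h y = 0" if y: "y \<in> U" for y
  proof (rule vanishing_by_test_functions[OF elementary_continuous[OF h] U(1) y])
    fix \<psi> assume el: "\<psi> \<in> elementary True" and \<psi>: "test_function U \<psi>"
    have t: "test_function U (fold (weak_factor u) zs \<psi>)" using el \<psi>
      by (induction zs arbitrary: \<psi>) (auto intro: elementary_weak_factor test_function_weak_factor)
    have "(LINT x|lborel. ?h x * \<psi> x) = (LINT x|lborel. F x * fold (weak_factor u) zs \<psi> x)"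
      by (rule weak_factors_by_parts[OF U(1) F el \<psi>, symmetric])
    also have "\<dots> = (LINT x|lborel. f x * fold (weak_factor u) zs \<psi> x)"
    proof (intro Bochner_Integration.integral_cong refl)
      fix x show "F x * fold (weak_factor u) zs \<psi> x = f x * fold (weak_factor u) zs \<psi> x"
        using eq[of x] test_function_zero[OF t, of x] by (cases "x \<in> U") auto
    qed
    also have "\<dots> = 0" by (rule w[OF el \<psi>])
    finally show "(LINT x|lborel. ?h x * \<psi> x) = 0" .
  qed
  from EP_eq_0[OF h U this] show ?thesis by blast
qed

section \<open>The Laplacian and reflection in a wall\<close>

lemma EP_dir_deriv_add: "h \<in> EP \<Longrightarrow> dir_deriv (u + v) h x = dir_deriv u h x + dir_deriv v h x"
  using linear_add[OF dir_deriv_linear[OF elementary_differentiable]] by fast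

lemma EP_dir_deriv_scale: "h \<in> EP \<Longrightarrow> dir_deriv (c *\<^sub>R u) h x = c *\<^sub>R dir_deriv u h x"
  using linear_cmul[OF dir_deriv_linear[OF elementary_differentiable]] by fast

lemma EP_dir_deriv_minus: "h \<in> EP \<Longrightarrow> dir_deriv (- u) h x = - dir_deriv u h x"
  using linear_neg[OF dir_deriv_linear[OF elementary_differentiable]] by fast

lemma EP_dir_deriv_sum: "h \<in> EP \<Longrightarrow> dir_deriv (\<Sum>i\<in>S. u i) h x = (\<Sum>i\<in>S. dir_deriv (u i) h x)"
  using linear_sum[OF dir_deriv_linear[OF elementary_differentiable]] by fast

lemma EP_dir_deriv_Basis: "h \<in> EP \<Longrightarrow> dir_deriv u h x = (\<Sum>b\<in>Basis. of_real (u \<bullet> b) * dir_deriv b h x)"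
  by (subst euclidean_representation[of u, symmetric])
     (simp add: EP_dir_deriv_sum EP_dir_deriv_scale scaleR_conv_of_real)

lemma EP_dir_deriv_affine:
  fixes A :: "'a::euclidean_space \<Rightarrow> 'b::euclidean_space"
  assumes h: "h \<in> EP" and A: "linear A"
  shows "dir_deriv u (\<lambda>x. h (A x + y)) x = dir_deriv (A u) h (A x + y)"
  by (rule dir_deriv_affine[OF elementary_differentiable[OF h] linear_conv_bounded_linear[THEN iffD1, OF A]])

text \<open>For \<open>\<gamma> \<noteq> 0\<close>, the orthogonal projection along
  \<open>\<gamma>\<close> onto the directions of the mirror.\<close>

definition tangential :: "'a::euclidean_space \<Rightarrow> 'a \<Rightarrow> 'a" where
  "tangential \<gamma> b = b - ((b \<bullet> \<gamma>) / (\<gamma> \<bullet> \<gamma>)) *\<^sub>R \<gamma>"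

lemma tangential_orth: "\<gamma> \<noteq> 0 \<Longrightarrow> \<gamma> \<bullet> tangential \<gamma> b = 0"
  by (simp add: tangential_def inner_diff_right inner_commute)

lemma tangential_add: "tangential \<gamma> (x + y) = tangential \<gamma> x + tangential \<gamma> y"
  by (simp add: tangential_def inner_add_left add_divide_distrib algebra_simps)

lemma tangential_scale: "tangential \<gamma> (c *\<^sub>R x) = c *\<^sub>R tangential \<gamma> x"
  by (simp add: tangential_def algebra_simps)

lemma tangential_sum: "tangential \<gamma> (\<Sum>i\<in>S. u i) = (\<Sum>i\<in>S. tangential \<gamma> (u i))"
  by (induction S rule: infinite_finite_induct) (auto simp: tangential_add, simp_all add: tangential_def)

text \<open>The projections of the standard basis are not orthonormal, yet their second derivatives
  add up to the Laplacian of the mirror. The mixed terms combine to a derivative along the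
  projection of a multiple of \<open>\<gamma>\<close>, which is zero.\<close>

lemma laplace_decomposition:
  fixes h :: "'a::euclidean_space \<Rightarrow> complex"
  assumes h: "h \<in> EP" and g: "\<gamma> \<noteq> 0"
  shows "(\<Sum>b\<in>Basis. dir_deriv b (dir_deriv b h) x) =
    of_real (1 / (\<gamma> \<bullet> \<gamma>)) * dir_deriv \<gamma> (dir_deriv \<gamma> h) x +
    (\<Sum>b\<in>Basis. dir_deriv (tangential \<gamma> b) (dir_deriv (tangential \<gamma> b) h) x)"
proof -
  note hd = elementary_dir_deriv[OF h]
  define n where "n = \<gamma> \<bullet> \<gamma>"
  have n: "n \<noteq> 0" using g by (simp add: n_def)
  define q where "q b = (b \<bullet> \<gamma>) / n" for b :: 'a
  have split: "b = tangential \<gamma> b + q b *\<^sub>R \<gamma>" for b by (simp add: tangential_def q_def n_def)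
  have lin: "dir_deriv v (\<lambda>y. dir_deriv s h y + of_real c * dir_deriv t h y) x =
     dir_deriv v (dir_deriv s h) x + of_real c * dir_deriv v (dir_deriv t h) x" for v s t c
    using elementary_differentiable[OF hd] by (simp add: dir_deriv_add dir_deriv_cmult)
  have expand: "dir_deriv b (dir_deriv b h) x =
     dir_deriv (tangential \<gamma> b) (dir_deriv (tangential \<gamma> b) h) x +
     of_real (2 * q b) * dir_deriv \<gamma> (dir_deriv (tangential \<gamma> b) h) x +
     of_real ((q b)\<^sup>2) * dir_deriv \<gamma> (dir_deriv \<gamma> h) x" for b
  proof -
    have 1: "dir_deriv b k y = dir_deriv (tangential \<gamma> b) k y + of_real (q b) * dir_deriv \<gamma> k y" if "k \<in> EP" for k y
      by (subst split) (simp add: EP_dir_deriv_add[OF that] EP_dir_deriv_scale[OF that] scaleR_conv_of_real)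
    have "dir_deriv b (dir_deriv b h) x = dir_deriv b (\<lambda>y. dir_deriv (tangential \<gamma> b) h y + of_real (q b) * dir_deriv \<gamma> h y) x"
      using 1[OF h] by presburger
    also have "\<dots> = dir_deriv b (dir_deriv (tangential \<gamma> b) h) x + of_real (q b) * dir_deriv b (dir_deriv \<gamma> h) x"
      by (rule lin)
    also have "\<dots> = dir_deriv (tangential \<gamma> b) (dir_deriv (tangential \<gamma> b) h) x + of_real (q b) * dir_deriv \<gamma> (dir_deriv (tangential \<gamma> b) h) x
      + of_real (q b) * (dir_deriv (tangential \<gamma> b) (dir_deriv \<gamma> h) x + of_real (q b) * dir_deriv \<gamma> (dir_deriv \<gamma> h) x)"
      by (simp only: 1[OF hd])
    finally show ?thesis
      using elementary_dir_deriv_commute[OF h, of "tangential \<gamma> b" \<gamma>] by (simp add: power2_eq_square algebra_simps)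
  qed
  have "(\<Sum>b\<in>Basis. (2 * q b) *\<^sub>R tangential \<gamma> b) = tangential \<gamma> ((2 / n) *\<^sub>R (\<Sum>b\<in>Basis. (\<gamma> \<bullet> b) *\<^sub>R b))"
    by (simp add: tangential_sum tangential_scale q_def inner_commute scaleR_sum_right)
  also have "\<dots> = 0" using g by (simp add: euclidean_representation tangential_scale) (simp add: tangential_def)
  finally have c0: "dir_deriv (\<Sum>b\<in>Basis. (2 * q b) *\<^sub>R tangential \<gamma> b) (dir_deriv \<gamma> h) x = 0"
    using EP_dir_deriv_scale[OF hd, of 0 0] by simp
  have "(\<Sum>b\<in>Basis. of_real (2 * q b) * dir_deriv \<gamma> (dir_deriv (tangential \<gamma> b) h) x) =
    (\<Sum>b\<in>Basis. of_real (2 * q b) * dir_deriv (tangential \<gamma> b) (dir_deriv \<gamma> h) x)"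
    by (simp only: elementary_dir_deriv_commute[OF h, of \<gamma>])
  also have "\<dots> = (\<Sum>b\<in>Basis. dir_deriv ((2 * q b) *\<^sub>R tangential \<gamma> b) (dir_deriv \<gamma> h) x)"
    by (simp only: EP_dir_deriv_scale[OF hd] scaleR_conv_of_real)
  also have "\<dots> = 0" using c0 by (simp only: EP_dir_deriv_sum[OF hd])
  finally have cross: "(\<Sum>b\<in>Basis. of_real (2 * q b) * dir_deriv \<gamma> (dir_deriv (tangential \<gamma> b) h) x) = 0" .
  have "(\<Sum>b\<in>Basis. (q b)\<^sup>2) = (\<Sum>b\<in>Basis. (\<gamma> \<bullet> b) * (\<gamma> \<bullet> b)) / n\<^sup>2"
    by (simp add: q_def power_divide sum_divide_distrib inner_commute power2_eq_square)
  also have "\<dots> = n / n\<^sup>2" by (simp add: n_def flip: euclidean_inner)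
  also have "\<dots> = 1 / n" using n by (simp add: power2_eq_square)
  finally have sq: "(\<Sum>b\<in>Basis. (q b)\<^sup>2) = 1 / n" .
  have "(\<Sum>b\<in>Basis. of_real ((q b)\<^sup>2) * dir_deriv \<gamma> (dir_deriv \<gamma> h) x) = of_real (1 / n) * dir_deriv \<gamma> (dir_deriv \<gamma> h) x"
    unfolding sq[symmetric] of_real_sum sum_distrib_right ..
  moreover have "(\<Sum>b\<in>Basis. dir_deriv b (dir_deriv b h) x) =
     (\<Sum>b\<in>Basis. dir_deriv (tangential \<gamma> b) (dir_deriv (tangential \<gamma> b) h) x) +
     (\<Sum>b\<in>Basis. of_real (2 * q b) * dir_deriv \<gamma> (dir_deriv (tangential \<gamma> b) h) x) +
     (\<Sum>b\<in>Basis. of_real ((q b)\<^sup>2) * dir_deriv \<gamma> (dir_deriv \<gamma> h) x)"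
    unfolding sum.distrib[symmetric] by (rule sum.cong[OF refl expand])
  ultimately show ?thesis unfolding cross n_def by (simp only: add_0_left add_0_right add.commute)
qed

text \<open>The Cauchy problem for an eigenfunction of the Laplacian has a unique solution, so the part of
  \<open>h\<close> that is even under a reflection vanishes as soon as it vanishes on the mirror.\<close>

lemma odd_of_vanishing_on_mirror:
  fixes h :: "'a::euclidean_space \<Rightarrow> complex"
  assumes h: "h \<in> EP" and a: "fst a \<noteq> 0"
    and lap: "\<And>x. (\<Sum>b\<in>Basis. dir_deriv b (dir_deriv b h) x) = c * h x"
    and z: "\<And>v. aff_eval a v = 0 \<Longrightarrow> h v = 0"
  shows "h (aff_refl a x) = - h x"
proof -
  let ?g = "fst a"
  let ?y = "- (snd a *\<^sub>R coroot ?g)"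
  have s: "aff_refl a = (\<lambda>x. refl ?g x + ?y)" by (rule ext) (simp add: aff_refl_eq)
  define hs where "hs = (\<lambda>x. h (refl ?g x + ?y))"
  have hs: "hs \<in> EP" unfolding hs_def by (rule EP_affine[OF refl_linear h])
  \<comment> \<open>Twice the even part of \<open>h\<close>. It satisfies the same equation because
    the reflection commutes with the Laplacian.\<close>
  define E where "E = (\<lambda>x. h x + hs x)"
  have E: "E \<in> EP" unfolding E_def by (rule elementary.add[OF h hs])
  note D = elementary_dir_deriv
  have dhs: "dir_deriv u (\<lambda>x. f (refl ?g x + ?y)) = (\<lambda>x. dir_deriv (refl ?g u) f (refl ?g x + ?y))" if "f \<in> EP" for f u
    by (rule ext) (rule EP_dir_deriv_affine[OF that refl_linear])
  have dE: "dir_deriv u (dir_deriv v E) x = dir_deriv u (dir_deriv v h) x + dir_deriv u (dir_deriv v hs) x" for u v x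
  proof -
    have "dir_deriv v E = (\<lambda>x. dir_deriv v h x + dir_deriv v hs x)" unfolding E_def
      by (rule ext) (intro dir_deriv_add elementary_differentiable[OF h] elementary_differentiable[OF hs])
    then show ?thesis
      by (simp add: dir_deriv_add elementary_differentiable[OF D[OF h]] elementary_differentiable[OF D[OF hs]])
  qed
  have rg: "refl ?g ?g = - ?g" by (rule refl_self)
  have rt: "refl ?g (tangential ?g b) = tangential ?g b" for b
    using tangential_orth[OF a, of b] by (simp add: refl_def)
  have "(\<Sum>b\<in>Basis. dir_deriv b (dir_deriv b hs) x) = c * hs x" for x
  proof -
    have 1: "dir_deriv ?g (dir_deriv ?g hs) x = dir_deriv ?g (dir_deriv ?g h) (refl ?g x + ?y)"
    proof -
      have "dir_deriv ?g hs = (\<lambda>x. (-1) * dir_deriv ?g h (refl ?g x + ?y))"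
        unfolding hs_def dhs[OF h] rg EP_dir_deriv_minus[OF h] by simp
      then show ?thesis
        using dhs[OF D[OF h], of ?g ?g]
          dir_deriv_cmult[OF elementary_differentiable[OF EP_affine[OF refl_linear D[OF h]]], where c = "-1"]
        by (simp only: rg EP_dir_deriv_minus[OF D[OF h]]) simp
    qed
    have 2: "dir_deriv (tangential ?g b) (dir_deriv (tangential ?g b) hs) x =
       dir_deriv (tangential ?g b) (dir_deriv (tangential ?g b) h) (refl ?g x + ?y)" for b
      unfolding hs_def dhs[OF h] rt dhs[OF D[OF h]] ..
    show ?thesis unfolding laplace_decomposition[OF hs a] 1 2
      using laplace_decomposition[OF h a, of "refl ?g x + ?y"] lap[of "refl ?g x + ?y"] by (simp add: hs_def)
  qed
  then have lapE: "(\<Sum>b\<in>Basis. dir_deriv b (dir_deriv b E) x) = c * E x" for x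
    unfolding dE sum.distrib lap by (simp add: E_def distrib_left)
  have Es: "E (refl ?g x + ?y) = E x" for x
    using aff_refl_aff_refl[OF a, of x] unfolding s by (simp add: E_def hs_def)
  have fixm: "refl ?g v + ?y = v" if "aff_eval a v = 0" for v
  proof -
    have "aff_refl a v = v" using that by (simp add: aff_refl_def)
    then show ?thesis by (simp add: s)
  qed
  have E0: "E v = 0" if "aff_eval a v = 0" for v
    using z[OF that] fixm[OF that] by (simp add: E_def hs_def)
  define P where "P m = foldr dir_deriv (replicate m ?g) E" for m
  have PEP: "P m \<in> EP" for m unfolding P_def by (rule elementary_foldr_dir_deriv[OF E])
  have PS: "P (Suc m) = dir_deriv ?g (P m)" for m by (simp add: P_def)
  have lapP: "(\<Sum>b\<in>Basis. dir_deriv b (dir_deriv b (P m)) x) = c * P m x" for m x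
  proof (induction m arbitrary: x)
    case 0 then show ?case using lapE by (simp add: P_def)
  next
    case (Suc m)
    have "dir_deriv b (dir_deriv b (P (Suc m))) = dir_deriv ?g (dir_deriv b (dir_deriv b (P m)))" for b
      unfolding PS elementary_dir_deriv_commute[OF PEP, of b ?g] elementary_dir_deriv_commute[OF D[OF PEP], of b ?g] ..
    then have "(\<Sum>b\<in>Basis. dir_deriv b (dir_deriv b (P (Suc m))) x) = (\<Sum>b\<in>Basis. dir_deriv ?g (dir_deriv b (dir_deriv b (P m))) x)"
      by simp
    also have "\<dots> = dir_deriv ?g (\<lambda>x. \<Sum>b\<in>Basis. dir_deriv b (dir_deriv b (P m)) x) x"
    proof (rule dir_deriv_eqI[symmetric])
      show "((\<lambda>x. \<Sum>b\<in>Basis. dir_deriv b (dir_deriv b (P m)) x) has_derivative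
         (\<lambda>u. \<Sum>b\<in>Basis. dir_deriv u (dir_deriv b (dir_deriv b (P m))) x)) (at x)"
        by (intro has_derivative_sum has_derivative_dir_deriv elementary_differentiable[OF D[OF D[OF PEP]]])
    qed
    also have "\<dots> = dir_deriv ?g (\<lambda>x. c * P m x) x" by (simp only: Suc)
    also have "\<dots> = c * P (Suc m) x" by (simp add: dir_deriv_cmult elementary_differentiable[OF PEP] PS)
    finally show ?case .
  qed
  have tang0: "dir_deriv (tangential ?g b) f v = 0"
    if "\<And>v. aff_eval a v = 0 \<Longrightarrow> f v = (0::complex)" "aff_eval a v = 0" for f b v
    using that by (simp add: dir_deriv_def aff_eval_shift tangential_orth[OF a])
  \<comment> \<open>On the mirror, \<open>P 0\<close> vanishes with \<open>h\<close> and
    \<open>P 1\<close> by evenness. The Laplace equation expresses \<open>P (m + 2)\<close> there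
    through \<open>P m\<close> and its second tangential derivatives, so two consecutive orders must
    be carried along.\<close>
  have van: "(\<forall>v. aff_eval a v = 0 \<longrightarrow> P m v = 0) \<and> (\<forall>v. aff_eval a v = 0 \<longrightarrow> P (Suc m) v = 0)" for m
  proof (induction m)
    case 0
    have "P 1 v = 0" if v: "aff_eval a v = 0" for v
    proof -
      have "E = (\<lambda>x. E (refl ?g x + ?y))" using Es by simp
      then have "dir_deriv ?g E v = dir_deriv ?g (\<lambda>x. E (refl ?g x + ?y)) v" by metis
      also have "\<dots> = - dir_deriv ?g E v" unfolding dhs[OF E] rg EP_dir_deriv_minus[OF E] fixm[OF v] ..
      finally show ?thesis by (simp add: P_def)
    qed
    then show ?case using E0 by (simp add: P_def)
  next
    case (Suc m)
    have "P (Suc (Suc m)) v = 0" if v: "aff_eval a v = 0" for v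
    proof -
      have p0: "\<And>v. aff_eval a v = 0 \<Longrightarrow> P m v = 0" using Suc by blast
      have "dir_deriv (tangential ?g b) (dir_deriv (tangential ?g b) (P m)) v = 0" for b
        by (rule tang0[OF tang0[OF p0] v])
      then have "of_real (1 / (?g \<bullet> ?g)) * dir_deriv ?g (dir_deriv ?g (P m)) v = 0"
        using laplace_decomposition[OF PEP a, of m v] lapP[of m v] p0[OF v] by simp
      then show ?thesis using a by (simp add: PS)
    qed
    then show ?case using Suc by blast
  qed
  have "E x = 0"
  proof -
    define t where "t = aff_eval a x / (?g \<bullet> ?g)"
    have "aff_eval a (x + (- t) *\<^sub>R ?g) = 0" using a unfolding aff_eval_shift t_def by simp
    then have "E ((x + (- t) *\<^sub>R ?g) + t *\<^sub>R ?g) = 0"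
      using van unfolding P_def by (intro EP_line_derivs_eq_0[OF E]) blast
    then show ?thesis by simp
  qed
  then show ?thesis by (simp add: E_def hs_def s add_eq_0_iff)
qed

text \<open>The function \<open>dir_deriv (coroot (fst a)) F - \<kappa> F\<close> solves the same
  Laplace equation and vanishes on the mirror, so it is odd. Splitting the affine reflection into
  its linear part and a translation puts this into a form with constant coefficients.\<close>

lemma wall_relation:
  fixes F :: "'a::euclidean_space \<Rightarrow> complex"
  assumes F: "F \<in> EP" and a: "fst a \<noteq> 0"
    and lap: "\<And>x. (\<Sum>b\<in>Basis. dir_deriv b (dir_deriv b F) x) = c * F x"
    and z: "\<And>v. aff_eval a v = 0 \<Longrightarrow> dir_deriv (coroot (fst a)) F v = of_real \<kappa> * F v"
  shows "dir_deriv (coroot (fst a)) (\<lambda>x. F (refl (fst a) x)) (x + snd a *\<^sub>R coroot (fst a)) +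
      of_real \<kappa> * F (refl (fst a) (x + snd a *\<^sub>R coroot (fst a))) =
    dir_deriv (coroot (fst a)) F x - of_real \<kappa> * F x"
proof -
  let ?b = "coroot (fst a)"
  define h where "h = (\<lambda>x. dir_deriv ?b F x - of_real \<kappa> * F x)"
  note D = elementary_dir_deriv
  have h: "h \<in> EP" unfolding h_def by (intro elementary_diff elementary_cmult D F)
  have dh: "dir_deriv u (dir_deriv u h) x = dir_deriv ?b (dir_deriv u (dir_deriv u F)) x - of_real \<kappa> * dir_deriv u (dir_deriv u F) x" for u x
  proof -
    have "dir_deriv u h = (\<lambda>x. dir_deriv ?b (dir_deriv u F) x - of_real \<kappa> * dir_deriv u F x)"
      unfolding h_def using elementary_differentiable[OF F] elementary_differentiable[OF D[OF F]]
      by (simp add: dir_deriv_diff dir_deriv_cmult elementary_dir_deriv_commute[OF F, of u ?b] fun_eq_iff)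
    then show ?thesis using elementary_differentiable[OF D[OF F]] elementary_differentiable[OF D[OF D[OF F]]]
      by (simp add: dir_deriv_diff dir_deriv_cmult elementary_dir_deriv_commute[OF D[OF F], of u ?b])
  qed
  have "(\<Sum>b\<in>Basis. dir_deriv b (dir_deriv b h) x) = c * h x" for x
  proof -
    have "(\<Sum>b\<in>Basis. dir_deriv ?b (dir_deriv b (dir_deriv b F)) x) = dir_deriv ?b (\<lambda>x. \<Sum>b\<in>Basis. dir_deriv b (dir_deriv b F) x) x"
    proof (rule dir_deriv_eqI[symmetric])
      show "((\<lambda>x. \<Sum>b\<in>Basis. dir_deriv b (dir_deriv b F) x) has_derivative
         (\<lambda>u. \<Sum>b\<in>Basis. dir_deriv u (dir_deriv b (dir_deriv b F)) x)) (at x)"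
        by (intro has_derivative_sum has_derivative_dir_deriv elementary_differentiable[OF D[OF D[OF F]]])
    qed
    also have "\<dots> = c * dir_deriv ?b F x"
      unfolding lap by (simp add: dir_deriv_cmult elementary_differentiable[OF F])
    finally show ?thesis unfolding dh sum_subtractf sum_distrib_left[symmetric] lap
      by (simp add: h_def algebra_simps)
  qed
  from odd_of_vanishing_on_mirror[OF h a this, of x] z
  have odd: "h (aff_refl a x) = - h x" by (simp add: h_def)
  let ?x = "x + snd a *\<^sub>R ?b"
  have rb: "refl (fst a) ?b = - ?b" by (simp add: coroot_def refl_scale refl_self)
  have s: "refl (fst a) ?x = aff_refl a x" by (simp add: aff_refl_eq refl_add refl_scale rb)
  have "dir_deriv ?b (\<lambda>x. F (refl (fst a) x)) ?x = - dir_deriv ?b F (aff_refl a x)"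
    using EP_dir_deriv_affine[OF F refl_linear, of ?b "fst a" 0 ?x] by (simp add: rb s EP_dir_deriv_minus[OF F])
  then show ?thesis using odd unfolding s by (simp add: h_def algebra_simps)
qed

section \<open>Tuples of exponential polynomials\<close>

definition tuple_op :: "'a::euclidean_space \<Rightarrow> complex \<Rightarrow> ('i \<Rightarrow> 'a \<Rightarrow> complex) \<Rightarrow> 'i \<Rightarrow> 'a \<Rightarrow> complex" where
  "tuple_op u z G = (\<lambda>w. lin_factor u z (G w))"

definition tuple_ops :: "('a::euclidean_space \<times> complex) list \<Rightarrow> ('i \<Rightarrow> 'a \<Rightarrow> complex) \<Rightarrow> 'i \<Rightarrow> 'a \<Rightarrow> complex" where
  "tuple_ops D G = foldr (\<lambda>(u, z). tuple_op u z) D G"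

abbreviation tuple_zero :: "'i \<Rightarrow> 'a \<Rightarrow> complex" where "tuple_zero \<equiv> \<lambda>w x. 0"

definition EP_tuple :: "('i \<Rightarrow> 'a::euclidean_space \<Rightarrow> complex) \<Rightarrow> bool" where
  "EP_tuple G \<longleftrightarrow> (\<forall>w. G w \<in> EP)"

lemma tuple_ops_simps [simp]:
  "tuple_ops [] G = G" "tuple_ops ((u, z) # D) G = tuple_op u z (tuple_ops D G)"
  "tuple_ops (D @ D') G = tuple_ops D (tuple_ops D' G)"
  by (simp_all add: tuple_ops_def)

lemma EP_tuple_op: "EP_tuple G \<Longrightarrow> EP_tuple (tuple_op u z G)"
  by (simp add: EP_tuple_def tuple_op_def lin_factor_EP)

lemma EP_tuple_ops: "EP_tuple G \<Longrightarrow> EP_tuple (tuple_ops D G)"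
  by (induction D) (auto intro: EP_tuple_op)

lemma tuple_op_zero: "tuple_op u z tuple_zero = tuple_zero"
  by (simp add: tuple_op_def lin_factor_def)

lemma tuple_ops_zero: "tuple_ops D tuple_zero = tuple_zero"
  by (induction D) (auto simp: tuple_op_zero)

lemma lin_factor_commute:
  "h \<in> EP \<Longrightarrow> lin_factor u z (lin_factor v y h) = lin_factor v y (lin_factor u z h)"
proof -
  assume h: "h \<in> EP"
  note d = elementary_differentiable[OF h] elementary_differentiable[OF elementary_dir_deriv[OF h]]
  have e: "lin_factor u z (lin_factor v y h) x =
    dir_deriv u (dir_deriv v h) x - y * dir_deriv u h x - z * (dir_deriv v h x - y * h x)" for u z v y x
    using d by (simp add: lin_factor_def dir_deriv_diff dir_deriv_cmult)
  show ?thesis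
  proof
    fix x show "lin_factor u z (lin_factor v y h) x = lin_factor v y (lin_factor u z h) x"
      unfolding e using elementary_dir_deriv_commute[OF h, of u v] by (simp add: algebra_simps)
  qed
qed

lemma tuple_op_commute:
  "EP_tuple G \<Longrightarrow> tuple_op u z (tuple_op v y G) = tuple_op v y (tuple_op u z G)"
  unfolding tuple_op_def EP_tuple_def using lin_factor_commute by blast

lemma tuple_op_ops_commute:
  "EP_tuple G \<Longrightarrow> tuple_op u z (tuple_ops D G) = tuple_ops D (tuple_op u z G)"
proof (induction D)
  case (Cons t D)
  obtain v y where t: "t = (v, y)" by force
  show ?case
    by (simp only: t tuple_ops_simps tuple_op_commute[OF EP_tuple_ops[OF Cons.prems], of u z v y] Cons.IH[OF Cons.prems])
qed simp

lemma tuple_ops_commute: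
  "EP_tuple G \<Longrightarrow> tuple_ops D (tuple_ops D' G) = tuple_ops D' (tuple_ops D G)"
proof (induction D)
  case (Cons t D)
  obtain v y where t: "t = (v, y)" by force
  show ?case using Cons tuple_op_ops_commute[OF EP_tuple_ops[OF Cons.prems]] by (simp add: t)
qed simp

lemma tuple_ops_partition:
  "EP_tuple G \<Longrightarrow> tuple_ops D G = tuple_ops (filter Q D) (tuple_ops (filter (\<lambda>d. \<not> Q d) D) G)"
proof (induction D)
  case (Cons t D)
  obtain v y where t: "t = (v, y)" by force
  show ?case
    using Cons tuple_op_ops_commute[OF EP_tuple_ops[OF Cons.prems], of v y "filter Q D" "filter (\<lambda>d. \<not> Q d) D"]
    by (auto simp: t)
qed simp

text \<open>Apply the factors in turn: the last tuple before zero is reached is a non-zero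
  eigenvector of the next factor.\<close>

lemma tuple_ops_first_kill:
  "G \<noteq> tuple_zero \<Longrightarrow> tuple_ops (map (Pair u) zs) G = tuple_zero \<Longrightarrow>
    \<exists>D. \<exists>z\<in>set zs. tuple_ops D G \<noteq> tuple_zero \<and> tuple_op u z (tuple_ops D G) = tuple_zero"
proof (induction zs)
  case (Cons z zs)
  show ?case
  proof (cases "tuple_ops (map (Pair u) zs) G = tuple_zero")
    case True
    then show ?thesis using Cons by auto
  next
    case False
    then show ?thesis using Cons.prems(2) by (intro exI[of _ "map (Pair u) zs"] bexI[of _ z]) auto
  qed
qed simp

text \<open>A common eigenvector is found one direction at a time; eigenvalue equations obtained
  earlier survive because all these operators commute.\<close>

lemma joint_kill:
  assumes G: "EP_tuple G" "G \<noteq> tuple_zero"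
    and ode: "\<And>b. b \<in> B \<Longrightarrow> tuple_ops (map (Pair b) (zs b)) G = tuple_zero" and B: "finite B"
  shows "\<exists>D. tuple_ops D G \<noteq> tuple_zero \<and> (\<forall>b\<in>B. \<exists>z\<in>set (zs b). tuple_op b z (tuple_ops D G) = tuple_zero)"
  using B ode
proof (induction B rule: finite_induct)
  case empty then show ?case using G by (intro exI[of _ "[]"]) auto
next
  case (insert b B)
  then obtain D where D: "tuple_ops D G \<noteq> tuple_zero" "\<forall>b\<in>B. \<exists>z\<in>set (zs b). tuple_op b z (tuple_ops D G) = tuple_zero"
    by auto
  have "tuple_ops (map (Pair b) (zs b)) (tuple_ops D G) = tuple_zero"
    using tuple_ops_commute[OF G(1), of "map (Pair b) (zs b)" D] insert.prems[of b] by (simp add: tuple_ops_zero)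
  then obtain D' z where D': "z \<in> set (zs b)" "tuple_ops D' (tuple_ops D G) \<noteq> tuple_zero"
    "tuple_op b z (tuple_ops D' (tuple_ops D G)) = tuple_zero"
    using tuple_ops_first_kill[OF D(1)] by blast
  have "\<exists>z\<in>set (zs c). tuple_op c z (tuple_ops D' (tuple_ops D G)) = tuple_zero" if "c \<in> B" for c
    using D(2) that tuple_op_ops_commute[OF EP_tuple_ops[OF G(1)], of c _ D' D] by (metis tuple_ops_zero)
  then show ?case using D' by (intro exI[of _ "D' @ D"]) auto
qed

lemma EP_exponential:
  assumes h: "h \<in> EP" and d: "\<And>b x. b \<in> Basis \<Longrightarrow> dir_deriv b h x = ceval \<nu> b * h x"
  shows "h x = h 0 * exp (ceval \<nu> x)" "dir_deriv u h x = ceval \<nu> u * h x"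
proof -
  have cb: "ceval \<nu> u = (\<Sum>b\<in>Basis. of_real (u \<bullet> b) * ceval \<nu> b)" for u
    by (subst euclidean_representation[of u, symmetric]) (simp add: ceval_sum ceval_scale)
  show du: "dir_deriv u h x = ceval \<nu> u * h x" for u x
    by (subst EP_dir_deriv_Basis[OF h], subst cb) (simp add: d sum_distrib_right mult.assoc)
  have "\<exists>c. \<forall>t\<in>UNIV. h (0 + t *\<^sub>R x) * exp (- of_real t * ceval \<nu> x) = c"
  proof (rule has_derivative_zero_constant)
    fix t :: real
    have "((\<lambda>t. h (0 + t *\<^sub>R x)) has_vector_derivative ceval \<nu> x * h (0 + t *\<^sub>R x)) (at t)"
      using dir_deriv_line[OF elementary_differentiable[OF h], where x = 0 and t = t and u = x] by (simp add: du)
    moreover have "((\<lambda>t::real. exp (- of_real t * ceval \<nu> x)) has_vector_derivative - ceval \<nu> x * exp (- of_real t * ceval \<nu> x)) (at t)"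
      using expo_monomial_deriv[of 0 "- ceval \<nu> x" t] by (simp add: expo_monomial_def[abs_def] mult.commute)
    ultimately have "((\<lambda>t. h (0 + t *\<^sub>R x) * exp (- of_real t * ceval \<nu> x)) has_vector_derivative
      h (0 + t *\<^sub>R x) * (- ceval \<nu> x * exp (- of_real t * ceval \<nu> x)) +
      ceval \<nu> x * h (0 + t *\<^sub>R x) * exp (- of_real t * ceval \<nu> x)) (at t)"
      by (rule has_vector_derivative_mult)
    then show "((\<lambda>t. h (0 + t *\<^sub>R x) * exp (- of_real t * ceval \<nu> x)) has_derivative (\<lambda>h. 0)) (at t within UNIV)"
      by (simp add: has_vector_derivative_def mult_ac)
  qed simp
  then obtain c where c: "\<And>t. h (0 + t *\<^sub>R x) * exp (- of_real t * ceval \<nu> x) = c" by blast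
  show "h x = h 0 * exp (ceval \<nu> x)"
    using c[of 0] c[of 1] by (simp add: exp_minus field_simps)
qed

text \<open>Along the ray through \<open>x\<close>, the product of \<open>h\<close> with the
  exponential of \<open>- \<nu>\<close> has the constant derivative \<open>l x\<close>.\<close>

lemma EP_affine_exponential:
  assumes h: "h \<in> EP" and d: "\<And>u x. dir_deriv u h x = ceval \<nu> u * h x + l u * exp (ceval \<nu> x)"
  shows "h x = (h 0 + l x) * exp (ceval \<nu> x)"
proof -
  let ?g = "\<lambda>t::real. h (0 + t *\<^sub>R x) * exp (- of_real t * ceval \<nu> x) - of_real t * l x"
  have "\<exists>c. \<forall>t\<in>UNIV. ?g t = c"
  proof (rule has_derivative_zero_constant)
    fix t :: real
    have e: "exp (of_real t * ceval \<nu> x) * exp (- of_real t * ceval \<nu> x) = 1" by (simp flip: exp_add)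
    have "((\<lambda>t. h (0 + t *\<^sub>R x)) has_vector_derivative ceval \<nu> x * h (0 + t *\<^sub>R x) + l x * exp (of_real t * ceval \<nu> x)) (at t)"
      using dir_deriv_line[OF elementary_differentiable[OF h], where x = 0 and t = t and u = x] by (simp add: d ceval_scale)
    moreover have "((\<lambda>t::real. exp (- of_real t * ceval \<nu> x)) has_vector_derivative - ceval \<nu> x * exp (- of_real t * ceval \<nu> x)) (at t)"
      using expo_monomial_deriv[of 0 "- ceval \<nu> x" t] by (simp add: expo_monomial_def[abs_def] mult.commute)
    ultimately have 1: "((\<lambda>t. h (0 + t *\<^sub>R x) * exp (- of_real t * ceval \<nu> x)) has_vector_derivative
      h (0 + t *\<^sub>R x) * (- ceval \<nu> x * exp (- of_real t * ceval \<nu> x)) +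
      (ceval \<nu> x * h (0 + t *\<^sub>R x) + l x * exp (of_real t * ceval \<nu> x)) * exp (- of_real t * ceval \<nu> x)) (at t)"
      by (rule has_vector_derivative_mult)
    have "h (0 + t *\<^sub>R x) * (- ceval \<nu> x * exp (- of_real t * ceval \<nu> x)) +
      (ceval \<nu> x * h (0 + t *\<^sub>R x) + l x * exp (of_real t * ceval \<nu> x)) * exp (- of_real t * ceval \<nu> x) =
      l x * (exp (of_real t * ceval \<nu> x) * exp (- of_real t * ceval \<nu> x))" by (simp add: algebra_simps)
    then have 1: "((\<lambda>t. h (0 + t *\<^sub>R x) * exp (- of_real t * ceval \<nu> x)) has_vector_derivative l x) (at t)"
      using 1 unfolding e by (simp only: mult_1_right)
    have "((\<lambda>t. of_real t * l x) has_vector_derivative 1 * l x) (at t)"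
      by (rule has_vector_derivative_mult_left) (auto intro!: derivative_eq_intros)
    from has_vector_derivative_diff[OF 1 this] have "(?g has_vector_derivative 0) (at t)" by simp
    then show "(?g has_derivative (\<lambda>h. 0)) (at t within UNIV)" by (simp add: has_vector_derivative_def)
  qed simp
  then obtain c where c: "\<And>t. ?g t = c" by blast
  have "h x * exp (- ceval \<nu> x) = h 0 + l x" using c[of 0] c[of 1] by (simp add: algebra_simps)
  then show ?thesis by (simp add: exp_minus field_simps)
qed

text \<open>The operator \<open>\<partial>_u - \<nu>0(u)\<close> removes one exponential and
  multiplies the others by \<open>\<nu>(u) - \<nu>0(u)\<close>. For
  \<open>\<nu> \<noteq> \<nu>0\<close> some \<open>u\<close> makes this factor non-zero.\<close>

lemma exponentials_independent:
  fixes C :: "'a::euclidean_space cdual \<Rightarrow> complex"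
  assumes "finite S" "\<And>x. (\<Sum>\<nu>\<in>S. C \<nu> * exp (ceval \<nu> x)) = 0" "\<nu> \<in> S"
  shows "C \<nu> = 0"
  using assms
proof (induction S arbitrary: C \<nu> rule: finite_induct)
  case (insert \<nu>0 S)
  let ?f = "\<lambda>x. \<Sum>\<nu>\<in>insert \<nu>0 S. C \<nu> * exp (ceval \<nu> x)"
  have D: "(\<Sum>\<nu>\<in>insert \<nu>0 S. C \<nu> * (ceval \<nu> u * exp (ceval \<nu> x))) = 0" for u x
  proof -
    have "(?f has_derivative (\<lambda>u. \<Sum>\<nu>\<in>insert \<nu>0 S. C \<nu> * (ceval \<nu> u * exp (ceval \<nu> x)))) (at x)"
    proof (intro has_derivative_sum has_derivative_mult_right)
      fix \<nu>
      show "((\<lambda>x. exp (ceval \<nu> x)) has_derivative (\<lambda>u. ceval \<nu> u * exp (ceval \<nu> x))) (at x)"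
        using has_derivative_dir_deriv[OF exp_ceval_differentiable[of \<nu> x]] by (simp add: dir_deriv_exp)
    qed
    from dir_deriv_eqI[OF this, of u] show ?thesis using insert.prems(1) by simp
  qed
  have S0: "C \<nu> = 0" if \<nu>: "\<nu> \<in> S" for \<nu>
  proof (rule ccontr)
    assume nz: "C \<nu> \<noteq> 0"
    have "ceval \<nu> u = ceval \<nu>0 u" for u
    proof -
      have "(\<Sum>\<nu>\<in>S. (C \<nu> * (ceval \<nu> u - ceval \<nu>0 u)) * exp (ceval \<nu> x)) = 0" for x
      proof -
        have "(\<Sum>\<nu>\<in>S. (C \<nu> * (ceval \<nu> u - ceval \<nu>0 u)) * exp (ceval \<nu> x)) =
          (\<Sum>\<nu>\<in>insert \<nu>0 S. C \<nu> * (ceval \<nu> u * exp (ceval \<nu> x))) - ceval \<nu>0 u * ?f x"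
          using insert.hyps by (simp add: sum_subtractf sum_distrib_left algebra_simps)
        then show ?thesis using D[of u x] insert.prems(1)[of x] by simp
      qed
      from insert.IH[OF this \<nu>] show ?thesis using nz by simp
    qed
    then have "fst \<nu> \<bullet> u = fst \<nu>0 \<bullet> u" "snd \<nu> \<bullet> u = snd \<nu>0 \<bullet> u" for u
      by (metis ceval_def complex.inject)+
    then have "fst \<nu> = fst \<nu>0" "snd \<nu> = snd \<nu>0" using vector_eq_rdot by blast+
    then have "\<nu> = \<nu>0" by (rule prod_eqI)
    then show False using \<nu> insert.hyps by simp
  qed
  then have "C \<nu>0 = 0" using insert.prems(1)[of 0] insert.hyps by simp
  then show ?case using S0 insert.prems(2) by blast
qed simp

text \<open>A real vector space is not a finite union of proper hyperplanes, which are null sets. A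
  choice of \<open>s\<close> depending on the direction can therefore be made uniform.\<close>

lemma ceval_eq_cover:
  fixes \<nu> :: "'a::euclidean_space cdual"
  assumes S: "finite S" and c: "\<And>u. \<exists>s\<in>S. ceval \<nu> u = ceval (m s) u"
  shows "\<exists>s\<in>S. \<nu> = m s"
proof (rule ccontr)
  assume "\<not> ?thesis"
  then have ne: "\<And>s. s \<in> S \<Longrightarrow> \<nu> \<noteq> m s" by blast
  have "negligible {u. ceval \<nu> u = ceval (m s) u}" if s: "s \<in> S" for s
  proof -
    consider "fst \<nu> - fst (m s) \<noteq> 0" | "snd \<nu> - snd (m s) \<noteq> 0" using ne[OF s] by (metis prod_eqI right_minus_eq)
    then show ?thesis
    proof cases
      case 1
      have "{u. ceval \<nu> u = ceval (m s) u} \<subseteq> {u. (fst \<nu> - fst (m s)) \<bullet> u = 0}"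
        by (auto simp: ceval_def inner_diff_left)
      then show ?thesis using negligible_hyperplane[of "fst \<nu> - fst (m s)" 0] 1 negligible_subset by blast
    next
      case 2
      have "{u. ceval \<nu> u = ceval (m s) u} \<subseteq> {u. (snd \<nu> - snd (m s)) \<bullet> u = 0}"
        by (auto simp: ceval_def inner_diff_left)
      then show ?thesis using negligible_hyperplane[of "snd \<nu> - snd (m s)" 0] 2 negligible_subset by blast
    qed
  qed
  then have "negligible (\<Union>s\<in>S. {u. ceval \<nu> u = ceval (m s) u})" using S by (intro negligible_Union) auto
  moreover have "(\<Union>s\<in>S. {u. ceval \<nu> u = ceval (m s) u}) = UNIV" using c by auto
  ultimately show False using non_negligible_UNIV by metis
qed

text \<open>A minimal non-vanishing product of the nilpotent operators \<open>b - \<nu>(b)\<close> splits off an element on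
  which they act as first-order operators.\<close>

lemma nilpotent_reduction:
  assumes G: "EP_tuple G" "G \<noteq> tuple_zero" and B: "finite B"
    and nil: "\<And>b. b \<in> B \<Longrightarrow> \<exists>N. tuple_ops (replicate N (b, y b)) G = tuple_zero"
    and ne: "\<exists>b\<in>B. tuple_op b (y b) G \<noteq> tuple_zero"
  shows "\<exists>D. (\<exists>b\<in>B. tuple_op b (y b) (tuple_ops D G) \<noteq> tuple_zero) \<and>
    (\<forall>b\<in>B. \<forall>c\<in>B. tuple_op b (y b) (tuple_op c (y c) (tuple_ops D G)) = tuple_zero)"
proof -
  let ?D = "\<lambda>us. map (\<lambda>b. (b, y b)) us"
  \<comment> \<open>Pigeonhole: a long product of the commuting operators contains either many
    copies of the one for \<open>b\<close>, enough to vanish, or many factors from the remaining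
    directions.\<close>
  have "\<exists>M. \<forall>us. set us \<subseteq> B \<longrightarrow> M \<le> length us \<longrightarrow> tuple_ops (?D us) G = tuple_zero"
    using B nil
  proof (induction B rule: finite_induct)
    case empty
    then show ?case by (intro exI[of _ 1]) auto
  next
    case (insert b B)
    then obtain M where M: "\<And>us. set us \<subseteq> B \<Longrightarrow> M \<le> length us \<Longrightarrow> tuple_ops (?D us) G = tuple_zero" by blast
    obtain N where N: "tuple_ops (replicate N (b, y b)) G = tuple_zero" using insert.prems by blast
    have "tuple_ops (?D us) G = tuple_zero" if us: "set us \<subseteq> insert b B" "M + N \<le> length us" for us
    proof -
      let ?p = "filter (\<lambda>c. c = b) us" and ?q = "filter (\<lambda>c. c \<noteq> b) us"
      have fm: "filter (\<lambda>d. Q (fst d)) (?D vs) = ?D (filter Q vs)" for Q vs by (induction vs) auto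
      have part: "tuple_ops (?D us) G = tuple_ops (?D ?p) (tuple_ops (?D ?q) G)"
        using tuple_ops_partition[OF G(1), of "?D us" "\<lambda>d. fst d = b"] fm[of "\<lambda>c. c = b" us] fm[of "\<lambda>c. c \<noteq> b" us] by simp
      have len: "length ?p + length ?q = length us" by (rule sum_length_filter_compl)
      have pr: "?p = replicate (length ?p) b" by (induction us) auto
      show ?thesis
      proof (cases "N \<le> length ?p")
        case True
        then have "?D ?p = replicate (length ?p - N) (b, y b) @ replicate N (b, y b)"
          by (subst pr) (simp flip: replicate_add)
        then have "tuple_ops (?D ?p) G = tuple_zero" using N by (simp add: tuple_ops_zero)
        then show ?thesis unfolding part by (subst tuple_ops_commute[OF G(1)]) (simp add: tuple_ops_zero)
      next
        case False
        then have "tuple_ops (?D ?q) G = tuple_zero" using us len by (intro M) auto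
        then show ?thesis unfolding part by (simp add: tuple_ops_zero)
      qed
    qed
    then show ?case by blast
  qed
  then have ex: "\<exists>M. \<forall>us. set us \<subseteq> B \<longrightarrow> length us = M \<longrightarrow> tuple_ops (?D us) G = tuple_zero"
    by (metis order_refl)
  \<comment> \<open>Some product of length \<open>M - 1\<close> does not vanish; dropping its first
    factor leaves an element killed by any two further factors but not by the dropped one. This
    needs \<open>M\<close> to be at least 2.\<close>
  define M where "M = (LEAST M. \<forall>us. set us \<subseteq> B \<longrightarrow> length us = M \<longrightarrow> tuple_ops (?D us) G = tuple_zero)"
  have M: "\<And>us. set us \<subseteq> B \<Longrightarrow> length us = M \<Longrightarrow> tuple_ops (?D us) G = tuple_zero"
    using LeastI_ex[OF ex] unfolding M_def by blast
  have Mmin: "\<exists>us. set us \<subseteq> B \<and> length us = m \<and> tuple_ops (?D us) G \<noteq> tuple_zero" if "m < M" for m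
    using not_less_Least[of m "\<lambda>M. \<forall>us. set us \<subseteq> B \<longrightarrow> length us = M \<longrightarrow> tuple_ops (?D us) G = tuple_zero"] that
    unfolding M_def by blast
  have "M \<noteq> 0" using M[of "[]"] G(2) by auto
  moreover have "M \<noteq> 1"
  proof
    assume "M = 1"
    then have "tuple_op b (y b) G = tuple_zero" if "b \<in> B" for b using M[of "[b]"] that by simp
    then show False using ne by blast
  qed
  ultimately obtain m where m: "M = Suc (Suc m)" by (metis One_nat_def old.nat.exhaust)
  then obtain us where us: "set us \<subseteq> B" "length us = Suc m" "tuple_ops (?D us) G \<noteq> tuple_zero"
    using Mmin[of "Suc m"] by auto
  then obtain b rest where r: "us = b # rest" by (cases us) auto
  have "tuple_op b (y b) (tuple_ops (?D rest) G) \<noteq> tuple_zero" "b \<in> B" using us r by auto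
  moreover have "tuple_op c (y c) (tuple_op d (y d) (tuple_ops (?D rest) G)) = tuple_zero" if "c \<in> B" "d \<in> B" for c d
    using M[of "c # d # rest"] us r m that by simp
  ultimately show ?thesis by (intro exI[of _ "?D rest"]) blast
qed

lemma finite_max_exists:
  fixes f :: "'b \<Rightarrow> real"
  assumes "finite S" "S \<noteq> {}"
  shows "\<exists>m\<in>S. \<forall>s\<in>S. f s \<le> f m"
proof -
  have "Max (f ` S) \<in> f ` S" using assms by simp
  then obtain m where "m \<in> S" "Max (f ` S) = f m" by auto
  then show ?thesis using assms by (metis Max_ge finite_imageI imageI)
qed

lemma lin_factor_exp:
  "lin_factor u z (\<lambda>x. c * exp (ceval \<nu> x)) = (\<lambda>x. (ceval \<nu> u - z) * c * exp (ceval \<nu> x))"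
  by (rule ext) (simp add: lin_factor_def dir_deriv_cmult exp_ceval_differentiable dir_deriv_exp algebra_simps)

lemma lin_factor_shift: "lin_factor u z (\<lambda>x. f (x + c)) = (\<lambda>x. lin_factor u z f (x + c))"
  using dir_deriv_shift[of u f "- c"] by (simp add: lin_factor_def)

lemma lin_factor_comb:
  "f \<in> EP \<Longrightarrow> g \<in> EP \<Longrightarrow> lin_factor u z (\<lambda>x. f x + c * g x) = (\<lambda>x. lin_factor u z f x + c * lin_factor u z g x)"
  by (rule ext)
     (simp add: lin_factor_def dir_deriv_add dir_deriv_cmult elementary_differentiable algebra_simps)

definition comb_tuple :: "('i \<Rightarrow> 'a \<Rightarrow> complex) \<Rightarrow> complex \<Rightarrow> ('i \<Rightarrow> 'a \<Rightarrow> complex) \<Rightarrow> 'i \<Rightarrow> 'a \<Rightarrow> complex" where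
  "comb_tuple G c H = (\<lambda>w x. G w x + c * H w x)"

lemma EP_comb_tuple: "EP_tuple G \<Longrightarrow> EP_tuple H \<Longrightarrow> EP_tuple (comb_tuple G c H)"
  unfolding EP_tuple_def comb_tuple_def by (simp add: elementary.add elementary_cmult)

lemma tuple_op_comb: "EP_tuple G \<Longrightarrow> EP_tuple H \<Longrightarrow>
  tuple_op u z (comb_tuple G c H) = comb_tuple (tuple_op u z G) c (tuple_op u z H)"
  unfolding EP_tuple_def comb_tuple_def tuple_op_def by (auto simp: lin_factor_comb)

lemma tuple_ops_comb: "EP_tuple G \<Longrightarrow> EP_tuple H \<Longrightarrow>
  tuple_ops D (comb_tuple G c H) = comb_tuple (tuple_ops D G) c (tuple_ops D H)"
proof (induction D)
  case (Cons t D)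
  obtain v y where t: "t = (v, y)" by force
  show ?case using Cons tuple_op_comb[OF EP_tuple_ops EP_tuple_ops] by (simp add: t)
qed simp

definition exp_tuple :: "('i \<Rightarrow> complex) \<Rightarrow> 'a::euclidean_space cdual \<Rightarrow> 'i \<Rightarrow> 'a \<Rightarrow> complex" where
  "exp_tuple c \<nu> = (\<lambda>w x. c w * exp (ceval \<nu> x))"

lemma tuple_op_exp: "tuple_op u z (exp_tuple c \<nu>) = exp_tuple (\<lambda>w. (ceval \<nu> u - z) * c w) \<nu>"
  by (simp add: tuple_op_def exp_tuple_def lin_factor_exp)

lemma tuple_ops_exp: "\<exists>q. tuple_ops D (exp_tuple c \<nu>) = exp_tuple (\<lambda>w. q * c w) \<nu> \<and>
  (q = 0 \<longleftrightarrow> (\<exists>(u, z)\<in>set D. ceval \<nu> u = z))"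
proof (induction D)
  case Nil then show ?case by (intro exI[of _ 1]) auto
next
  case (Cons t D)
  obtain v y where t: "t = (v, y)" by force
  from Cons obtain q where q: "tuple_ops D (exp_tuple c \<nu>) = exp_tuple (\<lambda>w. q * c w) \<nu>"
    "q = 0 \<longleftrightarrow> (\<exists>(u, z)\<in>set D. ceval \<nu> u = z)" by blast
  have "tuple_ops (t # D) (exp_tuple c \<nu>) = exp_tuple (\<lambda>w. ((ceval \<nu> v - y) * q) * c w) \<nu>"
    by (simp only: t tuple_ops_simps q(1) tuple_op_exp mult.assoc)
  moreover have "(ceval \<nu> v - y) * q = 0 \<longleftrightarrow> (\<exists>(u, z)\<in>set (t # D). ceval \<nu> u = z)"
    unfolding mult_eq_0_iff q(2) by (simp add: t)
  ultimately show ?case by blast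
qed

lemma exp_tuple_zero_iff: "exp_tuple c \<nu> = tuple_zero \<longleftrightarrow> (\<forall>w. c w = 0)"
  by (auto simp: exp_tuple_def fun_eq_iff)

lemma joint_eigen_exp:
  fixes H :: "'i \<Rightarrow> 'a::euclidean_space \<Rightarrow> complex"
  assumes H: "EP_tuple H" and e: "\<And>b. b \<in> Basis \<Longrightarrow> tuple_op b (z b) H = tuple_zero"
  shows "\<exists>c \<nu>. H = exp_tuple c \<nu> \<and> (\<forall>b\<in>Basis. ceval \<nu> b = z b)"
proof -
  define \<nu> where "\<nu> = ((\<Sum>b\<in>Basis. Re (z b) *\<^sub>R b), (\<Sum>b\<in>Basis. Im (z b) *\<^sub>R b) :: 'a)"
  have \<nu>: "ceval \<nu> b = z b" if "b \<in> Basis" for b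
    using that by (simp add: ceval_def \<nu>_def inner_sum_left_Basis)
  have "dir_deriv b (H w) x = ceval \<nu> b * H w x" if "b \<in> Basis" for b w x
    using e[OF that] \<nu>[OF that] by (simp add: tuple_op_def lin_factor_def fun_eq_iff)
  then have "H w x = H w 0 * exp (ceval \<nu> x)" for w x
    using EP_exponential(1)[of "H w" \<nu> x] H by (simp add: EP_tuple_def)
  then have "H = exp_tuple (\<lambda>w. H w 0) \<nu>" unfolding exp_tuple_def by blast
  then show ?thesis using \<nu> by blast
qed

context affine_root_system
begin

section \<open>Tuples satisfying the wall relations\<close>

lemma k_pos: "a \<in> aff_roots R \<Longrightarrow> 0 < k a"
  using multiplicity unfolding multiplicity_function_def by blast

text \<open>For the tuple of reflected copies of \<open>F\<close> these relations are
  \<open>wall_relation\<close> transported by \<open>w\<close>. Components outside \<open>W0\<close>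
  are zero, so that vanishing of a tuple concerns \<open>W0\<close> only.\<close>

definition good :: "(('a \<Rightarrow> 'a) \<Rightarrow> 'a \<Rightarrow> complex) \<Rightarrow> bool" where
  "good G \<longleftrightarrow> EP_tuple G \<and> (\<forall>w. w \<notin> W0 \<longrightarrow> G w = (\<lambda>x. 0)) \<and>
    (\<forall>w\<in>W0. \<forall>a\<in>A.
      (\<lambda>x. lin_factor (w (coroot (fst a))) (- of_real (k a)) (G (w \<circ> refl (fst a))) (x + snd a *\<^sub>R w (coroot (fst a)))) =
      lin_factor (w (coroot (fst a))) (of_real (k a)) (G w))"

lemma good_EP: "good G \<Longrightarrow> EP_tuple G" by (simp add: good_def)

lemma good_rel:
  assumes "good G" "w \<in> W0" "a \<in> A"
  shows "lin_factor (w (coroot (fst a))) (- of_real (k a)) (G (w \<circ> refl (fst a))) (x + snd a *\<^sub>R w (coroot (fst a))) =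
      lin_factor (w (coroot (fst a))) (of_real (k a)) (G w) x"
  using assms unfolding good_def by (metis (no_types, lifting))

text \<open>Both sides of a relation are built from constant coefficient operators and a
  translation, and an operator acting equally on all components commutes with these.\<close>

lemma good_op: "good G \<Longrightarrow> good (tuple_op u z G)"
  unfolding good_def
proof (intro conjI allI impI ballI)
  assume G: "EP_tuple G \<and> (\<forall>w. w \<notin> W0 \<longrightarrow> G w = (\<lambda>x. 0)) \<and>
    (\<forall>w\<in>W0. \<forall>a\<in>A.
      (\<lambda>x. lin_factor (w (coroot (fst a))) (- of_real (k a)) (G (w \<circ> refl (fst a))) (x + snd a *\<^sub>R w (coroot (fst a)))) =
      lin_factor (w (coroot (fst a))) (of_real (k a)) (G w))"
  then show "EP_tuple (tuple_op u z G)" using EP_tuple_op by blast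
  have EP: "G w \<in> EP" for w using G by (simp add: EP_tuple_def)
  fix w
  show "tuple_op u z G w = (\<lambda>x. 0)" if "w \<notin> W0" using G that by (simp add: tuple_op_def lin_factor_def)
  fix a assume w: "w \<in> W0" and a: "a \<in> A"
  let ?b = "w (coroot (fst a))"
  have "lin_factor u z (\<lambda>x. lin_factor ?b (- of_real (k a)) (G (w \<circ> refl (fst a))) (x + snd a *\<^sub>R ?b)) =
     lin_factor u z (lin_factor ?b (of_real (k a)) (G w))" using G w a by metis
  then show "(\<lambda>x. lin_factor ?b (- of_real (k a)) (tuple_op u z G (w \<circ> refl (fst a))) (x + snd a *\<^sub>R ?b)) =
      lin_factor ?b (of_real (k a)) (tuple_op u z G w)"
    unfolding lin_factor_shift tuple_op_def lin_factor_commute[OF EP, of u z] .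
qed

lemma good_ops: "good G \<Longrightarrow> good (tuple_ops D G)"
proof (induction D)
  case (Cons t D)
  then show ?case by (cases t) (simp add: good_op)
qed simp

lemma good_comb: "good G \<Longrightarrow> good H \<Longrightarrow> good (comb_tuple G c H)"
proof -
  assume G: "good G" and H: "good H"
  have EP: "G w \<in> EP" "H w \<in> EP" for w using good_EP[OF G] good_EP[OF H] by (auto simp: EP_tuple_def)
  have "lin_factor u z (comb_tuple G c H w) x = lin_factor u z (G w) x + c * lin_factor u z (H w) x" for u z w x
    unfolding comb_tuple_def lin_factor_comb[OF EP] ..
  then have "lin_factor (w (coroot (fst a))) (- of_real (k a)) (comb_tuple G c H (w \<circ> refl (fst a))) (x + snd a *\<^sub>R w (coroot (fst a))) =
      lin_factor (w (coroot (fst a))) (of_real (k a)) (comb_tuple G c H w) x" if "w \<in> W0" "a \<in> A" for w a x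
    using good_rel[OF G that, of x] good_rel[OF H that, of x] by simp
  moreover have "comb_tuple G c H w = (\<lambda>x. 0)" if "w \<notin> W0" for w
    using G H that by (simp add: good_def comb_tuple_def)
  ultimately show ?thesis unfolding good_def using EP_comb_tuple[OF good_EP[OF G] good_EP[OF H]] by blast
qed

lemma good_exp_rel:
  assumes "good (exp_tuple c \<nu>)" "w \<in> W0" "a \<in> A"
  defines "x \<equiv> ceval \<nu> (w (coroot (fst a)))"
  shows "(x + of_real (k a)) * exp (of_real (snd a) * x) * c (w \<circ> refl (fst a)) = (x - of_real (k a)) * c w"
  using good_rel[OF assms(1-3), of 0] unfolding exp_tuple_def lin_factor_exp
  by (simp add: ceval_scale x_def mult_ac)

text \<open>Composed with \<open>w\<close>, the functional is non-negative on the simple roots and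
  on \<open>- \<phi>\<close>. Since \<open>\<phi>\<close> is a combination of all simple roots with
  positive coefficients, every one of these values is zero.\<close>

lemma chamber_linear_zero:
  fixes l :: "'a \<Rightarrow> real"
  assumes l: "linear l" and w: "w \<in> W0" and nn: "\<And>a. a \<in> A \<Longrightarrow> 0 \<le> l (w (coroot (fst a)))"
  shows "l x = 0"
proof -
  define m where "m = (\<lambda>v. l (w v))"
  have lm: "linear m" unfolding m_def using linear_compose[OF W0_linear[OF w] l] by (simp add: o_def)
  have pos: "0 \<le> m (fst a)" if a: "a \<in> A" for a
  proof -
    have "0 \<le> (2 / (fst a \<bullet> fst a)) * m (fst a)"
      using nn[OF a] unfolding m_def coroot_def
      by (simp add: linear_cmul[OF W0_linear[OF w]] linear_cmul[OF l])
    moreover have "0 < 2 / (fst a \<bullet> fst a)" using A_ne0[OF a] by simp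
    ultimately show ?thesis using mult_pos_neg by (meson not_le)
  qed
  obtain c :: "'a \<Rightarrow> nat" where c: "\<phi> = (\<Sum>i\<in>I. real (c i) *\<^sub>R i)"
    using phi_nat_comb unfolding nat_combinations_def by auto
  have mi: "0 \<le> m i" if "i \<in> I" for i using pos[of "(i, 0)"] that by (auto simp: aff_basis_def)
  have "0 \<le> m (- \<phi>)" using pos[of "(- \<phi>, 1)"] by (auto simp: aff_basis_def)
  then have "m \<phi> \<le> 0" by (simp add: linear_neg[OF lm])
  then have "(\<Sum>i\<in>I. real (c i) * m i) \<le> 0" unfolding c by (simp add: linear_sum[OF lm] linear_cmul[OF lm])
  moreover have nn': "\<And>i. i \<in> I \<Longrightarrow> 0 \<le> real (c i) * m i" using mi by simp
  then have "0 \<le> (\<Sum>i\<in>I. real (c i) * m i)" by (rule sum_nonneg)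
  ultimately have "(\<Sum>i\<in>I. real (c i) * m i) = 0" by linarith
  then have cm: "\<forall>i\<in>I. real (c i) * m i = 0" using sum_nonneg_eq_0_iff[OF finite_I nn'] by simp
  have cne: "c i \<noteq> 0" if i: "i \<in> I" for i
  proof -
    have "\<phi> \<bullet> fund_weight i = (\<Sum>j\<in>I. real (c j) * (if j = i then 1 else 0))"
      by (subst c) (use fund_weight[OF i] in \<open>auto simp: inner_sum_left intro!: sum.cong\<close>)
    also have "\<dots> = real (c i)" using finite_I i by (simp add: if_distrib sum.delta cong: if_cong)
    finally show ?thesis using phi_weight[OF i] by auto
  qed
  have "m i = 0" if "i \<in> I" for i using bspec[OF cm that] cne[OF that] by simp
  then have "m v = 0" for v
    using linear_eq_0_on_span[OF lm, of I v] span_I by auto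
  from this[of "inv w x"] show ?thesis unfolding m_def by (simp add: W0_inv_apply[OF w])
qed

text \<open>Take \<open>w\<close> with \<open>cmod (c w)\<close> maximal and let \<open>x\<close> be
  the value of \<open>\<nu>\<close> at the transported co-root. If \<open>Re x < 0\<close>, then
  \<open>x + k\<close> has smaller modulus than \<open>x - k\<close> and the exponential has modulus
  at most 1, so the relation would force a larger coefficient at
  \<open>w \<circ> refl (fst a)\<close>. Hence all real parts are non-negative, and
  \<open>chamber_linear_zero\<close> applies.\<close>

lemma exp_tuple_imaginary:
  assumes g: "good (exp_tuple c \<nu>)" and nz: "exp_tuple c \<nu> \<noteq> tuple_zero"
  shows "fst \<nu> = 0"
proof -
  obtain w where w: "w \<in> W0" and max: "\<And>w'. w' \<in> W0 \<Longrightarrow> cmod (c w') \<le> cmod (c w)"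
    using finite_max_exists[OF finite_W0, of "\<lambda>w. cmod (c w)"] W0_id by blast
  obtain w1 where w1: "c w1 \<noteq> 0" using nz exp_tuple_zero_iff by blast
  then have "w1 \<in> W0" using g unfolding good_def exp_tuple_def by (metis exp_not_eq_zero mult_eq_0_iff)
  then have cw: "0 < cmod (c w)" using max[of w1] w1 less_le_trans[of 0 "cmod (c w1)" "cmod (c w)"] by simp
  have "0 \<le> fst \<nu> \<bullet> w (coroot (fst a))" if a: "a \<in> A" for a
  proof (rule ccontr)
    assume neg: "\<not> ?thesis"
    define x where "x = ceval \<nu> (w (coroot (fst a)))"
    have rx: "Re x < 0" using neg by (simp add: x_def ceval_def)
    have kp: "0 < k a" using k_pos A_roots a by blast
    have ws: "w \<circ> refl (fst a) \<in> W0" using W0_comp[OF w W0_refl] aff_root_fst A_roots a by blast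
    have "(cmod (x + of_real (k a)))\<^sup>2 < (cmod (x - of_real (k a)))\<^sup>2"
      unfolding cmod_power2 using mult_neg_pos[OF rx kp] by (simp add: power2_eq_square algebra_simps)
    then have lt: "cmod (x + of_real (k a)) < cmod (x - of_real (k a))"
      by (rule power2_less_imp_less) simp
    have s0: "0 \<le> snd a" using a by (auto simp: aff_basis_def)
    have "cmod (exp (of_real (snd a) * x)) \<le> 1"
      using rx s0 by (simp add: mult_nonneg_nonpos)
    then have "cmod (x + of_real (k a)) * cmod (exp (of_real (snd a) * x)) * cmod (c (w \<circ> refl (fst a))) \<le>
      cmod (x + of_real (k a)) * 1 * cmod (c w)"
      using max[OF ws] by (intro mult_mono) auto
    also have "\<dots> < cmod (x - of_real (k a)) * cmod (c w)" using lt cw by simp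
    finally show False
      using arg_cong[OF good_exp_rel[OF g w a], of cmod] by (simp add: norm_mult x_def)
  qed
  moreover have "linear (\<lambda>v. fst \<nu> \<bullet> v)" by (intro linearI) (auto simp: inner_add_right)
  ultimately have "fst \<nu> \<bullet> fst \<nu> = 0" using chamber_linear_zero[OF _ w] by blast
  then show ?thesis by simp
qed

text \<open>\<open>generated_by\<close> grows on the left whereas the relations multiply on the
  right, so the induction is run for all left factors \<open>v\<close> at once.\<close>

lemma W0_right_induct [consumes 1, case_names id step]:
  assumes w: "w \<in> W0" and 0: "Q id" and s: "\<And>w i. w \<in> W0 \<Longrightarrow> i \<in> I \<Longrightarrow> Q w \<Longrightarrow> Q (w \<circ> refl i)"
  shows "Q w"
proof -
  have "\<forall>v\<in>W0. Q v \<longrightarrow> Q (v \<circ> w)" using w unfolding W0_eq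
  proof (induction rule: generated_by.induct)
    case gen_id show ?case by simp
  next
    case (gen_comp r g)
    then obtain i where i: "i \<in> I" "r = refl i" by blast
    show ?case
    proof (intro ballI impI)
      fix v assume v: "v \<in> generated_by (refl ` I)" "Q v"
      have "v \<circ> r \<in> generated_by (refl ` I)" "Q (v \<circ> r)"
        using v s[of v i] i W0_comp[of v "refl i"] W0_refl I_R unfolding W0_eq by auto
      then have "Q ((v \<circ> r) \<circ> g)" using gen_comp.IH by blast
      then show "Q (v \<circ> (r \<circ> g))" by (simp only: comp_assoc)
    qed
  qed
  then have "Q (id \<circ> w)" using 0 W0_id by blast
  then show ?thesis by simp
qed

lemma imag_factor_ne0:
  assumes "fst \<nu> = 0" "a \<in> aff_roots R"
  shows "ceval \<nu> v + of_real (k a) \<noteq> 0" "ceval \<nu> v - of_real (k a) \<noteq> 0"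
  using k_pos[OF assms(2)] assms(1) by (auto simp: ceval_def complex_eq_iff)

lemma simple_A: "i \<in> I \<Longrightarrow> (i, 0) \<in> A" by (auto simp: aff_basis_def)

text \<open>For imaginary exponents \<open>x + k\<close> is not zero, so the relations for the
  simple roots determine all coefficients recursively from the one at the identity.\<close>

lemma exp_tuple_proportional:
  assumes g: "good (exp_tuple c \<nu>)" and g': "good (exp_tuple c' \<nu>)" and im: "fst \<nu> = 0" and w: "w \<in> W0"
  shows "c' w * c id = c w * c' id"
  using w
proof (induction rule: W0_right_induct)
  case (step w i)
  let ?x = "ceval \<nu> (w (coroot i))"
  note r = good_exp_rel[OF g step(1) simple_A[OF step(2)]] and r' = good_exp_rel[OF g' step(1) simple_A[OF step(2)]]
  have ne: "?x + of_real (k (i, 0)) \<noteq> 0" using imag_factor_ne0(1)[OF im A_roots[OF simple_A[OF step(2)]]] .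
  have "(?x + of_real (k (i, 0))) * (c' (w \<circ> refl i) * c id) = (?x - of_real (k (i, 0))) * (c' w * c id)"
    using r' by (simp add: mult.assoc[symmetric])
  also have "\<dots> = (?x - of_real (k (i, 0))) * c w * c' id" by (simp only: step(3) mult.assoc)
  also have "\<dots> = (?x + of_real (k (i, 0))) * (c (w \<circ> refl i) * c' id)"
    using r by (simp add: mult.assoc[symmetric])
  finally show ?case using mult_left_cancel[OF ne] by blast
qed simp

lemma exp_tuple_nonvanishing:
  assumes g: "good (exp_tuple c \<nu>)" and nz: "exp_tuple c \<nu> \<noteq> tuple_zero" and im: "fst \<nu> = 0" and w: "w \<in> W0"
  shows "c w \<noteq> 0"
proof -
  have *: "c w = 0 \<longleftrightarrow> c id = 0" if "w \<in> W0" for w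
    using that
  proof (induction rule: W0_right_induct)
    case (step w i)
    let ?x = "ceval \<nu> (w (coroot i))"
    have "?x + of_real (k (i, 0)) \<noteq> 0" "?x - of_real (k (i, 0)) \<noteq> 0"
      using imag_factor_ne0[OF im A_roots[OF simple_A[OF step(2)]]] by auto
    moreover have "(?x + of_real (k (i, 0))) * c (w \<circ> refl i) = (?x - of_real (k (i, 0))) * c w"
      using good_exp_rel[OF g step(1) simple_A[OF step(2)]] by simp
    ultimately show ?case using step(3) by (metis mult_eq_0_iff)
  qed simp
  obtain w1 where w1: "c w1 \<noteq> 0" using nz exp_tuple_zero_iff by blast
  then have "w1 \<in> W0" using g unfolding good_def exp_tuple_def by (metis exp_not_eq_zero mult_eq_0_iff)
  then show ?thesis using *[of w1] *[OF w] w1 by blast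
qed

text \<open>The infinitesimal version of the maximality argument for \<open>cmod (c w)\<close>.\<close>

lemma no_jordan_block:
  assumes gc: "good (exp_tuple c \<nu>)" and nz: "exp_tuple c \<nu> \<noteq> tuple_zero" and im: "fst \<nu> = 0"
    and gH: "good H" and l: "\<And>c u v. l (c *\<^sub>R u) = of_real c * l u" "\<And>u v. l (u + v) = l u + l v"
    and d: "\<And>w u x. w \<in> W0 \<Longrightarrow> dir_deriv u (H w) x = ceval \<nu> u * H w x + l u * c w * exp (ceval \<nu> x)"
  shows "l u = 0"
proof -
  have EP: "H w \<in> EP" for w using good_EP[OF gH] by (simp add: EP_tuple_def)
  have cne: "c w \<noteq> 0" if "w \<in> W0" for w by (rule exp_tuple_nonvanishing[OF gc nz im that])
  have Hx: "H w x = (H w 0 + l x * c w) * exp (ceval \<nu> x)" if "w \<in> W0" for w x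
    by (rule EP_affine_exponential[OF EP]) (rule d[OF that])
  \<comment> \<open>With this, \<open>H w x\<close> equals
    \<open>(r w + l x) * c w * exp (ceval \<nu> x)\<close>: \<open>r\<close> plays the role of a
    logarithmic derivative of the coefficients \<open>c w\<close>.\<close>
  define r where "r w = H w 0 / c w" for w
  have step: "\<exists>q>0. r (w \<circ> refl (fst a)) = r w - l (w (coroot (fst a))) * of_real q"
    if w: "w \<in> W0" and a: "a \<in> A" for w a
  proof -
    let ?b = "w (coroot (fst a))" and ?ws = "w \<circ> refl (fst a)"
    define x where "x = ceval \<nu> ?b"
    define y where "y = Im x"
    have xy: "x = \<i> * of_real y" using im by (simp add: x_def y_def ceval_def complex_eq_iff)
    let ?k = "complex_of_real (k a)" and ?t = "complex_of_real (snd a)"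
    have kp: "0 < k a" using k_pos A_roots a by blast
    have s0: "0 \<le> snd a" using a by (auto simp: aff_basis_def)
    have ws: "?ws \<in> W0" using W0_comp[OF w W0_refl] aff_root_fst A_roots a by blast
    have f: "x + ?k \<noteq> 0" "x - ?k \<noteq> 0" using imag_factor_ne0[OF im A_roots[OF a]] by (auto simp: x_def)
    define E where "E = exp (?t * x)"
    have lt: "l (snd a *\<^sub>R ?b) = ?t * l ?b" by (rule l(1))
    have c1: "(x + ?k) * E * c ?ws = (x - ?k) * c w" using good_exp_rel[OF gc w a] by (simp add: x_def E_def)
    have H1: "H ?ws (snd a *\<^sub>R ?b) = (H ?ws 0 + ?t * l ?b * c ?ws) * E"
      using Hx[OF ws, of "snd a *\<^sub>R ?b"] by (simp add: lt ceval_scale E_def x_def)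
    have "dir_deriv ?b (H ?ws) (snd a *\<^sub>R ?b) + ?k * H ?ws (snd a *\<^sub>R ?b) = dir_deriv ?b (H w) 0 - ?k * H w 0"
      using good_rel[OF gH w a, of 0] by (simp add: lin_factor_def)
    then have "x * H ?ws (snd a *\<^sub>R ?b) + l ?b * c ?ws * E + ?k * H ?ws (snd a *\<^sub>R ?b) =
       x * H w 0 + l ?b * c w - ?k * H w 0"
      using d[OF ws, of ?b "snd a *\<^sub>R ?b"] d[OF w, of ?b 0] by (simp add: x_def E_def ceval_scale)
    then have e: "(x + ?k) * E * H ?ws 0 + (x + ?k) * E * c ?ws * ?t * l ?b + l ?b * c ?ws * E =
       (x - ?k) * H w 0 + l ?b * c w"
      unfolding H1 by (simp add: algebra_simps)
    have h0: "H v 0 = r v * c v" if "v \<in> W0" for v using cne[OF that] by (simp add: r_def)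
    have c2: "E * c ?ws = (x - ?k) * c w / (x + ?k)" using c1 f by (simp add: field_simps)
    have "((x + ?k) * E * c ?ws) * (r ?ws + ?t * l ?b) + l ?b * (E * c ?ws) = (x - ?k) * c w * r w + l ?b * c w"
      using e by (simp add: h0[OF ws] h0[OF w] algebra_simps)
    then have "(x - ?k) * c w * (r ?ws + ?t * l ?b) + l ?b * ((x - ?k) * c w / (x + ?k)) = (x - ?k) * c w * r w + l ?b * c w"
      unfolding c1 c2 .
    then have "(x - ?k) * c w * (r ?ws + ?t * l ?b + l ?b / (x + ?k)) = (x - ?k) * c w * (r w + l ?b / (x - ?k))"
    proof -
      have 1: "p * c w * (r1 + t + m / q) = p * c w * (r1 + t) + m * (p * c w / q)" for p r1 t m q
        by (simp add: distrib_left mult_ac)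
      have 2: "p * c w * (r1 + m / p) = p * c w * r1 + m * c w" if "p \<noteq> 0" for p r1 m
        using that by (simp add: distrib_left)
      show ?thesis using \<open>(x - ?k) * c w * (r ?ws + ?t * l ?b) + l ?b * ((x - ?k) * c w / (x + ?k)) = (x - ?k) * c w * r w + l ?b * c w\<close>
        by (simp only: 1 2[OF f(2)])
    qed
    then have "r ?ws + ?t * l ?b + l ?b / (x + ?k) = r w + l ?b / (x - ?k)" using f cne[OF w] by simp
    then have "r ?ws = r w - l ?b * (?t + 1 / (x + ?k) - 1 / (x - ?k))" by (simp add: algebra_simps)
    \<comment> \<open>The logarithmic derivative of \<open>(x + k) / (x - k)\<close>. On the
      imaginary axis it is real and positive, which gives the jump of \<open>r\<close> a definite
      sign.\<close>
    moreover have "1 / (x + ?k) - 1 / (x - ?k) = of_real (2 * k a / ((k a)\<^sup>2 + y\<^sup>2))"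
    proof -
      have p: "(x + ?k) * (x - ?k) = - of_real ((k a)\<^sup>2 + y\<^sup>2)"
        by (simp add: xy algebra_simps power2_eq_square)
      have "1 / (x + ?k) - 1 / (x - ?k) = ((x - ?k) - (x + ?k)) / ((x + ?k) * (x - ?k))"
        using f by (simp add: diff_frac_eq)
      also have "(x - ?k) - (x + ?k) = - of_real (2 * k a)" by simp
      also have "- of_real (2 * k a) / ((x + ?k) * (x - ?k)) = of_real (2 * k a / ((k a)\<^sup>2 + y\<^sup>2))"
        unfolding p by (simp only: minus_divide_divide of_real_divide)
      finally show ?thesis .
    qed
    ultimately have "r ?ws = r w - l ?b * of_real (snd a + 2 * k a / ((k a)\<^sup>2 + y\<^sup>2))" by (simp add: add_diff_eq)
    moreover have "0 < snd a + 2 * k a / ((k a)\<^sup>2 + y\<^sup>2)"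
      using kp s0 by (intro add_nonneg_pos divide_pos_pos add_pos_nonneg) auto
    ultimately show ?thesis by blast
  qed
  \<comment> \<open>\<open>L\<close> stands for real and imaginary part. At an index maximizing
    \<open>L (r w)\<close> the jumps show that \<open>L \<circ> l\<close> is non-negative on all
    transported co-roots, so it vanishes.\<close>
  have part: "L (l u) = 0" if L: "linear L" "\<And>z q. L (z * of_real q) = L z * q" for L :: "complex \<Rightarrow> real"
  proof -
    obtain w where w: "w \<in> W0" and max: "\<And>w'. w' \<in> W0 \<Longrightarrow> L (r w') \<le> L (r w)"
      using finite_max_exists[OF finite_W0, of "\<lambda>w. L (r w)"] W0_id by blast
    have lin: "linear (\<lambda>u. L (l u))"
      by (intro linearI) (use l L in \<open>auto simp: linear_add mult.commute[of "of_real _"]\<close>)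
    have "0 \<le> L (l (w (coroot (fst a))))" if a: "a \<in> A" for a
    proof -
      obtain q where q: "q > 0" "r (w \<circ> refl (fst a)) = r w - l (w (coroot (fst a))) * of_real q"
        using step[OF w a] by blast
      have "w \<circ> refl (fst a) \<in> W0" using W0_comp[OF w W0_refl] aff_root_fst A_roots a by blast
      then have "L (r (w \<circ> refl (fst a))) \<le> L (r w)" by (rule max)
      then have "L (r w) - L (l (w (coroot (fst a)))) * q \<le> L (r w)"
        unfolding q(2) linear_diff[OF L(1)] L(2) .
      then show ?thesis using q(1) by (simp add: zero_le_mult_iff)
    qed
    from chamber_linear_zero[OF lin w this] show ?thesis by blast
  qed
  have "Re (l u) = 0" "Im (l u) = 0"
    by (rule part, auto intro!: linearI)+
  then show ?thesis by (simp add: complex_eq_iff)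
qed

text \<open>In direction \<open>u\<close>, the component of index \<open>w\<close> is governed by
  the orbit list of \<open>inv w u\<close>. Concatenation over the group gives one list that serves
  every component, at the price of repeated eigenvalues.\<close>

definition ode_list :: "'a cdual \<Rightarrow> 'a \<Rightarrow> complex list" where
  "ode_list \<mu> u = concat (map (\<lambda>w. map (ceval \<mu>) (orbit_list (inv w u))) W0_list)"

lemma ode_list_set: "z \<in> set (ode_list \<mu> u) \<Longrightarrow> \<exists>\<sigma>\<in>W0. z = ceval \<mu> (\<sigma> u)"
proof -
  assume "z \<in> set (ode_list \<mu> u)"
  then obtain w \<sigma> where ws: "w \<in> W0" "\<sigma> \<in> W0" "z = ceval \<mu> (\<sigma> (inv w u))"
    unfolding ode_list_def orbit_list_def using W0_list by auto
  then have "\<sigma> \<circ> inv w \<in> W0" "z = ceval \<mu> ((\<sigma> \<circ> inv w) u)" using W0_comp W0_inv by auto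
  then show ?thesis by blast
qed

section \<open>Joint eigenvectors and the decomposition into exponentials\<close>

definition solves_ode :: "'a cdual \<Rightarrow> (('a \<Rightarrow> 'a) \<Rightarrow> 'a \<Rightarrow> complex) \<Rightarrow> bool" where
  "solves_ode \<mu> G \<longleftrightarrow> (\<forall>u. tuple_ops (map (Pair u) (ode_list \<mu> u)) G = tuple_zero)"

lemma solves_ode_ops: "EP_tuple G \<Longrightarrow> solves_ode \<mu> G \<Longrightarrow> solves_ode \<mu> (tuple_ops D G)"
  unfolding solves_ode_def using tuple_ops_commute[of G _ D] by (metis tuple_ops_zero)

lemma solves_ode_comb: "EP_tuple G \<Longrightarrow> EP_tuple H \<Longrightarrow> solves_ode \<mu> G \<Longrightarrow> solves_ode \<mu> H \<Longrightarrow>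
  solves_ode \<mu> (comb_tuple G c H)"
  unfolding solves_ode_def by (simp add: tuple_ops_comb) (simp add: comb_tuple_def)

lemma ceval_cact: "w \<in> W0 \<Longrightarrow> ceval (cact w \<mu>) v = ceval \<mu> (inv w v)"
  by (simp add: ceval_def cact_def W0_adjoint)

text \<open>In every direction the value of \<nu> must be one of the listed eigenvalues, that is, a
  value of some element of the orbit of \<mu>. By \<open>ceval_eq_cover\<close> one element works
  for all directions.\<close>

lemma exp_tuple_orbit:
  assumes ode: "solves_ode \<mu> (exp_tuple c \<nu>)" and nz: "exp_tuple c \<nu> \<noteq> tuple_zero"
  shows "\<exists>w\<in>W0. \<nu> = cact w \<mu>"
proof -
  obtain w1 where w1: "c w1 \<noteq> 0" using nz exp_tuple_zero_iff by blast
  have "\<exists>\<sigma>\<in>W0. ceval \<nu> u = ceval (cact (inv \<sigma>) \<mu>) u" for u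
  proof -
    obtain q where q: "tuple_ops (map (Pair u) (ode_list \<mu> u)) (exp_tuple c \<nu>) = exp_tuple (\<lambda>w. q * c w) \<nu>"
      "q = 0 \<longleftrightarrow> (\<exists>(v, z)\<in>set (map (Pair u) (ode_list \<mu> u)). ceval \<nu> v = z)"
      using tuple_ops_exp by blast
    have "exp_tuple (\<lambda>w. q * c w) \<nu> = tuple_zero" using q(1) ode by (simp add: solves_ode_def)
    from exp_tuple_zero_iff[THEN iffD1, OF this, THEN spec[of _ w1]] have "q * c w1 = 0" .
    then have "q = 0" using w1 by simp
    then have "ceval \<nu> u \<in> set (ode_list \<mu> u)" using q(2) by auto
    then obtain \<sigma> where s: "\<sigma> \<in> W0" "ceval \<nu> u = ceval \<mu> (\<sigma> u)" using ode_list_set by blast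
    moreover have "inv (inv \<sigma>) = \<sigma>" using W0_inv(1)[OF s(1)] by (rule inv_inv_eq)
    ultimately have "ceval \<nu> u = ceval (cact (inv \<sigma>) \<mu>) u"
      using ceval_cact[OF W0_inv(2)[OF s(1)], of \<mu> u] by simp
    then show ?thesis using s(1) by blast
  qed
  from ceval_eq_cover[OF finite_W0 this] obtain \<sigma> where "\<sigma> \<in> W0" "\<nu> = cact (inv \<sigma>) \<mu>" by blast
  then show ?thesis using W0_inv(2) by blast
qed

lemma joint_eigen:
  assumes g: "good G" and ode: "solves_ode \<mu> G" and nz: "G \<noteq> tuple_zero"
  shows "\<exists>D c \<nu>. tuple_ops D G = exp_tuple c \<nu> \<and> exp_tuple c \<nu> \<noteq> tuple_zero \<and> fst \<nu> = 0 \<and> (\<exists>w\<in>W0. \<nu> = cact w \<mu>)"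
proof -
  have "\<And>b. b \<in> Basis \<Longrightarrow> tuple_ops (map (Pair b) (ode_list \<mu> b)) G = tuple_zero"
    using ode by (simp add: solves_ode_def)
  from joint_kill[OF good_EP[OF g] nz this finite_Basis] obtain D where D: "tuple_ops D G \<noteq> tuple_zero"
    "\<forall>b\<in>Basis. \<exists>z. tuple_op b z (tuple_ops D G) = tuple_zero" by blast
  obtain z where z: "\<And>b. b \<in> Basis \<Longrightarrow> tuple_op b (z b) (tuple_ops D G) = tuple_zero"
    using bchoice[OF D(2)] by blast
  obtain c \<nu> where c: "tuple_ops D G = exp_tuple c \<nu>"
    using joint_eigen_exp[OF EP_tuple_ops[OF good_EP[OF g]] z] by blast
  have g': "good (exp_tuple c \<nu>)" using good_ops[OF g, of D] c by simp
  have o': "solves_ode \<mu> (exp_tuple c \<nu>)" using solves_ode_ops[OF good_EP[OF g] ode, of D] c by simp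
  have nz': "exp_tuple c \<nu> \<noteq> tuple_zero" using D(1) c by simp
  show ?thesis using c nz' exp_tuple_imaginary[OF g' nz'] exp_tuple_orbit[OF o' nz'] by blast
qed

lemma nontrivial_imaginary:
  assumes g: "good G" and ode: "solves_ode \<mu> G" and nz: "G \<noteq> tuple_zero"
  shows "purely_imaginary \<mu>"
proof -
  obtain \<nu> w where "fst \<nu> = 0" "w \<in> W0" "\<nu> = cact w \<mu>" using joint_eigen[OF assms] by blast
  then have "w (fst \<mu>) = 0" by (simp add: cact_def)
  then have "fst \<mu> \<bullet> fst \<mu> = 0" using W0_inner[OF \<open>w \<in> W0\<close>, of "fst \<mu>" "fst \<mu>"] by simp
  then show ?thesis by (simp add: purely_imaginary_def)
qed

text \<open>In each direction \<open>b\<close>, apply the factors of the differential equation whose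
  eigenvalue differs from \<open>ceval \<nu> b\<close>. They act on the exponential by a non-zero
  scalar, so it survives, and only factors with the eigenvalue of \<nu> remain to annihilate the
  tuple.\<close>

lemma isolate_eigenvalue:
  assumes g: "good G" and ode: "solves_ode \<mu> G"
    and e: "tuple_op u z G = exp_tuple c \<nu>" and nz: "exp_tuple c \<nu> \<noteq> tuple_zero" and B: "finite B"
  shows "\<exists>D q. tuple_op u z (tuple_ops D G) = exp_tuple (\<lambda>w. q * c w) \<nu> \<and> q \<noteq> 0 \<and>
    (\<forall>b\<in>B. \<exists>N. tuple_ops (replicate N (b, ceval \<nu> b)) (tuple_ops D G) = tuple_zero)"
  using B
proof (induction B rule: finite_induct)
  case empty then show ?case using e by (intro exI[of _ "[]"] exI[of _ 1]) auto
next
  case (insert b B)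
  then obtain D q where D: "tuple_op u z (tuple_ops D G) = exp_tuple (\<lambda>w. q * c w) \<nu>" "q \<noteq> 0"
    "\<And>b. b \<in> B \<Longrightarrow> \<exists>N. tuple_ops (replicate N (b, ceval \<nu> b)) (tuple_ops D G) = tuple_zero" by blast
  let ?L = "map (Pair b) (ode_list \<mu> b)" and ?Q = "\<lambda>d. snd d = ceval \<nu> b"
  let ?E = "filter (\<lambda>d. \<not> ?Q d) ?L"
  note EP = good_EP[OF g] and EPD = EP_tuple_ops[OF good_EP[OF g], of D]
  obtain q' where q': "tuple_ops ?E (exp_tuple (\<lambda>w. q * c w) \<nu>) = exp_tuple (\<lambda>w. q' * (q * c w)) \<nu>"
    "q' = 0 \<longleftrightarrow> (\<exists>(v, y)\<in>set ?E. ceval \<nu> v = y)" using tuple_ops_exp by blast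
  have "q' \<noteq> 0" using q'(2) by auto
  moreover have "tuple_op u z (tuple_ops (?E @ D) G) = exp_tuple (\<lambda>w. (q' * q) * c w) \<nu>"
    by (simp only: tuple_ops_simps tuple_op_ops_commute[OF EPD] D(1) q'(1) mult.assoc)
  moreover have "\<exists>N. tuple_ops (replicate N (x, ceval \<nu> x)) (tuple_ops (?E @ D) G) = tuple_zero" if x: "x \<in> B" for x
  proof -
    obtain N where "tuple_ops (replicate N (x, ceval \<nu> x)) (tuple_ops D G) = tuple_zero" using D(3)[OF x] by blast
    then show ?thesis using tuple_ops_commute[OF EPD, of "replicate N (x, ceval \<nu> x)" ?E]
      by (intro exI[of _ N]) (simp add: tuple_ops_zero)
  qed
  moreover have "\<exists>N. tuple_ops (replicate N (b, ceval \<nu> b)) (tuple_ops (?E @ D) G) = tuple_zero"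
  proof -
    have f: "filter ?Q (map (Pair b) zs) = replicate (length (filter ?Q (map (Pair b) zs))) (b, ceval \<nu> b)" for zs
      by (induction zs) auto
    have "tuple_ops ?L (tuple_ops D G) = tuple_zero"
      using solves_ode_ops[OF EP ode, of D] unfolding solves_ode_def by blast
    then have "tuple_ops (filter ?Q ?L) (tuple_ops ?E (tuple_ops D G)) = tuple_zero"
      using tuple_ops_partition[OF EPD, of ?L ?Q] by simp
    then show ?thesis using f[of "ode_list \<mu> b"] by (metis tuple_ops_simps(3))
  qed
  ultimately show ?case using D(2)
    by (intro exI[of _ "?E @ D"] exI[of _ "q' * q"]) auto
qed

lemma tuple_op_linear:
  assumes H: "EP_tuple H"
  shows "tuple_op u (ceval \<nu> u) H w x = (\<Sum>b\<in>Basis. of_real (u \<bullet> b) * tuple_op b (ceval \<nu> b) H w x)"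
proof -
  have h: "H w \<in> EP" using H by (simp add: EP_tuple_def)
  have cb: "ceval \<nu> u = (\<Sum>b\<in>Basis. of_real (u \<bullet> b) * ceval \<nu> b)"
    by (subst euclidean_representation[of u, symmetric]) (simp add: ceval_sum ceval_scale)
  show ?thesis
    by (simp only: tuple_op_def lin_factor_def EP_dir_deriv_Basis[OF h, of u] cb right_diff_distrib
      sum_subtractf sum_distrib_right mult.assoc)
qed

text \<open>Otherwise, operators applied to \<open>tuple_op u z G\<close> leave a non-zero
  exponential tuple, whose exponent \<nu> satisfies \<open>ceval \<nu> u = z\<close>. Isolating
  \<nu> and passing to a minimal nilpotent step gives a tuple \<open>H\<close> on which each
  \<open>\<partial>_b - \<nu>(b)\<close> yields a multiple of one exponential tuple, the situation
  excluded by \<open>no_jordan_block\<close>.\<close>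

lemma semisimple:
  assumes g: "good G" and ode: "solves_ode \<mu> G" and sq: "tuple_op u z (tuple_op u z G) = tuple_zero"
  shows "tuple_op u z G = tuple_zero"
proof (rule ccontr)
  assume nz: "tuple_op u z G \<noteq> tuple_zero"
  note EP = good_EP[OF g]
  have "solves_ode \<mu> (tuple_op u z G)" using solves_ode_ops[OF EP ode, of "[(u, z)]"] by simp
  from joint_eigen[OF good_op[OF g] this nz] obtain D c \<nu> where
    D: "tuple_ops D (tuple_op u z G) = exp_tuple c \<nu>" "exp_tuple c \<nu> \<noteq> tuple_zero" "fst \<nu> = 0" by blast
  have D': "tuple_op u z (tuple_ops D G) = exp_tuple c \<nu>" using D(1) tuple_op_ops_commute[OF EP] by metis
  have "tuple_op u z (exp_tuple c \<nu>) = tuple_zero"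
    using D(1) sq tuple_op_ops_commute[OF EP_tuple_op[OF EP], of u z D u z] by (simp add: tuple_ops_zero)
  then have uz: "ceval \<nu> u = z" using D(2) unfolding tuple_op_exp exp_tuple_zero_iff by auto
  define G1 where "G1 = tuple_ops D G"
  have g1: "good G1" and o1: "solves_ode \<mu> G1" unfolding G1_def
    using good_ops[OF g] solves_ode_ops[OF EP ode] by auto
  from isolate_eigenvalue[OF g1 o1 D'[folded G1_def] D(2) finite_Basis] obtain E q where
    E: "tuple_op u z (tuple_ops E G1) = exp_tuple (\<lambda>w. q * c w) \<nu>" "q \<noteq> 0"
    "\<And>b. b \<in> Basis \<Longrightarrow> \<exists>N. tuple_ops (replicate N (b, ceval \<nu> b)) (tuple_ops E G1) = tuple_zero" by blast
  define G2 where "G2 = tuple_ops E G1"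
  have g2: "good G2" unfolding G2_def using good_ops[OF g1] .
  have nz2: "tuple_op u (ceval \<nu> u) G2 \<noteq> tuple_zero"
    using E(1,2) D(2) unfolding G2_def uz exp_tuple_zero_iff by (auto simp: exp_tuple_zero_iff)
  then have G2nz: "G2 \<noteq> tuple_zero" using tuple_op_zero by metis
  have ne: "\<exists>b\<in>Basis. tuple_op b (ceval \<nu> b) G2 \<noteq> tuple_zero"
  proof (rule ccontr)
    assume "\<not> ?thesis"
    then have "tuple_op u (ceval \<nu> u) G2 w x = 0" for w x
      unfolding tuple_op_linear[OF good_EP[OF g2], of u] by (intro sum.neutral) simp
    then show False using nz2 by blast
  qed
  from nilpotent_reduction[OF good_EP[OF g2] G2nz finite_Basis E(3)[folded G2_def] ne] obtain F b0 where
    F: "b0 \<in> Basis" "tuple_op b0 (ceval \<nu> b0) (tuple_ops F G2) \<noteq> tuple_zero"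
    "\<And>b c. b \<in> Basis \<Longrightarrow> c \<in> Basis \<Longrightarrow> tuple_op b (ceval \<nu> b) (tuple_op c (ceval \<nu> c) (tuple_ops F G2)) = tuple_zero"
    by blast
  define H where "H = tuple_ops F G2"
  have gH: "good H" unfolding H_def using good_ops[OF g2] .
  note EPH = good_EP[OF gH]
  have "\<exists>cb. tuple_op b (ceval \<nu> b) H = exp_tuple cb \<nu>" if b: "b \<in> Basis" for b
  proof -
    have "\<And>b'. b' \<in> Basis \<Longrightarrow> tuple_op b' (ceval \<nu> b') (tuple_op b (ceval \<nu> b) H) = tuple_zero"
      using F(3) b unfolding H_def by blast
    from joint_eigen_exp[OF EP_tuple_op[OF EPH] this] obtain cb \<nu>' where
      c: "tuple_op b (ceval \<nu> b) H = exp_tuple cb \<nu>'" "\<And>b. b \<in> Basis \<Longrightarrow> ceval \<nu>' b = ceval \<nu> b" by blast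
    have "ceval \<nu>' v = ceval \<nu> v" for v
      by (subst (1 2) euclidean_representation[of v, symmetric]) (simp add: ceval_sum ceval_scale c(2))
    then show ?thesis using c(1) unfolding exp_tuple_def by auto
  qed
  then obtain cc where cc: "\<And>b. b \<in> Basis \<Longrightarrow> tuple_op b (ceval \<nu> b) H = exp_tuple (cc b) \<nu>"
    using bchoice[of Basis "\<lambda>b cb. tuple_op b (ceval \<nu> b) H = exp_tuple cb \<nu>"] by blast
  let ?c = "cc b0"
  have gcc: "good (exp_tuple (cc b) \<nu>)" if "b \<in> Basis" for b using good_op[OF gH] cc[OF that] by metis
  have nzc: "exp_tuple ?c \<nu> \<noteq> tuple_zero" using F(2) cc[OF F(1)] unfolding H_def by simp
  have c0: "?c id \<noteq> 0" by (rule exp_tuple_nonvanishing[OF gcc[OF F(1)] nzc D(3) W0_id])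
  \<comment> \<open>By proportionality every coefficient vector \<open>cc b\<close> is a multiple of
    \<open>cc b0\<close>; \<open>l\<close> collects the ratios. By construction
    \<open>l b0 = 1\<close>, so the vanishing of \<open>l\<close> is absurd.\<close>
  define l where "l v = (\<Sum>b\<in>Basis. of_real (v \<bullet> b) * (cc b id / ?c id))" for v
  have cw: "cc b w = (cc b id / ?c id) * ?c w" if "b \<in> Basis" "w \<in> W0" for b w
    using exp_tuple_proportional[OF gcc[OF F(1)] gcc[OF that(1)] D(3) that(2)] c0 by (simp add: field_simps)
  have "l b0 = 0"
  proof (rule no_jordan_block[OF gcc[OF F(1)] nzc D(3) gH, of l])
    show "l (r *\<^sub>R v) = of_real r * l v" for r v by (simp add: l_def sum_distrib_left mult.assoc)
    show "l (v + v') = l v + l v'" for v v' by (simp add: l_def inner_add_left algebra_simps sum.distrib)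
    show "dir_deriv v (H w) x = ceval \<nu> v * H w x + l v * ?c w * exp (ceval \<nu> x)" if w: "w \<in> W0" for w v x
    proof -
      have "tuple_op v (ceval \<nu> v) H w x = (\<Sum>b\<in>Basis. of_real (v \<bullet> b) * (cc b w * exp (ceval \<nu> x)))"
        unfolding tuple_op_linear[OF EPH, of v] by (intro sum.cong refl) (simp add: cc exp_tuple_def)
      also have "\<dots> = l v * ?c w * exp (ceval \<nu> x)"
        unfolding l_def sum_distrib_right by (intro sum.cong refl) (simp add: cw[OF _ w] mult.assoc)
      finally show ?thesis by (simp add: tuple_op_def lin_factor_def algebra_simps)
    qed
  qed
  moreover have "l b0 = 1"
  proof -
    have "l b0 = (\<Sum>b\<in>Basis. if b = b0 then 1 else 0)"
      unfolding l_def using F(1) c0 by (intro sum.cong refl) (auto simp: inner_Basis)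
    then show ?thesis using F(1) by simp
  qed
  ultimately show False by simp
qed

definition orbit :: "'a cdual \<Rightarrow> 'a cdual set" where "orbit \<mu> = (\<lambda>w. cact w \<mu>) ` W0"

lemma finite_orbit: "finite (orbit \<mu>)" unfolding orbit_def using finite_W0 by simp

definition orbit_sum :: "'a cdual \<Rightarrow> ('a \<Rightarrow> complex) \<Rightarrow> bool" where
  "orbit_sum \<mu> h \<longleftrightarrow> (\<exists>C. \<forall>x. h x = (\<Sum>\<nu>\<in>orbit \<mu>. C \<nu> * exp (ceval \<nu> x)))"

lemma orbit_sum_add: "orbit_sum \<mu> f \<Longrightarrow> orbit_sum \<mu> g \<Longrightarrow> orbit_sum \<mu> (\<lambda>x. f x + g x)"
  unfolding orbit_sum_def
proof (elim exE)
  fix C D assume "\<forall>x. f x = (\<Sum>\<nu>\<in>orbit \<mu>. C \<nu> * exp (ceval \<nu> x))" "\<forall>x. g x = (\<Sum>\<nu>\<in>orbit \<mu>. D \<nu> * exp (ceval \<nu> x))"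
  then show "\<exists>C. \<forall>x. f x + g x = (\<Sum>\<nu>\<in>orbit \<mu>. C \<nu> * exp (ceval \<nu> x))"
    by (intro exI[of _ "\<lambda>\<nu>. C \<nu> + D \<nu>"]) (simp add: sum.distrib distrib_right)
qed

lemma orbit_sum_zero: "orbit_sum \<mu> (\<lambda>x. 0)"
  unfolding orbit_sum_def by (intro exI[of _ "\<lambda>_. 0"]) simp

text \<open>When the eigenvalue in front occurs again later, \<open>semisimple\<close> removes one
  of the two copies.\<close>

lemma squarefree_ode:
  assumes g: "good G" and ode: "solves_ode \<mu> G"
  shows "tuple_ops (map (Pair u) zs) G = tuple_zero \<Longrightarrow> tuple_ops (map (Pair u) (remdups zs)) G = tuple_zero"
  using g ode
proof (induction zs arbitrary: G)
  case (Cons z zs)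
  note g = Cons.prems(2) and ode = Cons.prems(3)
  note EP = good_EP[OF g]
  have e: "tuple_ops (map (Pair u) zs) (tuple_op u z G) = tuple_zero"
    using Cons.prems(1) tuple_op_ops_commute[OF EP] by (metis list.simps(9) tuple_ops_simps(2))
  have o: "solves_ode \<mu> (tuple_op u z G)" using solves_ode_ops[OF EP ode, of "[(u, z)]"] by simp
  have IH: "tuple_ops (map (Pair u) (remdups zs)) (tuple_op u z G) = tuple_zero"
    by (rule Cons.IH[OF e good_op[OF g] o])
  show ?case
  proof (cases "z \<in> set zs")
    case False
    then show ?thesis using IH tuple_op_ops_commute[OF EP, of u z] by simp
  next
    case True
    let ?L = "map (Pair u) (remdups zs)"
    let ?E = "filter (\<lambda>d. \<not> d = (u, z)) ?L"
    have "filter (\<lambda>d. d = (u, z)) (map (Pair u) ys) = map (Pair u) (filter (\<lambda>y. y = z) ys)" for ys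
      by (induction ys) auto
    moreover have "filter (\<lambda>y. y = z) (remdups zs) = [z]"
    proof -
      have "distinct ys \<Longrightarrow> z \<in> set ys \<Longrightarrow> filter (\<lambda>y. y = z) ys = [z]" for ys
        by (induction ys) (auto simp: filter_empty_conv)
      then show ?thesis using True by simp
    qed
    ultimately have f: "filter (\<lambda>d. d = (u, z)) ?L = [(u, z)]" by simp
    have p: "tuple_ops ?L K = tuple_op u z (tuple_ops ?E K)" if "EP_tuple K" for K
      using tuple_ops_partition[OF that, of ?L "\<lambda>d. d = (u, z)"] unfolding f by simp
    have "tuple_op u z (tuple_op u z (tuple_ops ?E G)) = tuple_zero"
      using IH p[OF EP_tuple_op[OF EP]] tuple_op_ops_commute[OF EP, of u z ?E] by simp
    then have "tuple_op u z (tuple_ops ?E G) = tuple_zero"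
      by (rule semisimple[OF good_ops[OF g] solves_ode_ops[OF EP ode]])
    then show ?thesis using p[OF EP] True by simp
  qed
qed simp

lemma comb_tuple_comb_zero: "comb_tuple tuple_zero p (comb_tuple tuple_zero q K) = comb_tuple tuple_zero (q * p) K"
proof (intro ext)
  fix w x
  have "p * (q * K w x) = q * p * K w x" by (simp only: ac_simps)
  then show "comb_tuple tuple_zero p (comb_tuple tuple_zero q K) w x = comb_tuple tuple_zero (q * p) K w x"
    unfolding comb_tuple_def add_0_left .
qed

text \<open>\<open>B\<close> contains the directions in which \<open>G\<close> is not yet known to
  be an eigenvector. In a direction \<open>b\<close> with distinct eigenvalues, Lagrange
  interpolation splits off one eigenspace after another, and each part has one undetermined
  direction less.\<close>

lemma good_orbit_sum:
  assumes "finite B" "B \<subseteq> Basis"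
  shows "good G \<Longrightarrow> solves_ode \<mu> G \<Longrightarrow> (\<forall>b\<in>Basis - B. \<exists>z. tuple_op b z G = tuple_zero) \<Longrightarrow> orbit_sum \<mu> (G id)"
  using assms
proof (induction B arbitrary: G rule: finite_induct)
  case empty
  show ?case
  proof (cases "G = tuple_zero")
    case True then show ?thesis using orbit_sum_zero by simp
  next
    case False
    obtain z where z: "\<And>b. b \<in> Basis \<Longrightarrow> tuple_op b (z b) G = tuple_zero"
      using bchoice[OF empty.prems(3)[unfolded Diff_empty]] by blast
    obtain c \<nu> where c: "G = exp_tuple c \<nu>" using joint_eigen_exp[OF good_EP[OF empty.prems(1)] z] by blast
    then have "\<nu> \<in> orbit \<mu>" using exp_tuple_orbit[of \<mu> c \<nu>] False empty.prems(2) unfolding orbit_def by blast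
    then have E: "G id x = (\<Sum>\<nu>'\<in>orbit \<mu>. (if \<nu>' = \<nu> then c id else 0) * exp (ceval \<nu>' x))" for x
      using finite_orbit by (simp add: c exp_tuple_def if_distrib[of "\<lambda>t. t * _"] sum.delta cong: if_cong)
    show ?thesis unfolding orbit_sum_def
      by (rule exI[where x = "\<lambda>\<nu>'. if \<nu>' = \<nu> then c id else 0"]) (rule allI, rule E)
  qed
next
  case (insert b B)
  note IH = insert.IH
  have main: "\<And>G. distinct zs \<Longrightarrow> good G \<Longrightarrow> solves_ode \<mu> G \<Longrightarrow>
     (\<forall>b\<in>Basis - insert b B. \<exists>z. tuple_op b z G = tuple_zero) \<Longrightarrow>
     tuple_ops (map (Pair b) zs) G = tuple_zero \<Longrightarrow> orbit_sum \<mu> (G id)" for zs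
  proof (induction zs)
    case Nil then show ?case using orbit_sum_zero by simp
  next
    case (Cons z zs)
    note g = Cons.prems(2) and ode = Cons.prems(3)
    note EP = good_EP[OF g]
    let ?K = "tuple_ops (map (Pair b) zs) G"
    note EPK = EP_tuple_ops[OF EP, of "map (Pair b) zs"]
    have Kz: "tuple_op b z ?K = tuple_zero" using Cons.prems(5) by simp
    have gK: "good ?K" and oK: "solves_ode \<mu> ?K" using good_ops[OF g] solves_ode_ops[OF EP ode] by auto
    have Ko: "\<exists>y. tuple_op x y G = tuple_zero \<and> tuple_op x y ?K = tuple_zero" if "x \<in> Basis - insert b B" for x
    proof -
      obtain y where "tuple_op x y G = tuple_zero" using Cons.prems(4) \<open>x \<in> Basis - insert b B\<close> by blast
      then show ?thesis using tuple_op_ops_commute[OF EP, of x y "map (Pair b) zs"] by (intro exI[of _ y]) (simp add: tuple_ops_zero)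
    qed
    \<comment> \<open>The scalar by which the product of the remaining factors acts on their image
      \<open>?K\<close>, an eigenvector for \<open>z\<close>. So \<open>?K\<close> divided by
      \<open>p\<close> is the projection of \<open>G\<close> to this eigenspace.\<close>
    define p where "p = (\<Prod>y\<leftarrow>zs. z - y)"
    have pne: "p \<noteq> 0" using Cons.prems(1) unfolding p_def by (auto simp: prod_list_zero_iff)
    have pK: "tuple_ops (map (Pair b) ys) ?K = comb_tuple tuple_zero (\<Prod>y\<leftarrow>ys. z - y) ?K" for ys
    proof (induction ys)
      case Nil show ?case by (simp add: comb_tuple_def)
    next
      case (Cons y ys)
      have "tuple_op b y ?K = comb_tuple tuple_zero (z - y) ?K"
        using Kz by (simp add: tuple_op_def lin_factor_def comb_tuple_def fun_eq_iff algebra_simps)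
      note y = this
      have "EP_tuple tuple_zero" by (simp add: EP_tuple_def elementary.const)
      note tc = tuple_op_comb[OF this EPK]
      have "tuple_ops (map (Pair b) (y # ys)) ?K = comb_tuple tuple_zero (\<Prod>y\<leftarrow>ys. z - y) (comb_tuple tuple_zero (z - y) ?K)"
        by (simp only: list.map tuple_ops_simps Cons tc tuple_op_zero y)
      then show ?case by (simp only: list.map prod_list.Cons comb_tuple_comb_zero)
    qed
    have EP0: "EP_tuple tuple_zero" by (simp add: EP_tuple_def elementary.const)
    let ?G1 = "comb_tuple tuple_zero (1/p) ?K" and ?G2 = "comb_tuple G (- (1/p)) ?K"
    have g0: "good tuple_zero" by (simp add: good_def EP0 lin_factor_def)
    have o0: "solves_ode \<mu> tuple_zero" by (simp add: solves_ode_def tuple_ops_zero)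
    have "orbit_sum \<mu> (?G1 id)"
    proof (rule IH)
      show "good ?G1" by (rule good_comb[OF g0 gK])
      show "solves_ode \<mu> ?G1" by (rule solves_ode_comb[OF EP0 EPK o0 oK])
      show "\<forall>x\<in>Basis - B. \<exists>y. tuple_op x y ?G1 = tuple_zero"
      proof
        fix x assume x: "x \<in> Basis - B"
        have "\<exists>y. tuple_op x y ?K = tuple_zero" using Ko[of x] Kz x by (cases "x = b") auto
        then obtain y where "tuple_op x y ?K = tuple_zero" by blast
        then have "tuple_op x y ?G1 = tuple_zero"
          unfolding tuple_op_comb[OF EP0 EPK] by (simp add: tuple_op_zero comb_tuple_def)
        then show "\<exists>y. tuple_op x y ?G1 = tuple_zero" by blast
      qed
    qed (use insert.prems in auto)
    moreover have "orbit_sum \<mu> (?G2 id)"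
    proof (rule Cons.IH)
      show "distinct zs" using Cons.prems(1) by simp
      show "good ?G2" by (rule good_comb[OF g gK])
      show "solves_ode \<mu> ?G2" by (rule solves_ode_comb[OF EP EPK ode oK])
      show "\<forall>x\<in>Basis - insert b B. \<exists>y. tuple_op x y ?G2 = tuple_zero"
      proof
        fix x assume "x \<in> Basis - insert b B"
        then obtain y where "tuple_op x y G = tuple_zero" "tuple_op x y ?K = tuple_zero" using Ko by blast
        then have "tuple_op x y ?G2 = tuple_zero" unfolding tuple_op_comb[OF EP EPK] by (simp add: comb_tuple_def)
        then show "\<exists>y. tuple_op x y ?G2 = tuple_zero" by blast
      qed
      show "tuple_ops (map (Pair b) zs) ?G2 = tuple_zero"
        unfolding tuple_ops_comb[OF EP EPK] pK using pne by (simp add: comb_tuple_def p_def fun_eq_iff)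
    qed
    ultimately have "orbit_sum \<mu> (\<lambda>x. ?G1 id x + ?G2 id x)" by (rule orbit_sum_add)
    moreover have "(\<lambda>x. ?G1 id x + ?G2 id x) = G id" by (simp add: comb_tuple_def fun_eq_iff)
    ultimately show ?case by (simp only:)
  qed
  show ?case
  proof (rule main[of "remdups (ode_list \<mu> b)"])
    have "tuple_ops (map (Pair b) (ode_list \<mu> b)) G = tuple_zero" using insert.prems(2) unfolding solves_ode_def by blast
    then show "tuple_ops (map (Pair b) (remdups (ode_list \<mu> b))) G = tuple_zero"
      by (rule squarefree_ode[OF insert.prems(1,2)])
  qed (use insert.prems in auto)
qed

end

lemma foldr_lin_factor_commute:
  "h \<in> EP \<Longrightarrow> foldr (lin_factor u) xs (foldr (lin_factor u) ys h) = foldr (lin_factor u) ys (foldr (lin_factor u) xs h)"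
proof (induction xs)
  case (Cons x xs)
  have "lin_factor u x (foldr (lin_factor u) ys g) = foldr (lin_factor u) ys (lin_factor u x g)" if "g \<in> EP" for g
    using that
  proof (induction ys)
    case (Cons y ys)
    then show ?case using lin_factor_commute[OF foldr_lin_factor_EP[OF Cons.prems, of u ys], of u x u y] by simp
  qed simp
  then show ?case using Cons foldr_lin_factor_EP[OF Cons.prems] by simp
qed simp

lemma foldr_lin_factor_zero: "foldr (lin_factor u) zs (\<lambda>x. 0) = (\<lambda>x. 0)"
  by (induction zs) (auto simp: lin_factor_def)

lemma weak_eigenfunction_mono: "weak_eigenfunction U p z f \<Longrightarrow> U' \<subseteq> U \<Longrightarrow> weak_eigenfunction U' p z f"
  unfolding weak_eigenfunction_def test_function_def by blast

lemma lin_factor_exp_sum: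
  assumes "finite S"
  shows "lin_factor u z (\<lambda>x. \<Sum>\<nu>\<in>S. C \<nu> * exp (ceval \<nu> x)) = (\<lambda>x. \<Sum>\<nu>\<in>S. (ceval \<nu> u - z) * C \<nu> * exp (ceval \<nu> x))"
proof
  fix x
  have "((\<lambda>x. \<Sum>\<nu>\<in>S. C \<nu> * exp (ceval \<nu> x)) has_derivative (\<lambda>u. \<Sum>\<nu>\<in>S. C \<nu> * (ceval \<nu> u * exp (ceval \<nu> x)))) (at x)"
  proof (intro has_derivative_sum has_derivative_mult_right)
    fix \<nu> :: "'a cdual"
    show "((\<lambda>x. exp (ceval \<nu> x)) has_derivative (\<lambda>u. ceval \<nu> u * exp (ceval \<nu> x))) (at x)"
      using has_derivative_dir_deriv[OF exp_ceval_differentiable[of \<nu> x]] by (simp add: dir_deriv_exp)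
  qed
  from dir_deriv_eqI[OF this, of u]
  show "lin_factor u z (\<lambda>x. \<Sum>\<nu>\<in>S. C \<nu> * exp (ceval \<nu> x)) x = (\<Sum>\<nu>\<in>S. (ceval \<nu> u - z) * C \<nu> * exp (ceval \<nu> x))"
    by (simp add: lin_factor_def sum_distrib_left flip: sum_subtractf) (simp add: algebra_simps)
qed

context affine_root_system
begin

section \<open>From a solution on the alcove to a tuple\<close>

lemma invariant_W_iff: "invariant_under W f \<longleftrightarrow> (\<forall>w\<in>W. \<forall>v. f (w v) = f v)"
proof
  assume inv: "invariant_under W f"
  show "\<forall>w\<in>W. \<forall>v. f (w v) = f v"
  proof (intro ballI allI)
    fix w v assume w: "w \<in> W"
    then have "act w f (w v) = f (w v)" using inv unfolding invariant_under_def by simp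
    then show "f (w v) = f v" by (simp add: act_def W_inv_apply[OF w])
  qed
next
  assume *: "\<forall>w\<in>W. \<forall>v. f (w v) = f v"
  show "invariant_under W f" unfolding invariant_under_def act_def
    using * W_inv(2) by (intro ballI ext) blast
qed

text \<open>The jump condition yields information only at relatively interior points of the wall. An
  arbitrary point of the hyperplane is reached along a line that starts inside the wall, on which an
  exponential polynomial is determined by an initial interval.\<close>

lemma wall_points_line:
  assumes a: "a \<in> A" and v: "aff_eval a v = 0"
  shows "\<exists>b>0. \<forall>t. 0 < t \<longrightarrow> t < b \<longrightarrow> aff_eval a (wall_center a + t *\<^sub>R (v - wall_center a)) = 0 \<and>
    (\<forall>c\<in>A - {a}. 0 < aff_eval c (wall_center a + t *\<^sub>R (v - wall_center a)))"
proof -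
  let ?q = "wall_center a"
  have "open (\<Inter>c\<in>A - {a}. {z. 0 < aff_eval c z})"
    using finite_A by (intro open_INT ballI open_Collect_less continuous_intros) auto
  moreover have "?q \<in> (\<Inter>c\<in>A - {a}. {z. 0 < aff_eval c z})" using wall_center(2)[OF a] by blast
  moreover have "((\<lambda>t::real. ?q + t *\<^sub>R (v - ?q)) \<longlongrightarrow> ?q + 0 *\<^sub>R (v - ?q)) (at_right 0)" by (intro tendsto_intros)
  ultimately have "eventually (\<lambda>t. ?q + t *\<^sub>R (v - ?q) \<in> (\<Inter>c\<in>A - {a}. {z. 0 < aff_eval c z})) (at_right (0::real))"
    by (intro topological_tendstoD) auto
  then obtain b where b: "b > 0" "\<forall>t>0. t < b \<longrightarrow> ?q + t *\<^sub>R (v - ?q) \<in> (\<Inter>c\<in>A - {a}. {z. 0 < aff_eval c z})"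
    unfolding eventually_at_right_field by blast
  moreover have "aff_eval a (?q + t *\<^sub>R (v - ?q)) = 0" for t
    using wall_center(1)[OF a] v by (simp add: aff_eval_segment)
  ultimately show ?thesis by blast
qed

lemma dir_deriv_EP_tendsto:
  assumes F: "F \<in> EP"
  shows "((\<lambda>t. dir_deriv u F (y + t *\<^sub>R v)) \<longlongrightarrow> dir_deriv u F y) (at_right (0::real))"
proof -
  have "continuous_on UNIV (dir_deriv u F)" by (rule elementary_continuous[OF elementary_dir_deriv[OF F]])
  then have "isCont (dir_deriv u F) (y + 0 *\<^sub>R v)" by (simp add: continuous_on_eq_continuous_at)
  moreover have "((\<lambda>t::real. y + t *\<^sub>R v) \<longlongrightarrow> y + 0 *\<^sub>R v) (at_right 0)" by (intro tendsto_intros)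
  ultimately show ?thesis using isCont_tendsto_compose by fastforce
qed

text \<open>On either side of a wall of the alcove, a \<open>W\<close>-invariant function given by \<open>F\<close> on the alcove has
  the normal derivatives \<open>\<plusminus>\<partial>F\<close>.\<close>

lemma wall_one_sided_derivatives:
  assumes F: "F \<in> EP" and fF: "\<And>x. x \<in> Cbar \<Longrightarrow> f x = F x" and inv: "\<And>w v. w \<in> W \<Longrightarrow> f (w v) = f v"
    and a: "a \<in> A" and y: "aff_eval a y = 0" "\<And>b. b \<in> A - {a} \<Longrightarrow> 0 < aff_eval b y"
  defines "u \<equiv> coroot (fst a)"
  shows "((\<lambda>t. dir_deriv u f (y + t *\<^sub>R u)) \<longlongrightarrow> dir_deriv u F y) (at_right 0)"
    "((\<lambda>t. dir_deriv u f (y - t *\<^sub>R u)) \<longlongrightarrow> - dir_deriv u F y) (at_right 0)"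
proof -
  obtain U where U: "open U" "y \<in> U" "\<And>z. z \<in> U \<Longrightarrow> 0 < aff_eval a z \<Longrightarrow> z \<in> C0"
    "\<And>z. z \<in> U \<Longrightarrow> aff_eval a z < 0 \<Longrightarrow> aff_refl a z \<in> C0"
    using wall_nbhd[OF a y] by blast
  have au: "fst a \<bullet> u = 2" unfolding u_def by (rule coroot_self[OF A_ne0[OF a]])
  have fC: "f x = F x" if "x \<in> C0" for x using fF alcove_Cbar that by blast
  have "((\<lambda>t::real. y + t *\<^sub>R u) \<longlongrightarrow> y + 0 *\<^sub>R u) (at_right 0)" by (intro tendsto_intros)
  then have e1: "eventually (\<lambda>t. y + t *\<^sub>R u \<in> U) (at_right (0::real))" using U by (intro topological_tendstoD) auto
  have "((\<lambda>t::real. y - t *\<^sub>R u) \<longlongrightarrow> y - 0 *\<^sub>R u) (at_right 0)" by (intro tendsto_intros)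
  then have e2: "eventually (\<lambda>t. y - t *\<^sub>R u \<in> U) (at_right (0::real))" using U by (intro topological_tendstoD) auto
  have p: "eventually (\<lambda>t::real. 0 < t) (at_right 0)" by (rule eventually_at_right_less)
  have "eventually (\<lambda>t. dir_deriv u F (y + t *\<^sub>R u) = dir_deriv u f (y + t *\<^sub>R u)) (at_right (0::real))"
    using e1 p
  proof eventually_elim
    case (elim t)
    have "aff_eval a (y + t *\<^sub>R u) = 2 * t" using y(1) au by (simp add: aff_eval_shift)
    then have "y + t *\<^sub>R u \<in> C0" using U(3)[OF elim(1)] elim(2) by simp
    then show ?case by (intro dir_deriv_cong[OF open_C0]) (auto simp: fC)
  qed
  from Lim_transform_eventually[OF dir_deriv_EP_tendsto[OF F] this]
  show "((\<lambda>t. dir_deriv u f (y + t *\<^sub>R u)) \<longlongrightarrow> dir_deriv u F y) (at_right 0)" .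
  have ru: "refl (fst a) u = - u" by (simp add: u_def coroot_def refl_scale refl_self)
  have "eventually (\<lambda>t. - dir_deriv u F (y + t *\<^sub>R u) = dir_deriv u f (y - t *\<^sub>R u)) (at_right (0::real))"
    using e2 p
  proof eventually_elim
    case (elim t)
    let ?z = "y - t *\<^sub>R u" and ?c = "- (snd a *\<^sub>R coroot (fst a))"
    have ar: "aff_refl a x = refl (fst a) x + ?c" for x by (simp add: aff_refl_eq)
    have "aff_eval a ?z = - (2 * t)" using aff_eval_shift[of a y "- t" u] y(1) au by simp
    then have z: "aff_refl a ?z \<in> C0" using U(4)[OF elim(1)] elim(2) by simp
    have o: "open {x. aff_refl a x \<in> C0}"
    proof -
      have "continuous_on UNIV (aff_refl a)" using aff_refl_continuous[OF continuous_on_id, of UNIV a] by simp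
      then have "open (aff_refl a -` C0)" using open_C0 open_vimage by blast
      then show ?thesis by (simp add: vimage_def)
    qed
    have "dir_deriv u f ?z = dir_deriv u (\<lambda>x. F (refl (fst a) x + ?c)) ?z"
    proof (rule dir_deriv_cong[OF o])
      show "?z \<in> {x. aff_refl a x \<in> C0}" using z by simp
      fix x assume "x \<in> {x. aff_refl a x \<in> C0}"
      then have "f (aff_refl a x) = F (aff_refl a x)" using fC by blast
      then show "f x = F (refl (fst a) x + ?c)" using inv[OF W_refl[OF A_roots[OF a]]] by (simp add: ar)
    qed
    also have "\<dots> = - dir_deriv u F (refl (fst a) ?z + ?c)"
      unfolding EP_dir_deriv_affine[OF F refl_linear] ru EP_dir_deriv_minus[OF F] ..
    also have "refl (fst a) ?z + ?c = y + t *\<^sub>R u"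
    proof -
      have "aff_refl a y = y" using y(1) by (simp add: aff_refl_def)
      then have "refl (fst a) y + ?c = y" by (simp add: ar)
      then show ?thesis by (simp add: refl_diff refl_scale ru algebra_simps)
    qed
    finally show ?case by simp
  qed
  from Lim_transform_eventually[OF tendsto_minus[OF dir_deriv_EP_tendsto[OF F]] this]
  show "((\<lambda>t. dir_deriv u f (y - t *\<^sub>R u)) \<longlongrightarrow> - dir_deriv u F y) (at_right 0)" .
qed

text \<open>The differential equations are used on the fundamental alcove alone. What the other
  alcoves contribute is the boundary condition, which holds at first on the open wall and then, by
  analyticity, on its whole hyperplane.\<close>

lemma BVP_extension:
  assumes f: "f \<in> BVP_W R I \<phi> k \<mu>"
  shows "\<exists>F\<in>EP. (\<forall>x\<in>Cbar. f x = F x) \<and>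
    (\<forall>x. (\<Sum>b\<in>Basis. dir_deriv b (dir_deriv b F) x) = sym_eval laplace_sym (ceval \<mu>) * F x) \<and>
    (\<forall>u. foldr (lin_factor u) (map (ceval \<mu>) (orbit_list u)) F = (\<lambda>x. 0)) \<and>
    (\<forall>a\<in>A. \<forall>v. aff_eval a v = 0 \<longrightarrow> dir_deriv (coroot (fst a)) F v = of_real (k a) * F v)"
proof -
  have fc: "continuous_on UNIV f" and C1: "f \<in> C1k R I \<phi> k"
    and weak: "\<And>p. sym_invariant R p \<Longrightarrow> weak_eigenfunction (V_reg R I \<phi>) p (sym_eval p (ceval \<mu>)) f"
    and invf: "invariant_under W f"
    using f unfolding BVP_W_def BVP_def C1k_def CB1_def by auto
  have inv: "\<And>w v. w \<in> W \<Longrightarrow> f (w v) = f v" using invf invariant_W_iff by blast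
  have weak0: "\<And>p. sym_invariant R p \<Longrightarrow> weak_eigenfunction C0 p (sym_eval p (ceval \<mu>)) f"
    using weak_eigenfunction_mono[OF weak C0_V_reg] by blast
  have fc0: "continuous_on C0 f" using fc continuous_on_subset by blast
  have ode: "(LINT y|lborel. f y * fold (weak_factor u) (map (ceval \<mu>) (orbit_list u)) \<psi> y) = 0"
    if "\<psi> \<in> elementary True" "test_function C0 \<psi>" for u \<psi>
    by (rule weak_ode_of_invariants[OF open_C0 fc0 orbit_list_self weak0[OF esym_invariant] that])
  obtain F where F: "F \<in> EP" "\<forall>x\<in>C0. f x = F x"
    using EP_extension[OF fc open_C0 convex_C0 center_C0 ode] by blast
  have eq: "f x = F x" if "x \<in> Cbar" for x
  proof -
    have "closed {x. f x = F x}"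
      by (intro closed_Collect_eq fc elementary_continuous[OF F(1)])
    then have "closure C0 \<subseteq> {x. f x = F x}" using F(2) by (intro closure_minimal) auto
    then show ?thesis using that closure_C0 by blast
  qed
  have lap: "(\<Sum>b\<in>Basis. dir_deriv b (dir_deriv b F) x) = sym_eval laplace_sym (ceval \<mu>) * F x" for x
  proof -
    have "diff_op laplace_sym F x = sym_eval laplace_sym (ceval \<mu>) * F x"
      by (rule weak_eigenfunction_EP[OF open_C0 center_C0 F(1) _ weak0[OF laplace_invariant]]) (use F(2) in blast)
    then show ?thesis unfolding diff_op_def sum_list_laplace by simp
  qed
  have odeF: "foldr (lin_factor u) (map (ceval \<mu>) (orbit_list u)) F = (\<lambda>x. 0)" for u
    by (rule weak_ode_EP[OF open_C0 center_C0 F(1) _ ode]) (use F(2) in blast)+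
  have wall: "dir_deriv (coroot (fst a)) F v = of_real (k a) * F v" if a: "a \<in> A" and v: "aff_eval a v = 0" for a v
  proof -
    let ?u = "coroot (fst a)"
    \<comment> \<open>By invariance the normal derivatives on the two sides are opposite, so the
      jump is \<open>2 * dir_deriv ?u F y\<close> and the factor 2 cancels.\<close>
    have wp: "dir_deriv ?u F y - of_real (k a) * F y = 0"
      if y: "aff_eval a y = 0" "\<And>b. b \<in> A - {a} \<Longrightarrow> 0 < aff_eval b y" for y
    proof -
      have "subregular R I \<phi> a y" by (rule wall_subregular[OF a y])
      then obtain dp dm where d: "((\<lambda>t. dir_deriv ?u f (y + t *\<^sub>R ?u)) \<longlongrightarrow> dp) (at_right 0)"
        "((\<lambda>t. dir_deriv ?u f (y - t *\<^sub>R ?u)) \<longlongrightarrow> dm) (at_right 0)" "dp - dm = 2 * of_real (k a) * f y"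
        using C1 A_pos[OF a] unfolding C1k_def Let_def by blast
      have o: "((\<lambda>t. dir_deriv ?u f (y + t *\<^sub>R ?u)) \<longlongrightarrow> dir_deriv ?u F y) (at_right 0)"
        "((\<lambda>t. dir_deriv ?u f (y - t *\<^sub>R ?u)) \<longlongrightarrow> - dir_deriv ?u F y) (at_right 0)"
        by (rule wall_one_sided_derivatives; (rule F(1) eq inv a y | assumption)+)+
      have "dp = dir_deriv ?u F y" by (rule tendsto_unique[OF _ d(1) o(1)]) simp
      moreover have "dm = - dir_deriv ?u F y" by (rule tendsto_unique[OF _ d(2) o(2)]) simp
      moreover have "y \<in> Cbar"
      proof -
        have "0 \<le> aff_eval b y" if "b \<in> A" for b using y that by (cases "b = a") (auto simp: less_imp_le)
        then show ?thesis by (simp add: Cbar_def)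
      qed
      ultimately show ?thesis using d(3) eq[of y] by simp
    qed
    obtain b where b: "b > 0" "\<forall>t. 0 < t \<longrightarrow> t < b \<longrightarrow> aff_eval a (wall_center a + t *\<^sub>R (v - wall_center a)) = 0 \<and>
      (\<forall>c\<in>A - {a}. 0 < aff_eval c (wall_center a + t *\<^sub>R (v - wall_center a)))"
      using wall_points_line[OF a v] by blast
    have h: "(\<lambda>x. dir_deriv ?u F x - of_real (k a) * F x) \<in> EP"
      by (intro elementary_diff elementary_cmult elementary_dir_deriv F(1))
    have "dir_deriv ?u F (wall_center a + 1 *\<^sub>R (v - wall_center a)) - of_real (k a) * F (wall_center a + 1 *\<^sub>R (v - wall_center a)) = 0"
      by (rule EP_line_eq_0[OF h b(1)]) (rule wp, use b(2) in blast, use b(2) in blast)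
    then show ?thesis by simp
  qed
  show ?thesis using F(1) eq lap odeF wall by blast
qed

definition weyl_tuple :: "('a \<Rightarrow> complex) \<Rightarrow> ('a \<Rightarrow> 'a) \<Rightarrow> 'a \<Rightarrow> complex" where
  "weyl_tuple F = (\<lambda>w. if w \<in> W0 then (\<lambda>x. F (inv w x)) else (\<lambda>x. 0))"

lemma EP_inv: "F \<in> EP \<Longrightarrow> w \<in> W0 \<Longrightarrow> (\<lambda>x. F (inv w x)) \<in> EP"
  using EP_affine[OF W0_linear[OF W0_inv(2)], of w F 0] by simp

lemma dir_deriv_inv: "F \<in> EP \<Longrightarrow> w \<in> W0 \<Longrightarrow> dir_deriv u (\<lambda>x. F (inv w x)) x = dir_deriv (inv w u) F (inv w x)"
  using EP_dir_deriv_affine[OF _ W0_linear[OF W0_inv(2)], of F w u 0 x] by simp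

lemma lin_factor_inv: "h \<in> EP \<Longrightarrow> w \<in> W0 \<Longrightarrow>
  lin_factor u z (\<lambda>x. h (inv w x)) = (\<lambda>x. lin_factor (inv w u) z h (inv w x))"
  by (rule ext) (simp add: lin_factor_def dir_deriv_inv)

lemma weyl_tuple_good:
  assumes F: "F \<in> EP" and lap: "\<And>x. (\<Sum>b\<in>Basis. dir_deriv b (dir_deriv b F) x) = c * F x"
    and wall: "\<And>a v. a \<in> A \<Longrightarrow> aff_eval a v = 0 \<Longrightarrow> dir_deriv (coroot (fst a)) F v = of_real (k a) * F v"
  shows "good (weyl_tuple F)"
  unfolding good_def
proof (intro conjI ballI allI impI ext)
  show "EP_tuple (weyl_tuple F)" unfolding EP_tuple_def weyl_tuple_def
    using EP_inv[OF F] elementary.const[of 0 False] by auto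
  show "weyl_tuple F w x = 0" if "w \<notin> W0" for w x using that by (simp add: weyl_tuple_def)
  fix w a x assume w: "w \<in> W0" and a: "a \<in> A"
  let ?g = "fst a"
  let ?b = "coroot ?g"
  have rg: "refl ?g \<in> W0" using W0_refl aff_root_fst A_roots a by blast
  have ws: "w \<circ> refl ?g \<in> W0" by (rule W0_comp[OF w rg])
  have "refl ?g \<circ> refl ?g = id" by auto
  then have "inv (refl ?g) = refl ?g" by (rule inv_unique_comp) auto
  then have iws: "inv (w \<circ> refl ?g) x = refl ?g (inv w x)" for x
    using o_inv_distrib[OF W0_inv(1)[OF w] W0_inv(1)[OF rg]] by simp
  define F' where "F' = (\<lambda>x. F (refl ?g x))"
  have F': "F' \<in> EP" unfolding F'_def using EP_affine[OF refl_linear F, of ?g 0] by simp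
  have G1: "weyl_tuple F (w \<circ> refl ?g) = (\<lambda>x. F' (inv w x))"
    using ws by (simp add: weyl_tuple_def iws F'_def)
  have G2: "weyl_tuple F w = (\<lambda>x. F (inv w x))" using w by (simp add: weyl_tuple_def)
  have il: "inv w (x + snd a *\<^sub>R w ?b) = inv w x + snd a *\<^sub>R ?b"
    using W0_linear[OF W0_inv(2)[OF w]] by (simp add: linear_add linear_cmul W0_inv_apply[OF w])
  have "lin_factor (w ?b) (- of_real (k a)) (\<lambda>x. F' (inv w x)) (x + snd a *\<^sub>R w ?b) =
    dir_deriv ?b F' (inv w x + snd a *\<^sub>R ?b) + of_real (k a) * F' (inv w x + snd a *\<^sub>R ?b)"
    by (simp add: lin_factor_def dir_deriv_inv[OF F' w] W0_inv_apply[OF w] il)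
  also have "\<dots> = dir_deriv ?b F (inv w x) - of_real (k a) * F (inv w x)"
    unfolding F'_def by (rule wall_relation[OF F A_ne0[OF a] lap wall[OF a]])
  also have "\<dots> = lin_factor (w ?b) (of_real (k a)) (\<lambda>x. F (inv w x)) x"
    by (simp add: lin_factor_def dir_deriv_inv[OF F w] W0_inv_apply[OF w])
  finally show "lin_factor (w ?b) (- of_real (k a)) (weyl_tuple F (w \<circ> refl ?g)) (x + snd a *\<^sub>R w ?b) =
    lin_factor (w ?b) (of_real (k a)) (weyl_tuple F w) x" unfolding G1 G2 .
qed

text \<open>The block of \<open>ode_list\<close> belonging to the index \<open>w\<close> annihilates
  the component of index \<open>w\<close>, and the other factors commute past it.\<close>

lemma weyl_tuple_ode:
  assumes F: "F \<in> EP" and ode: "\<And>u. foldr (lin_factor u) (map (ceval \<mu>) (orbit_list u)) F = (\<lambda>x. 0)"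
  shows "solves_ode \<mu> (weyl_tuple F)"
  unfolding solves_ode_def
proof (intro allI ext)
  fix u w x
  have t: "tuple_ops (map (Pair u) zs) G w = foldr (lin_factor u) zs (G w)" for zs and G :: "('a \<Rightarrow> 'a) \<Rightarrow> 'a \<Rightarrow> complex"
    by (induction zs) (auto simp: tuple_op_def)
  show "tuple_ops (map (Pair u) (ode_list \<mu> u)) (weyl_tuple F) w x = 0"
  proof (cases "w \<in> W0")
    case False
    then show ?thesis unfolding t by (simp add: weyl_tuple_def foldr_lin_factor_zero)
  next
    case True
    have sh: "foldr (lin_factor u) zs (\<lambda>x. F (inv w x)) = (\<lambda>x. foldr (lin_factor (inv w u)) zs F (inv w x))" for zs
    proof (induction zs)
      case (Cons z zs)
      show ?case unfolding foldr.simps o_apply Cons.IH by (rule lin_factor_inv[OF foldr_lin_factor_EP[OF F] True])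
    qed simp
    obtain l1 l2 where l: "W0_list = l1 @ w # l2" using True W0_list(1) split_list by metis
    let ?m = "map (ceval \<mu>) (orbit_list (inv w u))"
    obtain xs ys where xy: "ode_list \<mu> u = xs @ ?m @ ys" unfolding ode_list_def l by simp
    have "foldr (lin_factor (inv w u)) (ode_list \<mu> u) F = (\<lambda>x. 0)"
      unfolding xy foldr_append o_apply foldr_lin_factor_commute[OF F, of _ ?m ys] ode foldr_lin_factor_zero ..
    then show ?thesis unfolding t using True by (simp add: weyl_tuple_def sh)
  qed
qed

end

section \<open>Coefficients and the Bethe ansatz equations\<close>

lemma cact_comp: "cact (f \<circ> g) \<nu> = cact f (cact g \<nu>)" by (simp add: cact_def)

lemma cact_id [simp]: "cact id \<nu> = \<nu>" by (simp add: cact_def)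

lemma ceval_cact_refl: "ceval (cact (refl \<gamma>) \<nu>) v = ceval \<nu> (refl \<gamma> v)"
  by (simp add: ceval_def cact_def refl_adjoint)

lemma cact_refl_refl [simp]: "cact (refl \<gamma>) (cact (refl \<gamma>) \<nu>) = \<nu>" by (simp add: cact_def)

lemma ceval_refl_coroot: "\<gamma> \<noteq> 0 \<Longrightarrow> ceval \<nu> (refl \<gamma> (coroot \<gamma>)) = - ceval \<nu> (coroot \<gamma>)"
  by (simp add: coroot_def refl_scale refl_self ceval_minus ceval_scale)

context affine_root_system
begin

lemma k_fst: "a \<in> aff_roots R \<Longrightarrow> k a = k (fst a, 0)"
  using multiplicity unfolding multiplicity_function_def by blast

lemma k_W:
  assumes w: "w \<in> W" and a: "a \<in> aff_roots R" and b: "b \<in> aff_roots R" and e: "\<And>x. aff_eval a (w x) = aff_eval b x"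
  shows "k a = k b"
proof -
  have "aff_eval a = act w (aff_eval b)"
    unfolding act_def using e[of "inv w _"] W_inv_apply(1)[OF w] by (intro ext) metis
  then show ?thesis using multiplicity w a b unfolding multiplicity_function_def by blast
qed

lemma aff_root_0: "\<alpha> \<in> R \<Longrightarrow> (\<alpha>, 0) \<in> aff_roots R"
  unfolding aff_roots_def by (intro CollectI exI[of _ \<alpha>] exI[of _ 0]) simp

lemma k_refl: "\<alpha> \<in> R \<Longrightarrow> \<beta> \<in> R \<Longrightarrow> k (refl \<beta> \<alpha>, 0) = k (\<alpha>, 0)"
  by (rule k_W[OF W_refl[OF aff_root_0[of \<beta>]] aff_root_0 aff_root_0])
     (auto simp: refl_R aff_eval_def aff_refl_eq refl_adjoint)

lemma aff_root_minus: "b \<in> aff_roots R \<Longrightarrow> - b \<in> aff_roots R"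
  using root_refl_roots[of b b] root_refl_self[OF aff_root_ne0] by simp

lemma k_minus: "b \<in> aff_roots R \<Longrightarrow> k (- b) = k b"
proof -
  assume b: "b \<in> aff_roots R"
  show ?thesis
  proof (rule k_W[OF W_refl[OF b] aff_root_minus[OF b] b])
    fix x show "aff_eval (- b) (aff_refl b x) = aff_eval b x"
      using aff_eval_root_refl[of b "- b" x] root_refl_self[OF aff_root_ne0[OF b]] root_refl_involution[OF aff_root_ne0[OF b], of b] by simp
  qed
qed

lemma k_minus_0: "\<alpha> \<in> R \<Longrightarrow> k (- \<alpha>, 0) = k (\<alpha>, 0)"
  using k_minus[OF aff_root_0, of \<alpha>] by simp

lemma cact_refl_orbit: "\<gamma> \<in> R \<Longrightarrow> \<nu> \<in> orbit \<mu> \<Longrightarrow> cact (refl \<gamma>) \<nu> \<in> orbit \<mu>"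
  unfolding orbit_def using W0_comp[OF W0_refl] by (auto simp: cact_comp[symmetric])

lemma self_orbit: "\<mu> \<in> orbit \<mu>"
  unfolding orbit_def using W0_id by (intro image_eqI[of _ _ id]) auto

lemma orbit_imaginary: "purely_imaginary \<mu> \<Longrightarrow> \<nu> \<in> orbit \<mu> \<Longrightarrow> fst \<nu> = 0"
  unfolding orbit_def purely_imaginary_def cact_def using W0_linear linear_0 by fastforce

lemma cact_regular:
  assumes w: "w \<in> W0" and r: "regular_spectral R \<mu>"
  shows "regular_spectral R (cact w \<mu>)"
  unfolding regular_spectral_def
proof
  fix \<alpha> assume "\<alpha> \<in> R"
  then have "ceval \<mu> (coroot (inv w \<alpha>)) \<noteq> 0" using r W0_R[OF W0_inv(2)[OF w]] unfolding regular_spectral_def by blast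
  then show "ceval (cact w \<mu>) (coroot \<alpha>) \<noteq> 0" by (simp add: ceval_cact[OF w] W0_coroot[OF W0_inv(2)[OF w]])
qed

lemma orbit_regular: "regular_spectral R \<mu> \<Longrightarrow> \<nu> \<in> orbit \<mu> \<Longrightarrow> regular_spectral R \<nu>"
  unfolding orbit_def using cact_regular by blast

text \<open>\<open>m\<close> is the order of the stabilizer of \<mu>, whose cosets are the fibres of
  the orbit map. The formula is a sum over the group, whereas independence of exponentials needs
  distinct exponents.\<close>

lemma sum_orbit: "\<exists>m>0. \<forall>h :: 'a cdual \<Rightarrow> complex. (\<Sum>w\<in>W0. h (cact w \<mu>)) = of_nat m * (\<Sum>\<nu>\<in>orbit \<mu>. h \<nu>)"
proof (intro exI conjI allI)
  let ?St = "{w \<in> W0. cact w \<mu> = \<mu>}"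
  show "0 < card ?St" using finite_W0 W0_id by (auto simp: card_gt_0_iff intro!: exI[of _ id])
  fix h :: "'a cdual \<Rightarrow> complex"
  have "(\<Sum>w\<in>W0. h (cact w \<mu>)) = (\<Sum>\<nu>\<in>orbit \<mu>. \<Sum>w\<in>{w \<in> W0. cact w \<mu> = \<nu>}. h (cact w \<mu>))"
    unfolding orbit_def by (rule sum.image_gen[OF finite_W0])
  also have "\<dots> = (\<Sum>\<nu>\<in>orbit \<mu>. of_nat (card ?St) * h \<nu>)"
  proof (rule sum.cong[OF refl])
    fix \<nu> assume "\<nu> \<in> orbit \<mu>"
    then obtain g where g: "g \<in> W0" "\<nu> = cact g \<mu>" unfolding orbit_def by blast
    have "bij_betw ((\<circ>) g) ?St {w \<in> W0. cact w \<mu> = \<nu>}"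
    proof (rule bij_betwI[where g = "(\<circ>) (inv g)"])
      show "(\<circ>) g \<in> ?St \<rightarrow> {w \<in> W0. cact w \<mu> = \<nu>}"
        using W0_comp[OF g(1)] by (auto simp: cact_comp g(2))
      show "(\<circ>) (inv g) \<in> {w \<in> W0. cact w \<mu> = \<nu>} \<rightarrow> ?St"
        using W0_comp[OF W0_inv(2)[OF g(1)]] by (auto simp: cact_comp g(2)) (auto simp: cact_def W0_inv_apply[OF g(1)])
      show "inv g \<circ> (g \<circ> w) = w" if "w \<in> ?St" for w by (rule ext) (simp add: W0_inv_apply[OF g(1)])
      show "g \<circ> (inv g \<circ> w) = w" if "w \<in> {w \<in> W0. cact w \<mu> = \<nu>}" for w by (rule ext) (simp add: W0_inv_apply[OF g(1)])
    qed
    then have "card {w \<in> W0. cact w \<mu> = \<nu>} = card ?St" by (simp add: bij_betw_same_card)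
    moreover have "(\<Sum>w\<in>{w \<in> W0. cact w \<mu> = \<nu>}. h (cact w \<mu>)) = (\<Sum>w\<in>{w \<in> W0. cact w \<mu> = \<nu>}. h \<nu>)"
      by (rule sum.cong) auto
    ultimately show "(\<Sum>w\<in>{w \<in> W0. cact w \<mu> = \<nu>}. h (cact w \<mu>)) = of_nat (card ?St) * h \<nu>" by simp
  qed
  finally show "(\<Sum>w\<in>W0. h (cact w \<mu>)) = of_nat (card ?St) * (\<Sum>\<nu>\<in>orbit \<mu>. h \<nu>)" by (simp add: sum_distrib_left)
qed

text \<open>Exponential sums with coefficients \<open>C\<close> satisfying this relation are the ones obeying the
  boundary condition on the wall of \<open>a\<close>.\<close>

definition coeff_rel :: "('a cdual \<Rightarrow> complex) \<Rightarrow> 'a \<times> real \<Rightarrow> 'a cdual \<Rightarrow> bool" where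
  "coeff_rel C a \<nu> \<longleftrightarrow>
     (ceval \<nu> (coroot (fst a)) + of_real (k a)) * exp (of_real (snd a) * ceval \<nu> (coroot (fst a))) * C (cact (refl (fst a)) \<nu>) =
     (ceval \<nu> (coroot (fst a)) - of_real (k a)) * C \<nu>"

lemma sum_cact_refl:
  assumes S: "finite S" "\<And>\<nu>. \<nu> \<in> S \<Longrightarrow> cact (refl \<gamma>) \<nu> \<in> S"
  shows "(\<Sum>\<nu>\<in>S. h (cact (refl \<gamma>) \<nu>)) = (\<Sum>\<nu>\<in>S. h \<nu>)"
  by (rule sum.reindex_bij_witness[where i = "cact (refl \<gamma>)" and j = "cact (refl \<gamma>)"]) (auto simp: S)

text \<open>Both sides of the relation are sums over the same reflection-stable set of exponents, so
  independence of the exponentials allows comparing coefficients.\<close>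

lemma coeff_rel_of_wall:
  assumes S: "finite S" "\<And>\<nu>. \<nu> \<in> S \<Longrightarrow> cact (refl (fst a)) \<nu> \<in> S"
    and F: "F = (\<lambda>x. \<Sum>\<nu>\<in>S. C \<nu> * exp (ceval \<nu> x))"
    and rel: "\<And>x. dir_deriv (coroot (fst a)) (\<lambda>x. F (refl (fst a) x)) (x + snd a *\<^sub>R coroot (fst a)) +
       of_real (k a) * F (refl (fst a) (x + snd a *\<^sub>R coroot (fst a))) =
      dir_deriv (coroot (fst a)) F x - of_real (k a) * F x"
    and \<nu>: "\<nu> \<in> S"
  shows "coeff_rel C a \<nu>"
proof -
  let ?g = "fst a"
  let ?b = "coroot ?g"
  let ?D = "\<lambda>\<nu>. (ceval \<nu> ?b + of_real (k a)) * C (cact (refl ?g) \<nu>) * exp (of_real (snd a) * ceval \<nu> ?b) -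
    (ceval \<nu> ?b - of_real (k a)) * C \<nu>"
  have F': "(\<lambda>x. F (refl ?g x)) = (\<lambda>x. \<Sum>\<nu>\<in>S. C (cact (refl ?g) \<nu>) * exp (ceval \<nu> x))"
  proof
    fix x
    have "(\<Sum>\<nu>\<in>S. C (cact (refl ?g) (cact (refl ?g) \<nu>)) * exp (ceval (cact (refl ?g) \<nu>) x)) = (\<Sum>\<nu>\<in>S. C (cact (refl ?g) \<nu>) * exp (ceval \<nu> x))"
      by (rule sum_cact_refl[OF S])
    then show "F (refl ?g x) = (\<Sum>\<nu>\<in>S. C (cact (refl ?g) \<nu>) * exp (ceval \<nu> x))"
      by (simp add: F ceval_cact_refl)
  qed
  have "(\<Sum>\<nu>\<in>S. ?D \<nu> * exp (ceval \<nu> x)) = 0" for x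
  proof -
    have "lin_factor ?b (- of_real (k a)) (\<lambda>x. F (refl ?g x)) (x + snd a *\<^sub>R ?b) = lin_factor ?b (of_real (k a)) F x"
      using rel[of x] by (simp add: lin_factor_def)
    then have "(\<Sum>\<nu>\<in>S. (ceval \<nu> ?b - - of_real (k a)) * C (cact (refl ?g) \<nu>) * exp (ceval \<nu> (x + snd a *\<^sub>R ?b))) =
      (\<Sum>\<nu>\<in>S. (ceval \<nu> ?b - of_real (k a)) * C \<nu> * exp (ceval \<nu> x))"
      unfolding F' unfolding F lin_factor_exp_sum[OF S(1)] .
    moreover have "?D \<nu> * exp (ceval \<nu> x) =
      (ceval \<nu> ?b - - of_real (k a)) * C (cact (refl ?g) \<nu>) * exp (ceval \<nu> (x + snd a *\<^sub>R ?b)) -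
      (ceval \<nu> ?b - of_real (k a)) * C \<nu> * exp (ceval \<nu> x)" for \<nu>
      by (simp add: ceval_add ceval_scale exp_add algebra_simps)
    ultimately show ?thesis by (simp only: sum_subtractf diff_self)
  qed
  from exponentials_independent[where C = ?D, OF S(1) this \<nu>] show ?thesis by (simp add: coeff_rel_def mult_ac)
qed

text \<open>On the wall the linear reflection moves \<open>v\<close> by a multiple of the co-root.
  Then the summand at the reflected exponent is the negative of the summand at \<nu>, so the sum
  equals its own negative.\<close>

lemma wall_of_coeff_rel:
  assumes S: "finite S" "\<And>\<nu>. \<nu> \<in> S \<Longrightarrow> cact (refl (fst a)) \<nu> \<in> S"
    and F: "F = (\<lambda>x. \<Sum>\<nu>\<in>S. C \<nu> * exp (ceval \<nu> x))"
    and rel: "\<And>\<nu>. \<nu> \<in> S \<Longrightarrow> coeff_rel C a \<nu>" and a: "a \<in> A" and v: "aff_eval a v = 0"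
  shows "dir_deriv (coroot (fst a)) F v = of_real (k a) * F v"
proof -
  let ?g = "fst a"
  let ?b = "coroot ?g"
  let ?h = "\<lambda>\<nu>. (ceval \<nu> ?b - of_real (k a)) * C \<nu> * exp (ceval \<nu> v)"
  have rv: "refl ?g v = v + snd a *\<^sub>R ?b"
    using v by (simp add: refl_def aff_eval_def algebra_simps) (metis add.inverse_inverse eq_neg_iff_add_eq_0 scaleR_left.add scaleR_zero_left add.commute)
  have "?h (cact (refl ?g) \<nu>) = - ?h \<nu>" if "\<nu> \<in> S" for \<nu>
  proof -
    let ?x = "ceval \<nu> ?b"
    have "?h (cact (refl ?g) \<nu>) = - ((?x + of_real (k a)) * exp (of_real (snd a) * ?x) * C (cact (refl ?g) \<nu>)) * exp (ceval \<nu> v)"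
      by (simp add: ceval_cact_refl ceval_refl_coroot[OF A_ne0[OF a]] rv ceval_add ceval_scale exp_add algebra_simps)
    then show ?thesis using rel[OF that] by (simp add: coeff_rel_def)
  qed
  then have "(\<Sum>\<nu>\<in>S. ?h \<nu>) = - (\<Sum>\<nu>\<in>S. ?h \<nu>)"
    using sum_cact_refl[OF S, of ?h] by (simp add: sum_negf)
  then have "lin_factor ?b (of_real (k a)) F v = 0" unfolding F lin_factor_exp_sum[OF S(1)] by (simp add: eq_neg_iff_add_eq_0 flip: mult_2)
  then show ?thesis by (simp add: lin_factor_def)
qed

section \<open>The c-function under the simple and the highest reflection\<close>

abbreviation "cf \<equiv> c_function R I k"

definition c_factor :: "'a cdual \<Rightarrow> 'a \<Rightarrow> complex" where
  "c_factor \<nu> \<alpha> = (ceval \<nu> (coroot \<alpha>) + of_real (k (\<alpha>, 0))) / ceval \<nu> (coroot \<alpha>)"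

lemma finite_P: "finite P" using finite_R by (simp add: pos_roots_def)

lemma P_R: "\<alpha> \<in> P \<Longrightarrow> \<alpha> \<in> R" by (simp add: pos_roots_def)

lemma cf_eq: "cf \<nu> = (\<Prod>\<alpha>\<in>P. c_factor \<nu> \<alpha>)" by (simp add: c_function_def c_factor_def)

lemma cf_refl: "\<beta> \<in> R \<Longrightarrow> cf (cact (refl \<beta>) \<nu>) = (\<Prod>\<alpha>\<in>P. c_factor \<nu> (refl \<beta> \<alpha>))"
  unfolding c_function_def c_factor_def
  by (intro prod.cong) (auto simp: ceval_cact_refl coroot_refl k_refl P_R)

lemma P_pos: "\<alpha> \<in> R \<Longrightarrow> (\<alpha>, 0) \<in> pos \<longleftrightarrow> \<alpha> \<in> P"
proof
  assume "\<alpha> \<in> R" "(\<alpha>, 0) \<in> pos"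
  show "\<alpha> \<in> P"
  proof (rule ccontr)
    assume "\<alpha> \<notin> P"
    then have "- \<alpha> \<in> nat_combinations I" using R_cases[OF \<open>\<alpha> \<in> R\<close>] \<open>\<alpha> \<in> R\<close> by (auto simp: pos_roots_def)
    then have "- (\<alpha>, 0) \<in> pos" using lift_nat_comb[of "- \<alpha>"] aff_root_minus[OF aff_root_0[OF \<open>\<alpha> \<in> R\<close>]]
      by (auto simp: pos_aff_roots_def)
    then show False using pos_not_neg[OF \<open>(\<alpha>, 0) \<in> pos\<close>] by simp
  qed
qed (auto simp: pos_aff_roots_def pos_roots_def aff_root_0 lift_nat_comb)

lemma I_P: "i \<in> I \<Longrightarrow> i \<in> P"
  using I_R nat_combinations_base[OF finite_I] by (auto simp: pos_roots_def)

lemma refl_simple_P: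
  assumes i: "i \<in> I" and \<alpha>: "\<alpha> \<in> P - {i}"
  shows "refl i \<alpha> \<in> P - {i}"
proof -
  have "i \<in> R" "\<alpha> \<in> R" using i I_R \<alpha> P_R by auto
  then have "(\<alpha>, 0) \<in> pos" using \<alpha> P_pos by simp
  moreover have "(\<alpha>, 0) \<noteq> (i, 0)" using \<alpha> by simp
  ultimately have "root_refl (i, 0) (\<alpha>, 0) \<in> pos" using simple_refl_pos[OF simple_A[OF i]] by blast
  moreover have "root_refl (i, 0) (\<alpha>, 0) = (refl i \<alpha>, 0)"
    using fst_root_refl[of "(i, 0)" "(\<alpha>, 0)"] by (simp add: root_refl_def prod_eq_iff)
  ultimately have "refl i \<alpha> \<in> P" using P_pos refl_R[OF \<open>i \<in> R\<close> \<open>\<alpha> \<in> R\<close>] by simp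
  moreover have "refl i \<alpha> \<noteq> i"
  proof
    assume "refl i \<alpha> = i"
    then have "refl i (refl i \<alpha>) = refl i i" by (rule arg_cong)
    then have "\<alpha> = - i" by (simp add: refl_self)
    then have "- (i, 0) \<in> pos" using \<open>(\<alpha>, 0) \<in> pos\<close> by simp
    then show False using pos_not_neg[OF A_pos[OF simple_A[OF i]]] by blast
  qed
  ultimately show ?thesis by simp
qed

text \<open>A simple reflection permutes the positive roots other than its own, so in the product
  only the factor of \<open>i\<close> changes.\<close>

lemma cf_simple:
  assumes r: "regular_spectral R \<nu>" and i: "i \<in> I"
  shows "coeff_rel cf (i, 0) \<nu>"
proof -
  have iR: "i \<in> R" using i I_R by blast
  let ?x = "ceval \<nu> (coroot i)" and ?k = "complex_of_real (k (i, 0))"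
  let ?Q = "\<Prod>\<alpha>\<in>P - {i}. c_factor \<nu> \<alpha>"
  have x: "?x \<noteq> 0" using r iR unfolding regular_spectral_def by blast
  have "(\<Prod>\<alpha>\<in>P - {i}. c_factor \<nu> (refl i \<alpha>)) = ?Q"
    by (rule prod.reindex_bij_witness[where i = "refl i" and j = "refl i"]) (use refl_simple_P[OF i] in auto)
  then have "cf (cact (refl i) \<nu>) = c_factor \<nu> (- i) * ?Q"
    unfolding cf_refl[OF iR] using prod.remove[OF finite_P I_P[OF i], of "\<lambda>\<alpha>. c_factor \<nu> (refl i \<alpha>)"] by (simp add: refl_self)
  moreover have "cf \<nu> = c_factor \<nu> i * ?Q" unfolding cf_eq by (rule prod.remove[OF finite_P I_P[OF i]])
  moreover have "(?x + ?k) * c_factor \<nu> (- i) = (?x - ?k) * c_factor \<nu> i"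
    using x by (simp add: c_factor_def coroot_minus ceval_minus k_minus_0[OF iR] field_simps)
  ultimately show ?thesis by (simp add: coeff_rel_def)
qed

lemma cf_ne0:
  assumes "regular_spectral R \<nu>" "fst \<nu> = 0"
  shows "cf \<nu> \<noteq> 0"
  unfolding cf_eq c_factor_def using assms imag_factor_ne0(1)[OF assms(2) aff_root_0] P_R
  by (auto simp: prod_zero_iff[OF finite_P] regular_spectral_def)

lemma phi_P: "\<phi> \<in> P" using phi_R phi_nat_comb by (simp add: pos_roots_def)

lemma nat_comb_weights_0:
  assumes x: "x \<in> nat_combinations I" and 0: "\<And>i. i \<in> I \<Longrightarrow> x \<bullet> fund_weight i = 0"
  shows "x = 0"
proof -
  obtain c :: "'a \<Rightarrow> nat" where c: "x = (\<Sum>j\<in>I. real (c j) *\<^sub>R j)" using x unfolding nat_combinations_def by blast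
  have "real (c i) = 0" if i: "i \<in> I" for i
  proof -
    have "x \<bullet> fund_weight i = (\<Sum>j\<in>I. if j = i then real (c j) else 0)"
      unfolding c inner_sum_left by (intro sum.cong) (auto simp: fund_weight[OF i])
    then show ?thesis using 0[OF i] i finite_I by simp
  qed
  then show ?thesis unfolding c by (intro sum.neutral) auto
qed

text \<open>The difference \<open>\<phi> - refl i \<phi>\<close> is a non-negative combination and a
  multiple of \<open>i\<close>; the sign of the multiple is that of
  \<open>i \<bullet> \<phi>\<close>.\<close>

lemma phi_dominant:
  assumes "\<alpha> \<in> P"
  shows "0 \<le> \<alpha> \<bullet> coroot \<phi>"
proof -
  have i: "0 \<le> i \<bullet> \<phi>" if i: "i \<in> I" for i
  proof -
    have "i \<in> R" using i I_R by blast
    then have "\<phi> - refl i \<phi> \<in> nat_combinations I" using phi_highest refl_R phi_R by blast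
    then have "0 \<le> (\<phi> - refl i \<phi>) \<bullet> fund_weight i" using nat_comb_weight_ge0 i by blast
    also have "\<dots> = (i \<bullet> \<phi>) * (2 / (i \<bullet> i))" by (simp add: refl_def coroot_def fund_weight[OF i i])
    finally have "0 \<le> (i \<bullet> \<phi>) * (2 / (i \<bullet> i))" .
    moreover have "0 < 2 / (i \<bullet> i)" using R_ne0[OF \<open>i \<in> R\<close>] by simp
    ultimately show ?thesis unfolding zero_le_mult_iff by linarith
  qed
  obtain c :: "'a \<Rightarrow> nat" where c: "\<alpha> = (\<Sum>j\<in>I. real (c j) *\<^sub>R j)" using assms unfolding pos_roots_def nat_combinations_def by blast
  have "0 \<le> \<alpha> \<bullet> \<phi>" unfolding c inner_sum_left by (intro sum_nonneg) (simp add: i)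
  then show ?thesis by (simp add: inner_coroot)
qed

text \<open>If the pairing \<open>n\<close> were at least 2, then \<open>\<phi> - \<alpha>\<close>
  and \<open>\<phi> + refl \<phi> \<alpha>\<close>, both non-negative combinations, would add up to
  \<open>(2 - n) \<phi>\<close>. Both would vanish, forcing \<open>\<alpha> = \<phi>\<close>. Thus
  the exponents in the Bethe equations are 0 or 1, except for \<open>\<phi>\<close> itself.\<close>

lemma phi_coroot_cases:
  assumes \<alpha>: "\<alpha> \<in> P" "\<alpha> \<noteq> \<phi>"
  shows "\<alpha> \<bullet> coroot \<phi> = 0 \<or> \<alpha> \<bullet> coroot \<phi> = 1"
proof -
  have aR: "\<alpha> \<in> R" using \<alpha> P_R by blast
  obtain n where n: "\<alpha> \<bullet> coroot \<phi> = of_int n" using integral_R[OF phi_R aR] Ints_cases by blast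
  have n0: "0 \<le> n" using phi_dominant[OF \<alpha>(1)] n by simp
  have "n < 2"
  proof (rule ccontr)
    assume "\<not> n < 2"
    have r: "refl \<phi> \<alpha> = \<alpha> - of_int n *\<^sub>R \<phi>"
      unfolding n[symmetric] by (simp add: refl_def coroot_def inner_commute)
    have "- refl \<phi> \<alpha> \<in> R" using refl_R[OF phi_R aR] R_minus by blast
    then have 1: "\<phi> - (- refl \<phi> \<alpha>) \<in> nat_combinations I" by (rule phi_highest)
    have 2: "\<phi> - \<alpha> \<in> nat_combinations I" by (rule phi_highest[OF aR])
    have "(\<phi> - \<alpha>) \<bullet> fund_weight i = 0" if i: "i \<in> I" for i
    proof -
      have "0 \<le> (\<phi> - (- refl \<phi> \<alpha>)) \<bullet> fund_weight i" "0 \<le> (\<phi> - \<alpha>) \<bullet> fund_weight i"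
        using nat_comb_weight_ge0[OF 1 i] nat_comb_weight_ge0[OF 2 i] by auto
      moreover have "(real_of_int n - 2) * (\<phi> \<bullet> fund_weight i) \<ge> 0"
        using \<open>\<not> n < 2\<close> phi_weight[OF i] by (intro mult_nonneg_nonneg) auto
      ultimately show ?thesis unfolding r by (simp add: inner_diff_left inner_add_left algebra_simps)
    qed
    then have "\<phi> - \<alpha> = 0" by (rule nat_comb_weights_0[OF 2])
    then show False using \<alpha>(2) by simp
  qed
  then have "n = 0 \<or> n = 1" using n0 by auto
  then show ?thesis using n by auto
qed

definition bethe_factor :: "'a cdual \<Rightarrow> 'a \<Rightarrow> complex" where
  "bethe_factor \<nu> \<alpha> = (ceval \<nu> (coroot \<alpha>) - of_real (k (\<alpha>, 0))) / (ceval \<nu> (coroot \<alpha>) + of_real (k (\<alpha>, 0)))"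

lemma c_factor_minus:
  assumes "regular_spectral R \<nu>" "fst \<nu> = 0" "\<alpha> \<in> R"
  shows "c_factor \<nu> (- \<alpha>) = c_factor \<nu> \<alpha> * bethe_factor \<nu> \<alpha>"
proof -
  have x: "ceval \<nu> (coroot \<alpha>) \<noteq> 0" using assms(1,3) unfolding regular_spectral_def by blast
  have "ceval \<nu> (coroot \<alpha>) + of_real (k (\<alpha>, 0)) \<noteq> 0" by (rule imag_factor_ne0(1)[OF assms(2) aff_root_0[OF assms(3)]])
  then show ?thesis using x
    by (simp add: c_factor_def bethe_factor_def coroot_minus ceval_minus k_minus_0[OF assms(3)]) (simp add: divide_simps)
qed

text \<open>The reflection fixes the positive roots orthogonal to \<open>\<phi>\<close>, maps
  \<open>\<phi>\<close> to its negative, and sends a root \<open>\<alpha>\<close> with pairing 1 to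
  \<open>- (\<phi> - \<alpha>)\<close>, where \<open>\<phi> - \<alpha>\<close> is again of this
  kind. Each change of sign costs a Bethe factor. The root \<open>\<phi>\<close> gives one such
  factor but has exponent 2, hence the extra factor on the left.\<close>

lemma cf_highest:
  assumes r: "regular_spectral R \<nu>" and im: "fst \<nu> = 0"
  shows "cf (cact (refl \<phi>) \<nu>) * bethe_factor \<nu> \<phi> = cf \<nu> * (\<Prod>\<alpha>\<in>P. bethe_factor \<nu> \<alpha> powi \<lfloor>\<alpha> \<bullet> coroot \<phi>\<rfloor>)"
proof -
  define P0 where "P0 = {\<alpha> \<in> P. \<alpha> \<bullet> coroot \<phi> = 0}"
  define P1 where "P1 = {\<alpha> \<in> P. \<alpha> \<bullet> coroot \<phi> = 1}"
  have pp: "\<phi> \<bullet> coroot \<phi> = 2" by (rule coroot_self[OF R_ne0[OF phi_R]])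
  have split: "P = insert \<phi> (P0 \<union> P1)" using phi_coroot_cases phi_P unfolding P0_def P1_def by blast
  have fin: "finite P0" "finite P1" using finite_P unfolding P0_def P1_def by auto
  have disj: "\<phi> \<notin> P0 \<union> P1" "P0 \<inter> P1 = {}" using pp unfolding P0_def P1_def by auto
  have prodP: "prod h P = h \<phi> * (prod h P0 * prod h P1)" for h :: "'a \<Rightarrow> complex"
    using fin disj by (subst split) (simp add: prod.union_disjoint)
  have rphi: "refl \<phi> \<alpha> = \<alpha> - (\<alpha> \<bullet> coroot \<phi>) *\<^sub>R \<phi>" for \<alpha>
    by (simp add: refl_def coroot_def inner_commute)
  have minus: "\<phi> - \<alpha> \<in> P1" if "\<alpha> \<in> P1" for \<alpha>
  proof -
    have a: "\<alpha> \<in> R" "\<alpha> \<bullet> coroot \<phi> = 1" using that P_R unfolding P1_def by auto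
    then have "- refl \<phi> \<alpha> \<in> R" using refl_R[OF phi_R] R_minus by blast
    then have "\<phi> - \<alpha> \<in> R" using a by (simp add: rphi)
    then show ?thesis using phi_highest[OF a(1)] a(2) pp by (simp add: P1_def pos_roots_def inner_diff_left)
  qed
  have e0: "(\<Prod>\<alpha>\<in>P0. c_factor \<nu> (refl \<phi> \<alpha>)) = (\<Prod>\<alpha>\<in>P0. c_factor \<nu> \<alpha>)"
    by (rule prod.cong) (auto simp: rphi P0_def)
  have "(\<Prod>\<alpha>\<in>P1. c_factor \<nu> (refl \<phi> \<alpha>)) = (\<Prod>\<alpha>\<in>P1. c_factor \<nu> (- (\<phi> - \<alpha>)))"
    by (rule prod.cong) (auto simp: rphi P1_def)
  also have "\<dots> = (\<Prod>\<alpha>\<in>P1. c_factor \<nu> (- \<alpha>))"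
    by (rule prod.reindex_bij_witness[where i = "\<lambda>\<alpha>. \<phi> - \<alpha>" and j = "\<lambda>\<alpha>. \<phi> - \<alpha>"]) (use minus in auto)
  also have "\<dots> = (\<Prod>\<alpha>\<in>P1. c_factor \<nu> \<alpha> * bethe_factor \<nu> \<alpha>)"
    by (rule prod.cong) (auto simp: c_factor_minus[OF r im] P1_def P_R)
  finally have e1: "(\<Prod>\<alpha>\<in>P1. c_factor \<nu> (refl \<phi> \<alpha>)) = (\<Prod>\<alpha>\<in>P1. c_factor \<nu> \<alpha>) * (\<Prod>\<alpha>\<in>P1. bethe_factor \<nu> \<alpha>)"
    by (simp add: prod.distrib)
  have e2: "c_factor \<nu> (refl \<phi> \<phi>) = c_factor \<nu> \<phi> * bethe_factor \<nu> \<phi>"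
    by (simp add: refl_self c_factor_minus[OF r im phi_R])
  have b0: "(\<Prod>\<alpha>\<in>P0. bethe_factor \<nu> \<alpha> powi \<lfloor>\<alpha> \<bullet> coroot \<phi>\<rfloor>) = 1"
    by (rule prod.neutral) (auto simp: P0_def)
  have b1: "(\<Prod>\<alpha>\<in>P1. bethe_factor \<nu> \<alpha> powi \<lfloor>\<alpha> \<bullet> coroot \<phi>\<rfloor>) = (\<Prod>\<alpha>\<in>P1. bethe_factor \<nu> \<alpha>)"
    by (rule prod.cong) (auto simp: P1_def)
  have b2: "bethe_factor \<nu> \<phi> powi \<lfloor>\<phi> \<bullet> coroot \<phi>\<rfloor> = bethe_factor \<nu> \<phi> * bethe_factor \<nu> \<phi>"
    by (simp add: pp power2_eq_square)
  show ?thesis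
    unfolding cf_refl[OF phi_R] unfolding cf_eq prodP e0 e1 e2 b0 b1 b2 by (simp only: mult_ac mult_1_left mult_1_right)
qed

text \<open>The extra factor in \<open>cf_highest\<close> is precisely the quotient of the two
  linear factors in \<open>coeff_rel\<close> at the affine simple root. After cancelling the
  non-zero value of \<open>cf\<close>, the Bethe equation for \<nu> is left.\<close>

lemma cf_affine:
  assumes r: "regular_spectral R \<nu>" and im: "fst \<nu> = 0"
  shows "coeff_rel cf (- \<phi>, 1) \<nu> \<longleftrightarrow>
    exp (ceval \<nu> (coroot \<phi>)) = (\<Prod>\<alpha>\<in>P. bethe_factor \<nu> \<alpha> powi \<lfloor>\<alpha> \<bullet> coroot \<phi>\<rfloor>)"
proof -
  let ?X = "ceval \<nu> (coroot \<phi>)" and ?k = "complex_of_real (k (\<phi>, 0))" and ?c = "cf (cact (refl \<phi>) \<nu>)"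
  let ?B = "\<Prod>\<alpha>\<in>P. bethe_factor \<nu> \<alpha> powi \<lfloor>\<alpha> \<bullet> coroot \<phi>\<rfloor>"
  have kk: "k (- \<phi>, 1) = k (\<phi>, 0)"
    using k_fst[OF A_roots, of "(- \<phi>, 1)"] k_minus_0[OF phi_R] by (simp add: aff_basis_def)
  have ne: "?X + ?k \<noteq> 0" by (rule imag_factor_ne0(1)[OF im aff_root_0[OF phi_R]])
  have "coeff_rel cf (- \<phi>, 1) \<nu> \<longleftrightarrow> (- ?X + ?k) * exp (- ?X) * ?c = (- ?X - ?k) * cf \<nu>"
    by (simp add: coeff_rel_def kk coroot_minus ceval_minus)
  also have "\<dots> \<longleftrightarrow> (?X - ?k) * exp (- ?X) * ?c = (?X + ?k) * cf \<nu>"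
  proof -
    have "(- ?X + ?k) * exp (- ?X) * ?c = - ((?X - ?k) * exp (- ?X) * ?c)" "(- ?X - ?k) * cf \<nu> = - ((?X + ?k) * cf \<nu>)"
      by (simp_all add: algebra_simps)
    then show ?thesis by (simp only: neg_equal_iff_equal)
  qed
  also have "\<dots> \<longleftrightarrow> exp (- ?X) * (?c * bethe_factor \<nu> \<phi>) = cf \<nu>"
    using ne by (simp add: bethe_factor_def field_simps)
  also have "\<dots> \<longleftrightarrow> exp (- ?X) * ?B = 1"
    unfolding cf_highest[OF r im] using cf_ne0[OF r im] by (simp add: mult.left_commute[of _ "cf \<nu>"])
  also have "\<dots> \<longleftrightarrow> exp ?X = ?B" by (auto simp: exp_minus field_simps)
  finally show ?thesis .
qed

section \<open>Coefficients determined by the simple relations\<close>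

lemma coeff_zero:
  assumes im: "purely_imaginary \<mu>" and C: "\<And>\<nu> i. \<nu> \<in> orbit \<mu> \<Longrightarrow> i \<in> I \<Longrightarrow> coeff_rel C (i, 0) \<nu>"
    and \<nu>: "\<nu> \<in> orbit \<mu>" "C \<nu> = 0" and w: "w \<in> W0"
  shows "cact w \<nu> \<in> orbit \<mu> \<and> C (cact w \<nu>) = 0"
  using w unfolding W0_eq
proof (induction rule: generated_by.induct)
  case gen_id show ?case unfolding cact_id using \<nu> by blast
next
  case (gen_comp s w)
  then obtain i where i: "i \<in> I" "s = refl i" by blast
  then have iR: "i \<in> R" using I_R by blast
  have "cact (s \<circ> w) \<nu> \<in> orbit \<mu>" unfolding cact_comp i(2) using cact_refl_orbit[OF iR] gen_comp.IH by blast
  moreover have "C (cact (s \<circ> w) \<nu>) = 0"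
    using C[of "cact w \<nu>" i] gen_comp.IH i imag_factor_ne0(1)[OF orbit_imaginary[OF im] aff_root_0[OF iR], of "cact w \<nu>" "coroot i"]
    unfolding cact_comp by (simp add: coeff_rel_def)
  ultimately show ?case by blast
qed

text \<open>If a co-root vanishes at \<mu>, conjugate the root to a simple one. At the corresponding
  orbit point, fixed by the simple reflection, the relation reads \<open>k * C = - k * C\<close>. So
  \<open>C\<close> vanishes there, and then on the whole orbit.\<close>

lemma coeff_regular:
  assumes im: "purely_imaginary \<mu>" and C: "\<And>\<nu> i. \<nu> \<in> orbit \<mu> \<Longrightarrow> i \<in> I \<Longrightarrow> coeff_rel C (i, 0) \<nu>"
    and nz: "\<exists>\<nu>\<in>orbit \<mu>. C \<nu> \<noteq> 0"
  shows "regular_spectral R \<mu>"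
  unfolding regular_spectral_def
proof (rule ballI, rule notI)
  fix \<alpha> assume \<alpha>: "\<alpha> \<in> R" "ceval \<mu> (coroot \<alpha>) = 0"
  obtain w where w: "w \<in> W0" "w \<alpha> \<in> I" using root_conj_simple[OF \<alpha>(1)] by blast
  let ?i = "w \<alpha>" and ?n = "cact w \<mu>"
  have n: "?n \<in> orbit \<mu>" using w unfolding orbit_def by blast
  have iR: "?i \<in> R" using w I_R by blast
  have x: "ceval ?n (coroot ?i) = 0"
    unfolding ceval_cact[OF w(1)] W0_coroot[OF w(1), symmetric] using W0_inv_apply[OF w(1)] \<alpha>(2) by simp
  have "cact (refl ?i) ?n = ?n"
  proof -
    have "fst ?n \<bullet> coroot ?i = 0" "snd ?n \<bullet> coroot ?i = 0" using x by (auto simp: ceval_def complex_eq_iff)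
    then have "?i \<bullet> fst ?n = 0" "?i \<bullet> snd ?n = 0" using R_ne0[OF iR] by (auto simp: coroot_def inner_commute)
    then have "refl ?i (fst ?n) = fst ?n" "refl ?i (snd ?n) = snd ?n" by (auto simp: refl_def)
    then show ?thesis unfolding cact_def[of "refl ?i"] by simp
  qed
  then have "C ?n = 0" using C[OF n w(2)] x k_pos[OF aff_root_0[OF iR]] by (simp add: coeff_rel_def)
  have "C \<nu> = 0" if \<nu>: "\<nu> \<in> orbit \<mu>" for \<nu>
  proof -
    obtain g where g: "g \<in> W0" "\<nu> = cact g \<mu>" using \<nu> unfolding orbit_def by blast
    have "\<nu> = cact (g \<circ> inv w) ?n" using g by (simp add: cact_def W0_inv_apply[OF w(1)])
    then show ?thesis
      using coeff_zero[OF im C n \<open>C ?n = 0\<close> W0_comp[OF g(1) W0_inv(2)[OF w(1)]]] by simp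
  qed
  then show False using nz by blast
qed

text \<open>The relations are linear. Subtracting the multiple of \<open>cf\<close> that agrees with
  \<open>C\<close> at \<mu> leaves a solution with a zero, and zeros propagate.\<close>

lemma coeff_proportional:
  assumes im: "purely_imaginary \<mu>" and r: "regular_spectral R \<mu>"
    and C: "\<And>\<nu> i. \<nu> \<in> orbit \<mu> \<Longrightarrow> i \<in> I \<Longrightarrow> coeff_rel C (i, 0) \<nu>" and \<nu>: "\<nu> \<in> orbit \<mu>"
  shows "C \<nu> = (C \<mu> / cf \<mu>) * cf \<nu>"
proof -
  have im\<mu>: "fst \<mu> = 0" using im by (simp add: purely_imaginary_def)
  define D where "D \<nu>' = C \<nu>' - (C \<mu> / cf \<mu>) * cf \<nu>'" for \<nu>'
  have "coeff_rel D (i, 0) \<nu>'" if "\<nu>' \<in> orbit \<mu>" "i \<in> I" for \<nu>' i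
    using C[OF that] cf_simple[OF orbit_regular[OF r that(1)] that(2)]
    unfolding coeff_rel_def D_def by (simp add: right_diff_distrib mult.left_commute[of _ "C \<mu> / cf \<mu>"] mult.commute[of _ "C \<mu> / cf \<mu>"])
  moreover have "D \<mu> = 0" using cf_ne0[OF r im\<mu>] by (simp add: D_def)
  moreover obtain w where "w \<in> W0" "\<nu> = cact w \<mu>" using \<nu> unfolding orbit_def by blast
  ultimately have "D \<nu> = 0" using coeff_zero[OF im _ self_orbit, of D w] by blast
  then show ?thesis by (simp add: D_def)
qed

definition bethe_wave :: "'a cdual \<Rightarrow> 'a \<Rightarrow> complex" where
  "bethe_wave \<mu> x = 1 / of_nat (card W0) * (\<Sum>w\<in>W0. cf (cact w \<mu>) * exp (ceval (cact w \<mu>) x))"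

lemma bethe_wave_orbit:
  "\<exists>q. q \<noteq> 0 \<and> bethe_wave \<mu> = (\<lambda>x. \<Sum>\<nu>\<in>orbit \<mu>. (q * cf \<nu>) * exp (ceval \<nu> x))"
proof -
  obtain m where m: "m > 0" "\<forall>h :: 'a cdual \<Rightarrow> complex. (\<Sum>w\<in>W0. h (cact w \<mu>)) = of_nat m * (\<Sum>\<nu>\<in>orbit \<mu>. h \<nu>)"
    using sum_orbit by blast
  have "bethe_wave \<mu> x = (\<Sum>\<nu>\<in>orbit \<mu>. (1 / of_nat (card W0) * of_nat m * cf \<nu>) * exp (ceval \<nu> x))" for x
    unfolding bethe_wave_def using m(2)[rule_format, of "\<lambda>\<nu>. cf \<nu> * exp (ceval \<nu> x)"] by (simp add: sum_distrib_left mult.assoc)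
  then show ?thesis using m(1) card_W0 by (intro exI[of _ "1 / of_nat (card W0) * of_nat m"] conjI ext) auto
qed

lemma bethe_orbit_iff:
  assumes im: "purely_imaginary \<mu>" and r: "regular_spectral R \<mu>"
  shows "bethe_equations R I \<phi> k \<mu> \<longleftrightarrow> (\<forall>\<nu>\<in>orbit \<mu>. coeff_rel cf (- \<phi>, 1) \<nu>)"
proof -
  have "coeff_rel cf (- \<phi>, 1) \<nu> \<longleftrightarrow> exp (ceval \<nu> (coroot \<phi>)) = (\<Prod>\<alpha>\<in>P. bethe_factor \<nu> \<alpha> powi \<lfloor>\<alpha> \<bullet> coroot \<phi>\<rfloor>)"
    if "\<nu> \<in> orbit \<mu>" for \<nu>
    by (rule cf_affine[OF orbit_regular[OF r that] orbit_imaginary[OF im that]])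
  then show ?thesis unfolding bethe_equations_def bethe_factor_def orbit_def by simp
qed

lemma coeff_rel_cmult: "coeff_rel C a \<nu> \<Longrightarrow> coeff_rel (\<lambda>\<nu>. q * C \<nu>) a \<nu>"
  unfolding coeff_rel_def by (simp add: mult.left_commute[of _ q])

lemma coeff_rel_cmult_iff: "q \<noteq> 0 \<Longrightarrow> coeff_rel (\<lambda>\<nu>. q * C \<nu>) a \<nu> \<longleftrightarrow> coeff_rel C a \<nu>"
  unfolding coeff_rel_def by (simp add: mult.left_commute[of _ q])

text \<open>The component of the tuple at the identity is \<open>F\<close> itself, which is non-zero
  at the folded point of \<open>v\<close>. This excludes the zero tuple and sets off the chain:
  imaginary exponent, orbit sum, regularity, proportionality to \<open>cf\<close>, Bethe
  equations.\<close>

theorem BVP_necessary: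
  assumes f: "f \<in> BVP_W R I \<phi> k \<mu>" and nz: "f v \<noteq> 0"
  shows "purely_imaginary \<mu> \<and> regular_spectral R \<mu> \<and> bethe_equations R I \<phi> k \<mu> \<and>
    (\<exists>d. \<forall>x\<in>Cbar. f x = d * bethe_wave \<mu> x)"
proof -
  have inv: "\<And>w x. w \<in> W \<Longrightarrow> f (w x) = f x" using f invariant_W_iff unfolding BVP_W_def by blast
  obtain F where F: "F \<in> EP" "\<And>x. x \<in> Cbar \<Longrightarrow> f x = F x"
    "\<And>x. (\<Sum>b\<in>Basis. dir_deriv b (dir_deriv b F) x) = sym_eval laplace_sym (ceval \<mu>) * F x"
    "\<And>u. foldr (lin_factor u) (map (ceval \<mu>) (orbit_list u)) F = (\<lambda>x. 0)"
    "\<And>a v. a \<in> A \<Longrightarrow> aff_eval a v = 0 \<Longrightarrow> dir_deriv (coroot (fst a)) F v = of_real (k a) * F v"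
    using BVP_extension[OF f] by blast
  have g: "good (weyl_tuple F)" by (rule weyl_tuple_good[OF F(1,3,5)])
  have o: "solves_ode \<mu> (weyl_tuple F)" by (rule weyl_tuple_ode[OF F(1,4)])
  have Gid: "weyl_tuple F id = F" using W0_id by (simp add: weyl_tuple_def)
  obtain w0 where w0: "w0 \<in> W" "fold_pt v = w0 v" using fold_pt(2) by blast
  have Fv: "F (fold_pt v) \<noteq> 0" using F(2)[OF fold_pt(1), of v] inv[OF w0(1), of v] nz w0(2) by simp
  then have "weyl_tuple F \<noteq> tuple_zero" using Gid by metis
  then have im: "purely_imaginary \<mu>" by (rule nontrivial_imaginary[OF g o])
  have "orbit_sum \<mu> (weyl_tuple F id)" by (rule good_orbit_sum[OF finite_Basis subset_refl g o]) simp
  then obtain C where C: "\<And>x. F x = (\<Sum>\<nu>\<in>orbit \<mu>. C \<nu> * exp (ceval \<nu> x))"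
    unfolding Gid orbit_sum_def by blast
  have FC: "F = (\<lambda>x. \<Sum>\<nu>\<in>orbit \<mu>. C \<nu> * exp (ceval \<nu> x))" by (rule ext) (rule C)
  have rel: "coeff_rel C a \<nu>" if a: "a \<in> A" and \<nu>: "\<nu> \<in> orbit \<mu>" for a \<nu>
  proof (rule coeff_rel_of_wall[OF finite_orbit _ FC _ \<nu>])
    show "cact (refl (fst a)) \<nu>' \<in> orbit \<mu>" if "\<nu>' \<in> orbit \<mu>" for \<nu>'
      using cact_refl_orbit[OF aff_root_fst[OF A_roots[OF a]] that] .
    show "dir_deriv (coroot (fst a)) (\<lambda>x. F (refl (fst a) x)) (x + snd a *\<^sub>R coroot (fst a)) +
       of_real (k a) * F (refl (fst a) (x + snd a *\<^sub>R coroot (fst a))) =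
      dir_deriv (coroot (fst a)) F x - of_real (k a) * F x" for x
      by (rule wall_relation[OF F(1) A_ne0[OF a] F(3) F(5)[OF a]])
  qed
  have rel0: "coeff_rel C (i, 0) \<nu>" if "\<nu> \<in> orbit \<mu>" "i \<in> I" for \<nu> i
    by (rule rel[OF simple_A[OF that(2)] that(1)])
  have "\<exists>\<nu>\<in>orbit \<mu>. C \<nu> \<noteq> 0"
  proof (rule ccontr)
    assume "\<not> ?thesis"
    then have "F (fold_pt v) = 0" unfolding C by (intro sum.neutral) auto
    then show False using Fv by simp
  qed
  have r: "regular_spectral R \<mu>"
    by (rule coeff_regular[OF im _ \<open>\<exists>\<nu>\<in>orbit \<mu>. C \<nu> \<noteq> 0\<close>]) (rule rel0)
  define d where "d = C \<mu> / cf \<mu>"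
  have Cd: "C \<nu> = d * cf \<nu>" if "\<nu> \<in> orbit \<mu>" for \<nu> unfolding d_def by (rule coeff_proportional[OF im r rel0 that])
  have d0: "d \<noteq> 0" using \<open>\<exists>\<nu>\<in>orbit \<mu>. C \<nu> \<noteq> 0\<close> Cd by auto
  have "coeff_rel cf (- \<phi>, 1) \<nu>" if \<nu>: "\<nu> \<in> orbit \<mu>" for \<nu>
  proof -
    have a0: "(- \<phi>, 1) \<in> A" by (simp add: aff_basis_def)
    have "cact (refl (- \<phi>)) \<nu> \<in> orbit \<mu>" using cact_refl_orbit[OF R_minus[OF phi_R] \<nu>] .
    then have "coeff_rel (\<lambda>\<nu>. d * cf \<nu>) (- \<phi>, 1) \<nu>"
      using rel[OF a0 \<nu>] Cd \<nu> unfolding coeff_rel_def by simp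
    then show ?thesis unfolding coeff_rel_cmult_iff[OF d0] .
  qed
  then have b: "bethe_equations R I \<phi> k \<mu>" using bethe_orbit_iff[OF im r] by blast
  obtain q where q: "q \<noteq> 0" "bethe_wave \<mu> = (\<lambda>x. \<Sum>\<nu>\<in>orbit \<mu>. (q * cf \<nu>) * exp (ceval \<nu> x))"
    using bethe_wave_orbit by blast
  have "f x = (d / q) * bethe_wave \<mu> x" if "x \<in> Cbar" for x
    unfolding F(2)[OF that] C q(2) sum_distrib_left using q(1) Cd by (intro sum.cong) (auto simp: field_simps)
  then show ?thesis using im r b by blast
qed

end

lemma EP_continuously_differentiable:
  assumes h: "h \<in> EP"
  shows "continuously_differentiable_on h UNIV"
  unfolding continuously_differentiable_on_def
proof (intro exI conjI ballI)
  let ?D = "\<lambda>x. Blinfun (\<lambda>u. dir_deriv u h x)"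
  have hd: "(h has_derivative (\<lambda>u. dir_deriv u h x)) (at x)" for x
    by (rule has_derivative_dir_deriv[OF elementary_differentiable[OF h]])
  have ap: "blinfun_apply (?D x) = (\<lambda>u. dir_deriv u h x)" for x
    using has_derivative_bounded_linear[OF hd] by (rule bounded_linear_Blinfun_apply)
  show "(h has_derivative blinfun_apply (?D x)) (at x)" for x unfolding ap by (rule hd)
  show "continuous_on UNIV ?D"
    by (rule continuous_on_blinfun_componentwise) (simp only: ap elementary_continuous[OF elementary_dir_deriv[OF h]])
qed

section \<open>Macdonald's identity\<close>

lemma coeff_prod_linear:
  fixes a b :: "'i \<Rightarrow> complex"
  assumes "finite S"
  shows "degree (\<Prod>s\<in>S. [:a s, b s:]) \<le> card S \<and> coeff (\<Prod>s\<in>S. [:a s, b s:]) (card S) = (\<Prod>s\<in>S. b s)"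
  using assms
proof (induction S rule: finite_induct)
  case (insert x S)
  let ?p = "\<Prod>s\<in>S. [:a s, b s:]"
  have "degree ([:a x, b x:] * ?p) \<le> Suc (card S)"
    using degree_mult_le[of "[:a x, b x:]" ?p] insert.IH by (simp split: if_splits)
  moreover have "coeff ([:a x, b x:] * ?p) (Suc (card S)) = b x * (\<Prod>s\<in>S. b s)"
    using insert.IH coeff_eq_0[of ?p "Suc (card S)"] by (simp add: coeff_pCons)
  ultimately show ?case using insert.hyps by simp
qed simp

lemma poly_eq_0_many_roots:
  fixes q :: "complex poly"
  assumes d: "degree q \<le> card S" "coeff q (card S) = 0" and S: "finite S" "S \<noteq> {}"
    and r: "inj_on z S" "\<And>s. s \<in> S \<Longrightarrow> poly q (z s) = 0"
  shows "q = 0"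
proof (rule ccontr)
  assume q: "q \<noteq> 0"
  then have "degree q \<noteq> card S" using d(2) leading_coeff_neq_0 by metis
  then have "degree q < card S" using d(1) by simp
  moreover have "card S = card (z ` S)" using r(1) by (simp add: card_image)
  moreover have "card (z ` S) \<le> card {x. poly q x = 0}"
    using r(2) by (intro card_mono poly_roots_finite[OF q]) auto
  moreover have "card {x. poly q x = 0} \<le> degree q" using q by (rule card_poly_roots_bound)
  ultimately show False by simp
qed

text \<open>The complex line through \<mu> in a real direction, as a pair of real and imaginary
  part. Products of values at co-roots become polynomials in \<open>z\<close> on it.\<close>

definition cline :: "'a::euclidean_space cdual \<Rightarrow> 'a \<Rightarrow> complex \<Rightarrow> 'a cdual" where
  "cline \<mu> \<eta> z = (fst \<mu> + Re z *\<^sub>R \<eta>, snd \<mu> + Im z *\<^sub>R \<eta>)"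

lemma ceval_cline: "ceval (cline \<mu> \<eta> z) v = ceval \<mu> v + z * of_real (\<eta> \<bullet> v)"
  by (simp add: ceval_def cline_def complex_eq_iff inner_add_left)

lemma cact_cline: "linear w \<Longrightarrow> cact w (cline \<mu> \<eta> z) = cline (cact w \<mu>) (w \<eta>) z"
  by (simp add: cact_def cline_def linear_add linear_cmul)

lemma cline_0 [simp]: "cline \<mu> \<eta> 0 = \<mu>" by (simp add: cline_def)

text \<open>Restriction of the polynomial function \<open>p\<close> to the complex line through
  \<open>\<xi>\<close> in direction \<open>\<eta>\<close>. At \<open>z = \<i>\<close> it gives the
  value at the complex point with real part \<open>\<xi>\<close> and imaginary part
  \<open>\<eta>\<close>.\<close>

definition sym_poly :: "'a::euclidean_space sym \<Rightarrow> 'a \<Rightarrow> 'a \<Rightarrow> complex poly" where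
  "sym_poly p \<xi> \<eta> = (\<Sum>(c, us)\<leftarrow>p. smult (of_real c) (\<Prod>v\<leftarrow>us. [:of_real (\<xi> \<bullet> v), of_real (\<eta> \<bullet> v):]))"

lemma poly_sym_poly: "poly (sym_poly p \<xi> \<eta>) z = sym_eval p (ceval (cline (\<xi>, 0) \<eta> z))"
proof -
  have "poly (\<Prod>v\<leftarrow>us. [:of_real (\<xi> \<bullet> v), of_real (\<eta> \<bullet> v):]) z = prod_list (map (ceval (cline (\<xi>, 0) \<eta> z)) us)" for us
  proof (induction us)
    case (Cons v us)
    have "ceval (\<xi>, 0) v = of_real (\<xi> \<bullet> v)" by (simp add: ceval_alt)
    then show ?case using Cons by (simp add: ceval_cline algebra_simps)
  qed simp
  then show ?thesis unfolding sym_poly_def sym_eval_def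
    by (induction p) (auto simp: scaleR_conv_of_real)
qed

lemma sym_eval_real: "sym_eval p (ceval (\<xi>, 0)) = of_real (sym_eval p (\<lambda>v. \<xi> \<bullet> v))"
proof -
  have "prod_list (map (ceval (\<xi>, 0)) us) = of_real (prod_list (map (\<lambda>v. \<xi> \<bullet> v) us))" for us
    by (induction us) (auto simp: ceval_alt)
  then show ?thesis unfolding sym_eval_def by (induction p) (auto simp: scaleR_conv_of_real)
qed

lemma foldr_dir_deriv_exp_sum:
  "finite S \<Longrightarrow> foldr dir_deriv us (\<lambda>x. \<Sum>\<nu>\<in>S. C \<nu> * exp (ceval \<nu> x)) =
    (\<lambda>x. \<Sum>\<nu>\<in>S. (prod_list (map (ceval \<nu>) us) * C \<nu>) * exp (ceval \<nu> x))"
proof (induction us)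
  case (Cons u us)
  have "dir_deriv u h = lin_factor u 0 h" for h :: "'a \<Rightarrow> complex" by (simp add: lin_factor_def fun_eq_iff)
  then show ?case unfolding foldr.simps o_apply Cons.IH[OF Cons.prems] lin_factor_exp_sum[OF Cons.prems]
    by (simp only: lin_factor_exp_sum[OF Cons.prems]) (simp add: mult.assoc)
qed simp

lemma diff_op_exp_sum:
  assumes "finite S"
  shows "diff_op p (\<lambda>x. \<Sum>\<nu>\<in>S. C \<nu> * exp (ceval \<nu> x)) x = (\<Sum>\<nu>\<in>S. sym_eval p (ceval \<nu>) * C \<nu> * exp (ceval \<nu> x))"
  unfolding diff_op_def foldr_dir_deriv_exp_sum[OF assms] sym_eval_def
proof (induction p)
  case (Cons t p)
  then show ?case by (cases t) (simp add: scaleR_conv_of_real sum_distrib_left sum.distrib algebra_simps)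
qed simp

text \<open>Both sides are the derivative of the same function of \<open>t\<close>, so nothing is
  required of \<open>f\<close>. This allows its use for folded functions, whose differentiability at
  walls is not known.\<close>

lemma dir_deriv_comp_affine:
  "linear g \<Longrightarrow> dir_deriv u (\<lambda>x. f (g x + y)) x = dir_deriv (g u) f (g x + y)"
  by (simp add: dir_deriv_def linear_add linear_cmul algebra_simps)

context affine_root_system
begin

definition Delta :: "'a cdual \<Rightarrow> complex" where "Delta \<nu> = (\<Prod>\<alpha>\<in>P. ceval \<nu> (coroot \<alpha>))"

lemma Delta_regular: "regular_spectral R \<nu> \<Longrightarrow> Delta \<nu> \<noteq> 0"
  unfolding Delta_def prod_zero_iff[OF finite_P] regular_spectral_def using P_R by blast

lemma Delta_simple: "i \<in> I \<Longrightarrow> Delta (cact (refl i) \<nu>) = - Delta \<nu>"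
proof -
  assume i: "i \<in> I"
  have "(\<Prod>\<alpha>\<in>P - {i}. ceval \<nu> (coroot (refl i \<alpha>))) = (\<Prod>\<alpha>\<in>P - {i}. ceval \<nu> (coroot \<alpha>))"
    by (rule prod.reindex_bij_witness[where i = "refl i" and j = "refl i"]) (use refl_simple_P[OF i] in auto)
  moreover have "Delta (cact (refl i) \<nu>) = ceval \<nu> (coroot (refl i i)) * (\<Prod>\<alpha>\<in>P - {i}. ceval \<nu> (coroot (refl i \<alpha>)))"
    unfolding Delta_def ceval_cact_refl coroot_refl[symmetric] by (rule prod.remove[OF finite_P I_P[OF i]])
  moreover have "Delta \<nu> = ceval \<nu> (coroot i) * (\<Prod>\<alpha>\<in>P - {i}. ceval \<nu> (coroot \<alpha>))"
    unfolding Delta_def by (rule prod.remove[OF finite_P I_P[OF i]])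
  ultimately show ?thesis by (simp add: refl_self coroot_minus ceval_minus)
qed

lemma Delta_W0: "w \<in> W0 \<Longrightarrow> \<exists>e\<in>{1, -1}. \<forall>\<nu>. Delta (cact w \<nu>) = e * Delta \<nu>"
  unfolding W0_eq
proof (induction rule: generated_by.induct)
  case gen_id show ?case unfolding cact_id by (rule bexI[of _ 1]) auto
next
  case (gen_comp s w)
  then obtain e i where e: "e \<in> {1, -1}" "\<And>\<nu>. Delta (cact w \<nu>) = e * Delta \<nu>" "i \<in> I" "s = refl i" by blast
  have "Delta (cact (s \<circ> w) \<nu>) = - e * Delta \<nu>" for \<nu>
    unfolding e(4) cact_comp Delta_simple[OF e(3)] e(2) by (rule minus_mult_left)
  moreover have "- e \<in> {1, -1}" using e(1) by auto
  ultimately show ?case by blast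
qed

text \<open>The reflection is conjugate to a simple one, for which the sign is known, and the sign
  of the conjugating element occurs twice.\<close>

lemma sign_reflection:
  assumes \<alpha>: "\<alpha> \<in> R" and r: "regular_spectral R \<mu>"
  shows "Delta (cact (refl \<alpha>) \<nu>) = - Delta \<nu>"
proof -
  obtain w where w: "w \<in> W0" "w \<alpha> \<in> I" using root_conj_simple[OF \<alpha>] by blast
  obtain e where e: "e \<in> {1, -1}" "\<And>\<nu>. Delta (cact w \<nu>) = e * Delta \<nu>" using Delta_W0[OF w(1)] by blast
  have "refl (w \<alpha>) (w x) = w (refl \<alpha> x)" for x
    using refl_W0_conj[OF w(1), of \<alpha>] W0_inv_apply(2)[OF w(1)] by simp
  then have "cact (refl (w \<alpha>)) (cact w \<nu>) = cact w (cact (refl \<alpha>) \<nu>)" by (simp add: cact_def)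
  then have "- (e * Delta \<nu>) = e * Delta (cact (refl \<alpha>) \<nu>)"
    using Delta_simple[OF w(2), of "cact w \<nu>"] e(2) by simp
  then show ?thesis using e(1) by auto
qed

text \<open>Each condition says that a non-zero complex functional does not vanish at
  \<open>\<eta>\<close>, so finitely many proper subspaces must be avoided. The diagonal entries of
  \<open>f\<close> encode the first kind of condition, the others the second; the latter are
  non-zero since distinct positive co-roots are not proportional.\<close>

lemma generic_direction:
  assumes r: "regular_spectral R \<mu>"
  shows "\<exists>\<eta>. (\<forall>\<alpha>\<in>P. \<eta> \<bullet> coroot \<alpha> \<noteq> 0) \<and> (\<forall>\<alpha>\<in>P. \<forall>\<beta>\<in>P. \<alpha> \<noteq> \<beta> \<longrightarrow>
    ceval \<mu> (coroot \<alpha>) * of_real (\<eta> \<bullet> coroot \<beta>) \<noteq> ceval \<mu> (coroot \<beta>) * of_real (\<eta> \<bullet> coroot \<alpha>))"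
proof -
  define f where "f = (\<lambda>(\<alpha>, \<beta>). if \<alpha> = \<beta> then (coroot \<alpha>, 0) else
    (Re (ceval \<mu> (coroot \<alpha>)) *\<^sub>R coroot \<beta> - Re (ceval \<mu> (coroot \<beta>)) *\<^sub>R coroot \<alpha>,
     Im (ceval \<mu> (coroot \<alpha>)) *\<^sub>R coroot \<beta> - Im (ceval \<mu> (coroot \<beta>)) *\<^sub>R coroot \<alpha>))"
  have cne: "coroot \<alpha> \<noteq> 0" if "\<alpha> \<in> R" for \<alpha> using R_ne0[OF that] by (simp add: coroot_def)
  have parallel: "False" if c: "c *\<^sub>R coroot \<beta> = d *\<^sub>R coroot \<alpha>" and c0: "c \<noteq> 0" and ab: "\<alpha> \<in> P" "\<beta> \<in> P" "\<alpha> \<noteq> \<beta>" for \<alpha> \<beta> c d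
  proof -
    have R: "\<alpha> \<in> R" "\<beta> \<in> R" using ab P_R by auto
    have "coroot \<beta> = (d / c) *\<^sub>R coroot \<alpha>" using c c0 by (metis divide_inverse_commute real_vector_affinity_eq scaleR_scaleR scaleR_left_imp_eq right_inverse scaleR_one mult.commute)
    then have "(2 / (\<beta> \<bullet> \<beta>)) *\<^sub>R \<beta> = ((d / c) * (2 / (\<alpha> \<bullet> \<alpha>))) *\<^sub>R \<alpha>" by (simp add: coroot_def)
    then have "((\<beta> \<bullet> \<beta>) / 2) *\<^sub>R (2 / (\<beta> \<bullet> \<beta>)) *\<^sub>R \<beta> = ((\<beta> \<bullet> \<beta>) / 2) *\<^sub>R ((d / c) * (2 / (\<alpha> \<bullet> \<alpha>))) *\<^sub>R \<alpha>" by (rule arg_cong)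
    then have b: "\<beta> = ((\<beta> \<bullet> \<beta>) / 2 * ((d / c) * (2 / (\<alpha> \<bullet> \<alpha>)))) *\<^sub>R \<alpha>" using R_ne0[OF R(2)] by simp
    define t where "t = (\<beta> \<bullet> \<beta>) / 2 * ((d / c) * (2 / (\<alpha> \<bullet> \<alpha>)))"
    have t: "\<beta> = t *\<^sub>R \<alpha>" using b unfolding t_def .
    then have "t = 1 \<or> t = -1" using reduced_R[OF R(1), of t] R(2) by simp
    then have "\<beta> = - \<alpha>" using t ab(3) by auto
    then have "- (\<alpha>, 0) \<in> pos" "(\<alpha>, 0) \<in> pos" using P_pos[OF R(2)] P_pos[OF R(1)] ab by auto
    then show False using pos_not_neg by blast
  qed
  have "\<not> (\<exists>s\<in>P \<times> P. (0, 0) = f s)"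
  proof
    assume "\<exists>s\<in>P \<times> P. (0, 0) = f s"
    then obtain \<alpha> \<beta> where ab: "\<alpha> \<in> P" "\<beta> \<in> P" "f (\<alpha>, \<beta>) = (0, 0)" by (metis SigmaE)
    show False
    proof (cases "\<alpha> = \<beta>")
      case True
      then show ?thesis using ab cne P_R by (auto simp: f_def)
    next
      case False
      have "ceval \<mu> (coroot \<alpha>) \<noteq> 0" using r P_R[OF ab(1)] unfolding regular_spectral_def by blast
      then have "Re (ceval \<mu> (coroot \<alpha>)) \<noteq> 0 \<or> Im (ceval \<mu> (coroot \<alpha>)) \<noteq> 0" by (simp add: complex_eq_iff)
      then show False using ab parallel False by (auto simp: f_def)
    qed
  qed
  then have "\<not> (\<forall>u. \<exists>s\<in>P \<times> P. ceval (0, 0) u = ceval (f s) u)"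
    using ceval_eq_cover[where m = f and \<nu> = "(0, 0)" and S = "P \<times> P"] finite_P by blast
  then obtain u where u: "\<And>s. s \<in> P \<times> P \<Longrightarrow> ceval (f s) u \<noteq> 0" by (auto simp: ceval_def complex_eq_iff)
  have "u \<bullet> coroot \<alpha> \<noteq> 0" if "\<alpha> \<in> P" for \<alpha>
    using u[of "(\<alpha>, \<alpha>)"] that by (auto simp: f_def ceval_def complex_eq_iff inner_commute)
  moreover have "ceval \<mu> (coroot \<alpha>) * of_real (u \<bullet> coroot \<beta>) \<noteq> ceval \<mu> (coroot \<beta>) * of_real (u \<bullet> coroot \<alpha>)"
    if "\<alpha> \<in> P" "\<beta> \<in> P" "\<alpha> \<noteq> \<beta>" for \<alpha> \<beta>
    using u[of "(\<alpha>, \<beta>)"] that by (auto simp: f_def ceval_def complex_eq_iff inner_commute inner_diff_left inner_diff_right)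
  ultimately show ?thesis by blast
qed

text \<open>Macdonald's identity: along a generic complex line the alternating sum of the numerators is a
  polynomial of the same degree and leading coefficient as \<open>|W\<^sub>0| \<Delta>\<close>, and it vanishes at the
  (simple) zeros of \<open>\<Delta>\<close>.\<close>

lemma macdonald:
  assumes r: "regular_spectral R \<mu>"
  shows "(\<Sum>w\<in>W0. cf (cact w \<mu>)) = of_nat (card W0)"
proof -
  obtain \<eta> where \<eta>: "\<And>\<alpha>. \<alpha> \<in> P \<Longrightarrow> \<eta> \<bullet> coroot \<alpha> \<noteq> 0"
    "\<And>\<alpha> \<beta>. \<alpha> \<in> P \<Longrightarrow> \<beta> \<in> P \<Longrightarrow> \<alpha> \<noteq> \<beta> \<Longrightarrow>
      ceval \<mu> (coroot \<alpha>) * of_real (\<eta> \<bullet> coroot \<beta>) \<noteq> ceval \<mu> (coroot \<beta>) * of_real (\<eta> \<bullet> coroot \<alpha>)"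
    using generic_direction[OF r] by blast
  have "\<forall>w\<in>W0. \<exists>e. e \<in> {1, -1} \<and> (\<forall>\<nu>. Delta (cact w \<nu>) = e * Delta \<nu>)" using Delta_W0 by blast
  then obtain e :: "('a \<Rightarrow> 'a) \<Rightarrow> complex" where
    "\<forall>w\<in>W0. e w \<in> {1, -1} \<and> (\<forall>\<nu>. Delta (cact w \<nu>) = e w * Delta \<nu>)"
    using bchoice[of W0 "\<lambda>w e. e \<in> {1, -1} \<and> (\<forall>\<nu>. Delta (cact w \<nu>) = e * Delta \<nu>)"] by blast
  then have e: "\<And>w. w \<in> W0 \<Longrightarrow> e w = 1 \<or> e w = -1" "\<And>w \<nu>. w \<in> W0 \<Longrightarrow> Delta (cact w \<nu>) = e w * Delta \<nu>" by auto
  have D0: "Delta \<mu> \<noteq> 0" by (rule Delta_regular[OF r])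
  define num where "num \<nu> = (\<Prod>\<alpha>\<in>P. ceval \<nu> (coroot \<alpha>) + of_real (k (\<alpha>, 0)))" for \<nu>
  define pn where "pn w = (\<Prod>\<alpha>\<in>P. [:ceval (cact w \<mu>) (coroot \<alpha>) + of_real (k (\<alpha>, 0)), of_real (w \<eta> \<bullet> coroot \<alpha>):])" for w
  define pd where "pd = (\<Prod>\<alpha>\<in>P. [:ceval \<mu> (coroot \<alpha>), of_real (\<eta> \<bullet> coroot \<alpha>):])"
  define q where "q = (\<Sum>w\<in>W0. smult (e w) (pn w)) - smult (of_nat (card W0)) pd"
  have pn: "poly (pn w) z = num (cact w (cline \<mu> \<eta> z))" if "w \<in> W0" for w z
    unfolding pn_def num_def cact_cline[OF W0_linear[OF that]] ceval_cline poly_prod by (simp add: algebra_simps)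
  have pd: "poly pd z = Delta (cline \<mu> \<eta> z)" for z
    unfolding pd_def Delta_def ceval_cline poly_prod by simp
  \<comment> \<open>The leading coefficient of \<open>pn w\<close> is the value of
    \<open>Delta\<close> at \<open>w \<eta>\<close>, which carries the sign \<open>e w\<close>; the
    signs in the alternating sum cancel it.\<close>
  have lead: "(\<Prod>\<alpha>\<in>P. complex_of_real (w \<eta> \<bullet> coroot \<alpha>)) = e w * (\<Prod>\<alpha>\<in>P. complex_of_real (\<eta> \<bullet> coroot \<alpha>))" if w: "w \<in> W0" for w
  proof -
    have "Delta (\<xi>, 0) = (\<Prod>\<alpha>\<in>P. complex_of_real (\<xi> \<bullet> coroot \<alpha>))" for \<xi>
      unfolding Delta_def by (simp add: ceval_alt)
    then show ?thesis using e(2)[OF w, of "(\<eta>, 0)"] linear_0[OF W0_linear[OF w]] by (simp add: cact_def)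
  qed
  have "q = 0"
  proof (rule poly_eq_0_many_roots[where z = "\<lambda>\<alpha>. - ceval \<mu> (coroot \<alpha>) / of_real (\<eta> \<bullet> coroot \<alpha>)"])
    show "finite P" by (rule finite_P)
    show "P \<noteq> {}" using phi_P by blast
    have dn: "degree (pn w) \<le> card P" "coeff (pn w) (card P) = (\<Prod>\<alpha>\<in>P. complex_of_real (w \<eta> \<bullet> coroot \<alpha>))" for w
      unfolding pn_def by (rule coeff_prod_linear[OF finite_P, THEN conjunct1] coeff_prod_linear[OF finite_P, THEN conjunct2])+
    have dd: "degree pd \<le> card P" "coeff pd (card P) = (\<Prod>\<alpha>\<in>P. complex_of_real (\<eta> \<bullet> coroot \<alpha>))"
      unfolding pd_def by (rule coeff_prod_linear[OF finite_P, THEN conjunct1] coeff_prod_linear[OF finite_P, THEN conjunct2])+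
    show "degree q \<le> card P" unfolding q_def
      by (intro degree_diff_le degree_sum_le finite_W0 order_trans[OF degree_smult_le] dn dd)
    have "e w * (e w * x) = x" if "w \<in> W0" for w x using e(1)[OF that] by auto
    then have "(\<Sum>w\<in>W0. e w * (\<Prod>\<alpha>\<in>P. complex_of_real (w \<eta> \<bullet> coroot \<alpha>))) = (\<Sum>w\<in>W0. (\<Prod>\<alpha>\<in>P. complex_of_real (\<eta> \<bullet> coroot \<alpha>)))"
      by (intro sum.cong) (auto simp: lead)
    then show "coeff q (card P) = 0" unfolding q_def by (simp add: coeff_sum dn dd)
    show "inj_on (\<lambda>\<alpha>. - ceval \<mu> (coroot \<alpha>) / of_real (\<eta> \<bullet> coroot \<alpha>)) P"
    proof (rule inj_onI, rule ccontr)
      fix \<alpha> \<beta> assume ab: "\<alpha> \<in> P" "\<beta> \<in> P" "\<alpha> \<noteq> \<beta>"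
        "- ceval \<mu> (coroot \<alpha>) / of_real (\<eta> \<bullet> coroot \<alpha>) = - ceval \<mu> (coroot \<beta>) / complex_of_real (\<eta> \<bullet> coroot \<beta>)"
      then have "ceval \<mu> (coroot \<alpha>) * of_real (\<eta> \<bullet> coroot \<beta>) = ceval \<mu> (coroot \<beta>) * of_real (\<eta> \<bullet> coroot \<alpha>)"
        using \<eta>(1)[OF ab(1)] \<eta>(1)[OF ab(2)] by (simp add: frac_eq_eq)
      then show False using \<eta>(2)[OF ab(1-3)] by blast
    qed
    fix \<alpha> assume \<alpha>: "\<alpha> \<in> P"
    let ?z = "- ceval \<mu> (coroot \<alpha>) / of_real (\<eta> \<bullet> coroot \<alpha>)"
    let ?n = "cline \<mu> \<eta> ?z"
    have aR: "\<alpha> \<in> R" using \<alpha> P_R by blast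
    have 0: "ceval ?n (coroot \<alpha>) = 0" using \<eta>(1)[OF \<alpha>] by (simp add: ceval_cline)
    have fix_n: "cact (refl \<alpha>) ?n = ?n"
    proof -
      have "fst ?n \<bullet> coroot \<alpha> = 0" "snd ?n \<bullet> coroot \<alpha> = 0" using 0 by (auto simp: ceval_def complex_eq_iff)
      then have "\<alpha> \<bullet> fst ?n = 0" "\<alpha> \<bullet> snd ?n = 0" using R_ne0[OF aR] by (auto simp: coroot_def inner_commute)
      then have "refl \<alpha> (fst ?n) = fst ?n" "refl \<alpha> (snd ?n) = snd ?n" by (auto simp: refl_def)
      then show ?thesis unfolding cact_def by simp
    qed
    have es: "e (w \<circ> refl \<alpha>) = - e w" if w: "w \<in> W0" for w
    proof -
      have "e (w \<circ> refl \<alpha>) * Delta \<mu> = Delta (cact w (cact (refl \<alpha>) \<mu>))"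
        using e(2)[OF W0_comp[OF w W0_refl[OF aR]], of \<mu>] by (simp add: cact_comp)
      then have "e (w \<circ> refl \<alpha>) * Delta \<mu> = - e w * Delta \<mu>" by (simp add: e(2)[OF w] sign_reflection[OF aR r])
      then show ?thesis unfolding mult_right_cancel[OF D0] .
    qed
    \<comment> \<open>At this zero of \<open>Delta\<close> the point is fixed by the reflection,
      while right multiplication by the reflection flips all signs. The sum therefore equals its own
      negative.\<close>
    have "(\<Sum>w\<in>W0. e w * num (cact w ?n)) = (\<Sum>w\<in>W0. e (w \<circ> refl \<alpha>) * num (cact (w \<circ> refl \<alpha>) ?n))"
    proof (rule sum.reindex_bij_witness[where i = "\<lambda>w. w \<circ> refl \<alpha>" and j = "\<lambda>w. w \<circ> refl \<alpha>"])
      fix w assume w: "w \<in> W0"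
      show rr: "w \<circ> refl \<alpha> \<circ> refl \<alpha> = w" by (rule ext) simp
      then show "w \<circ> refl \<alpha> \<circ> refl \<alpha> = w" .
      show "w \<circ> refl \<alpha> \<in> W0" by (rule W0_comp[OF w W0_refl[OF aR]])
      then show "w \<circ> refl \<alpha> \<in> W0" .
      show "e (w \<circ> refl \<alpha> \<circ> refl \<alpha>) * num (cact (w \<circ> refl \<alpha> \<circ> refl \<alpha>) ?n) = e w * num (cact w ?n)" unfolding rr ..
    qed
    also have "\<dots> = - (\<Sum>w\<in>W0. e w * num (cact w ?n))"
      unfolding sum_negf[symmetric] by (intro sum.cong refl) (simp only: es cact_comp fix_n mult_minus_left)
    finally have "(\<Sum>w\<in>W0. e w * num (cact w ?n)) = 0" by (simp add: eq_neg_iff_add_eq_0 flip: mult_2)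
    then have "poly (\<Sum>w\<in>W0. smult (e w) (pn w)) ?z = 0" unfolding poly_sum by (simp add: pn)
    moreover have "poly pd ?z = 0" unfolding pd Delta_def
      by (rule prod_zero[OF finite_P]) (rule bexI[OF _ \<alpha>], rule 0)
    ultimately show "poly q ?z = 0" by (simp only: q_def poly_diff poly_smult mult_zero_right diff_self)
  qed
  \<comment> \<open>At \<open>z = 0\<close> the line passes through \<mu>, where dividing by
    \<open>Delta\<close> turns the polynomial identity into the claim.\<close>
  then have "poly q 0 = 0" by simp
  then have A: "(\<Sum>w\<in>W0. e w * num (cact w \<mu>)) = of_nat (card W0) * Delta \<mu>"
    unfolding q_def by (simp add: poly_sum pn pd)
  have "cf (cact w \<mu>) = e w * num (cact w \<mu>) / Delta \<mu>" if w: "w \<in> W0" for w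
  proof -
    have "cf (cact w \<mu>) = num (cact w \<mu>) / Delta (cact w \<mu>)"
      unfolding c_function_def num_def Delta_def by (rule prod_dividef)
    then show ?thesis using e(1)[OF w] by (auto simp: e(2)[OF w])
  qed
  then have "(\<Sum>w\<in>W0. cf (cact w \<mu>)) = (\<Sum>w\<in>W0. e w * num (cact w \<mu>)) / Delta \<mu>"
    by (simp add: sum_divide_distrib)
  then show ?thesis unfolding A using D0 by simp
qed

lemma bethe_wave_0: "regular_spectral R \<mu> \<Longrightarrow> bethe_wave \<mu> 0 = 1"
  using macdonald[of \<mu>] card_W0 by (simp add: bethe_wave_def)

text \<open>Invariance is assumed only at real points. Along the line through the real part in the
  direction of the imaginary part, the difference is a polynomial vanishing at all real parameters,
  and thus at \<open>\<i>\<close>.\<close>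

lemma sym_eval_cact:
  assumes p: "sym_invariant R p" and w: "w \<in> W0"
  shows "sym_eval p (ceval (cact w \<nu>)) = sym_eval p (ceval \<nu>)"
proof -
  let ?p = "sym_poly p (w (fst \<nu>)) (w (snd \<nu>)) - sym_poly p (fst \<nu>) (snd \<nu>)"
  have cl: "cline (\<xi>, 0) \<eta> (of_real t) = (\<xi> + t *\<^sub>R \<eta>, 0)" for \<xi> \<eta> :: 'a and t by (simp add: cline_def)
  have "poly ?p (of_real t) = 0" for t
  proof -
    have "sym_eval p (\<lambda>v. w (fst \<nu> + t *\<^sub>R snd \<nu>) \<bullet> v) = sym_eval p (\<lambda>v. (fst \<nu> + t *\<^sub>R snd \<nu>) \<bullet> v)"
      using p w unfolding sym_invariant_def by blast
    then show ?thesis using W0_linear[OF w]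
      by (simp add: poly_sym_poly cl sym_eval_real linear_add linear_cmul)
  qed
  then have "complex_of_real ` UNIV \<subseteq> {z. poly ?p z = 0}" by blast
  moreover have "infinite (complex_of_real ` UNIV)"
    using finite_imageD[of complex_of_real UNIV] infinite_UNIV_char_0 by (auto simp: inj_on_def)
  ultimately have "?p = 0" using poly_roots_finite finite_subset by blast
  then have "poly ?p \<i> = 0" by (simp only: poly_0)
  moreover have "cline (\<xi>, 0) \<eta> \<i> = (\<xi>, \<eta>)" for \<xi> \<eta> :: 'a by (simp add: cline_def)
  ultimately show ?thesis by (simp add: poly_sym_poly cact_def)
qed

section \<open>Folding orbit sums into solutions\<close>

lemma sym_eval_orbit: "sym_invariant R p \<Longrightarrow> \<nu> \<in> orbit \<mu> \<Longrightarrow> sym_eval p (ceval \<nu>) = sym_eval p (ceval \<mu>)"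
  unfolding orbit_def using sym_eval_cact by blast

lemma diff_op_orbit_sum:
  assumes p: "sym_invariant R p" and h: "orbit_sum \<mu> h"
  shows "diff_op p h x = sym_eval p (ceval \<mu>) * h x"
proof -
  obtain C where "\<And>x. h x = (\<Sum>\<nu>\<in>orbit \<mu>. C \<nu> * exp (ceval \<nu> x))" using h unfolding orbit_sum_def by blast
  then have C: "h = (\<lambda>x. \<Sum>\<nu>\<in>orbit \<mu>. C \<nu> * exp (ceval \<nu> x))" by (rule ext)
  show ?thesis unfolding C diff_op_exp_sum[OF finite_orbit] sum_distrib_left
    by (intro sum.cong refl) (simp add: sym_eval_orbit[OF p] mult.assoc)
qed

lemma orbit_sum_W:
  assumes h: "orbit_sum \<mu> h" and w: "w \<in> W"
  shows "orbit_sum \<mu> (\<lambda>x. h (w x))"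
proof -
  obtain C where C: "\<And>x. h x = (\<Sum>\<nu>\<in>orbit \<mu>. C \<nu> * exp (ceval \<nu> x))" using h unfolding orbit_sum_def by blast
  obtain g y where g: "g \<in> W0" "\<And>v. w v = g v + y" using W_linear_part[OF w] by blast
  have o: "cact v \<nu> \<in> orbit \<mu>" if v: "v \<in> W0" and n: "\<nu> \<in> orbit \<mu>" for v \<nu>
  proof -
    obtain u where "u \<in> W0" "\<nu> = cact u \<mu>" using n unfolding orbit_def by blast
    then show ?thesis unfolding orbit_def using W0_comp[OF v] by (intro image_eqI[of _ _ "v \<circ> u"]) (auto simp: cact_comp)
  qed
  have ci: "cact g (cact (inv g) \<nu>) = \<nu>" "cact (inv g) (cact g \<nu>) = \<nu>" for \<nu>
    by (simp_all add: cact_def W0_inv_apply[OF g(1)])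
  have cg: "ceval (cact g \<nu>) (g x) = ceval \<nu> x" for \<nu> x
    by (simp add: ceval_def cact_def W0_inner[OF g(1)])
  have "h (w x) = (\<Sum>\<nu>\<in>orbit \<mu>. (C (cact g \<nu>) * exp (ceval (cact g \<nu>) y)) * exp (ceval \<nu> x))" for x
  proof -
    have "h (w x) = (\<Sum>\<nu>\<in>orbit \<mu>. C (cact g \<nu>) * exp (ceval (cact g \<nu>) (w x)))"
      unfolding C
      by (rule sum.reindex_bij_witness[where i = "cact g" and j = "cact (inv g)"])
        (use o[OF g(1)] o[OF W0_inv(2)[OF g(1)]] ci in auto)
    then show ?thesis by (simp add: g(2) ceval_add cg exp_add mult_ac)
  qed
  then show ?thesis unfolding orbit_sum_def by (intro exI[of _ "\<lambda>\<nu>. C (cact g \<nu>) * exp (ceval (cact g \<nu>) y)"]) blast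
qed

lemma orbit_sum_EP: "orbit_sum \<mu> h \<Longrightarrow> h \<in> EP"
proof -
  assume "orbit_sum \<mu> h"
  then obtain C where "\<And>x. h x = (\<Sum>\<nu>\<in>orbit \<mu>. C \<nu> * exp (ceval \<nu> x))" unfolding orbit_sum_def by blast
  then have C: "h = (\<lambda>x. \<Sum>\<nu>\<in>orbit \<mu>. C \<nu> * exp (ceval \<nu> x))" by (rule ext)
  show ?thesis unfolding C by (intro elementary_sum elementary_cmult elementary.expo)
qed

lemma open_W_C0: "w \<in> W \<Longrightarrow> open {x. w x \<in> C0}"
proof -
  assume w: "w \<in> W"
  obtain g y where g: "g \<in> W0" "\<And>v. w v = g v + y" using W_linear_part[OF w] by blast
  have "continuous_on UNIV (\<lambda>v. g v + y)"
    by (intro continuous_intros linear_continuous_on linear_conv_bounded_linear[THEN iffD1] W0_linear[OF g(1)])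
  then have "continuous_on UNIV w" using g(2) by (simp only: continuous_on_cong[OF refl g(2)])
  then show ?thesis using open_vimage[OF open_C0] by (simp add: vimage_def)
qed

lemma W_C0_V_reg: "w \<in> W \<Longrightarrow> w x \<in> C0 \<Longrightarrow> x \<in> V_reg R I \<phi>"
  using V_reg_W[OF W_inv(2), of w "w x"] C0_V_reg W_inv_apply(2)[of w x] by auto

lemma open_V_reg: "open (V_reg R I \<phi>)"
proof -
  have "V_reg R I \<phi> = (\<Union>w\<in>W. {x. w x \<in> C0})" using V_reg_alcove W_C0_V_reg by blast
  then show ?thesis using open_W_C0 by auto
qed

text \<open>A sign -1 is removed by composing with the reflection in the wall, which fixes
  \<open>w v\<close>. The linear part of \<open>w\<close> then carries the co-root of
  \<open>b\<close> to that of \<open>a\<close>.\<close>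

lemma subregular_wall_oriented:
  assumes b: "b \<in> pos" and v: "subregular R I \<phi> b v"
  shows "\<exists>w\<in>W. \<exists>a\<in>A. aff_eval a (w v) = 0 \<and> (\<forall>a'\<in>A - {a}. 0 < aff_eval a' (w v)) \<and>
    (\<forall>x. aff_eval a (w x) = aff_eval b x)"
proof -
  obtain w a \<epsilon> where w: "w \<in> W" "a \<in> A" "aff_eval a (w v) = 0" "\<forall>a'\<in>A - {a}. 0 < aff_eval a' (w v)"
    "\<epsilon> = 1 \<or> \<epsilon> = -1" "\<And>x. aff_eval a (w x) = \<epsilon> * aff_eval b x"
    using subregular_wall[OF b v] by blast
  from w(5) show ?thesis
  proof
    assume "\<epsilon> = 1"
    then have "\<forall>x. aff_eval a (w x) = aff_eval b x" using w(6) by simp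
    then show ?thesis using w(1-4) by blast
  next
    assume e: "\<epsilon> = -1"
    let ?w = "aff_refl a \<circ> w"
    have "?w \<in> W" by (rule W_comp[OF W_refl[OF A_roots[OF w(2)]] w(1)])
    moreover have "?w v = w v" using w(3) by (simp add: aff_refl_def)
    moreover have "aff_eval a (?w x) = aff_eval b x" for x
      using aff_eval_root_refl[of a a "w x"] root_refl_self[OF A_ne0[OF w(2)]] w(6)[of x] e by (simp add: aff_eval_minus)
    ultimately show ?thesis using w(2-4) by (intro bexI[of _ ?w] bexI[of _ a]) auto
  qed
qed

text \<open>On each alcove the folded function is \<open>F \<circ> w\<close> with a single
  \<open>w\<close>, and this is again an orbit sum. So the extension required by \<open>CB1\<close>
  exists on the whole space, and the differential equations hold with the eigenvalue of \<mu>.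
  Invariance transports each jump condition to a wall of the fundamental alcove.\<close>

lemma BVP_sufficient:
  assumes F: "F = (\<lambda>x. \<Sum>\<nu>\<in>orbit \<mu>. C \<nu> * exp (ceval \<nu> x))"
    and rel: "\<And>a \<nu>. a \<in> A \<Longrightarrow> \<nu> \<in> orbit \<mu> \<Longrightarrow> coeff_rel C a \<nu>"
  shows "(\<lambda>v. F (fold_pt v)) \<in> BVP_W R I \<phi> k \<mu>"
proof -
  let ?f = "\<lambda>v. F (fold_pt v)"
  have os: "orbit_sum \<mu> F" unfolding orbit_sum_def F by blast
  have EP: "F \<in> EP" by (rule orbit_sum_EP[OF os])
  have inv: "?f (w v) = ?f v" if "w \<in> W" for w v by (simp only: fold_pt_W[OF that])
  have fF: "?f x = F x" if "x \<in> Cbar" for x by (simp only: fold_pt_Cbar[OF that])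
  have fw: "?f x = F (w x)" if "w \<in> W" "w x \<in> C0" for w x using fold_pt_eq[OF that(1), of x] that(2) alcove_Cbar by auto
  have wall: "dir_deriv (coroot (fst a)) F v = of_real (k a) * F v" if a: "a \<in> A" "aff_eval a v = 0" for a v
    by (rule wall_of_coeff_rel[OF finite_orbit _ F rel[OF a(1)] a]) (rule cact_refl_orbit[OF aff_root_fst[OF A_roots[OF a(1)]]])
  have cont: "continuous_on UNIV ?f"
    by (rule continuous_on_compose2[OF elementary_continuous[OF EP] fold_pt_continuous]) (rule subset_UNIV)
  have CB1: "?f \<in> CB1 R I \<phi>"
    unfolding CB1_def
  proof (intro CollectI conjI cont ballI)
    fix K assume "K \<in> alcoves R I \<phi>"
    then obtain w where w: "w \<in> W" "\<forall>x\<in>K. w x \<in> C0" using alcove_W by blast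
    show "\<exists>U g. open U \<and> closure K \<subseteq> U \<and> continuously_differentiable_on g U \<and> (\<forall>x\<in>K. g x = ?f x)"
      by (rule exI[of _ UNIV], rule exI[of _ "\<lambda>x. F (w x)"])
        (use EP_continuously_differentiable[OF orbit_sum_EP[OF orbit_sum_W[OF os w(1)]]] fw[OF w(1)] w(2) in auto)
  qed
  have jump: "\<exists>dp dm. ((\<lambda>t. dir_deriv (coroot (fst b)) ?f (v + t *\<^sub>R coroot (fst b))) \<longlongrightarrow> dp) (at_right 0) \<and>
      ((\<lambda>t. dir_deriv (coroot (fst b)) ?f (v - t *\<^sub>R coroot (fst b))) \<longlongrightarrow> dm) (at_right 0) \<and>
      dp - dm = 2 * of_real (k b) * ?f v" if b: "b \<in> pos" and v: "subregular R I \<phi> b v" for b v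
  proof -
    obtain w a where wa: "w \<in> W" "a \<in> A" "aff_eval a (w v) = 0" "\<And>a'. a' \<in> A - {a} \<Longrightarrow> 0 < aff_eval a' (w v)"
      "\<And>x. aff_eval a (w x) = aff_eval b x" using subregular_wall_oriented[OF b v] by blast
    obtain g y where g: "g \<in> W0" "\<And>v. w v = g v + y" using W_linear_part[OF wa(1)] by blast
    let ?u = "coroot (fst b)" and ?ua = "coroot (fst a)"
    have ka: "k a = k b" by (rule k_W[OF wa(1) A_roots[OF wa(2)] pos_roots_aff[OF b] wa(5)])
    have "fst a \<bullet> g x = fst b \<bullet> x" for x
      using wa(5)[of x] wa(5)[of 0] linear_0[OF W0_linear[OF g(1)]] by (simp add: aff_eval_def g(2) inner_add_right)
    then have "fst a \<bullet> x = g (fst b) \<bullet> x" for x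
      using W0_inv_apply(1)[OF g(1), of x] by (metis W0_adjoint[OF g(1)])
    then have ga: "g (fst b) = fst a" by (metis inner_eq_zero_iff inner_diff_left eq_iff_diff_eq_0)
    have gu: "g ?u = ?ua" by (simp add: W0_coroot[OF g(1)] ga)
    have fg: "?f = (\<lambda>x. ?f (g x + y))" using inv[OF wa(1)] g(2) by (intro ext) simp
    have dd: "dir_deriv ?u ?f x = dir_deriv ?ua ?f (w x)" for x
      by (subst fg) (simp only: dir_deriv_comp_affine[OF W0_linear[OF g(1)], where f = ?f] gu g(2))
    have wp: "w (v + t *\<^sub>R ?u) = w v + t *\<^sub>R ?ua" "w (v - t *\<^sub>R ?u) = w v - t *\<^sub>R ?ua" for t
      using W0_linear[OF g(1)] by (simp_all add: g(2) linear_add linear_diff linear_cmul gu)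
    have yC: "w v \<in> Cbar" unfolding Cbar_def using wa(3,4) by (auto simp: less_imp_le) (metis DiffI less_imp_le order_refl singletonD)
    have "((\<lambda>t. dir_deriv ?ua ?f (w v + t *\<^sub>R ?ua)) \<longlongrightarrow> dir_deriv ?ua F (w v)) (at_right 0)"
      "((\<lambda>t. dir_deriv ?ua ?f (w v - t *\<^sub>R ?ua)) \<longlongrightarrow> - dir_deriv ?ua F (w v)) (at_right 0)"
      by (rule wall_one_sided_derivatives[OF EP _ _ wa(2,3)]; (rule fF inv wa(4), assumption))+
    moreover have "dir_deriv ?ua F (w v) - - dir_deriv ?ua F (w v) = 2 * of_real (k b) * ?f v"
      using wall[OF wa(2,3)] fF[OF yC] inv[OF wa(1), of v] by (simp add: ka)
    ultimately show ?thesis unfolding dd wp by blast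
  qed
  have C1k: "?f \<in> C1k R I \<phi> k" unfolding C1k_def Let_def using CB1 jump by blast
  have loc: "locally_EP (V_reg R I \<phi>) ?f" unfolding locally_EP_def
  proof
    fix x assume "x \<in> V_reg R I \<phi>"
    then obtain w where w: "w \<in> W" "w x \<in> C0" using V_reg_alcove by blast
    show "\<exists>N Fa. open N \<and> x \<in> N \<and> N \<subseteq> V_reg R I \<phi> \<and> Fa \<in> EP \<and> (\<forall>y\<in>N. ?f y = Fa y)"
      by (rule exI[of _ "{x. w x \<in> C0}"], rule exI[of _ "\<lambda>x. F (w x)"])
        (use open_W_C0[OF w(1)] w(2) W_C0_V_reg[OF w(1)] orbit_sum_EP[OF orbit_sum_W[OF os w(1)]] fw[OF w(1)] in auto)
  qed
  have weak: "weak_eigenfunction (V_reg R I \<phi>) p (sym_eval p (ceval \<mu>)) ?f" if p: "sym_invariant R p" for p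
  proof (rule weak_eigenfunction_locally_EP[OF open_V_reg loc])
    fix x assume "x \<in> V_reg R I \<phi>"
    then obtain w where w: "w \<in> W" "w x \<in> C0" using V_reg_alcove by blast
    have "diff_op p ?f x = diff_op p (\<lambda>x. F (w x)) x"
      by (rule diff_op_cong[OF open_W_C0[OF w(1)]]) (use fw[OF w(1)] w(2) in auto)
    then show "diff_op p ?f x = sym_eval p (ceval \<mu>) * ?f x"
      unfolding diff_op_orbit_sum[OF p orbit_sum_W[OF os w(1)]] fw[OF w] .
  qed
  have "invariant_under W ?f" using inv invariant_W_iff[of ?f] by blast
  then show ?thesis unfolding BVP_W_def BVP_def using C1k weak by blast
qed

section \<open>Dimension, normalization and uniqueness\<close>

definition bethe_solution :: "'a cdual \<Rightarrow> 'a \<Rightarrow> complex" where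
  "bethe_solution \<mu> v = bethe_wave \<mu> (fold_pt v)"

lemma zero_BVP: "(\<lambda>v. 0) \<in> BVP_W R I \<phi> k \<mu>"
  using BVP_sufficient[where F = "\<lambda>x. 0" and \<mu> = \<mu> and C = "\<lambda>\<nu>. 0"] by (simp add: coeff_rel_def)

abbreviation "bethe_spectral \<mu> \<equiv> purely_imaginary \<mu> \<and> regular_spectral R \<mu> \<and> bethe_equations R I \<phi> k \<mu>"

lemma bethe_solution_BVP:
  assumes g: "bethe_spectral \<mu>"
  shows "(\<lambda>v. d * bethe_solution \<mu> v) \<in> BVP_W R I \<phi> k \<mu>"
proof -
  obtain q where q: "q \<noteq> 0" "bethe_wave \<mu> = (\<lambda>x. \<Sum>\<nu>\<in>orbit \<mu>. (q * cf \<nu>) * exp (ceval \<nu> x))"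
    using bethe_wave_orbit by blast
  have "(\<lambda>v. (\<lambda>x. d * bethe_wave \<mu> x) (fold_pt v)) \<in> BVP_W R I \<phi> k \<mu>"
  proof (rule BVP_sufficient)
    show "(\<lambda>x. d * bethe_wave \<mu> x) = (\<lambda>x. \<Sum>\<nu>\<in>orbit \<mu>. (d * q) * cf \<nu> * exp (ceval \<nu> x))"
      unfolding q(2) by (simp add: sum_distrib_left mult.assoc)
    fix a \<nu> assume a: "a \<in> A" and \<nu>: "\<nu> \<in> orbit \<mu>"
    from a consider "a = (- \<phi>, 1)" | i where "i \<in> I" "a = (i, 0)" unfolding aff_basis_def by blast
    then have "coeff_rel cf a \<nu>"
    proof cases
      case 1 then show ?thesis using bethe_orbit_iff[of \<mu>] g \<nu> by blast
    next
      case 2 then show ?thesis using cf_simple[OF orbit_regular[OF _ \<nu>]] g by blast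
    qed
    then show "coeff_rel (\<lambda>\<nu>. (d * q) * cf \<nu>) a \<nu>" by (rule coeff_rel_cmult)
  qed
  then show ?thesis by (simp add: bethe_solution_def)
qed

lemma BVP_multiple:
  assumes f: "f \<in> BVP_W R I \<phi> k \<mu>"
  shows "\<exists>d. f = (\<lambda>v. d * bethe_solution \<mu> v)"
proof (cases "\<forall>v. f v = 0")
  case True then show ?thesis by (intro exI[of _ 0]) auto
next
  case False
  then obtain v where "f v \<noteq> 0" by blast
  then obtain d where d: "\<And>x. x \<in> Cbar \<Longrightarrow> f x = d * bethe_wave \<mu> x" using BVP_necessary[OF f] by blast
  have "f v = d * bethe_solution \<mu> v" for v
  proof -
    obtain w where w: "w \<in> W" "fold_pt v = w v" using fold_pt(2) by blast
    have "f (w v) = f v" using f w invariant_W_iff unfolding BVP_W_def by blast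
    then show ?thesis using d[OF fold_pt(1), of v] w(2) by (simp add: bethe_solution_def)
  qed
  then show ?thesis by blast
qed

lemma BVP_trivial: "\<not> bethe_spectral \<mu> \<Longrightarrow> f \<in> BVP_W R I \<phi> k \<mu> \<Longrightarrow> f = 0"
  using BVP_necessary by (metis ext zero_fun_apply)

lemma bethe_solution_0: "regular_spectral R \<mu> \<Longrightarrow> bethe_solution \<mu> 0 = 1"
  by (simp add: bethe_solution_def fold_pt_Cbar[OF zero_Cbar] bethe_wave_0)

lemma bethe_formula_iff: "bethe_formula R I \<phi> k \<mu> f \<longleftrightarrow> (\<forall>v\<in>Cbar. f v = bethe_wave \<mu> v)"
  unfolding bethe_formula_def closure_C0 bethe_wave_def ..

text \<open>As \<open>has_cdim\<close> asserts that a basis of given size exists, dimension 0 and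
  the failure of dimension 1 are separate claims. The latter holds because a one-element basis of
  the zero space would consist of zero.\<close>

lemma has_cdim_BVP:
  "bethe_spectral \<mu> \<Longrightarrow> has_cdim (BVP_W R I \<phi> k \<mu>) 1"
  "\<not> bethe_spectral \<mu> \<Longrightarrow> has_cdim (BVP_W R I \<phi> k \<mu>) 0 \<and> \<not> has_cdim (BVP_W R I \<phi> k \<mu>) 1"
proof -
  assume g: "bethe_spectral \<mu>"
  have "bethe_solution \<mu> 0 = 1" using bethe_solution_0 g by blast
  then have "bethe_solution \<mu> \<noteq> 0" by auto
  then have "cfun.independent {bethe_solution \<mu>}" by (simp only: cfun.dependent_single not_False_eq_True simp_thms)
  moreover have "cfun.span {bethe_solution \<mu>} = BVP_W R I \<phi> k \<mu>"
    unfolding cfun.span_singleton using bethe_solution_BVP[OF g] BVP_multiple by blast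
  ultimately show "has_cdim (BVP_W R I \<phi> k \<mu>) 1"
    unfolding has_cdim_def by (intro exI[of _ "{bethe_solution \<mu>}"]) simp
next
  assume g: "\<not> bethe_spectral \<mu>"
  have "(0 :: 'a \<Rightarrow> complex) \<in> BVP_W R I \<phi> k \<mu>" using zero_BVP by (simp add: zero_fun_def)
  then have 0: "BVP_W R I \<phi> k \<mu> = {0}" using BVP_trivial[OF g] by blast
  have "has_cdim {0} 0" unfolding has_cdim_def by (intro exI[of _ "{}"]) (simp add: cfun.independent_empty)
  moreover have "\<not> has_cdim {0 :: 'a \<Rightarrow> complex} 1"
  proof
    assume "has_cdim {0 :: 'a \<Rightarrow> complex} 1"
    then obtain B :: "('a \<Rightarrow> complex) set" where B: "card B = 1" "cfun.independent B" "cfun.span B = {0}"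
      unfolding has_cdim_def by blast
    obtain b where b: "B = {b}" using B(1) card_1_singletonE by blast
    then have "b = 0" using B(3) cfun.span_base[of b B] by auto
    then show False using B(2) b cfun.dependent_single by blast
  qed
  ultimately show "has_cdim (BVP_W R I \<phi> k \<mu>) 0 \<and> \<not> has_cdim (BVP_W R I \<phi> k \<mu>) 1" unfolding 0 by blast
qed

lemma BVP_normalized:
  assumes g: "bethe_spectral \<mu>"
  shows "f \<in> BVP_W R I \<phi> k \<mu> \<and> f 0 = 1 \<longleftrightarrow> f = bethe_solution \<mu>"
proof
  assume "f \<in> BVP_W R I \<phi> k \<mu> \<and> f 0 = 1"
  then obtain d where "f = (\<lambda>v. d * bethe_solution \<mu> v)" "f 0 = 1" using BVP_multiple by blast
  moreover from this have "d = 1" using bethe_solution_0 g by simp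
  ultimately show "f = bethe_solution \<mu>" by (simp add: fun_eq_iff)
next
  assume "f = bethe_solution \<mu>"
  then show "f \<in> BVP_W R I \<phi> k \<mu> \<and> f 0 = 1" using bethe_solution_BVP[OF g, of 1] bethe_solution_0 g by simp
qed

text \<open>Every orbit of \<open>W\<close> meets the closed alcove, so an invariant function is
  determined by its values there. Folding supplies the invariant function with the prescribed
  values, for every \<mu>.\<close>

lemma bethe_solution_characterization:
  "invariant_under W f \<and> bethe_formula R I \<phi> k \<mu> f \<longleftrightarrow> f = bethe_solution \<mu>"
proof
  assume f: "invariant_under W f \<and> bethe_formula R I \<phi> k \<mu> f"
  have "f v = bethe_solution \<mu> v" for v
  proof -
    obtain w where w: "w \<in> W" "fold_pt v = w v" using fold_pt(2) by blast
    have "f (w v) = f v" using f w invariant_W_iff by blast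
    moreover have "f (fold_pt v) = bethe_wave \<mu> (fold_pt v)" using f fold_pt(1) bethe_formula_iff by blast
    ultimately show ?thesis using w(2) by (simp add: bethe_solution_def)
  qed
  then show "f = bethe_solution \<mu>" by blast
next
  assume f: "f = bethe_solution \<mu>"
  show "invariant_under W f \<and> bethe_formula R I \<phi> k \<mu> f"
    unfolding f invariant_W_iff bethe_formula_iff by (simp add: bethe_solution_def fold_pt_W fold_pt_Cbar)
qed

end

theorem theorem2p6:
  fixes R I :: "'a::euclidean_space set" and \<phi> :: 'a
    and k :: "'a \<times> real \<Rightarrow> real" and \<mu> :: "'a cdual"
  assumes "irreducible_reduced_root_system R"
    and "root_basis R I"
    and "highest_root R I \<phi>"
    and "multiplicity_function R k"
  shows "(has_cdim (BVP_W R I \<phi> k \<mu>) 1 \<or> has_cdim (BVP_W R I \<phi> k \<mu>) 0) \<and>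
    (has_cdim (BVP_W R I \<phi> k \<mu>) 1 \<longleftrightarrow>
       purely_imaginary \<mu> \<and> regular_spectral R \<mu> \<and> bethe_equations R I \<phi> k \<mu>) \<and>
    (has_cdim (BVP_W R I \<phi> k \<mu>) 1 \<longrightarrow>
       (\<exists>!f. f \<in> BVP_W R I \<phi> k \<mu> \<and> f 0 = 1) \<and>
       (\<forall>f\<in>BVP_W R I \<phi> k \<mu>. f 0 = 1 \<longrightarrow>
          invariant_under (aff_weyl_group R) f \<and> bethe_formula R I \<phi> k \<mu> f \<and>
          (\<forall>g. invariant_under (aff_weyl_group R) g \<and> bethe_formula R I \<phi> k \<mu> g \<longrightarrow> g = f)))"
proof -
  interpret affine_root_system R I \<phi> k by unfold_locales (fact assms)+
  show ?thesis
  proof (cases "bethe_spectral \<mu>")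
    case False
    then show ?thesis using has_cdim_BVP(2) by blast
  next
    case True
    have "\<exists>!f. f \<in> BVP_W R I \<phi> k \<mu> \<and> f 0 = 1" unfolding BVP_normalized[OF True] by simp
    moreover have "invariant_under (aff_weyl_group R) f \<and> bethe_formula R I \<phi> k \<mu> f \<and>
          (\<forall>g. invariant_under (aff_weyl_group R) g \<and> bethe_formula R I \<phi> k \<mu> g \<longrightarrow> g = f)"
      if "f \<in> BVP_W R I \<phi> k \<mu>" "f 0 = 1" for f
    proof -
      have "f = bethe_solution \<mu>" using BVP_normalized[OF True, of f] that by blast
      then show ?thesis using bethe_solution_characterization[where \<mu> = \<mu>] by metis
    qed
    ultimately show ?thesis using has_cdim_BVP(1)[OF True] True by blast
  qed
qed

end
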